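(* Let $\mathbb{K}$ be a field of characteristic $0$, let $S=\mathbb{K}[x_1,\dots,x_l]$ with the standard grading, and let $I$ be a homogeneous ideal of $S$ such that $S/I$ has the $l$-SLP. Suppose that the sequence $(\mathcal{M}_{S/I}(l-j,0),\dots,\mathcal{M}_{S/I}(l-j,\operatorname{reg}(I)))$ is quasi-symmetric for all $0\le j\le l-4$. Then $\operatorname{rgin}(I)$ is an almost revlex ideal and it is uniquely determined by the Hilbert function (that is, it is the only almost revlex ideal $J$ of $S$ for which $S/J$ has the same Hilbert function as $S/I$).
   Context: $\operatorname{HF}(S/I,d)=\dim_{\mathbb{K}}(S/I)_d$. The sectional matrix of $S/I$ is $\mathcal{M}_{S/I}(i,d)=\operatorname{HF}(S/(I+\langle\ell_1,\dots,\ell_{l-i}\rangle),d)$ for $1\le i\le l$, $d\ge0$, where $\ell_1,\dots,\ell_{l-i}$ are generic linear forms of $S$ (the value is constant on a nonempty Zariski open set of choices). Let $h=(h_0,\dots,h_c)$ be a unimodal sequence of positive integers and $h_i$ the maximum of $h$. Then $h$ is quasi-symmetric if, for every $i<j\le c$, $h_j$ coincides with one of $\{h_0,\dots,h_i\}$. $\operatorname{reg}(I)$ is the Castelnuovo–Mumford regularity of $I$: the maximum of the numbers $d_i-i$, where $d_i=\max\{j\mid\beta_{i,j}(I)\neq0\}$ and $\beta_{i,j}(I)$ are the graded Betti numbers of $I$ (this definition presupposes $I\ne0$). DegRevLex is the degree reverse lexicographic order with $x_1>\dots>x_l$. $\operatorname{rgin}(I)$ is the generic initial ideal of $I$ with respect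 to DegRevLex, i.e. the common value of $\mathrm{LT}_{\mathrm{DegRevLex}}(g(I))$ for $g$ in a nonempty Zariski open subset of $\mathrm{GL}(l)$ (Galligo). A monomial ideal $J$ of $S$ is almost revlex if for any power-product $t$ in the minimal generating set of $J$, every power-product $t'$ with $\deg(t')=\deg(t)$ and $t'>_{\mathrm{DegRevLex}}t$ belongs to $J$. A linear map is full-rank if it is injective or surjective. A graded ring $R=\bigoplus_{i\ge0}R_i$ over $\mathbb{K}$ with $\dim_{\mathbb{K}}R_i<\infty$ (not necessarily Artinian) has the SLP with Lefschetz element $\ell\in R_1$ if $\times\ell^s\colon R_i\to R_{i+s}$ is full-rank for all $i\ge 0$, $s\ge1$. For $k\ge1$, $R$ has the $k$-SLP if there exist $\ell_1,\dots,\ell_k\in R_1$ such that $R$ has the SLP with Lefschetz element $\ell_1$ and, for all $i=2,\dots,k$, $R/\langle\ell_1,\dots,\ell_{i-1}\rangle$ has the SLP with Lefschetz element (the class of) $\ell_i$. *)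

theory Defs
  imports
    "HOL-Library.Poly_Mapping"
    "HOL-Library.FuncSet"
    "HOL-Algebra.QuotRing"
    "HOL-Algebra.Embedded_Algebras"
    "Jordan_Normal_Form.Matrix"
begin

section \<open>The polynomial ring\<close>

text \<open>
  A power-product is a finitely supported exponent vector, and a polynomial is a finitely supported
  function from power-products to coefficients. Variables are counted from 0: index \<open>i\<close> stands for
  the variable written $x_{i+1}$ on paper, so $S = K[x_1,\dots,x_l]$ uses the indices \<open>i < l\<close>.
\<close>

type_synonym ('x, 'k) mpoly = "('x \<Rightarrow>\<^sub>0 nat) \<Rightarrow>\<^sub>0 'k"

definition const_poly :: "'k::comm_ring_1 \<Rightarrow> ('x, 'k) mpoly"
  where "const_poly c = Poly_Mapping.single 0 c"

definition var_poly :: "'x \<Rightarrow> ('x, 'k::comm_ring_1) mpoly"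
  where "var_poly i = Poly_Mapping.single (Poly_Mapping.single i 1) 1"

definition power_product :: "('x \<Rightarrow>\<^sub>0 nat) \<Rightarrow> ('x, 'k::comm_ring_1) mpoly"
  where "power_product t = Poly_Mapping.single t 1"

definition polys_in :: "'x set \<Rightarrow> ('x, 'k::zero) mpoly set"
  where "polys_in X = {p. \<forall>t \<in> Poly_Mapping.keys p. Poly_Mapping.keys t \<subseteq> X}"

text \<open>Evaluation at the point \<open>a\<close>, the coefficients being mapped by \<open>h\<close>.\<close>

definition evaluate :: "('k::zero \<Rightarrow> 'b::comm_ring_1) \<Rightarrow> ('x \<Rightarrow> 'b) \<Rightarrow> ('x, 'k) mpoly \<Rightarrow> 'b"
  where "evaluate h a p =
    (\<Sum>t \<in> Poly_Mapping.keys p. h (Poly_Mapping.lookup p t) *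
      (\<Prod>x \<in> Poly_Mapping.keys t. a x ^ Poly_Mapping.lookup t x))"

definition poly_ring :: "nat \<Rightarrow> (nat, 'k::comm_ring_1) mpoly ring"
  where "poly_ring l =
    \<lparr>carrier = polys_in {..<l}, monoid.mult = (*), one = 1, zero = 0, add = (+)\<rparr>"

definition pps :: "nat \<Rightarrow> (nat \<Rightarrow>\<^sub>0 nat) set"
  where "pps l = {t. Poly_Mapping.keys t \<subseteq> {..<l}}"

definition pp_degree :: "('x \<Rightarrow>\<^sub>0 nat) \<Rightarrow> nat"
  where "pp_degree t = (\<Sum>x \<in> Poly_Mapping.keys t. Poly_Mapping.lookup t x)"

definition forms :: "nat \<Rightarrow> nat \<Rightarrow> (nat, 'k::comm_ring_1) mpoly set"
  where "forms l d = {p \<in> carrier (poly_ring l). \<forall>t \<in> Poly_Mapping.keys p. pp_degree t = d}"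

definition homogeneous_component :: "nat \<Rightarrow> ('x, 'k::comm_ring_1) mpoly \<Rightarrow> ('x, 'k) mpoly"
  where "homogeneous_component d p =
    (\<Sum>t \<in> {t \<in> Poly_Mapping.keys p. pp_degree t = d}.
      Poly_Mapping.single t (Poly_Mapping.lookup p t))"

definition homogeneous_ideal :: "nat \<Rightarrow> (nat, 'k::comm_ring_1) mpoly set \<Rightarrow> bool"
  where "homogeneous_ideal l I \<longleftrightarrow>
    ideal I (poly_ring l) \<and> (\<forall>p \<in> I. \<forall>d. homogeneous_component d p \<in> I)"

lemma cring_poly_ring: "cring (poly_ring l :: (nat, 'k::comm_ring_1) mpoly ring)"
proof -
  let ?S = "polys_in {..<l} :: (nat, 'k) mpoly set"
  have add: "p + q \<in> ?S" if "p \<in> ?S" "q \<in> ?S" for p q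
    using that Poly_Mapping.keys_add[of p q] unfolding polys_in_def by blast
  have zero: "0 \<in> ?S" and one: "1 \<in> ?S"
    by (simp_all add: polys_in_def)
  have mult: "p * q \<in> ?S" if "p \<in> ?S" "q \<in> ?S" for p q
  proof -
    have "Poly_Mapping.keys t \<subseteq> {..<l}" if t: "t \<in> Poly_Mapping.keys (p * q)" for t
    proof -
      obtain u v where uv: "u \<in> Poly_Mapping.keys p" "v \<in> Poly_Mapping.keys q" "t = u + v"
        using t Poly_Mapping.keys_mult[of p q] by blast
      have "Poly_Mapping.keys u \<subseteq> {..<l}" "Poly_Mapping.keys v \<subseteq> {..<l}"
        using uv \<open>p \<in> ?S\<close> \<open>q \<in> ?S\<close> unfolding polys_in_def by blast+
      then show ?thesis using Poly_Mapping.keys_add[of u v] uv(3) by blast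
    qed
    then show ?thesis unfolding polys_in_def by blast
  qed
  have uminus: "- p \<in> ?S" if "p \<in> ?S" for p
    using that unfolding polys_in_def by (simp add: in_keys_iff)
  show ?thesis
  proof (rule cringI)
    show "abelian_group (poly_ring l :: (nat, 'k) mpoly ring)"
    proof (rule abelian_groupI)
      fix p assume "p \<in> carrier (poly_ring l :: (nat, 'k) mpoly ring)"
      then show "\<exists>q \<in> carrier (poly_ring l). q \<oplus>\<^bsub>poly_ring l\<^esub> p = \<zero>\<^bsub>poly_ring l\<^esub>"
        using uminus by (intro bexI[of _ "- p"]) (auto simp: poly_ring_def)
    qed (auto simp: poly_ring_def add zero add.assoc add.commute)
    show "comm_monoid (poly_ring l :: (nat, 'k) mpoly ring)"
      by (rule comm_monoidI) (auto simp: poly_ring_def mult one mult.assoc mult.commute)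
  qed (auto simp: poly_ring_def distrib_right)
qed


section \<open>Graded quotients and the Hilbert function\<close>

definition quotient_grading ::
    "('a, 'b) ring_scheme \<Rightarrow> (nat \<Rightarrow> 'a set) \<Rightarrow> 'a set \<Rightarrow> nat \<Rightarrow> 'a set set"
  where "quotient_grading R G J d = (\<lambda>x. J +>\<^bsub>R\<^esub> x) ` G d"

text \<open>\<open>HF l I d\<close> is $\dim_K (S/I)_d$, where $K$ acts on $S/I$ through the classes of the constants.\<close>

definition HF :: "nat \<Rightarrow> (nat, 'k::field) mpoly set \<Rightarrow> nat \<Rightarrow> nat"
  where "HF l I d =
    (ring.dim (poly_ring l Quot I) over (range (\<lambda>c. I +>\<^bsub>poly_ring l\<^esub> const_poly c)))
      (quotient_grading (poly_ring l) (forms l) I d)"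


section \<open>Zariski open sets and the sectional matrix\<close>

text \<open>The points of the affine space with coordinates indexed by \<open>X\<close> are the extensional functions
  on \<open>X\<close>; an open set is the complement of the common zero set of a set of polynomials.\<close>

definition zariski_open :: "'x set \<Rightarrow> ('x \<Rightarrow> 'k::field) set \<Rightarrow> bool"
  where "zariski_open X U \<longleftrightarrow>
    (\<exists>F \<subseteq> polys_in X. U = {a \<in> X \<rightarrow>\<^sub>E UNIV. \<exists>p \<in> F. evaluate (\<lambda>c. c) a p \<noteq> 0})"

definition linear_form :: "nat \<Rightarrow> (nat \<Rightarrow> 'k::comm_ring_1) \<Rightarrow> (nat, 'k) mpoly"
  where "linear_form l c = (\<Sum>j<l. const_poly (c j) * var_poly j)"

text \<open>A point \<open>a\<close> of the affine space with coordinates \<open>{..<l - i} \<times> {..<l}\<close> encodes the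
  \<open>l - i\<close> linear forms with coefficient vectors \<open>a (k, _)\<close>.\<close>

definition sectional_matrix :: "nat \<Rightarrow> (nat, 'k::field) mpoly set \<Rightarrow> nat \<Rightarrow> nat \<Rightarrow> nat"
  where "sectional_matrix l I i d =
    (THE v. \<exists>U. zariski_open ({..<l - i} \<times> {..<l}) U \<and> U \<noteq> {} \<and>
      (\<forall>a \<in> U. HF l (I <+>\<^bsub>poly_ring l\<^esub>
        genideal (poly_ring l) ((\<lambda>k. linear_form l (\<lambda>j. a (k, j))) ` {..<l - i})) d = v))"


section \<open>Unimodal and quasi-symmetric sequences\<close>

text \<open>The sequences are $(h_0,\dots,h_c)$; values of \<open>h\<close> beyond \<open>c\<close> are irrelevant.\<close>

definition unimodal :: "(nat \<Rightarrow> nat) \<Rightarrow> nat \<Rightarrow> bool"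
  where "unimodal h c \<longleftrightarrow>
    (\<exists>m \<le> c. (\<forall>i j. i \<le> j \<and> j \<le> m \<longrightarrow> h i \<le> h j) \<and>
             (\<forall>i j. m \<le> i \<and> i \<le> j \<and> j \<le> c \<longrightarrow> h j \<le> h i))"

text \<open>If the maximum is attained several times, the choice of \<open>i\<close> does not matter: by unimodality
  \<open>h\<close> is constant between any two such positions.\<close>

definition quasi_symmetric :: "(nat \<Rightarrow> nat) \<Rightarrow> nat \<Rightarrow> bool"
  where "quasi_symmetric h c \<longleftrightarrow>
    unimodal h c \<and> (\<forall>i \<le> c. 0 < h i) \<and>
    (\<exists>i \<le> c. h i = Max (h ` {..c}) \<and> (\<forall>j. i < j \<and> j \<le> c \<longrightarrow> h j \<in> h ` {..i}))"


section \<open>Strong Lefschetz properties\<close>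

definition SLP :: "('a, 'b) ring_scheme \<Rightarrow> (nat \<Rightarrow> 'a set) \<Rightarrow> 'a \<Rightarrow> bool"
  where "SLP R G z \<longleftrightarrow> z \<in> G 1 \<and>
    (\<forall>i. \<forall>s \<ge> 1. inj_on (\<lambda>x. z [^]\<^bsub>R\<^esub> (s::nat) \<otimes>\<^bsub>R\<^esub> x) (G i) \<or>
                 (\<lambda>x. z [^]\<^bsub>R\<^esub> s \<otimes>\<^bsub>R\<^esub> x) ` G i = G (i + s))"

definition k_SLP :: "nat \<Rightarrow> ('a, 'b) ring_scheme \<Rightarrow> (nat \<Rightarrow> 'a set) \<Rightarrow> bool"
  where "k_SLP k R G \<longleftrightarrow> 1 \<le> k \<and>
    (\<exists>z :: nat \<Rightarrow> 'a. (\<forall>i \<in> {1..k}. z i \<in> G 1) \<and> SLP R G (z 1) \<and>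
      (\<forall>i \<in> {2..k}. let J = genideal R (z ` {1..<i}) in
        SLP (R Quot J) (quotient_grading R G J) (J +>\<^bsub>R\<^esub> z i)))"


section \<open>Graded Betti numbers and Castelnuovo--Mumford regularity\<close>

definition free_module :: "nat \<Rightarrow> nat \<Rightarrow> (nat, 'k::comm_ring_1) mpoly vec set"
  where "free_module l r = {v \<in> carrier_vec r. \<forall>k < r. v $ k \<in> carrier (poly_ring l)}"

text \<open>
  A minimal graded free resolution $\cdots \to F_1 \to F_0 \to I \to 0$ with
  $F_i = \bigoplus_{k < r_i} S(-a_{i,k})$. The matrix \<open>\<phi> (Suc i)\<close> describes $F_{i+1} \to F_i$, and the
  row \<open>\<phi> 0\<close> describes $F_0 \to I \subseteq S$. The maps have degree 0, so a nonzero entry of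
  \<open>\<phi> (Suc i)\<close> at \<open>(m, k)\<close> is a form of degree $a_{i+1,k} - a_{i,m}$. Minimality says that the image
  of $F_{i+1}$ lies in $\langle x_1,\dots,x_l\rangle F_i$, i.e. the entries have constant term 0.
\<close>

definition minimal_free_resolution ::
    "nat \<Rightarrow> (nat, 'k::comm_ring_1) mpoly set \<Rightarrow> (nat \<Rightarrow> nat) \<Rightarrow> (nat \<Rightarrow> nat \<Rightarrow> nat) \<Rightarrow>
      (nat \<Rightarrow> (nat, 'k) mpoly mat) \<Rightarrow> bool"
  where "minimal_free_resolution l I r a \<phi> \<longleftrightarrow>
    \<phi> 0 \<in> carrier_mat 1 (r 0) \<and>
    (\<forall>i. \<phi> (Suc i) \<in> carrier_mat (r i) (r (Suc i))) \<and>
    (\<forall>k < r 0. \<phi> 0 $$ (0, k) \<in> forms l (a 0 k)) \<and>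
    (\<forall>i. \<forall>m < r i. \<forall>k < r (Suc i). \<phi> (Suc i) $$ (m, k) = 0 \<or>
      (\<exists>e. a (Suc i) k = a i m + e \<and> \<phi> (Suc i) $$ (m, k) \<in> forms l e)) \<and>
    (\<lambda>v. (\<phi> 0 *\<^sub>v v) $ 0) ` free_module l (r 0) = I \<and>
    (\<forall>i. (\<lambda>w. \<phi> (Suc i) *\<^sub>v w) ` free_module l (r (Suc i)) =
      {v \<in> free_module l (r i). \<phi> i *\<^sub>v v = 0\<^sub>v (dim_row (\<phi> i))}) \<and>
    (\<forall>i. \<forall>m < r i. \<forall>k < r (Suc i). Poly_Mapping.lookup (\<phi> (Suc i) $$ (m, k)) 0 = 0)"

text \<open>Minimal graded free resolutions are unique up to isomorphism.\<close>

definition betti :: "nat \<Rightarrow> (nat, 'k::comm_ring_1) mpoly set \<Rightarrow> nat \<Rightarrow> nat \<Rightarrow> nat"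
  where "betti l I i j =
    (THE b. \<exists>r a \<phi>. minimal_free_resolution l I r a \<phi> \<and> b = card {k. k < r i \<and> a i k = j})"

text \<open>Only meaningful for \<open>I \<noteq> {0}\<close>. The maximum is over those \<open>i\<close> for which some
  $\beta_{i,j}(I)$ is nonzero.\<close>

definition reg :: "nat \<Rightarrow> (nat, 'k::comm_ring_1) mpoly set \<Rightarrow> int"
  where "reg l I =
    Max {int (Max {j. betti l I i j \<noteq> 0}) - int i | i. \<exists>j. betti l I i j \<noteq> 0}"


section \<open>DegRevLex, generic initial ideals, almost revlex ideals\<close>

definition drl_greater :: "(nat \<Rightarrow>\<^sub>0 nat) \<Rightarrow> (nat \<Rightarrow>\<^sub>0 nat) \<Rightarrow> bool"
  where "drl_greater t u \<longleftrightarrow> pp_degree u < pp_degree t \<or>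
    (pp_degree t = pp_degree u \<and>
      (\<exists>i. Poly_Mapping.lookup t i < Poly_Mapping.lookup u i \<and>
        (\<forall>j > i. Poly_Mapping.lookup t j = Poly_Mapping.lookup u j)))"

definition leading_pp :: "(nat, 'k::comm_ring_1) mpoly \<Rightarrow> (nat \<Rightarrow>\<^sub>0 nat)"
  where "leading_pp p =
    (THE t. t \<in> Poly_Mapping.keys p \<and> (\<forall>u \<in> Poly_Mapping.keys p. u \<noteq> t \<longrightarrow> drl_greater t u))"

definition leading_ideal :: "nat \<Rightarrow> (nat, 'k::comm_ring_1) mpoly set \<Rightarrow> (nat, 'k) mpoly set"
  where "leading_ideal l I = genideal (poly_ring l) ((\<lambda>p. power_product (leading_pp p)) ` (I - {0}))"

text \<open>The \<open>K\<close>-algebra endomorphism sending $x_i$ to $\sum_j g_{i,j} x_j$.\<close>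

definition act :: "nat \<Rightarrow> 'k::comm_ring_1 mat \<Rightarrow> (nat, 'k) mpoly \<Rightarrow> (nat, 'k) mpoly"
  where "act l g p = evaluate const_poly (\<lambda>i. linear_form l (\<lambda>j. g $$ (i, j))) p"

text \<open>Points of the affine space with coordinates \<open>{..<l} \<times> {..<l}\<close> are identified with \<open>l \<times> l\<close>
  matrices; the open subsets of \<open>GL(l)\<close> are those of the subspace topology.\<close>

definition rgin :: "nat \<Rightarrow> (nat, 'k::field) mpoly set \<Rightarrow> (nat, 'k) mpoly set"
  where "rgin l I =
    (THE J. \<exists>U. zariski_open ({..<l} \<times> {..<l}) U \<and>
      (\<exists>a \<in> U. invertible_mat (mat l l a)) \<and>
      (\<forall>a \<in> U. invertible_mat (mat l l a) \<longrightarrow> leading_ideal l (act l (mat l l a) ` I) = J))"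

definition minimal_pp_generators ::
    "nat \<Rightarrow> (nat, 'k::comm_ring_1) mpoly set \<Rightarrow> (nat \<Rightarrow>\<^sub>0 nat) set \<Rightarrow> bool"
  where "minimal_pp_generators l J T \<longleftrightarrow>
    T \<subseteq> pps l \<and> genideal (poly_ring l) (power_product ` T) = J \<and>
    (\<forall>T' \<subset> T. genideal (poly_ring l) (power_product ` T') \<noteq> J)"

text \<open>That \<open>J\<close> is a monomial ideal is part of \<open>minimal_pp_generators\<close>; the set \<open>T\<close> is unique.\<close>

definition almost_revlex :: "nat \<Rightarrow> (nat, 'k::comm_ring_1) mpoly set \<Rightarrow> bool"
  where "almost_revlex l J \<longleftrightarrow>
    (\<exists>T. minimal_pp_generators l J T \<and>
      (\<forall>t \<in> T. \<forall>t' \<in> pps l. pp_degree t' = pp_degree t \<and> drl_greater t' t \<longrightarrow>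
        power_product t' \<in> J))"

end

theory Submission
  imports Defs "Jordan_Normal_Form.Determinant" "HOL-Computational_Algebra.Polynomial" "HOL-Library.Function_Algebras"
begin

text \<open>
  Let \<open>J\<close> be the set of power-products of \<open>rgin(I)\<close>. Since the characteristic is 0, \<open>J\<close> is closed under replacing
  a variable by a larger one, and since it dominates the leading power-products in all coordinates, the \<open>l\<close>-SLP passes to \<open>J\<close>:
  multiplication by powers of \<open>x\<^sub>n\<close> on \<open>K[x\<^sub>1,\<dots>,x\<^sub>n]/J\<close> has full rank for all \<open>n\<close>, and the Hilbert functions of these
  rings are the rows of the sectional matrix.

  Let \<open>t\<close> be a minimal generator of \<open>J\<close> with last variable \<open>x\<^sub>n\<close> that violates the almost revlex condition. Stability
  excludes \<open>n \<le> 3\<close>. For \<open>n \<ge> 4\<close> the Hilbert function of \<open>K[x\<^sub>1,\<dots>,x\<^sub>n]/J\<close> drops at the degree of \<open>t\<close>, by quasi-symmetry to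
  a value that it has already taken before, and full rank then forces a bijection that contradicts the violation.
  This needs \<open>deg t \<le> reg(I)\<close>. In generic coordinates, the Koszul homology of \<open>I\<close> on all variables has the graded
  Betti numbers as dimensions, so it vanishes beyond the regularity. Peeling off one variable at a time and descending
  from large degrees, one gets the same vanishing on the last \<open>l - n\<close> variables. It says that \<open>x\<^sub>n\<close> is injective on
  \<open>S/(I + \<langle>x\<^sub>n\<^sub>+\<^sub>1,\<dots>,x\<^sub>l\<rangle>)\<close> in degrees \<open>\<ge> reg(I)\<close>.
\<close>

subsection \<open>Polynomials and forms\<close>

text \<open>The Lefschetz elements supplied by the SLP need not be generic, so full rank is not
  visible in generic coordinates. It is therefore encoded by cardinalities. In DegRevLex the
  power-products in the first n variables, and those among them whose exponent at the last of these
  variables is below s, form initial segments in each degree. Counting standard power-products on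
  them measures sections and cokernels of multiplications, and generic coordinates make all these
  counts minimal. Full rank means that they are already as small as the Hilbert function permits, so
  it passes from Lefschetz coordinates to generic ones.

  The regularity is given by a description over minimal free resolutions. Hence a resolution has to
  be constructed, and its ranks have to be identified with dimensions of Koszul homology, which
  depend on the ideal alone. The large degrees where the descent starts also come from full rank: a
  multiplication by a variable that is surjective in one degree stays so, the Hilbert function then
  cannot increase and becomes constant, and from there on the multiplication is bijective.\<close>

abbreviation "lookup \<equiv> Poly_Mapping.lookup"
abbreviation "keys \<equiv> Poly_Mapping.keys"
abbreviation "single \<equiv> Poly_Mapping.single"

lemma sum_single_keys: "(\<Sum>t\<in>keys p. single t (lookup p t)) = p"
  by (rule poly_mapping_eqI) (simp add: lookup_sum lookup_single when_def in_keys_iff)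

lemma keys_sum_subset: "keys (sum f A) \<subseteq> (\<Union>a\<in>A. keys (f a))"
proof
  fix t assume "t \<in> keys (sum f A)"
  then have "(\<Sum>a\<in>A. lookup (f a) t) \<noteq> 0" by (simp add: in_keys_iff lookup_sum)
  then obtain a where "a \<in> A" "lookup (f a) t \<noteq> 0" by (meson sum.not_neutral_contains_not_neutral)
  then show "t \<in> (\<Union>a\<in>A. keys (f a))" by (auto simp: in_keys_iff)
qed

lemma single_times_eq_sum:
  fixes p :: "('x::cancel_comm_monoid_add \<Rightarrow>\<^sub>0 'k::comm_ring_1)"
  shows "single s c * p = (\<Sum>t\<in>keys p. single (s + t) (c * lookup p t))"
  by (subst sum_single_keys[of p, symmetric]) (simp add: sum_distrib_left mult_single)

lemma lookup_single_times:
  fixes p :: "('x::cancel_comm_monoid_add \<Rightarrow>\<^sub>0 'k::comm_ring_1)"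
  shows "lookup (single s c * p) (s + t) = c * lookup p t"
  by (auto simp: single_times_eq_sum lookup_sum lookup_single when_def in_keys_iff)

lemma keys_single_times:
  fixes p :: "('x::cancel_comm_monoid_add \<Rightarrow>\<^sub>0 'k::comm_ring_1)"
  shows "keys (single s c * p) \<subseteq> (+) s ` keys p"
  unfolding single_times_eq_sum by (rule order_trans[OF keys_sum_subset]) (auto split: if_splits)

lemma keys_single_times_eq:
  fixes p :: "('x::cancel_comm_monoid_add \<Rightarrow>\<^sub>0 'k::idom)"
  assumes "c \<noteq> 0"
  shows "keys (single s c * p) = (+) s ` keys p"
  using keys_single_times[of s c p] assms by (auto simp: in_keys_iff lookup_single_times)

lemma lookup_const_times:
  fixes p :: "('x::cancel_comm_monoid_add \<Rightarrow>\<^sub>0 'k::comm_ring_1)"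
  shows "lookup (single 0 c * p) t = c * lookup p t"
  using lookup_single_times[of 0 c p t] by simp

lemma pp_degree_eq_sum: "finite A \<Longrightarrow> keys t \<subseteq> A \<Longrightarrow> pp_degree t = (\<Sum>x\<in>A. lookup t x)"
  unfolding pp_degree_def by (rule sum.mono_neutral_left) (auto simp: in_keys_iff)

lemma pp_degree_add [simp]: "pp_degree (s + t) = pp_degree s + pp_degree t"
proof -
  have 1: "pp_degree u = (\<Sum>x\<in>keys s \<union> keys t. lookup u x)" if "keys u \<subseteq> keys s \<union> keys t" for u
    using that by (intro pp_degree_eq_sum) auto
  have "keys (s + t) \<subseteq> keys s \<union> keys t" by (rule Poly_Mapping.keys_add)
  then show ?thesis by (simp add: 1 lookup_add sum.distrib)
qed

lemma pp_degree_single [simp]: "pp_degree (single i n) = n"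
  unfolding pp_degree_def by simp

lemma pp_degree_zero [simp]: "pp_degree 0 = 0"
  unfolding pp_degree_def by simp

lemma pp_degree_eq_0_iff [simp]: "pp_degree t = 0 \<longleftrightarrow> t = 0"
  unfolding pp_degree_def by (auto simp: in_keys_iff intro: poly_mapping_eqI)

lemma lookup_le_pp_degree: "lookup t i \<le> pp_degree t"
  unfolding pp_degree_def
  by (cases "i \<in> keys t") (auto simp: in_keys_iff intro: member_le_sum)

definition mons :: "nat \<Rightarrow> nat \<Rightarrow> (nat \<Rightarrow>\<^sub>0 nat) set"
  where "mons l d = {t \<in> pps l. pp_degree t = d}"

lemma finite_mons [simp]: "finite (mons l d)"
proof (rule inj_on_finite)
  let ?f = "\<lambda>t::nat \<Rightarrow>\<^sub>0 nat. restrict (lookup t) {..<l}"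
  show "inj_on ?f (mons l d)"
  proof (rule inj_onI)
    fix s t assume s: "s \<in> mons l d" and t: "t \<in> mons l d" and eq: "?f s = ?f t"
    show "s = t"
    proof (rule poly_mapping_eqI)
      fix i
      show "lookup s i = lookup t i"
      proof (cases "i < l")
        case True then show ?thesis using fun_cong[OF eq, of i] by simp
      next
        case False
        then have "i \<notin> keys s" "i \<notin> keys t" using s t by (auto simp: mons_def pps_def)
        then show ?thesis by (simp add: in_keys_iff)
      qed
    qed
  qed
  show "?f ` mons l d \<subseteq> {..<l} \<rightarrow>\<^sub>E {..d}"
    using lookup_le_pp_degree by (auto simp: mons_def PiE_iff extensional_def split: if_splits)
  show "finite ({..<l} \<rightarrow>\<^sub>E {..d})" by (rule finite_PiE) auto
qed

lemma keys_add_nat: "keys (s + t) = keys s \<union> keys (t :: 'x \<Rightarrow>\<^sub>0 nat)"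
  by (auto simp: in_keys_iff lookup_add)

lemma pps_add_iff [simp]: "s + t \<in> pps l \<longleftrightarrow> s \<in> pps l \<and> t \<in> pps l"
  by (auto simp: pps_def keys_add_nat)

lemma zero_in_pps [simp]: "0 \<in> pps l"
  by (simp add: pps_def)

lemma single_in_pps [simp]: "single i n \<in> pps l \<longleftrightarrow> n = 0 \<or> i < l"
  by (auto simp: pps_def)

lemma pps_mono: "n \<le> l \<Longrightarrow> pps n \<subseteq> pps l"
  by (auto simp: pps_def)

lemma lookup_pps: "t \<in> pps l \<Longrightarrow> l \<le> i \<Longrightarrow> lookup t i = 0"
  by (fastforce simp: pps_def in_keys_iff)

lemma pp_split: "lookup t i \<ge> s \<Longrightarrow> t = (t - single i s) + single i (s::nat)"
  by (rule poly_mapping_eqI) (auto simp: lookup_add lookup_minus lookup_single when_def)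

section \<open>The polynomial ring and its graded pieces\<close>

abbreviation polyS :: "nat \<Rightarrow> (nat, 'k::zero) mpoly set"
  where "polyS l \<equiv> polys_in {..<l}"

lemma polyS_iff: "p \<in> polyS l \<longleftrightarrow> keys p \<subseteq> pps l"
  by (auto simp: polys_in_def pps_def)

lemma carrier_poly_ring [simp]: "carrier (poly_ring l) = polyS l"
  and mult_poly_ring [simp]: "monoid.mult (poly_ring l) = (*)"
  and one_poly_ring [simp]: "monoid.one (poly_ring l) = 1"
  and zero_poly_ring [simp]: "ring.zero (poly_ring l) = 0"
  and add_poly_ring [simp]: "ring.add (poly_ring l) = (+)"
  by (simp_all add: poly_ring_def)

lemma polyS_zero [simp]: "0 \<in> polyS l"
  by (simp add: polyS_iff)

lemma polyS_single [simp]: "t \<in> pps l \<Longrightarrow> single t c \<in> polyS l"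
  by (auto simp: polyS_iff)

lemma polyS_one [simp]: "(1 :: (nat, 'k::comm_ring_1) mpoly) \<in> polyS l"
  using polyS_single[of 0 l "1::'k"] by simp

lemma polyS_add [intro]: "p \<in> polyS l \<Longrightarrow> q \<in> polyS l \<Longrightarrow> p + q \<in> polyS l"
  using Poly_Mapping.keys_add[of p q] by (auto simp: polyS_iff)

lemma polyS_uminus [simp]: "- p \<in> polyS l \<longleftrightarrow> p \<in> polyS l" for p :: "(nat, 'k::comm_ring_1) mpoly"
  by (auto simp: polyS_iff in_keys_iff)

lemma polyS_diff [intro]: "p \<in> polyS l \<Longrightarrow> q \<in> polyS l \<Longrightarrow> p - q \<in> polyS l" for p :: "(nat, 'k::comm_ring_1) mpoly"
  using polyS_add[of p l "- q"] by simp

lemma polyS_mult [intro]: "p \<in> polyS l \<Longrightarrow> q \<in> polyS l \<Longrightarrow> p * q \<in> polyS l" for p :: "(nat, 'k::comm_ring_1) mpoly"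
  using Poly_Mapping.keys_mult[of p q] by (fastforce simp: polyS_iff)

lemma polyS_power [intro]: "p \<in> polyS l \<Longrightarrow> p ^ n \<in> polyS l" for p :: "(nat, 'k::comm_ring_1) mpoly"
  by (induction n) auto

lemma polyS_sum [intro]: "(\<And>a. a \<in> A \<Longrightarrow> f a \<in> polyS l) \<Longrightarrow> sum f A \<in> polyS l" for f :: "_ \<Rightarrow> (nat, 'k::comm_ring_1) mpoly"
  by (induction A rule: infinite_finite_induct) auto

lemma forms_iff: "p \<in> forms l d \<longleftrightarrow> keys p \<subseteq> mons l d"
  by (auto simp: forms_def polyS_iff mons_def)

lemma forms_polyS: "p \<in> forms l d \<Longrightarrow> p \<in> polyS l"
  by (simp add: forms_def)

lemma forms_zero [simp]: "0 \<in> forms l d"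
  by (simp add: forms_iff)

lemma forms_single: "t \<in> mons l d \<Longrightarrow> single t c \<in> forms l d"
  by (auto simp: forms_iff)

lemma forms_add [intro]: "p \<in> forms l d \<Longrightarrow> q \<in> forms l d \<Longrightarrow> p + q \<in> forms l d"
  using Poly_Mapping.keys_add[of p q] by (auto simp: forms_iff)

lemma forms_uminus [simp]: "- p \<in> forms l d \<longleftrightarrow> p \<in> forms l d"
  by (auto simp: forms_iff in_keys_iff)

lemma forms_diff [intro]: "p \<in> forms l d \<Longrightarrow> q \<in> forms l d \<Longrightarrow> p - q \<in> forms l d"
  using forms_add[of p l d "- q"] by simp

lemma forms_mult: "p \<in> forms l d \<Longrightarrow> q \<in> forms l e \<Longrightarrow> p * q \<in> forms l (d + e)"
  using Poly_Mapping.keys_mult[of p q] by (fastforce simp: forms_iff mons_def)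

lemma forms_one [simp]: "1 \<in> forms l 0"
  by (auto simp: forms_iff mons_def)

lemma forms_const [simp]: "const_poly c \<in> forms l 0"
  by (auto simp: forms_iff mons_def const_poly_def)

lemma forms_power: "p \<in> forms l d \<Longrightarrow> p ^ n \<in> forms l (n * d)"
  by (induction n) (auto intro: forms_mult)

lemma forms_scale [intro]: "p \<in> forms l d \<Longrightarrow> const_poly c * p \<in> forms l d"
  using forms_mult[OF forms_const] by fastforce

lemma forms_sum [intro]: "(\<And>a. a \<in> A \<Longrightarrow> f a \<in> forms l d) \<Longrightarrow> sum f A \<in> forms l d"
  by (induction A rule: infinite_finite_induct) auto

lemma forms_0: "p \<in> forms l 0 \<Longrightarrow> p = const_poly (lookup p 0)"
  by (rule poly_mapping_eqI) (force simp: forms_iff mons_def const_poly_def lookup_single when_def in_keys_iff)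

lemma var_poly_form: "i < l \<Longrightarrow> var_poly i \<in> forms l 1"
  by (auto simp: var_poly_def forms_iff mons_def)

lemma lookup_scale [simp]: "lookup (const_poly c * p) t = c * lookup p t"
  for p :: "('x, 'k::comm_ring_1) mpoly"
  by (simp add: const_poly_def lookup_const_times)

lemma const_poly_hom:
  "const_poly 0 = 0" "const_poly 1 = 1" "const_poly (a + b) = const_poly a + const_poly b"
  "const_poly (a * b) = const_poly a * const_poly b" "const_poly (- a) = - const_poly a"
  by (simp_all add: const_poly_def single_add mult_single single_uminus)

lemma const_poly_in_polyS [simp]: "const_poly c \<in> polyS l"
  by (simp add: const_poly_def)

lemma power_product_in_polyS [simp]: "t \<in> pps l \<Longrightarrow> power_product t \<in> polyS l"
  by (simp add: power_product_def)

lemma keys_power_product [simp]: "keys (power_product t :: ('x, 'k::comm_ring_1) mpoly) = {t}"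
  by (simp add: power_product_def)

lemma lookup_homogeneous_component:
  "lookup (homogeneous_component d p) t = (if pp_degree t = d then lookup p t else 0)"
proof -
  have "lookup (homogeneous_component d p) t = (\<Sum>u\<in>{u \<in> keys p. pp_degree u = d}. if u = t then lookup p u else 0)"
    by (simp add: homogeneous_component_def lookup_sum lookup_single when_def)
  also have "\<dots> = (if t \<in> {u \<in> keys p. pp_degree u = d} then lookup p t else 0)"
    by (rule sum.delta) simp
  finally show ?thesis by (auto simp: in_keys_iff)
qed

lemma homogeneous_component_form: "p \<in> polyS l \<Longrightarrow> homogeneous_component d p \<in> forms l d"
  by (auto simp: forms_iff polyS_iff mons_def in_keys_iff lookup_homogeneous_component subset_iff split: if_splits)

lemma homogeneous_component_of_form:
  "p \<in> forms l d \<Longrightarrow> homogeneous_component e p = (if e = d then p else 0)"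
  by (rule poly_mapping_eqI) (auto simp: lookup_homogeneous_component forms_iff mons_def in_keys_iff subset_iff)

lemma homogeneous_component_add:
  "homogeneous_component d (p + q) = homogeneous_component d p + homogeneous_component d q"
  by (rule poly_mapping_eqI) (auto simp: lookup_homogeneous_component lookup_add)

lemma homogeneous_component_diff:
  "homogeneous_component d (p - q) = homogeneous_component d p - homogeneous_component d q"
  by (rule poly_mapping_eqI) (auto simp: lookup_homogeneous_component lookup_minus)

lemma homogeneous_component_zero [simp]: "homogeneous_component d 0 = 0"
  by (rule poly_mapping_eqI) (auto simp: lookup_homogeneous_component)

lemma homogeneous_component_sum:
  "homogeneous_component d (sum f A) = (\<Sum>a\<in>A. homogeneous_component d (f a))"
  by (induction A rule: infinite_finite_induct) (auto simp: homogeneous_component_add)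

lemma sum_homogeneous_components:
  "(\<Sum>d\<in>pp_degree ` keys p. homogeneous_component d p) = p"
  by (rule poly_mapping_eqI) (auto simp: lookup_sum lookup_homogeneous_component in_keys_iff)

lemma homogeneous_component_mult_form:
  fixes p q :: "(nat, 'k::comm_ring_1) mpoly"
  assumes p: "p \<in> polyS l" and q: "q \<in> forms l e"
  shows "homogeneous_component (d + e) (p * q) = homogeneous_component d p * q"
    and "n < e \<Longrightarrow> homogeneous_component n (p * q) = 0"
proof -
  have *: "homogeneous_component n (p * q) = (\<Sum>c\<in>pp_degree ` keys p. if n = c + e then homogeneous_component c p * q else 0)" for n
    by (subst sum_homogeneous_components[of p, symmetric])
      (auto simp: sum_distrib_right homogeneous_component_sum intro!: sum.cong
        homogeneous_component_of_form[OF forms_mult[OF homogeneous_component_form[OF p] q], THEN trans])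
  show "n < e \<Longrightarrow> homogeneous_component n (p * q) = 0"
    unfolding * by (auto intro!: sum.neutral)
  have "homogeneous_component (d + e) (p * q) = (\<Sum>c\<in>pp_degree ` keys p. if d = c then homogeneous_component c p * q else 0)"
    unfolding * by (auto intro!: sum.cong)
  also have "\<dots> = homogeneous_component d p * q"
  proof (cases "d \<in> pp_degree ` keys p")
    case False
    then have "homogeneous_component d p = 0"
      by (intro poly_mapping_eqI) (auto simp: lookup_homogeneous_component in_keys_iff)
    then show ?thesis using False by (auto intro!: sum.neutral)
  qed simp
  finally show "homogeneous_component (d + e) (p * q) = homogeneous_component d p * q" .
qed

subsection \<open>Leading power-products\<close>

lemma drl_irrefl [simp]: "\<not> drl_greater t t"
  by (simp add: drl_greater_def)

lemma drl_trans: "drl_greater s t \<Longrightarrow> drl_greater t u \<Longrightarrow> drl_greater s u"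
proof -
  assume a: "drl_greater s t" "drl_greater t u"
  show ?thesis
  proof (cases "pp_degree s = pp_degree t \<and> pp_degree t = pp_degree u")
    case True
    then obtain i j where
      i: "lookup s i < lookup t i" "\<forall>k>i. lookup s k = lookup t k" and
      j: "lookup t j < lookup u j" "\<forall>k>j. lookup t k = lookup u k"
      using a by (auto simp: drl_greater_def)
    have "lookup s (max i j) < lookup u (max i j)"
      using i j by (cases i j rule: linorder_cases) (auto simp: max_def)
    moreover have "\<forall>k>max i j. lookup s k = lookup u k" using i j by auto
    ultimately show ?thesis using True unfolding drl_greater_def
      by (intro disjI2 conjI exI[of _ "max i j"]) auto
  qed (use a in \<open>auto simp: drl_greater_def\<close>)
qed

lemma drl_asym: "drl_greater s t \<Longrightarrow> \<not> drl_greater t s"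
  using drl_trans drl_irrefl by blast

lemma drl_total: "s \<noteq> t \<Longrightarrow> drl_greater s t \<or> drl_greater t s"
proof -
  assume "s \<noteq> t"
  let ?D = "{i. lookup s i \<noteq> lookup t i}"
  have "?D \<subseteq> keys s \<union> keys t" by (auto simp: in_keys_iff)
  then have fin: "finite ?D" by (rule finite_subset) auto
  moreover have "?D \<noteq> {}" using \<open>s \<noteq> t\<close> by (auto simp: poly_mapping_eq_iff fun_eq_iff)
  ultimately have "Max ?D \<in> ?D" by (rule Max_in)
  moreover have "lookup s k = lookup t k" if "k > Max ?D" for k
    using Max_ge[OF fin, of k] that by force
  ultimately have "\<exists>i. lookup s i \<noteq> lookup t i \<and> (\<forall>k>i. lookup s k = lookup t k)" by blast
  then obtain i where i: "lookup s i \<noteq> lookup t i" "\<forall>k>i. lookup s k = lookup t k" by blast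
  show ?thesis
  proof (cases "pp_degree s" "pp_degree t" rule: linorder_cases)
    case equal
    then show ?thesis using i unfolding drl_greater_def
      by (cases "lookup s i < lookup t i") (auto intro!: exI[of _ i])
  qed (auto simp: drl_greater_def)
qed

lemma drl_add_iff [simp]: "drl_greater (u + s) (u + t) \<longleftrightarrow> drl_greater s t"
  by (simp add: drl_greater_def lookup_add)

lemma drl_max_exists:
  assumes "finite A" "A \<noteq> {}"
  shows "\<exists>t\<in>A. \<forall>u\<in>A. u \<noteq> t \<longrightarrow> drl_greater t u"
  using assms
proof (induction A rule: finite_ne_induct)
  case (insert x F)
  then obtain t where "t \<in> F" "\<forall>u\<in>F. u \<noteq> t \<longrightarrow> drl_greater t u" by blast
  then show ?case using drl_total[of x t] drl_trans drl_asym insert.hyps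
    by (metis insert_iff)
qed simp

text \<open>A relation is used because \<open>leading_pp\<close> is a description without a
  meaningful value at 0; \<open>leading_pp_eqI\<close> connects the two.\<close>

definition lead :: "(nat, 'k::zero) mpoly \<Rightarrow> (nat \<Rightarrow>\<^sub>0 nat) \<Rightarrow> bool"
  where "lead p t \<longleftrightarrow> t \<in> keys p \<and> (\<forall>u\<in>keys p. u \<noteq> t \<longrightarrow> drl_greater t u)"

lemma lead_exists: "p \<noteq> 0 \<Longrightarrow> \<exists>t. lead p t"
  using drl_max_exists[of "keys p"] unfolding lead_def
  by (metis Poly_Mapping.finite_keys equals0I poly_mapping_eqI lookup_zero in_keys_iff)

lemma lead_unique: "lead p t \<Longrightarrow> lead p u \<Longrightarrow> t = u"
  unfolding lead_def by (metis drl_asym)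

lemma lead_nonzero: "lead p t \<Longrightarrow> p \<noteq> 0"
  by (auto simp: lead_def)

lemma leading_pp_eqI: "lead p t \<Longrightarrow> leading_pp p = t"
  unfolding leading_pp_def lead_def[symmetric] using lead_unique by blast

lemma lead_form_degree: "lead p t \<Longrightarrow> p \<in> forms l d \<Longrightarrow> t \<in> mons l d"
  by (auto simp: lead_def forms_iff)

lemma lead_single_times:
  fixes p :: "(nat, 'k::idom) mpoly"
  shows "lead p t \<Longrightarrow> lead (single s 1 * p) (s + t)"
  by (auto simp: lead_def keys_single_times_eq)

section \<open>Homogeneous ideals and monomial ideals\<close>

definition hideal :: "nat \<Rightarrow> (nat, 'k::comm_ring_1) mpoly set \<Rightarrow> bool"
  where "hideal l I \<longleftrightarrow> I \<subseteq> polyS l \<and> 0 \<in> I \<and> (\<forall>p\<in>I. \<forall>q\<in>I. p + q \<in> I) \<and>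
    (\<forall>p\<in>polyS l. \<forall>q\<in>I. p * q \<in> I) \<and> (\<forall>p\<in>I. \<forall>d. homogeneous_component d p \<in> I)"

lemma a_inv_poly_ring: "p \<in> polyS l \<Longrightarrow> \<ominus>\<^bsub>poly_ring l\<^esub> p = - p" for p :: "(nat, 'k::comm_ring_1) mpoly"
proof -
  interpret cring "poly_ring l :: (nat, 'k) mpoly ring" by (rule cring_poly_ring)
  assume "p \<in> polyS l"
  then show ?thesis by (intro minus_equality) auto
qed

lemma ideal_poly_ringI:
  fixes I :: "(nat, 'k::comm_ring_1) mpoly set"
  assumes "I \<subseteq> polyS l" "0 \<in> I" "\<And>p q. p \<in> I \<Longrightarrow> q \<in> I \<Longrightarrow> p + q \<in> I"
    "\<And>p q. p \<in> polyS l \<Longrightarrow> q \<in> I \<Longrightarrow> p * q \<in> I"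
  shows "ideal I (poly_ring l)"
proof -
  interpret R: cring "poly_ring l :: (nat, 'k) mpoly ring" by (rule cring_poly_ring)
  show ?thesis
  proof (rule idealI)
    show "ring (poly_ring l :: (nat, 'k) mpoly ring)" by (rule R.ring_axioms)
    have inv: "- p \<in> I" if "p \<in> I" for p
      using assms(4)[of "- 1" p] that by simp
    show "subgroup I (add_monoid (poly_ring l))"
    proof
      fix x assume x: "x \<in> I"
      have "inv\<^bsub>add_monoid (poly_ring l)\<^esub> x = \<ominus>\<^bsub>poly_ring l\<^esub> x" by (simp add: a_inv_def)
      then show "inv\<^bsub>add_monoid (poly_ring l)\<^esub> x \<in> I"
        using x assms(1) inv by (auto simp: a_inv_poly_ring subset_iff)
    qed (use assms in auto)
  next
    fix a x assume "a \<in> I" "x \<in> carrier (poly_ring l :: (nat, 'k) mpoly ring)"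
    then have "x * a \<in> I" using assms(4) by simp
    then show "x \<otimes>\<^bsub>poly_ring l\<^esub> a \<in> I" "a \<otimes>\<^bsub>poly_ring l\<^esub> x \<in> I" by (simp_all add: mult.commute)
  qed
qed

lemma ideal_poly_ringD:
  fixes I :: "(nat, 'k::comm_ring_1) mpoly set"
  assumes "ideal I (poly_ring l)"
  shows "I \<subseteq> polyS l" "0 \<in> I" "\<And>p q. p \<in> I \<Longrightarrow> q \<in> I \<Longrightarrow> p + q \<in> I"
    "\<And>p q. p \<in> polyS l \<Longrightarrow> q \<in> I \<Longrightarrow> p * q \<in> I"
proof -
  interpret ideal I "poly_ring l" by (rule assms)
  show "I \<subseteq> polyS l" using a_subset by simp
  show "0 \<in> I" using additive_subgroup.zero_closed[OF additive_subgroup_axioms] by simp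
  show "p + q \<in> I" if "p \<in> I" "q \<in> I" for p q using additive_subgroup.a_closed[OF additive_subgroup_axioms that] by simp
  show "p * q \<in> I" if "p \<in> polyS l" "q \<in> I" for p q using I_l_closed[of q p] that by simp
qed

text \<open>From here on ideals are handled by the plain operations of the polynomial type instead
  of the ring record.\<close>

lemma homogeneous_ideal_iff: "homogeneous_ideal l I \<longleftrightarrow> hideal l I"
  unfolding homogeneous_ideal_def hideal_def
  using ideal_poly_ringI[of I l] ideal_poly_ringD[of I l] by blast

lemma hideal_ideal: "hideal l I \<Longrightarrow> ideal I (poly_ring l)"
  using homogeneous_ideal_iff unfolding homogeneous_ideal_def by blast

lemma hidealD:
  assumes "hideal l I"
  shows "p \<in> I \<Longrightarrow> p \<in> polyS l" "0 \<in> I" "p \<in> I \<Longrightarrow> q \<in> I \<Longrightarrow> p + q \<in> I"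
    "p \<in> polyS l \<Longrightarrow> q \<in> I \<Longrightarrow> p * q \<in> I" "p \<in> I \<Longrightarrow> homogeneous_component d p \<in> I"
    "p \<in> I \<Longrightarrow> const_poly c * p \<in> I" "p \<in> I \<Longrightarrow> - p \<in> I" "p \<in> I \<Longrightarrow> q \<in> I \<Longrightarrow> p - q \<in> I"
proof -
  show s: "p \<in> polyS l \<Longrightarrow> q \<in> I \<Longrightarrow> p * q \<in> I" for p q using assms by (auto simp: hideal_def)
  show a: "p \<in> I \<Longrightarrow> q \<in> I \<Longrightarrow> p + q \<in> I" for p q using assms by (auto simp: hideal_def)
  show m: "p \<in> I \<Longrightarrow> - p \<in> I" for p using s[of "- 1" p] by simp
  show "p \<in> I \<Longrightarrow> q \<in> I \<Longrightarrow> p - q \<in> I" using a[of p "- q"] m[of q] by simp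
qed (use assms in \<open>auto simp: hideal_def\<close>)

lemma hideal_sum: "hideal l I \<Longrightarrow> (\<And>a. a \<in> A \<Longrightarrow> f a \<in> I) \<Longrightarrow> sum f A \<in> I"
  by (induction A rule: infinite_finite_induct) (auto intro: hidealD)

definition ltset :: "(nat, 'k::zero) mpoly set \<Rightarrow> (nat \<Rightarrow>\<^sub>0 nat) set"
  where "ltset I = {t. \<exists>p\<in>I. lead p t}"

lemma lead_homogeneous_component:
  assumes "lead p t" shows "lead (homogeneous_component (pp_degree t) p) t"
  using assms by (auto simp: lead_def in_keys_iff lookup_homogeneous_component split: if_splits)

lemma ltset_homogeneous:
  assumes "hideal l I" "t \<in> ltset I"
  obtains p where "p \<in> I" "p \<in> forms l (pp_degree t)" "lead p t"
proof -
  obtain p where "p \<in> I" "lead p t" using assms(2) by (auto simp: ltset_def)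
  then show ?thesis
    using that[OF hidealD(5)[OF assms(1)] homogeneous_component_form[OF hidealD(1)[OF assms(1)]] lead_homogeneous_component]
    by simp
qed

lemma ltset_pps: "hideal l I \<Longrightarrow> ltset I \<subseteq> pps l"
  by (fastforce simp: ltset_def lead_def hideal_def polyS_iff)

text \<open>These are the sets of power-products of monomial ideals; the combinatorial arguments
  take place on them instead of on the ideals.\<close>

definition upcl :: "nat \<Rightarrow> (nat \<Rightarrow>\<^sub>0 nat) set \<Rightarrow> bool"
  where "upcl l M \<longleftrightarrow> M \<subseteq> pps l \<and> (\<forall>t\<in>M. \<forall>u\<in>pps l. u + t \<in> M)"

lemma upclD: "upcl l M \<Longrightarrow> t \<in> M \<Longrightarrow> u \<in> pps l \<Longrightarrow> u + t \<in> M"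
  by (simp add: upcl_def)

lemma upcl_pps: "upcl l M \<Longrightarrow> t \<in> M \<Longrightarrow> t \<in> pps l"
  by (auto simp: upcl_def)

lemma ltset_upcl:
  fixes I :: "(nat, 'k::idom) mpoly set"
  shows "hideal l I \<Longrightarrow> upcl l (ltset I)"
  unfolding upcl_def
proof (intro conjI ballI)
  fix t u assume I: "hideal l I" and "t \<in> ltset I" and u: "u \<in> pps l"
  then obtain p where "p \<in> I" "lead p t" by (auto simp: ltset_def)
  then have "single u 1 * p \<in> I" "lead (single u 1 * p) (u + t)"
    using hidealD(4)[OF I] u by (auto intro: lead_single_times)
  then show "u + t \<in> ltset I" by (auto simp: ltset_def)
qed (rule ltset_pps)

definition mono_ideal :: "nat \<Rightarrow> (nat \<Rightarrow>\<^sub>0 nat) set \<Rightarrow> (nat, 'k::comm_ring_1) mpoly set"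
  where "mono_ideal l M = {p \<in> polyS l. keys p \<subseteq> M}"

lemma power_product_mono_ideal:
  "M \<subseteq> pps l \<Longrightarrow> power_product t \<in> (mono_ideal l M :: (nat, 'k::comm_ring_1) mpoly set) \<longleftrightarrow> t \<in> M"
  by (auto simp: mono_ideal_def polyS_iff)

lemma hideal_mono_ideal: "upcl l M \<Longrightarrow> hideal l (mono_ideal l M)"
  unfolding hideal_def
proof (intro conjI ballI allI)
  assume M: "upcl l M"
  show "p + q \<in> mono_ideal l M" if "p \<in> mono_ideal l M" "q \<in> mono_ideal l M" for p q
    using that Poly_Mapping.keys_add[of p q] by (auto simp: mono_ideal_def)
  show "p * q \<in> mono_ideal l M" if "p \<in> polyS l" "q \<in> mono_ideal l M" for p q
  proof -
    have "t \<in> M" if t: "t \<in> keys (p * q)" for t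
    proof -
      obtain u v where "t = u + v" "u \<in> keys p" "v \<in> keys q"
        using t Poly_Mapping.keys_mult[of p q] by blast
      then show ?thesis using \<open>p \<in> polyS l\<close> \<open>q \<in> mono_ideal l M\<close> upclD[OF M, of v u]
        by (auto simp: mono_ideal_def polyS_iff)
    qed
    then show ?thesis using that by (auto simp: mono_ideal_def)
  qed
  show "homogeneous_component d p \<in> mono_ideal l M" if "p \<in> mono_ideal l M" for p d
    using that by (auto simp: mono_ideal_def polyS_iff in_keys_iff lookup_homogeneous_component subset_iff split: if_splits)
qed (auto simp: mono_ideal_def)

lemma genideal_power_products:
  assumes T: "T \<subseteq> pps l"
  shows "genideal (poly_ring l) (power_product ` T) =
    (mono_ideal l {u + t | t u. t \<in> T \<and> u \<in> pps l} :: (nat, 'k::comm_ring_1) mpoly set)"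
    (is "_ = mono_ideal l ?M")
proof
  have up: "upcl l ?M" unfolding upcl_def
  proof (intro conjI ballI)
    fix s v assume "s \<in> ?M" and v: "v \<in> pps l"
    then obtain t u where "s = u + t" "t \<in> T" "u \<in> pps l" by auto
    then have "v + s = (v + u) + t" "t \<in> T" "v + u \<in> pps l" using v by (auto simp: add.assoc)
    then show "v + s \<in> ?M" by blast
  qed (use T in auto)
  then have id: "ideal (mono_ideal l ?M :: (nat, 'k) mpoly set) (poly_ring l)"
    using hideal_mono_ideal hideal_ideal by blast
  have "T \<subseteq> ?M" by force
  then have sub: "power_product ` T \<subseteq> (mono_ideal l ?M :: (nat, 'k) mpoly set)"
    using T by (auto simp: mono_ideal_def polyS_iff)
  show "genideal (poly_ring l) (power_product ` T) \<subseteq> (mono_ideal l ?M :: (nat, 'k) mpoly set)"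
    using id sub by (auto simp: genideal_def)
  show "(mono_ideal l ?M :: (nat, 'k) mpoly set) \<subseteq> genideal (poly_ring l) (power_product ` T)"
    unfolding genideal_def
  proof (intro Inter_greatest subsetI)
    fix J and p :: "(nat, 'k) mpoly"
    assume "J \<in> {I :: (nat, 'k) mpoly set. ideal I (poly_ring l) \<and> power_product ` T \<subseteq> I}" and p: "p \<in> mono_ideal l ?M"
    then have J: "ideal J (poly_ring l)" and TJ: "power_product ` T \<subseteq> J" by auto
    have s: "single s c \<in> J" if sM: "s \<in> ?M" for s c
    proof -
      obtain t u where s: "s = u + t" "t \<in> T" "u \<in> pps l" using sM by auto
      have "single s c = single u c * power_product t"
        by (simp add: power_product_def mult_single s)
      then show ?thesis using ideal_poly_ringD(4)[OF J, of "single u c" "power_product t"] s TJ by auto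
    qed
    have "(\<Sum>t\<in>A. f t) \<in> J" if "\<forall>a\<in>A. f a \<in> J" for f and A :: "(nat \<Rightarrow>\<^sub>0 nat) set"
      using that by (induction A rule: infinite_finite_induct) (auto intro: ideal_poly_ringD[OF J])
    moreover have "\<forall>t\<in>keys p. single t (lookup p t) \<in> J"
    proof
      fix t assume "t \<in> keys p"
      then have "t \<in> ?M" using p by (auto simp: mono_ideal_def simp del: mem_Collect_eq)
      then show "single t (lookup p t) \<in> J" by (rule s)
    qed
    ultimately have "(\<Sum>t\<in>keys p. single t (lookup p t)) \<in> J" by simp
    then show "p \<in> J" by (simp add: sum_single_keys)
  qed
qed

lemma mono_ideal_inj:
  assumes "M \<subseteq> pps l" "N \<subseteq> pps l" "(mono_ideal l M :: (nat, 'k::comm_ring_1) mpoly set) = mono_ideal l N"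
  shows "M = N"
proof -
  have "t \<in> M \<longleftrightarrow> t \<in> N" for t
    using power_product_mono_ideal[where 'k = 'k, OF assms(1), of t]
      power_product_mono_ideal[where 'k = 'k, OF assms(2), of t] assms(3) by simp
  then show ?thesis by auto
qed

lemma leading_ideal_eq:
  fixes I :: "(nat, 'k::idom) mpoly set"
  assumes I: "hideal l I"
  shows "leading_ideal l I = mono_ideal l (ltset I)"
proof -
  have 1: "(\<lambda>p. power_product (leading_pp p)) ` (I - {0}) = (power_product ` ltset I :: (nat, 'k) mpoly set)"
  proof (intro equalityI subsetI)
    fix x :: "(nat, 'k) mpoly" assume "x \<in> (\<lambda>p. power_product (leading_pp p)) ` (I - {0})"
    then obtain p where p: "p \<in> I" "p \<noteq> 0" "x = power_product (leading_pp p)" by auto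
    then obtain t where "lead p t" using lead_exists by blast
    then show "x \<in> power_product ` ltset I" using p by (auto simp: ltset_def leading_pp_eqI)
  next
    fix x :: "(nat, 'k) mpoly" assume "x \<in> power_product ` ltset I"
    then obtain p t where p: "p \<in> I" "lead p t" "x = power_product t" by (auto simp: ltset_def)
    then show "x \<in> (\<lambda>p. power_product (leading_pp p)) ` (I - {0})"
      using lead_nonzero leading_pp_eqI by (intro image_eqI[of _ _ p]) auto
  qed
  have "{u + t | t u. t \<in> ltset I \<and> u \<in> pps l} = ltset I"
  proof (intro equalityI subsetI)
    fix s assume "s \<in> ltset I"
    then have "s = 0 + s \<and> s \<in> ltset I \<and> 0 \<in> pps l" by simp
    then show "s \<in> {u + t | t u. t \<in> ltset I \<and> u \<in> pps l}" by blast
  qed (use upclD[OF ltset_upcl[OF I]] in auto)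
  then show ?thesis
    unfolding leading_ideal_def 1 genideal_power_products[OF ltset_pps[OF I]] by simp
qed

section \<open>Linear algebra with coefficients at power-products\<close>

lemma nontrivial_solution:
  fixes A :: "'i \<Rightarrow> 'j \<Rightarrow> 'k::field"
  assumes "finite E" "finite F" "card E < card F"
  shows "\<exists>c. (\<exists>j\<in>F. c j \<noteq> 0) \<and> (\<forall>i\<in>E. (\<Sum>j\<in>F. A i j * c j) = 0)"
  using assms
proof (induction E arbitrary: F A rule: finite_induct)
  case empty
  then show ?case by (intro exI[of _ "\<lambda>_. 1"]) (auto simp: card_gt_0_iff)
next
  case (insert e E)
  show ?case
  proof (cases "\<forall>j\<in>F. A e j = 0")
    case True
    have "card E < card F" using insert.prems insert.hyps by simp
    from insert.IH[OF insert.prems(1) this, of A] True show ?thesis by auto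
  next
    case False
    then obtain j0 where j0: "j0 \<in> F" "A e j0 \<noteq> 0" by auto
    \<comment> \<open>Elimination: the equation \<open>e\<close> is solved for the unknown
      \<open>j0\<close> and substituted into the others; back-substitution gives
      \<open>c'\<close>.\<close>
    let ?F = "F - {j0}" and ?A = "\<lambda>i j. A i j - A i j0 * A e j / A e j0"
    have "card E < card ?F" using insert.prems insert.hyps j0 by simp
    from insert.IH[OF _ this, of ?A] insert.prems obtain c where
      c: "\<exists>j\<in>?F. c j \<noteq> 0" "\<forall>i\<in>E. (\<Sum>j\<in>?F. ?A i j * c j) = 0" by auto
    define c' where "c' = c(j0 := - (\<Sum>j\<in>?F. A e j * c j) / A e j0)"
    have split: "(\<Sum>j\<in>F. A i j * c' j) = A i j0 * c' j0 + (\<Sum>j\<in>?F. A i j * c j)" for i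
    proof -
      have "(\<Sum>j\<in>F. A i j * c' j) = A i j0 * c' j0 + (\<Sum>j\<in>?F. A i j * c' j)"
        by (rule sum.remove[OF insert.prems(1) j0(1)])
      moreover have "(\<Sum>j\<in>?F. A i j * c' j) = (\<Sum>j\<in>?F. A i j * c j)"
        by (rule sum.cong) (auto simp: c'_def)
      ultimately show ?thesis by simp
    qed
    have "(\<Sum>j\<in>F. A i j * c' j) = 0" if "i \<in> insert e E" for i
    proof (cases "i = e")
      case True
      then show ?thesis unfolding split using j0 by (simp add: c'_def)
    next
      case False
      then have "(\<Sum>j\<in>?F. ?A i j * c j) = 0" using that c by auto
      moreover have "(\<Sum>j\<in>?F. ?A i j * c j) =
          (\<Sum>j\<in>?F. A i j * c j) - (A i j0 / A e j0) * (\<Sum>j\<in>?F. A e j * c j)"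
        by (simp add: sum_distrib_left sum_subtractf[symmetric] algebra_simps)
      ultimately show ?thesis unfolding split by (simp add: c'_def algebra_simps)
    qed
    moreover have "\<exists>j\<in>F. c' j \<noteq> 0" using c(1) by (auto simp: c'_def)
    ultimately show ?thesis by blast
  qed
qed

text \<open>Independence is expressed by a single polynomial in the entries, which is what turns
  independence of forms into a Zariski open condition.\<close>

lemma det_nonzero_iff:
  fixes m :: "nat \<Rightarrow> nat \<Rightarrow> 'k::field"
  shows "det (mat r r (\<lambda>(i, j). m i j)) \<noteq> 0 \<longleftrightarrow>
    (\<forall>c. (\<forall>i<r. (\<Sum>j<r. m i j * c j) = 0) \<longrightarrow> (\<forall>j<r. c j = 0))"
proof -
  let ?M = "mat r r (\<lambda>(i, j). m i j)"
  have mv: "(?M *\<^sub>v v) $ i = (\<Sum>j<r. m i j * v $ j)" if "v \<in> carrier_vec r" "i < r" for v i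
    using that by (auto simp: scalar_prod_def atLeast0LessThan intro!: sum.cong)
  have "det ?M = 0 \<longleftrightarrow> (\<exists>v. v \<in> carrier_vec r \<and> v \<noteq> 0\<^sub>v r \<and> ?M *\<^sub>v v = 0\<^sub>v r)"
    by (rule det_0_iff_vec_prod_zero) simp
  also have "\<dots> \<longleftrightarrow> (\<exists>c. (\<forall>i<r. (\<Sum>j<r. m i j * c j) = 0) \<and> (\<exists>j<r. c j \<noteq> 0))"
  proof
    assume "\<exists>v. v \<in> carrier_vec r \<and> v \<noteq> 0\<^sub>v r \<and> ?M *\<^sub>v v = 0\<^sub>v r"
    then obtain v where v: "v \<in> carrier_vec r" "v \<noteq> 0\<^sub>v r" "?M *\<^sub>v v = 0\<^sub>v r" by auto
    have "\<exists>j<r. v $ j \<noteq> 0"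
      using v(1,2) by (metis eq_vecI index_zero_vec carrier_vecD)
    moreover have "(\<Sum>j<r. m i j * v $ j) = 0" if "i < r" for i
      using mv[OF v(1) that] v(3) that by simp
    ultimately show "\<exists>c. (\<forall>i<r. (\<Sum>j<r. m i j * c j) = 0) \<and> (\<exists>j<r. c j \<noteq> 0)"
      by (intro exI[of _ "\<lambda>j. v $ j"]) auto
  next
    assume "\<exists>c. (\<forall>i<r. (\<Sum>j<r. m i j * c j) = 0) \<and> (\<exists>j<r. c j \<noteq> 0)"
    then obtain c j where c: "\<forall>i<r. (\<Sum>j<r. m i j * c j) = 0" "j < r" "c j \<noteq> 0" by auto
    have "vec r c \<noteq> 0\<^sub>v r"
    proof
      assume "vec r c = 0\<^sub>v r"
      then have "vec r c $ j = 0\<^sub>v r $ j" by simp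
      then show False using c by simp
    qed
    moreover have "?M *\<^sub>v vec r c = 0\<^sub>v r"
    proof (rule eq_vecI)
      fix i assume "i < dim_vec (0\<^sub>v r :: 'k vec)"
      then have i: "i < r" by simp
      have "(?M *\<^sub>v vec r c) $ i = (\<Sum>j<r. m i j * vec r c $ j)" by (rule mv) (use i in auto)
      also have "\<dots> = (\<Sum>j<r. m i j * c j)" by (rule sum.cong) auto
      finally show "(?M *\<^sub>v vec r c) $ i = 0\<^sub>v r $ i" using c i by simp
    qed simp
    ultimately show "\<exists>v. v \<in> carrier_vec r \<and> v \<noteq> 0\<^sub>v r \<and> ?M *\<^sub>v v = 0\<^sub>v r"
      by (intro exI[of _ "vec r c"]) auto
  qed
  finally show ?thesis by auto
qed

definition subsp :: "('x, 'k::comm_ring_1) mpoly set \<Rightarrow> bool"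
  where "subsp V \<longleftrightarrow> 0 \<in> V \<and> (\<forall>p\<in>V. \<forall>q\<in>V. p + q \<in> V) \<and> (\<forall>c. \<forall>p\<in>V. const_poly c * p \<in> V)"

lemma subsp_sum: "subsp V \<Longrightarrow> (\<And>a. a \<in> A \<Longrightarrow> f a \<in> V) \<Longrightarrow> sum f A \<in> V"
  by (induction A rule: infinite_finite_induct) (auto simp: subsp_def)

lemma subsp_hideal_forms: "hideal l I \<Longrightarrow> subsp (I \<inter> forms l d)"
  unfolding subsp_def by (auto intro: hidealD)

lemma ltset_inter_forms: "hideal l I \<Longrightarrow> ltset (I \<inter> forms l d) = ltset I \<inter> mons l d"
proof (intro equalityI subsetI)
  fix t assume I: "hideal l I" and t: "t \<in> ltset I \<inter> mons l d"
  then obtain p where "p \<in> I" "p \<in> forms l (pp_degree t)" "lead p t" using ltset_homogeneous by blast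
  then show "t \<in> ltset (I \<inter> forms l d)" using t by (auto simp: ltset_def mons_def)
qed (auto simp: ltset_def dest: lead_form_degree)

text \<open>Initial segments of DegRevLex in one degree, counted from the largest power-product.
  Leading power-products are compared by their numbers on such segments.\<close>

definition upper :: "nat \<Rightarrow> nat \<Rightarrow> (nat \<Rightarrow>\<^sub>0 nat) set \<Rightarrow> bool"
  where "upper l d Y \<longleftrightarrow> Y \<subseteq> mons l d \<and> (\<forall>t\<in>Y. \<forall>u\<in>mons l d. drl_greater u t \<longrightarrow> u \<in> Y)"

lemma upper_mons [simp]: "upper l d (mons l d)"
  by (simp add: upper_def)

text \<open>A form in \<open>V\<close> with a nonzero coefficient in \<open>Y\<close> also has its
  leading power-product in \<open>Y\<close>, as \<open>Y\<close> is an initial segment. Hence a form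
  that vanishes at the leading power-products of \<open>V\<close> in \<open>Y\<close> vanishes on
  all of \<open>Y\<close>, and their number bounds the rank of \<open>V\<close> on
  \<open>Y\<close>.\<close>

lemma indep_le_card_ltset:
  fixes p :: "'j \<Rightarrow> (nat, 'k::field) mpoly"
  assumes V: "subsp V" "V \<subseteq> forms l d" and Y: "upper l d Y" and F: "finite F" "\<And>j. j \<in> F \<Longrightarrow> p j \<in> V"
    and indep: "\<And>c. (\<And>t. t \<in> Y \<Longrightarrow> (\<Sum>j\<in>F. lookup (p j) t * c j) = 0) \<Longrightarrow> \<forall>j\<in>F. c j = 0"
  shows "card F \<le> card (ltset V \<inter> Y)"
proof (rule ccontr)
  assume "\<not> ?thesis"
  then have "card (ltset V \<inter> Y) < card F" by simp
  moreover have "finite (ltset V \<inter> Y)"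
    using Y finite_subset[of "ltset V \<inter> Y" "mons l d"] by (auto simp: upper_def)
  ultimately obtain c where c: "\<exists>j\<in>F. c j \<noteq> 0"
    "\<forall>t\<in>ltset V \<inter> Y. (\<Sum>j\<in>F. lookup (p j) t * c j) = 0"
    using nontrivial_solution[of "ltset V \<inter> Y" F "\<lambda>t j. lookup (p j) t"] F(1) by blast
  define q where "q = (\<Sum>j\<in>F. const_poly (c j) * p j)"
  have q: "q \<in> V" unfolding q_def using F V by (intro subsp_sum) (auto simp: subsp_def)
  have lq: "lookup q t = (\<Sum>j\<in>F. lookup (p j) t * c j)" for t
    by (auto simp: q_def lookup_sum intro!: sum.cong)
  have "lookup q t = 0" if t: "t \<in> Y" for t
  proof (rule ccontr)
    assume nz: "lookup q t \<noteq> 0"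
    then have "q \<noteq> 0" by auto
    then obtain t0 where t0: "lead q t0" using lead_exists by blast
    then have "t0 \<in> ltset V" using q by (auto simp: ltset_def)
    moreover have "t0 \<in> Y"
    proof (cases "t = t0")
      case False
      then have "drl_greater t0 t" using t0 nz by (auto simp: lead_def in_keys_iff)
      moreover have "t0 \<in> mons l d" using t0 q V(2) lead_form_degree by blast
      ultimately show ?thesis using Y t by (auto simp: upper_def)
    qed (use t in simp)
    ultimately have "lookup q t0 = 0" using c(2) lq by simp
    then show False using t0 by (auto simp: lead_def in_keys_iff)
  qed
  then have "\<forall>j\<in>F. c j = 0" using indep[of c] lq by simp
  then show False using c(1) by blast
qed

text \<open>The coefficient matrix is triangular: the largest \<open>t i\<close> with
  \<open>c i\<close> nonzero occurs in no other member that takes part in the combination.\<close>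

lemma lead_family_indep:
  fixes p :: "'j \<Rightarrow> (nat, 'k::field) mpoly"
  assumes F: "finite F" and t: "\<And>j. j \<in> F \<Longrightarrow> lead (p j) (t j)" "inj_on t F"
    and z: "\<And>i. i \<in> F \<Longrightarrow> (\<Sum>j\<in>F. lookup (p j) (t i) * c j) = 0"
  shows "\<forall>j\<in>F. c j = 0"
proof (rule ccontr)
  assume "\<not> ?thesis"
  then have ne: "{j\<in>F. c j \<noteq> 0} \<noteq> {}" by auto
  then obtain s where s: "s \<in> t ` {j\<in>F. c j \<noteq> 0}" "\<forall>u\<in>t ` {j\<in>F. c j \<noteq> 0}. u \<noteq> s \<longrightarrow> drl_greater s u"
    using drl_max_exists[of "t ` {j\<in>F. c j \<noteq> 0}"] F by auto
  then obtain i where i: "i \<in> F" "c i \<noteq> 0" "s = t i" by auto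
  have *: "lookup (p j) (t i) * c j = 0" if j: "j \<in> F - {i}" for j
  proof (cases "c j = 0")
    case False
    then have "drl_greater (t i) (t j)" using s(2) i j t(2) by (auto simp: inj_on_def)
    then have "t i \<notin> keys (p j)" using t(1)[of j] j drl_asym by (force simp: lead_def)
    then show ?thesis by (simp add: in_keys_iff)
  qed simp
  have "(\<Sum>j\<in>F. lookup (p j) (t i) * c j) = lookup (p i) (t i) * c i"
    using sum.remove[OF F i(1), of "\<lambda>j. lookup (p j) (t i) * c j"] sum.neutral[of "F - {i}"] * by simp
  then show False using z[OF i(1)] i t(1)[OF i(1)] by (auto simp: lead_def in_keys_iff)
qed

text \<open>Division by leading terms: the largest reducible term of \<open>f\<close> is cancelled,
  and only smaller ones can appear. The measure counts the elements of \<open>ltset V\<close> that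
  lie at or below some reducible term.\<close>

lemma reduce_mod_subsp:
  fixes f :: "(nat, 'k::field) mpoly"
  assumes V: "subsp V" "V \<subseteq> forms l d" and f: "f \<in> forms l d"
  shows "\<exists>v\<in>V. keys (f - v) \<inter> ltset V = {}"
  using f
proof (induction "card {u\<in>ltset V. \<exists>t\<in>keys f \<inter> ltset V. t = u \<or> drl_greater t u}" arbitrary: f rule: less_induct)
  case less
  have fin: "finite (ltset V)"
    using V(2) lead_form_degree by (intro finite_subset[OF _ finite_mons[of l d]]) (fastforce simp: ltset_def)
  show ?case
  proof (cases "keys f \<inter> ltset V = {}")
    case True
    then show ?thesis using V by (intro bexI[of _ 0]) (auto simp: subsp_def)
  next
    case False
    obtain t where t: "t \<in> keys f \<inter> ltset V" "\<forall>u\<in>keys f \<inter> ltset V. u \<noteq> t \<longrightarrow> drl_greater t u"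
      using drl_max_exists[OF _ False] by auto
    then obtain p where p: "p \<in> V" "lead p t" by (auto simp: ltset_def)
    define v where "v = const_poly (lookup f t / lookup p t) * p"
    have v: "v \<in> V" using V p by (auto simp: v_def subsp_def)
    let ?g = "f - v"
    have g: "?g \<in> forms l d" using less.prems v V by auto
    have lower: "drl_greater t u" if u: "u \<in> keys ?g \<inter> ltset V" for u
    proof -
      have "u \<noteq> t" using u p(2) by (auto simp: in_keys_iff lookup_minus v_def lead_def)
      moreover have "u \<in> keys f \<or> u \<in> keys p"
        using u by (auto simp: in_keys_iff lookup_minus v_def)
      ultimately show ?thesis using t(2) p(2) u by (auto simp: lead_def)
    qed
    let ?L = "\<lambda>f. {u\<in>ltset V. \<exists>t\<in>keys f \<inter> ltset V. t = u \<or> drl_greater t u}"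
    have "?L ?g \<subseteq> ?L f" using lower t(1) drl_trans by blast
    moreover have "t \<in> ?L f" "t \<notin> ?L ?g" using t(1) lower drl_asym drl_irrefl by (blast, auto)
    ultimately have "card (?L ?g) < card (?L f)"
      using fin by (intro psubset_card_mono) auto
    from less.hyps[OF this g] obtain w where "w \<in> V" "keys (?g - w) \<inter> ltset V = {}" by blast
    then show ?thesis using v V by (intro bexI[of _ "v + w"]) (auto simp: subsp_def diff_diff_eq)
  qed
qed

subsection \<open>The Hilbert function\<close>

lemma quotient_eq_iff:
  fixes I :: "(nat, 'k::comm_ring_1) mpoly set"
  assumes "ideal I (poly_ring l)" "p \<in> polyS l" "q \<in> polyS l"
  shows "I +>\<^bsub>poly_ring l\<^esub> p = I +>\<^bsub>poly_ring l\<^esub> q \<longleftrightarrow> p - q \<in> I"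
proof
  note I = ideal_poly_ringD[OF assms(1)]
  have c: "I +>\<^bsub>poly_ring l\<^esub> p = (\<lambda>i. i + p) ` I" for p by (auto simp: a_r_coset_def')
  show "p - q \<in> I" if "I +>\<^bsub>poly_ring l\<^esub> p = I +>\<^bsub>poly_ring l\<^esub> q"
  proof -
    have "0 + p \<in> (\<lambda>i. i + q) ` I" using that I(2) unfolding c by blast
    then show ?thesis by auto
  qed
  have *: "(\<lambda>i. i + p) ` I \<subseteq> (\<lambda>i. i + q) ` I" if "p - q \<in> I" for p q
  proof
    fix x assume "x \<in> (\<lambda>i. i + p) ` I"
    then obtain i where "i \<in> I" "x = (i + (p - q)) + q" by auto
    then show "x \<in> (\<lambda>i. i + q) ` I" using I(3)[OF _ that] by blast
  qed
  show "I +>\<^bsub>poly_ring l\<^esub> p = I +>\<^bsub>poly_ring l\<^esub> q" if "p - q \<in> I"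
  proof -
    have "q - p \<in> I" using I(4)[of "- 1" "p - q"] that by simp
    then show ?thesis unfolding c using *[OF that] * by blast
  qed
qed

lemma quotient_ring_simps:
  fixes I :: "(nat, 'k::comm_ring_1) mpoly set"
  assumes "ideal I (poly_ring l)"
  shows "carrier (poly_ring l Quot I) = (\<lambda>p. I +>\<^bsub>poly_ring l\<^esub> p) ` polyS l"
    and "p \<in> polyS l \<Longrightarrow> q \<in> polyS l \<Longrightarrow>
      (I +>\<^bsub>poly_ring l\<^esub> p) \<otimes>\<^bsub>poly_ring l Quot I\<^esub> (I +>\<^bsub>poly_ring l\<^esub> q) = I +>\<^bsub>poly_ring l\<^esub> (p * q)"
    and "p \<in> polyS l \<Longrightarrow> q \<in> polyS l \<Longrightarrow>
      (I +>\<^bsub>poly_ring l\<^esub> p) \<oplus>\<^bsub>poly_ring l Quot I\<^esub> (I +>\<^bsub>poly_ring l\<^esub> q) = I +>\<^bsub>poly_ring l\<^esub> (p + q)"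
    and "\<one>\<^bsub>poly_ring l Quot I\<^esub> = I +>\<^bsub>poly_ring l\<^esub> 1"
    and "\<zero>\<^bsub>poly_ring l Quot I\<^esub> = I"
    and "I +>\<^bsub>poly_ring l\<^esub> 0 = I"
proof -
  interpret ideal I "poly_ring l" by (rule assms)
  show "carrier (poly_ring l Quot I) = (\<lambda>p. I +>\<^bsub>poly_ring l\<^esub> p) ` polyS l"
    by (auto simp: FactRing_def A_RCOSETS_def')
  show "(I +>\<^bsub>poly_ring l\<^esub> p) \<otimes>\<^bsub>poly_ring l Quot I\<^esub> (I +>\<^bsub>poly_ring l\<^esub> q) = I +>\<^bsub>poly_ring l\<^esub> (p * q)"
    if "p \<in> polyS l" "q \<in> polyS l"
    using rcoset_mult_add[of p q] that by (simp add: FactRing_def)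
  show "(I +>\<^bsub>poly_ring l\<^esub> p) \<oplus>\<^bsub>poly_ring l Quot I\<^esub> (I +>\<^bsub>poly_ring l\<^esub> q) = I +>\<^bsub>poly_ring l\<^esub> (p + q)"
    if "p \<in> polyS l" "q \<in> polyS l"
    using a_rcos_sum[of p q] that by (simp add: FactRing_def)
  show "I +>\<^bsub>poly_ring l\<^esub> 0 = I" by (auto simp: a_r_coset_def')
qed (simp_all add: FactRing_def)

lemma quotient_cring: "ideal I (poly_ring l) \<Longrightarrow> cring (poly_ring l Quot I)"
  for I :: "(nat, 'k::comm_ring_1) mpoly set"
  by (rule ideal.quotient_is_cring[OF _ cring_poly_ring])

text \<open>The dimension in \<open>HF\<close> is taken over the classes of the constants, which
  form a field unless the quotient is the zero ring.\<close>

lemma quotient_constants_subfield: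
  fixes I :: "(nat, 'k::field) mpoly set"
  assumes I: "ideal I (poly_ring l)" and one: "1 \<notin> I"
  shows "subfield (range (\<lambda>c. I +>\<^bsub>poly_ring l\<^esub> const_poly c)) (poly_ring l Quot I)"
proof -
  let ?Q = "poly_ring l Quot I" and ?k = "\<lambda>c. I +>\<^bsub>poly_ring l\<^esub> const_poly c"
  note s = quotient_ring_simps[OF I]
  interpret Q: cring ?Q by (rule quotient_cring[OF I])
  have mult: "?k a \<otimes>\<^bsub>?Q\<^esub> ?k b = ?k (a * b)" for a b by (simp add: s const_poly_hom)
  have add: "?k a \<oplus>\<^bsub>?Q\<^esub> ?k b = ?k (a + b)" for a b by (simp add: s const_poly_hom)
  have car: "range ?k \<subseteq> carrier ?Q" by (auto simp: s)
  have zero: "?k 0 = \<zero>\<^bsub>?Q\<^esub>" "?k 1 = \<one>\<^bsub>?Q\<^esub>" by (simp_all add: s const_poly_hom)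
  have inv: "\<ominus>\<^bsub>?Q\<^esub> ?k a = ?k (- a)" for a
    by (rule Q.minus_equality) (use car in \<open>auto simp: add zero\<close>)
  have nz: "?k a = \<zero>\<^bsub>?Q\<^esub> \<longleftrightarrow> a = 0" for a
  proof
    assume "?k a = \<zero>\<^bsub>?Q\<^esub>"
    then have "const_poly a \<in> I"
      using quotient_eq_iff[OF I, of "const_poly a" 0] by (simp add: s)
    then have "const_poly (inverse a) * const_poly a \<in> I" using ideal_poly_ringD(4)[OF I] by simp
    then show "a = 0" using one by (cases "a = 0") (auto simp: const_poly_hom(4)[symmetric] const_poly_hom(2))
  qed (simp add: zero)
  show ?thesis
  proof (rule Q.subfieldI)
    show "subcring (range ?k) ?Q"
      by (rule Q.subcringI', rule Q.subringI) (use car mult add inv zero in \<open>auto simp: zero(2)[symmetric]\<close>)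
    show "Units (?Q\<lparr>carrier := range ?k\<rparr>) = range ?k - {\<zero>\<^bsub>?Q\<^esub>}"
    proof (intro equalityI subsetI)
      fix x assume "x \<in> Units (?Q\<lparr>carrier := range ?k\<rparr>)"
      then obtain a b where ab: "x = ?k a" "?k b \<otimes>\<^bsub>?Q\<^esub> ?k a = \<one>\<^bsub>?Q\<^esub>" by (auto simp: Units_def)
      then have "?k (b * a) = ?k 1" by (simp add: mult zero)
      moreover have "?k 1 \<noteq> \<zero>\<^bsub>?Q\<^esub>" using nz by simp
      ultimately have "a \<noteq> 0" using zero(1) by auto
      then show "x \<in> range ?k - {\<zero>\<^bsub>?Q\<^esub>}" using ab nz by auto
    next
      fix x assume "x \<in> range ?k - {\<zero>\<^bsub>?Q\<^esub>}"
      then obtain a where a: "x = ?k a" "a \<noteq> 0" using zero by auto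
      then have "?k (inverse a) \<otimes>\<^bsub>?Q\<^esub> x = \<one>\<^bsub>?Q\<^esub>" "x \<otimes>\<^bsub>?Q\<^esub> ?k (inverse a) = \<one>\<^bsub>?Q\<^esub>"
        by (simp_all add: mult zero)
      then show "x \<in> Units (?Q\<lparr>carrier := range ?k\<rparr>)" using a by (auto simp: Units_def)
    qed
  qed
qed

text \<open>A relation modulo \<open>I\<close> among power-products outside \<open>ltset I\<close>
  would be an element of \<open>I\<close> whose leading power-product is outside
  \<open>ltset I\<close>.\<close>

lemma quotient_grading_dimension:
  fixes I :: "(nat, 'k::field) mpoly set"
  assumes I: "hideal l I" and B: "finite B" "B \<subseteq> mons l d" "B \<inter> ltset I = {}"
  shows "ring.dimension (poly_ring l Quot I) (card B) (range (\<lambda>c. I +>\<^bsub>poly_ring l\<^esub> const_poly c))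
    ((\<lambda>p. I +>\<^bsub>poly_ring l\<^esub> p) ` {p \<in> forms l d. keys p \<subseteq> B})"
  using B
proof (induction B rule: finite_induct)
  let ?Q = "poly_ring l Quot I" and ?k = "\<lambda>p. I +>\<^bsub>poly_ring l\<^esub> p"
  have id: "ideal I (poly_ring l)" using I by (rule hideal_ideal)
  note s = quotient_ring_simps[OF id]
  interpret Q: cring ?Q by (rule quotient_cring[OF id])
  {
    case empty
    have "{p \<in> forms l d. keys p \<subseteq> {}} = {0 :: (nat, 'k) mpoly}" by auto
    then show ?case using Q.zero_dim by (simp add: s)
  next
    case (insert t B)
    let ?E = "\<lambda>B. ?k ` {p \<in> forms l d. keys p \<subseteq> B}" and ?K = "range (\<lambda>c. ?k (const_poly c))"
    have t: "t \<in> pps l" using insert by (auto simp: mons_def)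
    have pt: "power_product t \<in> forms l d" using insert.prems by (simp add: power_product_def forms_single)
    have "?k (power_product t) \<notin> ?E B"
    proof
      assume "?k (power_product t) \<in> ?E B"
      then obtain p where p: "p \<in> forms l d" "keys p \<subseteq> B" "?k (power_product t) = ?k p" by blast
      define q where "q = power_product t - p"
      have "q \<in> I" using p t quotient_eq_iff[OF id, of "power_product t" p] by (simp add: q_def forms_polyS)
      have "t \<notin> keys p" using p insert.hyps by auto
      then have "lookup q t = 1" by (simp add: q_def lookup_minus power_product_def in_keys_iff)
      then have "q \<noteq> 0" by auto
      then obtain u where u: "lead q u" using lead_exists by blast
      then have "u \<in> ltset I" using \<open>q \<in> I\<close> by (auto simp: ltset_def)
      moreover have "keys q \<subseteq> insert t B" using p(2)
        by (auto simp: q_def in_keys_iff lookup_minus power_product_def lookup_single when_def split: if_splits)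
      ultimately show False using u insert.prems by (auto simp: lead_def)
    qed
    moreover have "?k (power_product t) \<in> carrier ?Q" using t by (simp add: s)
    ultimately have "Q.dimension (Suc (card B)) ?K (Q.line_extension ?K (?k (power_product t)) (?E B))"
      using insert.IH insert.prems by (intro Q.Suc_dim) auto
    moreover have "Q.line_extension ?K (?k (power_product t)) (?E B) = ?E (insert t B)"
    proof (intro equalityI subsetI)
      fix x assume "x \<in> Q.line_extension ?K (?k (power_product t)) (?E B)"
      then obtain c p where c: "x = ?k (const_poly c) \<otimes>\<^bsub>?Q\<^esub> ?k (power_product t) \<oplus>\<^bsub>?Q\<^esub> ?k p"
        and p: "p \<in> forms l d" "keys p \<subseteq> B"
        by (auto simp: Q.line_extension_def set_add_def' r_coset_def)
      then have "x = ?k (const_poly c * power_product t + p)"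
        using t by (simp add: s forms_polyS polyS_mult)
      moreover have "const_poly c * power_product t + p \<in> forms l d" using pt p by auto
      moreover have "keys (const_poly c * power_product t + p) \<subseteq> insert t B" using p(2)
        by (auto simp: in_keys_iff lookup_add power_product_def lookup_single when_def split: if_splits)
      ultimately show "x \<in> ?E (insert t B)" by blast
    next
      fix x assume "x \<in> ?E (insert t B)"
      then obtain p where p: "p \<in> forms l d" "keys p \<subseteq> insert t B" "x = ?k p" by blast
      define q where "q = p - const_poly (lookup p t) * power_product t"
      have q: "q \<in> forms l d" using p pt by (auto simp: q_def)
      moreover have "keys q \<subseteq> B" using p(2)
        by (auto simp: q_def in_keys_iff lookup_minus power_product_def lookup_single when_def split: if_splits)
      moreover have "x = ?k (const_poly (lookup p t)) \<otimes>\<^bsub>?Q\<^esub> ?k (power_product t) \<oplus>\<^bsub>?Q\<^esub> ?k q"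
        using t q p(3) by (simp add: s forms_polyS polyS_mult q_def)
      ultimately show "x \<in> Q.line_extension ?K (?k (power_product t)) (?E B)"
        unfolding Q.line_extension_def set_add_def' r_coset_def by blast
    qed
    ultimately show ?case using insert.hyps by simp
  }
qed

lemma one_in_hideal: "hideal l I \<Longrightarrow> 1 \<in> I \<Longrightarrow> I = polyS l"
  using hidealD(4)[of l I _ 1] hidealD(1)[of l I] by auto

lemma ltset_polyS: "ltset (polyS l :: (nat, 'k::field) mpoly set) = pps l"
proof (intro equalityI subsetI)
  fix t assume "t \<in> pps l"
  then have "single t 1 \<in> (polyS l :: (nat, 'k) mpoly set)" "lead (single t (1::'k)) t"
    by (auto simp: lead_def)
  then show "t \<in> ltset (polyS l :: (nat, 'k) mpoly set)" unfolding ltset_def by blast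
qed (auto simp: ltset_def lead_def polyS_iff)

text \<open>Macaulay's theorem: the standard power-products of degree \<open>d\<close> are a basis
  of the graded piece.\<close>

lemma HF_eq_card:
  fixes I :: "(nat, 'k::field) mpoly set"
  assumes I: "hideal l I"
  shows "HF l I d = card (mons l d - ltset I)"
proof -
  let ?Q = "poly_ring l Quot I" and ?k = "\<lambda>p. I +>\<^bsub>poly_ring l\<^esub> p"
  let ?K = "range (\<lambda>c. ?k (const_poly c))" and ?E = "quotient_grading (poly_ring l) (forms l) I d"
  let ?B = "mons l d - ltset I"
  have id: "ideal I (poly_ring l)" using I by (rule hideal_ideal)
  note s = quotient_ring_simps[OF id]
  interpret Q: cring ?Q by (rule quotient_cring[OF id])
  have E: "?k ` {p \<in> forms l d. keys p \<subseteq> ?B} = ?E"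
  proof (intro equalityI subsetI)
    fix x assume "x \<in> ?E"
    then obtain f where f: "f \<in> forms l d" "x = ?k f" by (auto simp: quotient_grading_def)
    obtain v where v: "v \<in> I \<inter> forms l d" "keys (f - v) \<inter> ltset (I \<inter> forms l d) = {}"
      using reduce_mod_subsp[OF subsp_hideal_forms[OF I, of d] _ f(1)] by auto
    have g: "f - v \<in> forms l d" using f v by auto
    have "keys (f - v) \<subseteq> ?B" using v(2) g by (auto simp: ltset_inter_forms[OF I] forms_iff)
    moreover have "?k f = ?k (f - v)" using f v g by (subst quotient_eq_iff[OF id]) (auto simp: forms_polyS)
    ultimately show "x \<in> ?k ` {p \<in> forms l d. keys p \<subseteq> ?B}" using f g by blast
  qed (auto simp: quotient_grading_def)
  have dim: "Q.dimension (card ?B) ?K ?E"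
    using quotient_grading_dimension[OF I, of ?B d] unfolding E by auto
  show ?thesis
  proof (cases "1 \<in> I")
    case False
    show ?thesis unfolding HF_def
      by (rule Q.dimI[OF quotient_constants_subfield[OF id False] dim])
  next
    case True
    \<comment> \<open>In the zero ring the constants do not form a field, so the dimension is
      evaluated directly: every set that has a dimension has dimension 0.\<close>
    then have IS: "I = polyS l" using one_in_hideal[OF I] by simp
    have car: "carrier ?Q = {\<zero>\<^bsub>?Q\<^esub>}"
    proof -
      have "?k p = I" if "p \<in> polyS l" for p
        using quotient_eq_iff[OF id that, of 0] that s(6) IS by simp
      then show ?thesis using s(1,5,6) by auto
    qed
    have "n = 0" if "Q.dimension n ?K X" for n X
    proof -
      have "n = 0 \<and> \<zero>\<^bsub>?Q\<^esub> \<in> X" using that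
        by (induction rule: Q.dimension.induct) (auto simp: car)
      then show ?thesis by simp
    qed
    moreover have "card ?B = 0"
    proof -
      have "?B = {}" using IS by (auto simp: mons_def ltset_polyS)
      then show ?thesis by (simp only: card.empty)
    qed
    ultimately show ?thesis unfolding HF_def over_def Q.dim_def using dim by (intro the_equality) metis+
  qed
qed

section \<open>Evaluation homomorphisms\<close>

definition rhom :: "('a::comm_ring_1 \<Rightarrow> 'b::comm_ring_1) \<Rightarrow> bool"
  where "rhom h \<longleftrightarrow> h 0 = 0 \<and> h 1 = 1 \<and> (\<forall>a b. h (a + b) = h a + h b) \<and> (\<forall>a b. h (a * b) = h a * h b)"

lemma rhomD:
  assumes "rhom h"
  shows "h 0 = 0" "h 1 = 1" "h (a + b) = h a + h b" "h (a * b) = h a * h b" "h (a ^ n) = h a ^ n"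
    "h (sum f A) = (\<Sum>x\<in>A. h (f x))" "h (prod f A) = (\<Prod>x\<in>A. h (f x))" "h (- a) = - h a" "h (a - b) = h a - h b"
proof -
  show 0: "h 0 = 0" "h 1 = 1" and a: "h (a + b) = h a + h b" and m: "h (a * b) = h a * h b" for a b
    using assms by (auto simp: rhom_def)
  show "h (a ^ n) = h a ^ n" by (induction n) (auto simp: 0 m)
  show "h (sum f A) = (\<Sum>x\<in>A. h (f x))" by (induction A rule: infinite_finite_induct) (auto simp: 0 a)
  show "h (prod f A) = (\<Prod>x\<in>A. h (f x))" by (induction A rule: infinite_finite_induct) (auto simp: 0 m)
  show u: "h (- a) = - h a" for a using a[of a "- a"] 0 by (metis add.right_inverse minus_unique)
  show "h (a - b) = h a - h b" using a[of a "- b"] u[of b] by simp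
qed

lemma rhom_id [simp]: "rhom (\<lambda>c. c)"
  by (simp add: rhom_def)

lemma rhom_const_poly [simp]: "rhom const_poly"
  by (simp add: rhom_def const_poly_hom)

definition eval_pp :: "('x \<Rightarrow> 'b::comm_ring_1) \<Rightarrow> ('x \<Rightarrow>\<^sub>0 nat) \<Rightarrow> 'b"
  where "eval_pp a t = (\<Prod>x\<in>keys t. a x ^ lookup t x)"

lemma eval_pp_add: "eval_pp a (s + t) = eval_pp a s * eval_pp a t"
proof -
  have 1: "eval_pp a u = (\<Prod>x\<in>keys s \<union> keys t. a x ^ lookup u x)" if "keys u \<subseteq> keys s \<union> keys t" for u
    unfolding eval_pp_def using that by (intro prod.mono_neutral_left) (auto simp: in_keys_iff)
  show ?thesis by (simp add: 1 keys_add_nat lookup_add power_add prod.distrib)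
qed

lemma eval_pp_zero [simp]: "eval_pp a 0 = 1"
  by (simp add: eval_pp_def)

lemma eval_pp_single [simp]: "eval_pp a (single i n) = a i ^ n"
  by (simp add: eval_pp_def)

lemma evaluate_superset:
  assumes "finite A" "keys p \<subseteq> A" "h 0 = 0"
  shows "evaluate h a p = (\<Sum>t\<in>A. h (lookup p t) * eval_pp a t)"
  unfolding evaluate_def eval_pp_def using assms
  by (intro sum.mono_neutral_left) (auto simp: in_keys_iff)

lemma evaluate_single:
  assumes "rhom h" shows "evaluate h a (single t c) = h c * eval_pp a t"
proof -
  have "evaluate h a (single t c) = (\<Sum>u\<in>{t}. h (lookup (single t c) u) * eval_pp a u)"
    by (rule evaluate_superset) (auto simp: rhomD[OF assms])
  then show ?thesis by simp
qed

lemma evaluate_zero [simp]: "evaluate h a 0 = 0"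
  by (simp add: evaluate_def)

lemma evaluate_add:
  assumes "rhom h" shows "evaluate h a (p + q) = evaluate h a p + evaluate h a q"
proof -
  have 1: "evaluate h a u = (\<Sum>t\<in>keys p \<union> keys q. h (lookup u t) * eval_pp a t)" if "keys u \<subseteq> keys p \<union> keys q" for u
    using that by (intro evaluate_superset) (auto simp: rhomD[OF assms])
  have "keys (p + q) \<subseteq> keys p \<union> keys q" by (rule Poly_Mapping.keys_add)
  then show ?thesis
    by (simp add: 1 lookup_add rhomD[OF assms] distrib_right sum.distrib)
qed

lemma evaluate_sum: "rhom h \<Longrightarrow> evaluate h a (sum f A) = (\<Sum>x\<in>A. evaluate h a (f x))"
  by (induction A rule: infinite_finite_induct) (auto simp: evaluate_add)

lemma evaluate_mult:
  assumes "rhom h" shows "evaluate h a (p * q) = evaluate h a p * evaluate h a q"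
proof -
  have e: "evaluate h a u = (\<Sum>t\<in>keys u. h (lookup u t) * eval_pp a t)" for u
    by (simp add: evaluate_def eval_pp_def)
  have "p * q = (\<Sum>s\<in>keys p. single s (lookup p s)) * (\<Sum>t\<in>keys q. single t (lookup q t))"
    by (simp only: sum_single_keys)
  also have "\<dots> = (\<Sum>s\<in>keys p. \<Sum>t\<in>keys q. single (s + t) (lookup p s * lookup q t))"
    by (simp only: sum_product mult_single)
  also have "evaluate h a \<dots> = (\<Sum>s\<in>keys p. \<Sum>t\<in>keys q. h (lookup p s) * eval_pp a s * (h (lookup q t) * eval_pp a t))"
    by (simp only: evaluate_sum[OF assms] evaluate_single[OF assms] eval_pp_add rhomD[OF assms] ac_simps)
  also have "\<dots> = evaluate h a p * evaluate h a q"
    by (simp only: e sum_product)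
  finally show ?thesis .
qed

lemma evaluate_const_poly [simp]: "rhom h \<Longrightarrow> evaluate h a (const_poly c) = h c"
  by (simp add: const_poly_def evaluate_single)

lemma evaluate_var_poly [simp]: "rhom h \<Longrightarrow> evaluate h a (var_poly i) = a i"
  by (simp add: var_poly_def evaluate_single rhomD)

lemma evaluate_one: "rhom h \<Longrightarrow> evaluate h a 1 = 1"
  using evaluate_const_poly[of h a 1] by (simp add: const_poly_hom rhomD)

lemma rhom_evaluate: "rhom h \<Longrightarrow> rhom (evaluate h a)"
  by (simp add: rhom_def[of "evaluate h a"] evaluate_add evaluate_mult evaluate_one)

lemma rhom_comp_evaluate: "rhom f \<Longrightarrow> f (evaluate h a p) = evaluate (\<lambda>c. f (h c)) (\<lambda>x. f (a x)) p"
  by (simp add: evaluate_def rhomD)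

lemma evaluate_cong:
  assumes "\<And>c. h c = h' c" "\<And>t x. t \<in> keys p \<Longrightarrow> x \<in> keys t \<Longrightarrow> a x = b x"
  shows "evaluate h a p = evaluate h' b p"
  unfolding evaluate_def using assms by (intro sum.cong arg_cong2[where f = "(*)"] prod.cong) auto

lemma var_poly_power: "var_poly i ^ n = single (single i n) 1"
  by (induction n) (auto simp: var_poly_def mult_single single_add[symmetric])

lemma prod_single: "(\<Prod>x\<in>A. single (f x) (1::'k::comm_ring_1)) = single (\<Sum>x\<in>A. f x) 1"
  for f :: "_ \<Rightarrow> 'x::comm_monoid_add"
  by (induction A rule: infinite_finite_induct) (auto simp: mult_single)

lemma evaluate_vars: "evaluate const_poly var_poly p = p"
proof -
  have "eval_pp var_poly t = (single t 1 :: ('a, 'b::comm_ring_1) mpoly)" for t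
    by (simp only: eval_pp_def var_poly_power prod_single sum_single_keys)
  then have "evaluate const_poly var_poly p = (\<Sum>t\<in>keys p. single t (lookup p t))"
    by (simp add: evaluate_def eval_pp_def[symmetric] const_poly_def mult_single)
  then show ?thesis by (simp only: sum_single_keys)
qed

subsection \<open>Linear substitutions\<close>

lemma linear_form_form [simp]: "linear_form l c \<in> forms l 1"
  unfolding linear_form_def by (intro forms_sum forms_scale var_poly_form) simp

lemma linear_form_form_Suc [simp]: "linear_form l c \<in> forms l (Suc 0)"
  using linear_form_form[of l c] by simp

lemma single_Suc_0_eq_iff [simp]: "single x (Suc 0) = single i (Suc 0) \<longleftrightarrow> x = i"
  by (metis keys_single nat.distinct(1) singleton_inject)

lemma linear_form_polyS [simp]: "linear_form l c \<in> polyS l"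
  using linear_form_form forms_polyS by blast

lemma linear_form_cong: "(\<And>j. j < l \<Longrightarrow> c j = c' j) \<Longrightarrow> linear_form l c = linear_form l c'"
  unfolding linear_form_def by (intro sum.cong) auto

lemma lookup_linear_form: "i < l \<Longrightarrow> lookup (linear_form l c) (single i 1) = c i"
proof -
  assume "i < l"
  have "lookup (linear_form l c) (single i 1) = (\<Sum>j<l. if j = i then c j else 0)"
    unfolding linear_form_def lookup_sum lookup_scale
    by (intro sum.cong) (auto simp: var_poly_def lookup_single when_def)
  then show ?thesis using \<open>i < l\<close> by simp
qed

lemma form1_eq_linear_form: "p \<in> forms l 1 \<Longrightarrow> p = linear_form l (\<lambda>j. lookup p (single j 1))"
proof (rule poly_mapping_eqI)
  fix t assume p: "p \<in> forms l 1"
  show "lookup p t = lookup (linear_form l (\<lambda>j. lookup p (single j 1))) t"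
  proof (cases "t \<in> mons l 1")
    case False
    then show ?thesis using p linear_form_form[of l] unfolding forms_iff by (metis in_keys_iff subsetD)
  next
    case True
    then have "t \<noteq> 0" by (auto simp: mons_def)
    then obtain i where i: "i \<in> keys t" by (metis keys_eq_empty all_not_in_conv)
    have "t = (t - single i 1) + single i 1" using i by (intro pp_split) (auto simp: in_keys_iff)
    moreover from this have "pp_degree (t - single i 1) + 1 = 1" using True pp_degree_add pp_degree_single
      by (metis (mono_tags, lifting) mem_Collect_eq mons_def)
    ultimately have "t = single i 1" by (metis add.left_neutral add_right_cancel pp_degree_eq_0_iff)
    moreover have "i < l" using True i by (auto simp: mons_def pps_def)
    ultimately show ?thesis by (simp add: lookup_linear_form[simplified])
  qed
qed

lemma forms_prod: "(\<And>x. x \<in> A \<Longrightarrow> f x \<in> forms l (n x)) \<Longrightarrow> prod f A \<in> forms l (sum n A)"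
  by (induction A rule: infinite_finite_induct) (auto intro: forms_mult)

lemma polyS_prod: "(\<And>a. a \<in> A \<Longrightarrow> f a \<in> polyS l) \<Longrightarrow> prod f A \<in> polyS l" for f :: "_ \<Rightarrow> (nat, 'k::comm_ring_1) mpoly"
  by (induction A rule: infinite_finite_induct) auto

lemma rhom_act: "rhom (act l g)"
proof -
  have "act l g = evaluate const_poly (\<lambda>i. linear_form l (\<lambda>j. g $$ (i, j)))"
    by (rule ext) (simp add: act_def)
  then show ?thesis by (simp add: rhom_evaluate)
qed

lemmas act_simps = rhomD[OF rhom_act]

lemma act_const [simp]: "act l g (const_poly c) = const_poly c"
  by (simp add: act_def)

lemma act_var [simp]: "act l g (var_poly i) = linear_form l (\<lambda>j. g $$ (i, j))"
  by (simp add: act_def)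

lemma act_forms:
  assumes "p \<in> forms l d" shows "act l g p \<in> forms l d"
  unfolding act_def evaluate_def
proof (intro forms_sum forms_scale)
  fix t assume t: "t \<in> keys p"
  have "(\<Prod>x\<in>keys t. linear_form l (\<lambda>j. g $$ (x, j)) ^ lookup t x) \<in> forms l (\<Sum>x\<in>keys t. lookup t x)"
  proof (rule forms_prod)
    fix x show "linear_form l (\<lambda>j. g $$ (x, j)) ^ lookup t x \<in> forms l (lookup t x)"
      using forms_power[OF linear_form_form[of l "\<lambda>j. g $$ (x, j)"], of "lookup t x"] by simp
  qed
  moreover have "(\<Sum>x\<in>keys t. lookup t x) = d" using assms t by (auto simp: forms_iff mons_def pp_degree_def)
  ultimately show "(\<Prod>x\<in>keys t. linear_form l (\<lambda>j. g $$ (x, j)) ^ lookup t x) \<in> forms l d" by simp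
qed

lemma act_polyS [simp]: "act l g p \<in> polyS l"
  unfolding act_def evaluate_def by (intro polyS_sum polyS_mult polyS_prod polyS_power) auto

lemma act_homogeneous_component:
  assumes "p \<in> polyS l"
  shows "homogeneous_component d (act l g p) = act l g (homogeneous_component d p)"
proof -
  have h: "homogeneous_component d (act l g (homogeneous_component e p)) =
      (if d = e then act l g (homogeneous_component e p) else 0)" for e
    by (rule homogeneous_component_of_form[OF act_forms[OF homogeneous_component_form[OF assms]]])
  have "act l g p = (\<Sum>e\<in>pp_degree ` keys p. act l g (homogeneous_component e p))"
    by (subst sum_homogeneous_components[of p, symmetric]) (simp only: act_simps)
  then have "homogeneous_component d (act l g p) =
      (\<Sum>e\<in>pp_degree ` keys p. if d = e then act l g (homogeneous_component e p) else 0)"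
    by (simp only: homogeneous_component_sum h)
  also have "\<dots> = act l g (homogeneous_component d p)"
  proof (cases "d \<in> pp_degree ` keys p")
    case False
    then have "homogeneous_component d p = 0"
      by (intro poly_mapping_eqI) (auto simp: lookup_homogeneous_component in_keys_iff)
    then show ?thesis using False by (auto simp: act_simps intro!: sum.neutral)
  qed simp
  finally show ?thesis .
qed

lemma act_linear_form: "act l g (linear_form l c) = linear_form l (\<lambda>m. \<Sum>j<l. c j * g $$ (j, m))"
proof -
  have "act l g (linear_form l c) = (\<Sum>j<l. \<Sum>m<l. const_poly (c j * g $$ (j, m)) * var_poly m)"
    unfolding linear_form_def by (simp add: act_simps linear_form_def sum_distrib_left const_poly_hom mult.assoc)
  also have "\<dots> = (\<Sum>m<l. \<Sum>j<l. const_poly (c j * g $$ (j, m)) * var_poly m)" by (rule sum.swap)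
  also have "\<dots> = linear_form l (\<lambda>m. \<Sum>j<l. c j * g $$ (j, m))"
    unfolding linear_form_def by (simp add: sum_distrib_right rhomD(6)[OF rhom_const_poly])
  finally show ?thesis .
qed

text \<open>Substitution reverses products: \<open>h\<close> acts first but stands on the left,
  since row \<open>i\<close> of a matrix holds the image of variable \<open>i\<close>.\<close>

lemma act_act:
  assumes "g \<in> carrier_mat l l" "h \<in> carrier_mat l l" "p \<in> polyS l"
  shows "act l g (act l h p) = act l (h * g) p"
proof -
  have "act l g (act l h p) = evaluate (\<lambda>c. act l g (const_poly c)) (\<lambda>i. act l g (linear_form l (\<lambda>j. h $$ (i, j)))) p"
    unfolding act_def[of l h] by (rule rhom_comp_evaluate[OF rhom_act])
  also have "\<dots> = evaluate const_poly (\<lambda>i. linear_form l (\<lambda>j. (h * g) $$ (i, j))) p"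
  proof (rule evaluate_cong)
    fix t i assume "t \<in> keys p" "i \<in> keys t"
    then have i: "i < l" using assms(3) by (auto simp: polyS_iff pps_def)
    show "act l g (linear_form l (\<lambda>j. h $$ (i, j))) = linear_form l (\<lambda>j. (h * g) $$ (i, j))"
      unfolding act_linear_form
      by (rule linear_form_cong) (use i assms in \<open>auto simp: scalar_prod_def atLeast0LessThan intro!: sum.cong\<close>)
  qed simp
  finally show ?thesis by (simp add: act_def)
qed

lemma act_one: "p \<in> polyS l \<Longrightarrow> act l (1\<^sub>m l) p = p"
proof -
  assume p: "p \<in> polyS l"
  have "act l (1\<^sub>m l) p = evaluate const_poly var_poly p"
    unfolding act_def
  proof (rule evaluate_cong)
    fix t i assume "t \<in> keys p" "i \<in> keys t"
    then have i: "i < l" using p by (auto simp: polyS_iff pps_def)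
    have "linear_form l (\<lambda>j. 1\<^sub>m l $$ (i, j)) = (\<Sum>j<l. if j = i then var_poly j else 0)"
      unfolding linear_form_def using i by (intro sum.cong) (auto simp: const_poly_hom)
    then show "linear_form l (\<lambda>j. 1\<^sub>m l $$ (i, j)) = var_poly i" using i by simp
  qed simp
  then show ?thesis by (simp add: evaluate_vars)
qed

section \<open>The general linear group acting on homogeneous ideals\<close>

definition GL :: "nat \<Rightarrow> 'k::field mat set"
  where "GL l = {g \<in> carrier_mat l l. invertible_mat g}"

lemma GL_inverse:
  assumes "g \<in> GL l" obtains h where "h \<in> GL l" "g * h = 1\<^sub>m l" "h * g = 1\<^sub>m l"
proof -
  from assms have g: "g \<in> carrier_mat l l" by (simp add: GL_def)
  from assms obtain h where h: "g * h = 1\<^sub>m (dim_row g)" "h * g = 1\<^sub>m (dim_row h)"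
    by (auto simp: GL_def invertible_mat_def inverts_mat_def)
  have "dim_row h = l" "dim_col h = l"
    using arg_cong[OF h(2), of dim_col] arg_cong[OF h(1), of dim_col] g by auto
  then have hc: "h \<in> carrier_mat l l" by auto
  moreover have "invertible_mat h" using h g hc
    by (auto simp: invertible_mat_def inverts_mat_def intro!: exI[of _ g])
  ultimately show ?thesis using that h g by (auto simp: GL_def)
qed

lemma GL_iff_det: "g \<in> GL l \<longleftrightarrow> g \<in> carrier_mat l l \<and> det g \<noteq> 0"
proof
  assume g: "g \<in> GL l"
  then obtain h where h: "h \<in> GL l" "g * h = 1\<^sub>m l" by (rule GL_inverse)
  then have "det g * det h = 1" using det_mult[of g l h] g by (auto simp: GL_def)
  then show "g \<in> carrier_mat l l \<and> det g \<noteq> 0" using g by (auto simp: GL_def)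
next
  assume g: "g \<in> carrier_mat l l \<and> det g \<noteq> 0"
  then have "g \<in> Units (ring_mat TYPE('a) l undefined)" using det_non_zero_imp_unit[of g l] by simp
  then obtain h where "h \<in> carrier_mat l l" "g * h = 1\<^sub>m l" "h * g = 1\<^sub>m l"
    by (auto simp: Units_def ring_mat_def)
  then show "g \<in> GL l" using g by (auto simp: GL_def invertible_mat_def inverts_mat_def intro!: exI[of _ h])
qed

lemma act_inverse:
  assumes "g \<in> carrier_mat l l" "h \<in> carrier_mat l l" "h * g = 1\<^sub>m l" "p \<in> polyS l"
  shows "act l g (act l h p) = p"
  using assms by (simp add: act_act act_one)

lemma hideal_act:
  assumes I: "hideal l I" and g: "g \<in> GL l"
  shows "hideal l (act l g ` I)"
proof -
  obtain h where h: "h \<in> GL l" "h * g = 1\<^sub>m l" using g by (rule GL_inverse)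
  have gh: "g \<in> carrier_mat l l" "h \<in> carrier_mat l l" using g h by (auto simp: GL_def)
  show ?thesis unfolding hideal_def
  proof (intro conjI ballI allI)
    show "0 \<in> act l g ` I" using hidealD(2)[OF I] by (force simp: act_simps)
    fix p q assume "p \<in> act l g ` I" "q \<in> act l g ` I"
    then show "p + q \<in> act l g ` I" by (auto simp: act_simps(3)[symmetric] hidealD[OF I])
  next
    fix p q :: "(nat, 'a) mpoly" assume p: "p \<in> polyS l" and "q \<in> act l g ` I"
    then obtain r where r: "r \<in> I" "q = act l g r" by auto
    have "p * q = act l g (act l h p * r)" using act_inverse[OF gh h(2) p] r by (simp add: act_simps)
    then show "p * q \<in> act l g ` I" using r hidealD(4)[OF I] by auto
  next
    fix p d assume "p \<in> act l g ` I"
    then obtain r where r: "r \<in> I" "p = act l g r" by auto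
    then show "homogeneous_component d p \<in> act l g ` I"
      using act_homogeneous_component[OF hidealD(1)[OF I r(1)], of d g] hidealD(5)[OF I r(1)] by auto
  qed auto
qed

text \<open>Forms of \<open>I\<close> with distinct leading power-products stay independent under
  the invertible substitution, so their number is a lower bound in the new coordinates.\<close>

lemma card_ltset_act_le:
  fixes I :: "(nat, 'k::field) mpoly set"
  assumes I: "hideal l I" and g: "g \<in> GL l"
  shows "card (ltset I \<inter> mons l d) \<le> card (ltset (act l g ` I) \<inter> mons l d)"
proof -
  obtain h where h: "h \<in> GL l" "g * h = 1\<^sub>m l" using g by (rule GL_inverse)
  have gh: "g \<in> carrier_mat l l" "h \<in> carrier_mat l l" using g h by (auto simp: GL_def)
  let ?F = "ltset I \<inter> mons l d"
  have "\<exists>p. p \<in> I \<inter> forms l d \<and> lead p t" if "t \<in> ?F" for t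
    using that ltset_inter_forms[OF I, of d] by (auto simp: ltset_def)
  then obtain p where p: "\<And>t. t \<in> ?F \<Longrightarrow> p t \<in> I \<inter> forms l d \<and> lead (p t) t" by metis
  note gI = hideal_act[OF I g]
  have "card ?F \<le> card (ltset (act l g ` I \<inter> forms l d) \<inter> mons l d)"
  proof (rule indep_le_card_ltset[where p = "\<lambda>t. act l g (p t)"])
    show "subsp (act l g ` I \<inter> forms l d)" by (rule subsp_hideal_forms[OF gI])
    show "act l g (p t) \<in> act l g ` I \<inter> forms l d" if "t \<in> ?F" for t
      using p[OF that] act_forms by auto
    fix c assume z: "\<And>t. t \<in> mons l d \<Longrightarrow> (\<Sum>j\<in>?F. lookup (act l g (p j)) t * c j) = 0"
    let ?q = "\<Sum>j\<in>?F. const_poly (c j) * p j"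
    have q: "?q \<in> forms l d" using p by (intro forms_sum) auto
    have "act l g ?q = 0"
    proof (rule poly_mapping_eqI)
      fix t
      have "lookup (act l g ?q) t = (\<Sum>j\<in>?F. lookup (act l g (p j)) t * c j)"
        by (simp add: act_simps lookup_sum mult.commute[of "c _"])
      moreover have "lookup (act l g ?q) t = 0" if "t \<notin> mons l d"
        using that act_forms[OF q, of g] by (auto simp only: forms_iff in_keys_iff)
      ultimately show "lookup (act l g ?q) t = lookup 0 t"
        using z[of t] by (cases "t \<in> mons l d") simp_all
    qed
    then have "?q = 0" using act_inverse[OF gh(2,1) h(2) forms_polyS[OF q]] by (simp add: act_simps)
    then have "(\<Sum>j\<in>?F. lookup (p j) t * c j) = 0" for t
      by (metis (no_types, lifting) lookup_scale lookup_sum lookup_zero mult.commute sum.cong)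
    then show "\<forall>j\<in>?F. c j = 0"
      by (intro lead_family_indep[where p = p and t = "\<lambda>t. t"]) (use p in \<open>auto simp: inj_on_def\<close>)
  qed auto
  also have "\<dots> = card (ltset (act l g ` I) \<inter> mons l d)" by (simp add: ltset_inter_forms[OF gI] Int_assoc)
  finally show ?thesis .
qed

lemma card_ltset_act:
  fixes I :: "(nat, 'k::field) mpoly set"
  assumes I: "hideal l I" and g: "g \<in> GL l"
  shows "card (ltset (act l g ` I) \<inter> mons l d) = card (ltset I \<inter> mons l d)"
proof (rule antisym)
  obtain h where h: "h \<in> GL l" "g * h = 1\<^sub>m l" using g by (rule GL_inverse)
  have gh: "g \<in> carrier_mat l l" "h \<in> carrier_mat l l" using g h by (auto simp: GL_def)
  have "act l h ` act l g ` I = I"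
    using act_inverse[OF gh(2,1) h(2)] hidealD(1)[OF I] by (force simp: image_image)
  then show "card (ltset (act l g ` I) \<inter> mons l d) \<le> card (ltset I \<inter> mons l d)"
    using card_ltset_act_le[OF hideal_act[OF I g] h(1), of d] by simp
qed (rule card_ltset_act_le[OF I g])

subsection \<open>Polynomial functions\<close>

text \<open>Points are total functions here. Since the polynomial involves only coordinates in
  \<open>X\<close>, values outside \<open>X\<close> do not matter
  (\<open>polyfun_cong\<close>).\<close>

definition polyfun :: "'x set \<Rightarrow> (('x \<Rightarrow> 'k::comm_ring_1) \<Rightarrow> 'k) \<Rightarrow> bool"
  where "polyfun X f \<longleftrightarrow> (\<exists>p\<in>polys_in X. \<forall>a. evaluate (\<lambda>c. c) a p = f a)"

lemma polys_in_add: "p \<in> polys_in X \<Longrightarrow> q \<in> polys_in X \<Longrightarrow> p + q \<in> polys_in X"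
  using Poly_Mapping.keys_add[of p q] by (auto simp: polys_in_def)

lemma polys_in_mult: "p \<in> polys_in X \<Longrightarrow> q \<in> polys_in X \<Longrightarrow> p * q \<in> polys_in X" for p :: "('x, 'k::comm_ring_1) mpoly"
proof -
  assume pq: "p \<in> polys_in X" "q \<in> polys_in X"
  have "keys t \<subseteq> X" if t: "t \<in> keys (p * q)" for t
  proof -
    obtain u v where "t = u + v" "u \<in> keys p" "v \<in> keys q" using t Poly_Mapping.keys_mult[of p q] by blast
    then show ?thesis using pq by (auto simp: polys_in_def keys_add_nat)
  qed
  then show "p * q \<in> polys_in X" by (auto simp: polys_in_def)
qed

lemma polyfun_const [simp]: "polyfun X (\<lambda>_. c)"
  unfolding polyfun_def by (rule bexI[of _ "const_poly c"]) (simp, simp add: polys_in_def const_poly_def)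

lemma polyfun_coord: "x \<in> X \<Longrightarrow> polyfun X (\<lambda>a. a x)"
  unfolding polyfun_def by (rule bexI[of _ "var_poly x"]) (simp, simp add: polys_in_def var_poly_def)

lemma polyfun_add: "polyfun X f \<Longrightarrow> polyfun X g \<Longrightarrow> polyfun X (\<lambda>a. f a + g a)"
  unfolding polyfun_def by (metis evaluate_add polys_in_add rhom_id)

lemma polyfun_mult: "polyfun X f \<Longrightarrow> polyfun X g \<Longrightarrow> polyfun X (\<lambda>a. f a * g a)"
  unfolding polyfun_def by (metis evaluate_mult polys_in_mult rhom_id)

lemma polyfun_sum: "(\<And>i. i \<in> A \<Longrightarrow> polyfun X (f i)) \<Longrightarrow> polyfun X (\<lambda>a. \<Sum>i\<in>A. f i a)"
  by (induction A rule: infinite_finite_induct) (auto intro: polyfun_add)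

lemma polyfun_prod: "(\<And>i. i \<in> A \<Longrightarrow> polyfun X (f i)) \<Longrightarrow> polyfun X (\<lambda>a. \<Prod>i\<in>A. f i a)"
  by (induction A rule: infinite_finite_induct) (auto intro: polyfun_mult)

lemma polyfun_det:
  assumes "\<And>i j. i < r \<Longrightarrow> j < r \<Longrightarrow> polyfun X (m i j)"
  shows "polyfun X (\<lambda>a. det (mat r r (\<lambda>(i, j). m i j a)))"
proof -
  have "det (mat r r (\<lambda>(i, j). m i j a)) =
      (\<Sum>p\<in>{p. p permutes {0..<r}}. signof p * (\<Prod>i\<in>{0..<r}. m i (p i) a))" for a
  proof -
    have "det (mat r r (\<lambda>(i, j). m i j a)) =
      (\<Sum>p\<in>{p. p permutes {0..<r}}. signof p * (\<Prod>i\<in>{0..<r}. mat r r (\<lambda>(i, j). m i j a) $$ (i, p i)))"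
      by (simp add: det_def)
    also have "\<dots> = (\<Sum>p\<in>{p. p permutes {0..<r}}. signof p * (\<Prod>i\<in>{0..<r}. m i (p i) a))"
      by (intro sum.cong refl arg_cong2[where f = "(*)"] prod.cong)
        (auto dest: permutes_in_image[of _ "{0..<r}"])
    finally show ?thesis .
  qed
  moreover have "polyfun X (\<lambda>a. \<Sum>p\<in>{p. p permutes {0..<r}}. signof p * (\<Prod>i\<in>{0..<r}. m i (p i) a))"
    using assms by (intro polyfun_sum polyfun_mult polyfun_prod) (auto dest: permutes_in_image[of _ "{0..<r}"])
  ultimately show ?thesis by simp
qed

lemma polyfun_cong:
  assumes "polyfun X f" "\<And>x. x \<in> X \<Longrightarrow> a x = b x" shows "f a = f b"
proof -
  obtain p where p: "p \<in> polys_in X" "\<And>a. evaluate (\<lambda>c. c) a p = f a" using assms(1) by (auto simp: polyfun_def)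
  have "evaluate (\<lambda>c. c) a p = evaluate (\<lambda>c. c) b p"
    using p(1) assms(2) by (intro evaluate_cong) (auto simp: polys_in_def)
  then show ?thesis using p by simp
qed

lemma rhom_poly: "rhom (\<lambda>q. poly q s)"
  by (simp add: rhom_def)

text \<open>Along a polynomial curve a polynomial function becomes univariate, so that the
  finiteness of roots can be applied to it.\<close>

lemma polyfun_curve:
  fixes f :: "('x \<Rightarrow> 'k::comm_ring_1) \<Rightarrow> 'k"
  assumes "polyfun X f"
  shows "\<exists>r. \<forall>s. f (\<lambda>x. poly (q x) s) = poly r s"
proof -
  obtain p where p: "p \<in> polys_in X" "\<And>a. evaluate (\<lambda>c. c) a p = f a" using assms(1) by (auto simp: polyfun_def)
  have "f (\<lambda>x. poly (q x) s) = poly (evaluate (\<lambda>c. [:c:]) q p) s" for s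
    using rhom_comp_evaluate[OF rhom_poly[of s], of "\<lambda>c. [:c:]" q p] p(2) by simp
  then show ?thesis by blast
qed

text \<open>Nonempty open sets meet: on the line from \<open>a\<close> to \<open>b\<close> both
  functions become nonzero univariate polynomials, and the field is infinite.\<close>

lemma polyfun_common_nonzero:
  fixes f :: "('x \<Rightarrow> 'k::field_char_0) \<Rightarrow> 'k"
  assumes f: "polyfun X f" "f a \<noteq> 0" and g: "polyfun X g" "g b \<noteq> 0"
  shows "\<exists>c\<in>X \<rightarrow>\<^sub>E UNIV. f c \<noteq> 0 \<and> g c \<noteq> 0"
proof -
  let ?q = "\<lambda>x. [:a x, b x - a x:]"
  obtain r where r: "\<And>s. f (\<lambda>x. poly (?q x) s) = poly r s" using polyfun_curve[OF f(1), of ?q] by blast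
  obtain r' where r': "\<And>s. g (\<lambda>x. poly (?q x) s) = poly r' s" using polyfun_curve[OF g(1), of ?q] by blast
  have "poly r 0 \<noteq> 0" "poly r' 1 \<noteq> 0" using r[of 0] r'[of 1] f g by simp_all
  then have "r * r' \<noteq> 0" by auto
  then have "finite {s. poly (r * r') s = 0}" by (rule poly_roots_finite)
  then obtain s where s: "poly (r * r') s \<noteq> 0" using infinite_UNIV_char_0 ex_new_if_finite by blast
  let ?c = "\<lambda>x. poly (?q x) s"
  have "f ?c \<noteq> 0" "g ?c \<noteq> 0" using s r r' by auto
  moreover have "f (restrict ?c X) = f ?c" "g (restrict ?c X) = g ?c"
    by (rule polyfun_cong[OF f(1)], simp, rule polyfun_cong[OF g(1)], simp)
  ultimately show ?thesis by (intro bexI[of _ "restrict ?c X"]) auto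
qed

lemma zariski_open_polyfun:
  fixes f :: "('x \<Rightarrow> 'k::field) \<Rightarrow> 'k"
  assumes "polyfun X f" shows "zariski_open X {a \<in> X \<rightarrow>\<^sub>E UNIV. f a \<noteq> 0}"
proof -
  obtain p where p: "p \<in> polys_in X" "\<And>a. evaluate (\<lambda>c. c) a p = f a" using assms(1) by (auto simp: polyfun_def)
  then show ?thesis unfolding zariski_open_def by (intro exI[of _ "{p}"]) auto
qed

text \<open>Every point of an open set has a basic open neighbourhood, so openness is used only
  through one polynomial function.\<close>

lemma zariski_openE:
  fixes U :: "('x \<Rightarrow> 'k::field) set"
  assumes "zariski_open X U" "a \<in> U"
  obtains f where "polyfun X f" "f a \<noteq> 0" "\<And>b. b \<in> X \<rightarrow>\<^sub>E UNIV \<Longrightarrow> f b \<noteq> 0 \<Longrightarrow> b \<in> U"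
proof -
  obtain F where F: "F \<subseteq> polys_in X" "U = {a \<in> X \<rightarrow>\<^sub>E UNIV. \<exists>p\<in>F. evaluate (\<lambda>c. c) a p \<noteq> 0}"
    using assms(1) by (auto simp: zariski_open_def)
  then obtain p where "p \<in> F" "evaluate (\<lambda>c. c) a p \<noteq> 0" using assms(2) by auto
  then show ?thesis using F by (intro that[of "\<lambda>a. evaluate (\<lambda>c. c) a p"]) (auto simp: polyfun_def)
qed

text \<open>Families of polynomials whose coefficients depend polynomially on a parameter. The
  inductive form keeps their supports uniformly finite and gives closure under products by
  induction.\<close>

inductive polyfam :: "'x set \<Rightarrow> (('x \<Rightarrow> 'k::comm_ring_1) \<Rightarrow> (nat, 'k) mpoly) \<Rightarrow> bool" for X where
  polyfam_single: "polyfun X f \<Longrightarrow> polyfam X (\<lambda>a. single t (f a))"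
| polyfam_add: "polyfam X F \<Longrightarrow> polyfam X G \<Longrightarrow> polyfam X (\<lambda>a. F a + G a)"

lemma polyfam_lookup: "polyfam X F \<Longrightarrow> polyfun X (\<lambda>a. lookup (F a) t)"
proof (induction rule: polyfam.induct)
  case (polyfam_single f u)
  then show ?case by (cases "t = u") (auto simp: lookup_single when_def)
qed (auto simp: lookup_add intro: polyfun_add)

lemma polyfam_const [simp]: "polyfam X (\<lambda>_. p)"
proof -
  have "polyfam X (\<lambda>_. \<Sum>t\<in>A. single t (lookup p t))" for A
  proof (induction A rule: infinite_finite_induct)
    case (insert t A)
    then show ?case using polyfam_add[OF polyfam_single[of X "\<lambda>_. lookup p t" t] insert.IH] by simp
  qed (use polyfam_single[of X "\<lambda>_. 0" 0] in auto)
  from this[of "keys p"] show ?thesis by (simp add: sum_single_keys)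
qed

lemma polyfam_mult: "polyfam X F \<Longrightarrow> polyfam X G \<Longrightarrow> polyfam X (\<lambda>a. F a * G a)"
proof (induction rule: polyfam.induct)
  case (polyfam_single f t)
  from polyfam_single(2) show ?case
  proof (induction rule: polyfam.induct)
    case (polyfam_single g u)
    show ?case unfolding mult_single
      using polyfam.polyfam_single[OF polyfun_mult[OF \<open>polyfun X f\<close> polyfam_single]] .
  qed (auto simp: distrib_left intro: polyfam_add)
qed (auto simp: distrib_right intro: polyfam_add)

lemma polyfam_sum: "(\<And>i. i \<in> A \<Longrightarrow> polyfam X (F i)) \<Longrightarrow> polyfam X (\<lambda>a. \<Sum>i\<in>A. F i a)"
  by (induction A rule: infinite_finite_induct) (auto intro: polyfam_add)

lemma polyfam_prod: "(\<And>i. i \<in> A \<Longrightarrow> polyfam X (F i)) \<Longrightarrow> polyfam X (\<lambda>a. \<Prod>i\<in>A. F i a)"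
  by (induction A rule: infinite_finite_induct) (auto intro: polyfam_mult)

lemma polyfam_power: "polyfam X F \<Longrightarrow> polyfam X (\<lambda>a. F a ^ n)"
  by (induction n) (auto intro: polyfam_mult)

lemma polyfam_linear_form:
  assumes "\<And>j. j < l \<Longrightarrow> polyfun X (\<lambda>a. c a j)"
  shows "polyfam X (\<lambda>a. linear_form l (c a))"
  unfolding linear_form_def const_poly_def
  using assms by (intro polyfam_sum polyfam_mult polyfam_single) auto

lemma polyfam_act:
  assumes "p \<in> polyS l"
  shows "polyfam ({..<l} \<times> {..<l}) (\<lambda>a. act l (mat l l a) p)"
  unfolding act_def evaluate_def
proof (intro polyfam_sum polyfam_mult polyfam_prod polyfam_power polyfam_const polyfam_linear_form)
  fix t i j assume "t \<in> keys p" "i \<in> keys t" "j < l"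
  moreover from this have "i < l" using assms by (auto simp: polyS_iff pps_def)
  ultimately show "polyfun ({..<l} \<times> {..<l}) (\<lambda>a. mat l l a $$ (i, j))"
    by (simp add: polyfun_coord)
qed

section \<open>Dickson's lemma, as a bound on the degrees of generators\<close>

lemma nat_mono_subseq:
  fixes s :: "nat \<Rightarrow> nat"
  shows "\<exists>\<phi>::nat \<Rightarrow> nat. strict_mono \<phi> \<and> (\<forall>i j. i \<le> j \<longrightarrow> s (\<phi> i) \<le> s (\<phi> j))"
proof -
  obtain f where f: "strict_mono f" "monoseq (\<lambda>n. s (f n))" using seq_monosub[of s] by blast
  then consider "\<forall>m. \<forall>n\<ge>m. s (f m) \<le> s (f n)" | "\<forall>m. \<forall>n\<ge>m. s (f n) \<le> s (f m)"
    by (auto simp: monoseq_def)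
  then show ?thesis
  proof cases
    case 1
    then show ?thesis using f(1) by blast
  next
    case 2
    obtain N where N: "\<forall>m. s (f N) \<le> s (f m)" using ex_has_least_nat[of "\<lambda>_. True" 0 "\<lambda>n. s (f n)"] by auto
    have "s (f (n + N)) = s (f N)" for n using 2 N by (metis le_add2 antisym)
    moreover have "strict_mono (\<lambda>n. f (n + N))" using f(1) by (auto simp: strict_mono_def)
    ultimately show ?thesis by (intro exI[of _ "\<lambda>n. f (n + N)"]) auto
  qed
qed

lemma dickson_subseq:
  fixes f :: "nat \<Rightarrow> nat \<Rightarrow>\<^sub>0 nat"
  shows "\<exists>\<phi>::nat \<Rightarrow> nat. strict_mono \<phi> \<and> (\<forall>x<l. \<forall>i j. i \<le> j \<longrightarrow> lookup (f (\<phi> i)) x \<le> lookup (f (\<phi> j)) x)"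
proof (induction l)
  case 0
  then show ?case by (intro exI[of _ id]) (auto simp: strict_mono_def)
next
  case (Suc l)
  then obtain \<phi> :: "nat \<Rightarrow> nat" where \<phi>: "strict_mono \<phi>" "\<forall>x<l. \<forall>i j. i \<le> j \<longrightarrow> lookup (f (\<phi> i)) x \<le> lookup (f (\<phi> j)) x" by blast
  obtain \<psi> :: "nat \<Rightarrow> nat" where \<psi>: "strict_mono \<psi>" "\<forall>i j. i \<le> j \<longrightarrow> lookup (f (\<phi> (\<psi> i))) l \<le> lookup (f (\<phi> (\<psi> j))) l"
    using nat_mono_subseq[of "\<lambda>n. lookup (f (\<phi> n)) l"] by blast
  have "strict_mono (\<phi> \<circ> \<psi>)" using \<phi>(1) \<psi>(1) by (auto simp: strict_mono_def)
  moreover have "lookup (f (\<phi> (\<psi> i))) x \<le> lookup (f (\<phi> (\<psi> j))) x" if "x < Suc l" "i \<le> j" for x i j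
    using that \<phi>(2) \<psi>(2) strict_mono_less_eq[OF \<psi>(1)] by (cases "x = l") auto
  ultimately show ?case by (intro exI[of _ "\<phi> \<circ> \<psi>"]) (simp add: comp_def)
qed

lemma dickson:
  assumes M: "M \<subseteq> pps l"
  shows "\<exists>N. \<forall>t\<in>M. \<exists>s\<in>M. pp_degree s \<le> N \<and> (\<exists>u\<in>pps l. t = u + s)"
proof (rule ccontr)
  assume "\<not> ?thesis"
  then have "\<forall>N. \<exists>t. t \<in> M \<and> (\<forall>s\<in>M. pp_degree s \<le> N \<longrightarrow> \<not> (\<exists>u\<in>pps l. t = u + s))" by blast
  then obtain F where F: "\<And>N. F N \<in> M" "\<And>N s. s \<in> M \<Longrightarrow> pp_degree s \<le> N \<Longrightarrow> \<not> (\<exists>u\<in>pps l. F N = u + s)"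
    by metis
  \<comment> \<open>Each term is chosen to be no multiple of an element of \<open>M\<close> of
    degree at most that of its predecessor. The degrees therefore grow strictly, and a subsequence
    monotone in all exponents yields a forbidden multiple.\<close>
  define f where "f = rec_nat (F 0) (\<lambda>_ t. F (pp_degree t))"
  have f: "f 0 = F 0" "\<And>n. f (Suc n) = F (pp_degree (f n))" by (simp_all add: f_def)
  have fM: "f n \<in> M" for n by (cases n) (auto simp: f F)
  have "pp_degree (f n) < pp_degree (f (Suc n))" for n
  proof (rule ccontr)
    assume "\<not> ?thesis"
    then have "\<not> (\<exists>u\<in>pps l. F (pp_degree (f n)) = u + f (Suc n))" using F(2)[OF fM] by simp
    moreover have "F (pp_degree (f n)) = 0 + f (Suc n)" by (simp add: f)
    ultimately show False using zero_in_pps by blast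
  qed
  then have sm: "strict_mono (\<lambda>n. pp_degree (f n))" by (simp add: strict_mono_Suc_iff)
  obtain \<phi> :: "nat \<Rightarrow> nat" where \<phi>: "strict_mono \<phi>" "\<forall>x<l. \<forall>i j. i \<le> j \<longrightarrow> lookup (f (\<phi> i)) x \<le> lookup (f (\<phi> j)) x"
    using dickson_subseq[where l = l and f = f] by blast
  have "\<phi> 0 < \<phi> 1" using \<phi>(1) by (simp add: strict_mono_def)
  then obtain n where n: "\<phi> 1 = Suc n" "\<phi> 0 \<le> n" by (cases "\<phi> 1") auto
  have le: "lookup (f (\<phi> 0)) x \<le> lookup (f (Suc n)) x" for x
  proof (cases "x < l")
    case True then show ?thesis using \<phi>(2) n(1)[symmetric] by simp
  next
    case False then show ?thesis using lookup_pps[of "f (\<phi> 0)" l x] subsetD[OF M fM] by auto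
  qed
  then have eq: "f (Suc n) = (f (Suc n) - f (\<phi> 0)) + f (\<phi> 0)"
    by (intro poly_mapping_eqI) (simp add: lookup_add lookup_minus)
  moreover have "f (Suc n) - f (\<phi> 0) \<in> pps l" using fM[of "Suc n"] M eq pps_add_iff by (metis subsetD)
  moreover have "pp_degree (f (\<phi> 0)) \<le> pp_degree (f n)" using strict_mono_less_eq[OF sm] n(2) by simp
  ultimately show False using F(2)[OF fM, of "\<phi> 0" "pp_degree (f n)"] f(2)[of n] by auto
qed

subsection \<open>Generic initial ideals\<close>

lemma GL_polyfun: "polyfun ({..<l} \<times> {..<l}) (\<lambda>a. det (mat l l a :: 'k::field mat))"
proof -
  have "polyfun ({..<l} \<times> {..<l}) (\<lambda>a. det (mat l l (\<lambda>(i, j). a (i, j)) :: 'k mat))"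
    by (rule polyfun_det) (auto intro: polyfun_coord)
  then show ?thesis by simp
qed

lemma mat_entries: "g \<in> carrier_mat l l \<Longrightarrow> mat l l (($$) g) = g"
  by (intro eq_matI) auto

text \<open>Lower semicontinuity of the count on a segment. Forms of \<open>I\<close> whose images
  under \<open>g0\<close> have the counted leading power-products give a square coefficient matrix.
  Its determinant is nonzero at \<open>g0\<close>, and wherever it is nonzero the images remain
  independent on \<open>Y\<close>.\<close>

lemma ltset_act_semicontinuous:
  fixes I :: "(nat, 'k::field) mpoly set"
  assumes I: "hideal l I" and g0: "g0 \<in> GL l" and Y: "upper l d Y"
  shows "\<exists>f. polyfun ({..<l} \<times> {..<l}) f \<and> f (($$) g0) \<noteq> 0 \<and>
    (\<forall>a. f a \<noteq> 0 \<longrightarrow> mat l l a \<in> GL l \<longrightarrow>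
      card (ltset (act l g0 ` I) \<inter> Y) \<le> card (ltset (act l (mat l l a) ` I) \<inter> Y))"
proof -
  let ?T = "ltset (act l g0 ` I) \<inter> Y"
  have Ym: "Y \<subseteq> mons l d" using Y by (auto simp: upper_def)
  have inter: "ltset (act l g ` I \<inter> forms l d) \<inter> Y = ltset (act l g ` I) \<inter> Y" if "g \<in> GL l" for g
    using ltset_inter_forms[OF hideal_act[OF I that], of d] Ym by auto
  have finT: "finite ?T" using Ym finite_subset[OF _ finite_mons] by blast
  obtain t where t: "bij_betw t {..<card ?T} ?T"
    using ex_bij_betw_nat_finite[OF finT] by (auto simp: atLeast0LessThan)
  have "\<exists>p. p \<in> I \<inter> forms l d \<and> lead (act l g0 p) (t i)" if "i < card ?T" for i
  proof -
    have ti: "t i \<in> ?T" using t that by (auto simp: bij_betw_def)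
    then have "t i \<in> ltset (act l g0 ` I)" "pp_degree (t i) = d" using Ym by (auto simp: mons_def)
    then obtain q where q: "q \<in> act l g0 ` I" "q \<in> forms l d" "lead q (t i)"
      using ltset_homogeneous[OF hideal_act[OF I g0], of "t i"] by auto
    then obtain p where p: "p \<in> I" "q = act l g0 p" by auto
    have "homogeneous_component d p \<in> I \<inter> forms l d"
      using hidealD(1,5)[OF I] p homogeneous_component_form by blast
    moreover have "act l g0 (homogeneous_component d p) = q"
      using act_homogeneous_component[OF hidealD(1)[OF I p(1)], of d g0] q(2) p(2)
      by (simp add: homogeneous_component_of_form)
    ultimately show ?thesis using q(3) by metis
  qed
  then obtain p where p: "\<And>i. i < card ?T \<Longrightarrow> p i \<in> I \<inter> forms l d \<and> lead (act l g0 (p i)) (t i)" by metis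
  let ?f = "\<lambda>a. det (mat (card ?T) (card ?T) (\<lambda>(i, j). lookup (act l (mat l l a) (p j)) (t i)))"
  have pf: "polyfun ({..<l} \<times> {..<l}) ?f"
    by (rule polyfun_det, rule polyfam_lookup, rule polyfam_act) (use p forms_polyS in blast)
  have g0m: "mat l l (($$) g0) = g0" using g0 by (intro mat_entries) (auto simp: GL_def)
  have nz: "?f (($$) g0) \<noteq> 0"
    unfolding g0m det_nonzero_iff
  proof (intro allI impI)
    fix c j assume z: "\<forall>i<card ?T. (\<Sum>j<card ?T. lookup (act l g0 (p j)) (t i) * c j) = 0" and j: "j < card ?T"
    have "\<forall>j\<in>{..<card ?T}. c j = 0"
      by (rule lead_family_indep[where p = "\<lambda>j. act l g0 (p j)" and t = t])
        (use p z t in \<open>auto simp: bij_betw_def\<close>)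
    then show "c j = 0" using j by simp
  qed
  have "card ?T \<le> card (ltset (act l (mat l l a) ` I) \<inter> Y)" if a: "?f a \<noteq> 0" "mat l l a \<in> GL l" for a
  proof -
    have "card {..<card ?T} \<le> card (ltset (act l (mat l l a) ` I \<inter> forms l d) \<inter> Y)"
    proof (rule indep_le_card_ltset[where p = "\<lambda>j. act l (mat l l a) (p j)"])
      show "subsp (act l (mat l l a) ` I \<inter> forms l d)" by (rule subsp_hideal_forms[OF hideal_act[OF I a(2)]])
      show "act l (mat l l a) (p j) \<in> act l (mat l l a) ` I \<inter> forms l d" if "j \<in> {..<card ?T}" for j
        using p that by (auto intro: act_forms)
      fix c assume z: "\<And>u. u \<in> Y \<Longrightarrow> (\<Sum>j\<in>{..<card ?T}. lookup (act l (mat l l a) (p j)) u * c j) = 0"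
      have "t i \<in> Y" if "i < card ?T" for i using t that by (auto simp: bij_betw_def)
      then show "\<forall>j\<in>{..<card ?T}. c j = 0" using a(1) z unfolding det_nonzero_iff by auto
    qed (use Y in auto)
    then show ?thesis using inter[OF a(2)] by simp
  qed
  then show ?thesis using pf nz by blast
qed

lemma polyfun_common_nonzero_finite:
  fixes f :: "'i \<Rightarrow> ('x \<Rightarrow> 'k::field_char_0) \<Rightarrow> 'k"
  assumes "finite A" "\<And>i. i \<in> A \<Longrightarrow> polyfun X (f i)" "\<And>i. i \<in> A \<Longrightarrow> \<exists>a. f i a \<noteq> 0"
  shows "\<exists>a\<in>X \<rightarrow>\<^sub>E UNIV. (\<Prod>i\<in>A. f i a) \<noteq> 0"
  using assms
proof (induction A rule: finite_induct)
  case empty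
  have "restrict (\<lambda>_. 0) X \<in> X \<rightarrow>\<^sub>E (UNIV :: 'k set)" by auto
  then show ?case by (intro bexI) auto
next
  case (insert i A)
  then obtain a b where "f i a \<noteq> 0" "(\<Prod>i\<in>A. f i b) \<noteq> 0" by blast
  then obtain c where "c \<in> X \<rightarrow>\<^sub>E UNIV" "f i c \<noteq> 0" "(\<Prod>i\<in>A. f i c) \<noteq> 0"
    using polyfun_common_nonzero[of X "f i" a "\<lambda>a. \<Prod>i\<in>A. f i a" b] polyfun_prod[of A X f] insert by auto
  then show ?case using insert.hyps by (intro bexI[of _ c]) auto
qed

text \<open>At the largest element \<open>t\<close> of the symmetric difference, the segment that
  ends with \<open>t\<close> has one more element of one set than of the other, because all larger
  elements are common.\<close>

lemma upper_sets_determine: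
  assumes "A \<subseteq> mons l d" "B \<subseteq> mons l d" "\<And>Y. upper l d Y \<Longrightarrow> card (A \<inter> Y) = card (B \<inter> Y)"
  shows "A = B"
proof (rule ccontr)
  assume ne: "A \<noteq> B"
  let ?D = "(A - B) \<union> (B - A)"
  have "finite ?D" using assms(1,2) finite_subset[OF _ finite_mons[of l d], of ?D] by blast
  moreover have "?D \<noteq> {}" using ne by auto
  ultimately obtain t where t: "t \<in> ?D" "\<forall>u\<in>?D. u \<noteq> t \<longrightarrow> drl_greater t u"
    using drl_max_exists by blast
  let ?Y = "{u \<in> mons l d. drl_greater u t}"
  have tm: "t \<in> mons l d" using t assms by auto
  have up: "upper l d ?Y" "upper l d (insert t ?Y)"
    using tm drl_trans by (auto simp: upper_def)
  have "u \<notin> ?D" if "drl_greater u t" for u using t(2) drl_asym[OF that] that by (cases "u = t") auto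
  then have eq: "A \<inter> ?Y = B \<inter> ?Y" by blast
  have fin: "finite (A \<inter> ?Y)" by auto
  have tY: "t \<notin> ?Y" by simp
  have "A \<inter> insert t ?Y = (if t \<in> A then insert t (A \<inter> ?Y) else A \<inter> ?Y)"
    "B \<inter> insert t ?Y = (if t \<in> B then insert t (A \<inter> ?Y) else A \<inter> ?Y)"
    using eq by auto
  then have "card (A \<inter> insert t ?Y) \<noteq> card (B \<inter> insert t ?Y)"
    using t(1) fin tY by auto
  then show False using assms(3)[OF up(2)] by simp
qed

text \<open>Galligo's theorem in one degree, together with maximality. For each of the finitely many
  segments some \<open>g0\<close> attains the largest count; by semicontinuity all maxima are
  attained at once off the zero set of a product, and the counts on segments determine the
  set.\<close>

lemma gin_degree:
  fixes I :: "(nat, 'k::field_char_0) mpoly set"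
  assumes I: "hideal l I"
  shows "\<exists>J P. polyfun ({..<l} \<times> {..<l}) P \<and> (\<exists>a. P a \<noteq> 0) \<and>
    (\<forall>a. P a \<noteq> 0 \<longrightarrow> mat l l a \<in> GL l \<longrightarrow> ltset (act l (mat l l a) ` I) \<inter> mons l d = J) \<and>
    (\<forall>g\<in>GL l. \<forall>Y. upper l d Y \<longrightarrow> card (ltset (act l g ` I) \<inter> Y) \<le> card (J \<inter> Y))"
proof -
  let ?L = "\<lambda>g. ltset (act l g ` I)" and ?X = "{..<l} \<times> {..<l}"
  have fin: "finite {Y. upper l d Y}"
    by (rule finite_subset[of _ "Pow (mons l d)"]) (auto simp: upper_def)
  have one: "1\<^sub>m l \<in> GL l" by (simp add: GL_iff_det)
  define good where "good = (\<lambda>Y f. polyfun ?X f \<and> (\<exists>a. f a \<noteq> 0) \<and> (\<forall>a. f a \<noteq> 0 \<longrightarrow> mat l l a \<in> GL l \<longrightarrow>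
      (\<forall>g\<in>GL l. card (?L g \<inter> Y) \<le> card (?L (mat l l a) \<inter> Y))))"
  have "\<exists>f. good Y f" if Y: "upper l d Y" for Y
  proof -
    have "card (?L g \<inter> Y) \<le> card (mons l d)" for g
      using Y by (intro card_mono) (auto simp: upper_def)
    then have "card (?L g \<inter> Y) < Suc (card (mons l d))" for g by (simp add: less_Suc_eq_le)
    then obtain g0 where g0: "g0 \<in> GL l" "\<forall>g. g \<in> GL l \<longrightarrow> card (?L g \<inter> Y) \<le> card (?L g0 \<inter> Y)"
      using ex_has_greatest_nat[of "\<lambda>g. g \<in> GL l" "1\<^sub>m l" "\<lambda>g. card (?L g \<inter> Y)" "Suc (card (mons l d))"] one
      by auto
    obtain f where f: "polyfun ?X f" "f (($$) g0) \<noteq> 0"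
      "\<And>a. f a \<noteq> 0 \<Longrightarrow> mat l l a \<in> GL l \<Longrightarrow> card (?L g0 \<inter> Y) \<le> card (?L (mat l l a) \<inter> Y)"
      using ltset_act_semicontinuous[OF I g0(1) Y] by blast
    have "good Y f" unfolding good_def
    proof (intro conjI allI impI ballI)
      fix a and g :: "'k mat" assume "f a \<noteq> 0" "mat l l a \<in> GL l" "g \<in> GL l"
      then show "card (?L g \<inter> Y) \<le> card (?L (mat l l a) \<inter> Y)"
        using f(3)[of a] g0(2) by (blast intro: le_trans)
    qed (use f in auto)
    then show ?thesis by blast
  qed
  then have "\<forall>Y\<in>{Y. upper l d Y}. \<exists>f. good Y f" by simp
  from bchoice[OF this] obtain f where f0: "\<And>Y. upper l d Y \<Longrightarrow> good Y (f Y)" by auto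
  have f: "polyfun ?X (f Y)" "\<exists>a. f Y a \<noteq> 0"
    "f Y a \<noteq> 0 \<Longrightarrow> mat l l a \<in> GL l \<Longrightarrow> g \<in> GL l \<Longrightarrow> card (?L g \<inter> Y) \<le> card (?L (mat l l a) \<inter> Y)"
    if "upper l d Y" for Y a and g :: "'k mat"
    using f0[OF that] by (auto simp: good_def)
  define P where "P = (\<lambda>a. \<Prod>Y\<in>{Y. upper l d Y}. f Y a)"
  have P: "polyfun ?X P" unfolding P_def using f by (intro polyfun_prod) auto
  obtain a where a: "P a \<noteq> 0"
    using polyfun_common_nonzero_finite[OF fin, of ?X f] f unfolding P_def by auto
  obtain a0 where a0: "P a0 \<noteq> 0" "det (mat l l a0) \<noteq> 0"
    using polyfun_common_nonzero[OF P a GL_polyfun, of "($$) (1\<^sub>m l)"] mat_entries[of "1\<^sub>m l :: 'k mat" l]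
    by auto
  have a0GL: "mat l l a0 \<in> GL l" using a0 by (simp add: GL_iff_det)
  let ?J = "?L (mat l l a0) \<inter> mons l d"
  have fP: "f Y a \<noteq> 0" if "P a \<noteq> 0" "upper l d Y" for a Y
    using that fin unfolding P_def by auto
  have JY: "?J \<inter> Y = ?L (mat l l a0) \<inter> Y" if "upper l d Y" for Y using that by (auto simp: upper_def)
  have G1: "card (?L g \<inter> Y) \<le> card (?J \<inter> Y)" if "g \<in> GL l" "upper l d Y" for g Y
    using f(3)[OF that(2) fP[OF a0(1) that(2)] a0GL that(1)] JY[OF that(2)] by simp
  have "?L (mat l l a) \<inter> mons l d = ?J" if a: "P a \<noteq> 0" "mat l l a \<in> GL l" for a
  proof (rule upper_sets_determine)
    fix Y assume Y: "upper l d Y"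
    have "?L (mat l l a) \<inter> mons l d \<inter> Y = ?L (mat l l a) \<inter> Y" using Y by (auto simp: upper_def)
    moreover have "card (?L (mat l l a) \<inter> Y) \<le> card (?J \<inter> Y)" by (rule G1[OF a(2) Y])
    moreover have "card (?J \<inter> Y) \<le> card (?L (mat l l a) \<inter> Y)"
      using f(3)[OF Y fP[OF a(1) Y] a(2) a0GL] JY[OF Y] by simp
    ultimately show "card (?L (mat l l a) \<inter> mons l d \<inter> Y) = card (?J \<inter> Y)" by simp
  qed auto
  then show ?thesis using P a G1 by (intro exI[of _ ?J] exI[of _ P]) auto
qed

text \<open>The set \<open>J\<close> of power-products of the generic initial ideal dominates the leading
  power-products of all coordinate changes on initial segments.\<close>

definition is_gin :: "nat \<Rightarrow> (nat, 'k::field) mpoly set \<Rightarrow> (nat \<Rightarrow>\<^sub>0 nat) set \<Rightarrow> ((nat \<times> nat \<Rightarrow> 'k) \<Rightarrow> 'k) \<Rightarrow> bool"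
  where "is_gin l I J P \<longleftrightarrow> upcl l J \<and> polyfun ({..<l} \<times> {..<l}) P \<and> (\<exists>a. P a \<noteq> 0) \<and>
    (\<forall>a. P a \<noteq> 0 \<longrightarrow> mat l l a \<in> GL l \<longrightarrow> ltset (act l (mat l l a) ` I) = J) \<and>
    (\<forall>g\<in>GL l. \<forall>d Y. upper l d Y \<longrightarrow> card (ltset (act l g ` I) \<inter> Y) \<le> card (J \<inter> Y))"

text \<open>Invertibility is itself an open condition, satisfied by the identity matrix, so it can
  be added to any nonempty one.\<close>

lemma polyfun_GL_nonzero:
  fixes P :: "(nat \<times> nat \<Rightarrow> 'k::field_char_0) \<Rightarrow> 'k"
  assumes "polyfun ({..<l} \<times> {..<l}) P" "P a \<noteq> 0"
  shows "\<exists>b\<in>({..<l} \<times> {..<l}) \<rightarrow>\<^sub>E UNIV. P b \<noteq> 0 \<and> mat l l b \<in> GL l"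
proof -
  obtain b where "b \<in> ({..<l} \<times> {..<l}) \<rightarrow>\<^sub>E UNIV" "P b \<noteq> 0" "det (mat l l b) \<noteq> 0"
    using polyfun_common_nonzero[OF assms GL_polyfun, of "($$) (1\<^sub>m l)"] mat_entries[of "1\<^sub>m l :: 'k mat" l]
    by auto
  then show ?thesis by (auto simp: GL_iff_det)
qed

text \<open>A single polynomial has to serve all degrees. By Dickson's lemma the degrees up to some
  \<open>N\<close> generate \<open>M\<close>; in the other degrees containment and maximality of the
  counts force equality.\<close>

lemma gin_exists:
  fixes I :: "(nat, 'k::field_char_0) mpoly set"
  assumes I: "hideal l I"
  shows "\<exists>J P. is_gin l I J P"
proof -
  let ?L = "\<lambda>a. ltset (act l (mat l l a) ` I)" and ?X = "{..<l} \<times> {..<l}"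
  define good where "good = (\<lambda>d (J, P). polyfun ?X P \<and> (\<exists>a. P a \<noteq> 0) \<and>
    (\<forall>a. P a \<noteq> 0 \<longrightarrow> mat l l a \<in> GL l \<longrightarrow> ?L a \<inter> mons l d = J) \<and>
    (\<forall>g\<in>GL l. \<forall>Y. upper l d Y \<longrightarrow> card (ltset (act l g ` I) \<inter> Y) \<le> card (J \<inter> Y)))"
  have "\<forall>d. \<exists>JP. good d JP" using gin_degree[OF I] by (simp add: good_def)
  from choice[OF this] obtain JP where JP0: "\<And>d. good d (JP d)" by auto
  define J where "J d = fst (JP d)" for d
  define P where "P d = snd (JP d)" for d
  have JP: "polyfun ?X (P d)" "\<exists>a. P d a \<noteq> 0"
    "P d a \<noteq> 0 \<Longrightarrow> mat l l a \<in> GL l \<Longrightarrow> ?L a \<inter> mons l d = J d"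
    "g \<in> GL l \<Longrightarrow> upper l d Y \<Longrightarrow> card (ltset (act l g ` I) \<inter> Y) \<le> card (J d \<inter> Y)" for d a Y and g :: "'k mat"
    using JP0[of d] by (auto simp: good_def J_def P_def case_prod_beta)
  have Jm: "J d \<subseteq> mons l d" for d
  proof -
    obtain a where "P d a \<noteq> 0" using JP(2) by blast
    then obtain b where "P d b \<noteq> 0" "mat l l b \<in> GL l" using polyfun_GL_nonzero[OF JP(1)] by blast
    then show ?thesis using JP(3) by blast
  qed
  define M where "M = (\<Union>d. J d)"
  have Mm: "M \<inter> mons l d = J d" for d using Jm by (fastforce simp: M_def mons_def)
  have up: "upcl l M" unfolding upcl_def
  proof (intro conjI ballI)
    show "M \<subseteq> pps l" using Jm by (fastforce simp: M_def mons_def)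
    fix t u assume "t \<in> M" and u: "u \<in> pps l"
    then obtain d where t: "t \<in> J d" by (auto simp: M_def)
    let ?e = "pp_degree u + d"
    \<comment> \<open>Coordinates that are generic for both degrees exist, and there closure under
      multiples is that of an actual ideal.\<close>
    obtain a b where "P d a \<noteq> 0" "P ?e b \<noteq> 0" using JP(2) by metis
    then obtain c where "P d c * P ?e c \<noteq> 0"
      using polyfun_common_nonzero[OF JP(1)[of d] _ JP(1)[of ?e], of a b] by auto
    then obtain b where b: "P d b * P ?e b \<noteq> 0" "mat l l b \<in> GL l"
      using polyfun_GL_nonzero[OF polyfun_mult[OF JP(1)[of d] JP(1)[of ?e]], of c] by auto
    have "t \<in> ?L b" using JP(3)[of d b] b t by auto
    then have "u + t \<in> ?L b" using upclD[OF ltset_upcl[OF hideal_act[OF I b(2)]] _ u] by simp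
    moreover have "u + t \<in> mons l ?e" using t u Jm[of d] by (auto simp: mons_def)
    ultimately show "u + t \<in> M" using JP(3)[of ?e b] b by (auto simp: M_def)
  qed
  obtain N where N: "\<And>t. t \<in> M \<Longrightarrow> \<exists>s\<in>M. pp_degree s \<le> N \<and> (\<exists>u\<in>pps l. t = u + s)"
    using dickson[of M l] up by (auto simp: upcl_def)
  define Q where "Q = (\<lambda>a. \<Prod>d\<in>{..N}. P d a)"
  have Q: "polyfun ?X Q" "\<exists>a. Q a \<noteq> 0"
    unfolding Q_def using JP(1,2) polyfun_common_nonzero_finite[of "{..N}" ?X P] by (auto intro: polyfun_prod)
  have G1: "card (ltset (act l g ` I) \<inter> Y) \<le> card (M \<inter> Y)" if "g \<in> GL l" "upper l d Y" for g d Y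
  proof -
    have "M \<inter> Y = J d \<inter> Y" using Mm[of d] that(2) by (auto simp: upper_def)
    then show ?thesis using JP(4)[OF that] by simp
  qed
  have "?L a = M" if a: "Q a \<noteq> 0" "mat l l a \<in> GL l" for a
  proof -
    note La = ltset_upcl[OF hideal_act[OF I a(2)]]
    have "M \<subseteq> ?L a"
    proof
      fix t assume "t \<in> M"
      then obtain s u where su: "s \<in> M" "pp_degree s \<le> N" "u \<in> pps l" "t = u + s" using N by blast
      have "s \<in> J (pp_degree s)" using su(1) Mm[of "pp_degree s"] up by (auto simp: mons_def upcl_def)
      moreover have "P (pp_degree s) a \<noteq> 0" using a(1) su(2) by (auto simp: Q_def)
      ultimately have "s \<in> ?L a" using JP(3)[OF _ a(2)] by blast
      then show "t \<in> ?L a" using upclD[OF La _ su(3)] su(4) by simp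
    qed
    moreover have "?L a \<subseteq> M"
    proof
      fix t assume t: "t \<in> ?L a"
      let ?d = "pp_degree t"
      have tm: "t \<in> mons l ?d" using t La by (auto simp: upcl_def mons_def)
      have "M \<inter> mons l ?d = ?L a \<inter> mons l ?d"
        using \<open>M \<subseteq> ?L a\<close> G1[OF a(2) upper_mons, of ?d] by (intro card_seteq) auto
      then show "t \<in> M" using t tm by blast
    qed
    ultimately show ?thesis by blast
  qed
  then show ?thesis using up Q G1 unfolding is_gin_def by blast
qed

text \<open>The value is unique because any other admissible open set of coordinates meets the set
  where \<open>P\<close> and the determinant are nonzero.\<close>

lemma rgin_eq:
  fixes I :: "(nat, 'k::field_char_0) mpoly set"
  assumes I: "hideal l I" and J: "is_gin l I J P"
  shows "rgin l I = mono_ideal l J"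
  unfolding rgin_def
proof (rule the_equality)
  let ?X = "{..<l} \<times> {..<l}"
  have inv: "invertible_mat (mat l l a) \<longleftrightarrow> mat l l a \<in> GL l" for a :: "nat \<times> nat \<Rightarrow> 'k" by (simp add: GL_def)
  have lead_eq: "leading_ideal l (act l (mat l l a) ` I) = mono_ideal l J" if "P a \<noteq> 0" "mat l l a \<in> GL l" for a
    using leading_ideal_eq[OF hideal_act[OF I that(2)]] J that by (simp add: is_gin_def)
  obtain a0 where a0: "P a0 \<noteq> 0" using J by (auto simp: is_gin_def)
  have P: "polyfun ?X P" using J by (simp add: is_gin_def)
  show "\<exists>U. zariski_open ?X U \<and> (\<exists>a\<in>U. invertible_mat (mat l l a)) \<and>
      (\<forall>a\<in>U. invertible_mat (mat l l a) \<longrightarrow> leading_ideal l (act l (mat l l a) ` I) = mono_ideal l J)"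
    using zariski_open_polyfun[OF P] polyfun_GL_nonzero[OF P a0] lead_eq
    unfolding inv by (intro exI[of _ "{a \<in> ?X \<rightarrow>\<^sub>E UNIV. P a \<noteq> 0}"]) auto
  fix J' assume "\<exists>U. zariski_open ?X U \<and> (\<exists>a\<in>U. invertible_mat (mat l l a)) \<and>
      (\<forall>a\<in>U. invertible_mat (mat l l a) \<longrightarrow> leading_ideal l (act l (mat l l a) ` I) = J')"
  then obtain U a where U: "zariski_open ?X U" "a \<in> U"
      "\<And>a. a \<in> U \<Longrightarrow> mat l l a \<in> GL l \<Longrightarrow> leading_ideal l (act l (mat l l a) ` I) = J'"
    unfolding inv by blast
  obtain f where f: "polyfun ?X f" "f a \<noteq> 0" "\<And>b. b \<in> ?X \<rightarrow>\<^sub>E UNIV \<Longrightarrow> f b \<noteq> 0 \<Longrightarrow> b \<in> U"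
    using zariski_openE[OF U(1,2)] by blast
  obtain b where "f b * P b \<noteq> 0" using polyfun_common_nonzero[OF f(1,2) P a0] by auto
  then obtain c where c: "c \<in> ?X \<rightarrow>\<^sub>E UNIV" "f c * P c \<noteq> 0" "mat l l c \<in> GL l"
    using polyfun_GL_nonzero[OF polyfun_mult[OF f(1) P]] by blast
  then show "J' = mono_ideal l J" using U(3)[OF f(3)[OF c(1)]] lead_eq by auto
qed

subsection \<open>Stability under Borel moves\<close>

text \<open>The exponent vector read as a number in base \<open>B\<close>. With \<open>B\<close>
  larger than the degree it reverses DegRevLex on power-products of that degree, because the last
  differing exponent decides both.\<close>

definition weight :: "nat \<Rightarrow> nat \<Rightarrow> (nat \<Rightarrow>\<^sub>0 nat) \<Rightarrow> nat"
  where "weight l B t = (\<Sum>x<l. lookup t x * B ^ x)"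

lemma digits_less: "(\<And>y. y < x \<Longrightarrow> a y \<le> d) \<Longrightarrow> (\<Sum>y<x. a y * Suc d ^ y) < Suc d ^ x"
proof (induction x)
  case (Suc x)
  then have "(\<Sum>y<x. a y * Suc d ^ y) < Suc d ^ x" "a x \<le> d" by auto
  then have "(\<Sum>y<Suc x. a y * Suc d ^ y) < Suc d ^ x + d * Suc d ^ x"
    by (simp add: add_less_le_mono)
  then show ?case by simp
qed simp

text \<open>A lead of one at the largest differing index outweighs all smaller indices, since
  exponents are at most \<open>d\<close>.\<close>

lemma weight_less:
  assumes "t \<in> mons l d" "u \<in> mons l d" "drl_greater t u"
  shows "weight l (Suc d) t < weight l (Suc d) u"
proof -
  obtain x where x: "lookup t x < lookup u x" "\<And>y. y > x \<Longrightarrow> lookup t y = lookup u y"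
    using assms by (auto simp: drl_greater_def mons_def)
  have xl: "x < l" using x(1) assms(2) lookup_pps[of u l x] by (force simp: mons_def)
  let ?B = "Suc d"
  have split: "weight l ?B s = (\<Sum>y<x. lookup s y * ?B ^ y) + lookup s x * ?B ^ x + (\<Sum>y\<in>{Suc x..<l}. lookup s y * ?B ^ y)" for s
  proof -
    have "(\<Sum>y\<in>{..<l}. lookup s y * ?B ^ y) = (\<Sum>y\<in>{..<Suc x}. lookup s y * ?B ^ y) + (\<Sum>y\<in>{Suc x..<l}. lookup s y * ?B ^ y)"
      using sum.atLeastLessThan_concat[of 0 "Suc x" l "\<lambda>y. lookup s y * ?B ^ y"] xl
      by (simp only: atLeast0LessThan)
    then show ?thesis by (simp add: weight_def)
  qed
  have "(\<Sum>y<x. lookup t y * ?B ^ y) < ?B ^ x"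
    using lookup_le_pp_degree[of t] assms(1) by (intro digits_less) (auto simp: mons_def)
  moreover have "(\<Sum>y\<in>{Suc x..<l}. lookup t y * ?B ^ y) = (\<Sum>y\<in>{Suc x..<l}. lookup u y * ?B ^ y)"
    using x(2) by (intro sum.cong) auto
  moreover have "lookup t x * ?B ^ x + ?B ^ x \<le> lookup u x * ?B ^ x"
    using x(1) mult_le_mono1[of "Suc (lookup t x)" "lookup u x" "?B ^ x"] by simp
  ultimately show ?thesis unfolding split[of t] split[of u] by linarith
qed

lemma act_single: "act l g (single t c) = const_poly c * (\<Prod>x\<in>keys t. linear_form l (\<lambda>j. g $$ (x, j)) ^ lookup t x)"
  unfolding act_def by (simp add: evaluate_single eval_pp_def)

definition scaling_mat :: "nat \<Rightarrow> nat \<Rightarrow> 'k::field \<Rightarrow> 'k mat"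
  where "scaling_mat l B s = mat l l (\<lambda>(i, j). if i = j then s ^ (B ^ i) else 0)"

lemma linear_form_delta: "i < l \<Longrightarrow> linear_form l (\<lambda>j. if i = j then c else 0) = const_poly c * var_poly i"
proof -
  assume i: "i < l"
  have "linear_form l (\<lambda>j. if i = j then c else 0) = (\<Sum>j<l. if i = j then const_poly c * var_poly j else 0)"
    unfolding linear_form_def by (intro sum.cong) (auto simp: const_poly_hom)
  then show ?thesis using i by simp
qed

lemma act_scaling_single:
  assumes "t \<in> pps l"
  shows "act l (scaling_mat l B s) (single t c) = single t (c * s ^ weight l B t)"
proof -
  have kt: "x < l" if "x \<in> keys t" for x using that assms by (auto simp: pps_def)
  have "(\<Prod>x\<in>keys t. linear_form l (\<lambda>j. scaling_mat l B s $$ (x, j)) ^ lookup t x) =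
      (\<Prod>x\<in>keys t. const_poly (s ^ (lookup t x * B ^ x)) * single (single x (lookup t x)) 1)"
  proof (rule prod.cong)
    fix x assume "x \<in> keys t"
    then have x: "x < l" by (rule kt)
    have "linear_form l (\<lambda>j. scaling_mat l B s $$ (x, j)) = linear_form l (\<lambda>j. if x = j then s ^ (B ^ x) else 0)"
      using x by (intro linear_form_cong) (simp add: scaling_mat_def)
    also have "\<dots> = const_poly (s ^ (B ^ x)) * var_poly x" by (rule linear_form_delta[OF x])
    finally show "linear_form l (\<lambda>j. scaling_mat l B s $$ (x, j)) ^ lookup t x =
        const_poly (s ^ (lookup t x * B ^ x)) * single (single x (lookup t x)) 1"
      by (simp add: power_mult_distrib var_poly_power power_mult[symmetric] mult.commute
          rhomD(5)[OF rhom_const_poly, symmetric])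
  qed simp
  also have "\<dots> = const_poly (s ^ (\<Sum>x\<in>keys t. lookup t x * B ^ x)) * single t 1"
    by (simp only: prod.distrib prod_single sum_single_keys rhomD(7)[OF rhom_const_poly, symmetric] power_sum)
  also have "(\<Sum>x\<in>keys t. lookup t x * B ^ x) = weight l B t"
    unfolding weight_def by (rule sum.mono_neutral_left) (auto simp: in_keys_iff dest: kt)
  finally show ?thesis by (simp add: act_single const_poly_def mult_single)
qed

text \<open>The elementary substitution that adds \<open>c\<close> times variable \<open>i\<close>
  to variable \<open>j\<close>.\<close>

definition transvection_mat :: "nat \<Rightarrow> nat \<Rightarrow> nat \<Rightarrow> 'k::field \<Rightarrow> 'k mat"
  where "transvection_mat l i j c = mat l l (\<lambda>(x, y). (if x = y then 1 else 0) + (if x = j \<and> y = i then c else 0))"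

lemma transvection_mult:
  assumes "i < j" "j < l"
  shows "transvection_mat l i j a * transvection_mat l i j b = transvection_mat l i j (a + b :: 'k::field)"
proof (rule eq_matI)
  fix x z assume "x < dim_row (transvection_mat l i j (a + b))" "z < dim_col (transvection_mat l i j (a + b))"
  then have xz: "x < l" "z < l" by (auto simp: transvection_mat_def)
  let ?d = "\<lambda>x y. if x = y then 1 else (0 :: 'k)" and ?e = "\<lambda>c x y. if x = j \<and> y = i then c else (0 :: 'k)"
  have "(transvection_mat l i j a * transvection_mat l i j b) $$ (x, z) =
      (\<Sum>y<l. (?d x y + ?e a x y) * (?d y z + ?e b y z))"
    using xz by (simp add: transvection_mat_def scalar_prod_def atLeast0LessThan)
  also have "\<dots> = (\<Sum>y<l. (if y = x then ?d x z else 0) + (if y = x then ?e b x z else 0) + (if y = i then ?e a x i * ?d i z else 0))"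
    using assms by (intro sum.cong) (auto simp: algebra_simps)
  also have "\<dots> = ?d x z + ?e b x z + ?e a x i * ?d i z"
    using xz assms by (simp add: sum.distrib)
  also have "\<dots> = transvection_mat l i j (a + b) $$ (x, z)"
    using xz by (auto simp: transvection_mat_def)
  finally show "(transvection_mat l i j a * transvection_mat l i j b) $$ (x, z) = transvection_mat l i j (a + b) $$ (x, z)" .
qed (simp_all add: transvection_mat_def)

lemma transvection_GL:
  assumes "i < j" "j < l" shows "(transvection_mat l i j c :: 'k::field mat) \<in> GL l"
proof -
  have one: "(transvection_mat l i j 0 :: 'k mat) = 1\<^sub>m l" by (rule eq_matI) (auto simp: transvection_mat_def)
  have c: "transvection_mat l i j a \<in> carrier_mat l l" for a :: 'k by (simp add: transvection_mat_def)
  have "transvection_mat l i j c * transvection_mat l i j (- c) = 1\<^sub>m l" using transvection_mult[OF assms, of c "- c"] one by simp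
  then have "det (transvection_mat l i j c) * det (transvection_mat l i j (- c)) = 1"
    using det_mult[OF c[of c] c[of "- c"]] by simp
  then show ?thesis using c by (auto simp: GL_iff_det)
qed

lemma act_transvection_single:
  fixes t :: "nat \<Rightarrow>\<^sub>0 nat"
  assumes ij: "i < j" "j < l" and t: "t \<in> pps l"
  defines "n \<equiv> lookup t j"
  defines "t0 \<equiv> t - single j n"
  shows "act l (transvection_mat l i j 1) (single t (1::'k::field)) =
    (\<Sum>k\<le>n. single (t0 + single i k + single j (n - k)) (of_nat (n choose k)))"
proof -
  let ?b = "transvection_mat l i j (1::'k)"
  have t_eq: "t = t0 + single j n" unfolding t0_def n_def by (rule pp_split) simp
  have jt0: "j \<notin> keys t0" by (simp add: t0_def n_def in_keys_iff lookup_minus)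
  have t0: "t0 \<in> pps l" using t t_eq by simp
  let ?lin = "\<lambda>x. linear_form l (\<lambda>y. ?b $$ (x, y))"
  have other: "?lin x = var_poly x" if "x < l" "x \<noteq> j" for x
  proof -
    have "?lin x = linear_form l (\<lambda>y. if x = y then 1 else 0)"
      using that by (intro linear_form_cong) (auto simp: transvection_mat_def)
    then show ?thesis using linear_form_delta[OF that(1), of 1] by (simp add: const_poly_hom)
  qed
  have linj: "?lin j = var_poly i + var_poly j"
  proof -
    have "?lin j = (\<Sum>y<l. (if y = i then var_poly i else 0) + (if y = j then var_poly j else 0))"
      unfolding linear_form_def using ij by (intro sum.cong) (auto simp: transvection_mat_def const_poly_hom)
    then show ?thesis using ij by (simp add: sum.distrib)
  qed
  have e0: "eval_pp ?lin t0 = single t0 1"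
  proof -
    have "eval_pp ?lin t0 = (\<Prod>x\<in>keys t0. single (single x (lookup t0 x)) (1::'k))"
      unfolding eval_pp_def
    proof (rule prod.cong)
      fix x assume "x \<in> keys t0"
      then have "x < l" "x \<noteq> j" using t0 jt0 by (auto simp: pps_def)
      then show "?lin x ^ lookup t0 x = single (single x (lookup t0 x)) 1" by (simp add: other var_poly_power)
    qed simp
    then show ?thesis by (simp only: prod_single sum_single_keys)
  qed
  have "act l ?b (single t 1) = eval_pp ?lin (t0 + single j n)"
    unfolding act_def by (simp add: evaluate_single const_poly_hom t_eq[symmetric])
  also have "\<dots> = single t0 1 * (var_poly i + var_poly j) ^ n"
    by (simp add: eval_pp_add e0 linj)
  also have "\<dots> = (\<Sum>k\<le>n. single (t0 + single i k + single j (n - k)) (of_nat (n choose k)))"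
    unfolding binomial_ring sum_distrib_left var_poly_power
    by (intro sum.cong) (auto simp: mult_single of_nat_single[symmetric] ac_simps simp flip: single_of_nat)
  finally show ?thesis .
qed

text \<open>By the binomial theorem the image of \<open>t\<close> is \<open>t\<close> plus larger
  power-products, and the Borel move of \<open>t\<close> has coefficient \<open>lookup t j\<close>.
  In characteristic 0 this scalar is nonzero, which is where the Borel move needs the
  characteristic.\<close>

lemma act_transvection_coeffs:
  fixes t :: "nat \<Rightarrow>\<^sub>0 nat"
  assumes ij: "i < j" "j < l" and t: "t \<in> pps l"
  defines "e \<equiv> act l (transvection_mat l i j 1) (single t (1::'k::field))"
  shows "lookup e t = 1" "lookup e v \<noteq> 0 \<Longrightarrow> v = t \<or> drl_greater v t"
    "lookup t j > 0 \<Longrightarrow> lookup e (t - single j 1 + single i 1) = of_nat (lookup t j)"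
proof -
  define n where "n = lookup t j"
  define t0 where "t0 = t - single j n"
  let ?m = "\<lambda>k. t0 + single i k + single j (n - k)"
  have t_eq: "t = t0 + single j n" unfolding t0_def n_def by (rule pp_split) simp
  have lj: "lookup (?m k) j = n - k" for k
    using ij by (simp add: lookup_add t0_def n_def lookup_minus lookup_single when_def)
  have le: "lookup e v = (\<Sum>k\<le>n. if ?m k = v then of_nat (n choose k) else 0)" for v
    unfolding e_def act_transvection_single[OF ij t] lookup_sum n_def[symmetric] t0_def[symmetric]
    by (simp add: lookup_single when_def)
  have lm: "lookup e (?m k) = of_nat (n choose k)" if "k \<le> n" for k
  proof -
    have "?m k' = ?m k \<longleftrightarrow> k' = k" if "k' \<le> n" for k' using lj[of k] lj[of k'] that \<open>k \<le> n\<close> by (metis diff_diff_cancel)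
    then have "lookup e (?m k) = (\<Sum>k'\<le>n. if k' = k then of_nat (n choose k') else 0)"
      unfolding le by (intro sum.cong) auto
    then show ?thesis using that by simp
  qed
  show "lookup e t = 1" using lm[of 0] t_eq by simp
  show "v = t \<or> drl_greater v t" if nz: "lookup e v \<noteq> 0"
  proof -
    obtain k where k: "k \<le> n" "?m k = v" using nz sum.neutral[of "{..n}" "\<lambda>k. if ?m k = v then of_nat (n choose k) else (0::'k)"]
      unfolding le by (metis (full_types) atMost_iff)
    show ?thesis
    proof (cases "k = 0")
      case True then show ?thesis using k t_eq by simp
    next
      case False
      have "pp_degree v = pp_degree t" using arg_cong[OF t_eq, of pp_degree] k by auto
      moreover have "lookup v j < lookup t j" using lj[of k] k False by (simp add: n_def)
      moreover have "lookup v y = lookup t y" if "y > j" for y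
        using arg_cong[OF t_eq, of "\<lambda>t. lookup t y"] that ij k(2)[symmetric]
        by (simp add: lookup_add lookup_single when_def)
      ultimately show ?thesis by (auto simp: drl_greater_def)
    qed
  qed
  assume pos: "lookup t j > 0"
  have "t - single j 1 + single i 1 = ?m 1"
    using pos ij by (intro poly_mapping_eqI)
      (auto simp: lookup_add lookup_minus lookup_single when_def t0_def n_def)
  then show "lookup e (t - single j 1 + single i 1) = of_nat (lookup t j)"
    using lm[of 1] pos by (simp add: n_def)
qed

text \<open>The one-parameter group with these weights degenerates the leading forms to their leading terms.
  By semicontinuity at the limit, the transvection cannot move the initial segments of the
  generic initial ideal to larger ones.\<close>

lemma gin_stable:
  fixes I :: "(nat, 'k::field_char_0) mpoly set"
  assumes I: "hideal l I" and up: "upcl l J" and J: "g1 \<in> GL l" "ltset (act l g1 ` I) = J"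
    and G1: "\<And>g d Y. g \<in> GL l \<Longrightarrow> upper l d Y \<Longrightarrow> card (ltset (act l g ` I) \<inter> Y) \<le> card (J \<inter> Y)"
    and t: "t \<in> J" and ij: "i < j" "j < l" "lookup t j > 0"
  shows "t - single j 1 + single i 1 \<in> J"
proof (rule ccontr)
  let ?t' = "t - single j 1 + single i 1" and ?b = "transvection_mat l i j (1::'k)"
  assume not: "?t' \<notin> J"
  define d where "d = pp_degree t"
  let ?B = "Suc d"
  define I1 where "I1 = act l g1 ` I"
  have I1: "hideal l I1" "ltset I1 = J" using hideal_act[OF I J(1)] J by (simp_all add: I1_def)
  have tp: "t \<in> pps l" using upcl_pps[OF up t] .
  have td: "t = (t - single j 1) + single j 1" using ij(3) by (intro pp_split) simp
  have t'm: "?t' \<in> mons l d"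
  proof -
    have "t - single j 1 \<in> pps l" "pp_degree (t - single j 1) + 1 = d"
      using tp arg_cong[OF td, of pp_degree] td by (auto simp: d_def) (metis pps_add_iff)
    then show ?thesis using ij by (simp add: mons_def)
  qed
  have t't: "drl_greater ?t' t"
  proof -
    have "lookup (act l ?b (single t 1)) ?t' \<noteq> 0"
      using act_transvection_coeffs(3)[OF ij(1,2) tp ij(3), where 'k = 'k] ij(3) by simp
    then show ?thesis using act_transvection_coeffs(2)[OF ij(1,2) tp, of ?t', where 'k = 'k] t not by auto
  qed
  \<comment> \<open>\<open>Y\<close> is the segment that ends with \<open>?t'\<close>. As
    \<open>?t'\<close> is missing from \<open>J\<close>, only \<open>A\<close> lies in both. One
    more independent form on \<open>Y\<close>, obtained from \<open>t\<close>, will exceed the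
    maximal count.\<close>
  define A where "A = {u \<in> J \<inter> mons l d. drl_greater u ?t'}"
  define Y where "Y = {u \<in> mons l d. u = ?t' \<or> drl_greater u ?t'}"
  have Y: "upper l d Y" using drl_trans by (auto simp: Y_def upper_def)
  have JY: "J \<inter> Y = A" using not by (auto simp: A_def Y_def)
  have finA: "finite A" by (rule finite_subset[of _ "mons l d"]) (auto simp: A_def)
  have tA: "t \<notin> A" using t't drl_asym by (auto simp: A_def)
  define F where "F = insert t A"
  have FJ: "F \<subseteq> J \<inter> mons l d" using t tp by (auto simp: F_def A_def mons_def d_def)
  define r where "r = card F"
  have r: "r = Suc (card A)" using finA tA by (simp add: r_def F_def)
  have finF: "finite F" using finA by (simp add: F_def)
  have "\<exists>p. p \<in> I1 \<inter> forms l d \<and> lead p u" if "u \<in> F" for u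
  proof -
    have "u \<in> ltset I1" "pp_degree u = d" using that FJ I1(2) by (auto simp: mons_def)
    then show ?thesis using ltset_homogeneous[OF I1(1)] by (metis IntI)
  qed
  then obtain p where p: "\<And>u. u \<in> F \<Longrightarrow> p u \<in> I1 \<inter> forms l d \<and> lead (p u) u" by metis
  obtain h where h: "bij_betw h {..<r} F"
    using ex_bij_betw_nat_finite[OF finF] by (auto simp: atLeast0LessThan r_def)
  have hF: "h k \<in> F" if "k < r" for k using h that by (auto simp: bij_betw_def)
  \<comment> \<open>The coordinate in \<open>Y\<close> at which the form for \<open>u\<close> is
    read: \<open>u\<close> itself, except that the form for \<open>t\<close> is read at
    \<open>?t'\<close>.\<close>
  define \<nu> where "\<nu> = (\<lambda>u. if u = t then ?t' else u)"
  define e where "e = (\<lambda>u. act l ?b (single u (1::'k)))"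
  let ?W = "weight l ?B"
  \<comment> \<open>Coefficients of the transformed form as polynomials in the torus parameter. The
    weight of \<open>u\<close> can be divided out since the leading power-product has the least
    weight, and at parameter 0 only the leading term remains.\<close>
  define M where "M = (\<lambda>v u. \<Sum>w\<in>keys (p u). monom (lookup (p u) w * lookup (e w) v) (?W w - ?W u))"
  define q where "q = (\<lambda>u s. \<Sum>w\<in>keys (p u). single w (lookup (p u) w * s ^ (?W w - ?W u)))"
  have Mq: "poly (M v u) s = lookup (act l ?b (q u s)) v" for v u s
  proof -
    have 1: "single w (lookup (p u) w * s ^ m) = const_poly (lookup (p u) w * s ^ m) * single w 1" for w m
      by (simp add: const_poly_def mult_single)
    show ?thesis unfolding M_def q_def e_def
      by (subst 1) (simp add: poly_sum poly_monom act_simps lookup_sum, simp only: mult_ac)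
  qed
  have M0: "poly (M v u) 0 = lookup (p u) u * lookup (e u) v" if u: "u \<in> F" for u v
  proof -
    have lu: "lead (p u) u" "p u \<in> forms l d" using p[OF u] by auto
    have "poly (M v u) 0 = (\<Sum>w\<in>keys (p u). if w = u then lookup (p u) u * lookup (e u) v else 0)"
      unfolding M_def poly_sum
    proof (rule sum.cong)
      fix w assume w: "w \<in> keys (p u)"
      show "poly (monom (lookup (p u) w * lookup (e w) v) (?W w - ?W u)) 0 = (if w = u then lookup (p u) u * lookup (e u) v else 0)"
      proof (cases "w = u")
        case False
        then have "drl_greater u w" using lu w by (auto simp: lead_def)
        moreover have "w \<in> mons l d" "u \<in> mons l d" using w lu by (auto simp: forms_iff lead_def)
        ultimately have "?W u < ?W w" by (intro weight_less)
        then show ?thesis using False by (simp add: poly_monom)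
      qed (simp add: poly_monom)
    qed simp
    also have "\<dots> = lookup (p u) u * lookup (e u) v" using lu by (simp add: lead_def)
    finally show ?thesis .
  qed
  have diag: "lookup (e u) (\<nu> u) \<noteq> 0" if u: "u \<in> F" for u
  proof (cases "u = t")
    case True
    then show ?thesis using act_transvection_coeffs(3)[OF ij(1,2) tp ij(3), where 'k = 'k] ij(3)
      by (simp add: \<nu>_def e_def)
  next
    case False
    have "u \<in> pps l" using u FJ by (auto simp: mons_def)
    then show ?thesis using act_transvection_coeffs(1)[OF ij(1,2), of u, where 'k = 'k] False
      by (simp add: \<nu>_def e_def)
  qed
  have lower: "lookup (e u) v = 0" if u: "u \<in> A" and v: "drl_greater u v" for u v
  proof (rule ccontr)
    assume "lookup (e u) v \<noteq> 0"
    moreover have "u \<in> pps l" using u by (auto simp: mons_def A_def)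
    ultimately have "v = u \<or> drl_greater v u" using act_transvection_coeffs(2)[OF ij(1,2), of u v, where 'k = 'k]
      by (simp add: e_def)
    then show False using v drl_asym drl_irrefl by blast
  qed
  have \<nu>Y: "\<nu> u \<in> Y" if "u \<in> F" for u using that t'm by (auto simp: \<nu>_def F_def A_def Y_def)
  have \<nu>inj: "inj_on \<nu> F"
    using not by (auto simp: inj_on_def \<nu>_def F_def A_def split: if_splits)
  have det0: "det (mat r r (\<lambda>(k, m). poly (M (\<nu> (h k)) (h m)) 0)) \<noteq> 0"
    unfolding det_nonzero_iff
  proof (intro allI impI, rule ccontr)
    fix c m assume z: "\<forall>k<r. (\<Sum>m<r. poly (M (\<nu> (h k)) (h m)) 0 * c m) = 0" and m: "m < r" "c m \<noteq> 0"
    let ?S = "{m. m < r \<and> c m \<noteq> 0}"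
    \<comment> \<open>\<open>?t'\<close> is the least row, and it belongs to the column of \<open>t\<close>; take the least row occurring.\<close>
    have "\<exists>k\<in>?S. \<forall>m\<in>?S. m \<noteq> k \<longrightarrow> drl_greater (\<nu> (h m)) (\<nu> (h k))"
    proof -
      have "finite ((\<lambda>m. \<nu> (h m)) ` ?S)" "(\<lambda>m. \<nu> (h m)) ` ?S \<noteq> {}" using m by auto
      then have "\<exists>x\<in>(\<lambda>m. \<nu> (h m)) ` ?S. \<forall>y\<in>(\<lambda>m. \<nu> (h m)) ` ?S. y \<noteq> x \<longrightarrow> drl_greater y x"
      proof (induction rule: finite_ne_induct)
        case (insert x G)
        then obtain y where "y \<in> G" "\<forall>z\<in>G. z \<noteq> y \<longrightarrow> drl_greater z y" by blast
        then show ?case using drl_total[of x y] drl_trans drl_asym insert.hyps by (metis insert_iff)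
      qed simp
      then obtain k where k: "k \<in> ?S" "\<forall>m\<in>?S. \<nu> (h m) \<noteq> \<nu> (h k) \<longrightarrow> drl_greater (\<nu> (h m)) (\<nu> (h k))" by auto
      have "\<nu> (h m) \<noteq> \<nu> (h k)" if "m \<in> ?S" "m \<noteq> k" for m
        using that k(1) \<nu>inj hF h by (auto simp: inj_on_def bij_betw_def)
      then show ?thesis using k by blast
    qed
    then obtain k where k: "k < r" "c k \<noteq> 0" and kmin: "\<And>m. m < r \<Longrightarrow> c m \<noteq> 0 \<Longrightarrow> m \<noteq> k \<Longrightarrow> drl_greater (\<nu> (h m)) (\<nu> (h k))"
      by auto
    have off: "poly (M (\<nu> (h k)) (h m)) 0 * c m = 0" if m: "m \<in> {..<r} - {k}" for m
    proof (cases "c m = 0")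
      case False
      then have g: "drl_greater (\<nu> (h m)) (\<nu> (h k))" using kmin m by auto
      have "h m \<noteq> t"
      proof
        assume "h m = t"
        then have "drl_greater ?t' (\<nu> (h k))" using g by (simp add: \<nu>_def)
        moreover have "\<nu> (h k) \<in> Y" using \<nu>Y hF k by blast
        ultimately show False using drl_asym drl_irrefl by (auto simp: Y_def)
      qed
      then have "h m \<in> A" "\<nu> (h m) = h m" using hF[of m] m by (auto simp: F_def \<nu>_def)
      then have "lookup (e (h m)) (\<nu> (h k)) = 0" using lower g by simp
      then show ?thesis using M0[OF hF] m by simp
    qed simp
    have "(\<Sum>m<r. poly (M (\<nu> (h k)) (h m)) 0 * c m) = poly (M (\<nu> (h k)) (h k)) 0 * c k"
      using sum.remove[of "{..<r}" k "\<lambda>m. poly (M (\<nu> (h k)) (h m)) 0 * c m"] k off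
        sum.neutral[of "{..<r} - {k}" "\<lambda>m. poly (M (\<nu> (h k)) (h m)) 0 * c m"] by simp
    moreover have "poly (M (\<nu> (h k)) (h k)) 0 \<noteq> 0"
      using M0[OF hF[OF k(1)]] diag[OF hF[OF k(1)]] p[OF hF[OF k(1)]] by (auto simp: lead_def in_keys_iff)
    ultimately show False using z k by simp
  qed
  have "polyfun ({..<r} \<times> {..<r}) (\<lambda>a. det (mat r r (\<lambda>(k, m). a (k, m)) :: 'k mat))"
    by (rule polyfun_det) (auto intro: polyfun_coord)
  \<comment> \<open>The determinant is a polynomial in the torus parameter. Being nonzero at 0, it
    is also nonzero at some parameter for which the scaling is invertible.\<close>
  from polyfun_curve[OF this, of "\<lambda>x. M (\<nu> (h (fst x))) (h (snd x))"] obtain R where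
    R: "\<And>s. det (mat r r (\<lambda>(k, m). poly (M (\<nu> (h k)) (h m)) s)) = poly R s" by auto
  have "R \<noteq> 0" using R[of 0] det0 by auto
  then have "finite (insert 0 {s. poly R s = 0})" using poly_roots_finite by auto
  then obtain s where s: "s \<noteq> 0" "poly R s \<noteq> 0" using infinite_UNIV_char_0 ex_new_if_finite by blast
  let ?g = "g1 * (scaling_mat l ?B s * ?b)"
  have bGL: "?b \<in> GL l" by (rule transvection_GL[OF ij(1,2)])
  have sGL: "scaling_mat l ?B s \<in> GL l"
  proof -
    have c: "scaling_mat l ?B x \<in> carrier_mat l l" for x :: 'k by (simp add: scaling_mat_def)
    have "upper_triangular (scaling_mat l ?B s)" by (auto simp: upper_triangular_def scaling_mat_def)
    then have "det (scaling_mat l ?B s) = prod_list (diag_mat (scaling_mat l ?B s))"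
      by (rule det_upper_triangular[OF _ c])
    also have "\<dots> \<noteq> 0" using s(1) by (auto simp: prod_list_zero_iff diag_mat_def scaling_mat_def)
    finally show ?thesis using c by (simp add: GL_iff_det)
  qed
  have cm: "g1 \<in> carrier_mat l l" "scaling_mat l ?B s \<in> carrier_mat l l" "?b \<in> carrier_mat l l"
    using J(1) sGL bGL by (auto simp: GL_def)
  have gGL: "?g \<in> GL l"
    using J(1) sGL bGL cm by (auto simp: GL_iff_det det_mult[of _ l])
  have img: "act l ?b (act l (scaling_mat l ?B s) f) \<in> act l ?g ` I" if fI: "f \<in> I1" for f
  proof -
    obtain f0 where f0: "f0 \<in> I" "f = act l g1 f0" using fI by (auto simp: I1_def)
    have "act l ?b (act l (scaling_mat l ?B s) f) = act l ?g f0"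
      using cm f0 hidealD(1)[OF I f0(1)]
      by (simp add: act_act mult_carrier_mat[of _ l l])
    then show ?thesis using f0 by blast
  qed
  note gI = hideal_act[OF I gGL]
  have "card {..<r} \<le> card (ltset (act l ?g ` I \<inter> forms l d) \<inter> Y)"
  proof (rule indep_le_card_ltset[where p = "\<lambda>m. act l ?b (q (h m) s)"])
    show "subsp (act l ?g ` I \<inter> forms l d)" by (rule subsp_hideal_forms[OF gI])
    fix m assume "m \<in> {..<r}"
    then have u: "h m \<in> F" using hF by simp
    let ?u = "h m"
    have pu: "p ?u \<in> I1" "p ?u \<in> forms l d" "lead (p ?u) ?u" using p[OF u] by auto
    have "q ?u s \<in> forms l d" unfolding q_def using pu(2)
      by (intro forms_sum forms_single) (auto simp: forms_iff)
    then have f: "act l ?b (q ?u s) \<in> forms l d" by (rule act_forms)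
    \<comment> \<open>For nonzero \<open>s\<close> the form \<open>q\<close> is the torus image of
      \<open>p ?u\<close> up to a unit, hence its transvection lies in the transformed
      ideal.\<close>
    have "const_poly (s ^ ?W ?u) * q ?u s = act l (scaling_mat l ?B s) (p ?u)"
    proof -
      have "act l (scaling_mat l ?B s) (p ?u) = (\<Sum>w\<in>keys (p ?u). act l (scaling_mat l ?B s) (single w (lookup (p ?u) w)))"
        using arg_cong[OF sum_single_keys[of "p ?u"], of "act l (scaling_mat l ?B s)"] by (simp only: act_simps)
      also have "\<dots> = (\<Sum>w\<in>keys (p ?u). const_poly (s ^ ?W ?u) * single w (lookup (p ?u) w * s ^ (?W w - ?W ?u)))"
      proof (rule sum.cong)
        fix w assume w: "w \<in> keys (p ?u)"
        then have "w \<in> mons l d" "?u \<in> mons l d" using pu by (auto simp: forms_iff lead_def)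
        moreover have "w = ?u \<or> drl_greater ?u w" using pu(3) w by (auto simp: lead_def)
        ultimately have "?W ?u \<le> ?W w" using weight_less[of ?u l d w] by auto
        then have "s ^ ?W w = s ^ ?W ?u * s ^ (?W w - ?W ?u)" by (simp add: power_add[symmetric])
        then show "act l (scaling_mat l ?B s) (single w (lookup (p ?u) w)) =
            const_poly (s ^ ?W ?u) * single w (lookup (p ?u) w * s ^ (?W w - ?W ?u))"
          using \<open>w \<in> mons l d\<close> by (simp add: act_scaling_single mons_def const_poly_def mult_single mult_ac)
      qed simp
      finally show ?thesis by (simp add: q_def sum_distrib_left)
    qed
    then have "act l ?b (const_poly (s ^ ?W ?u) * q ?u s) \<in> act l ?g ` I" using img[OF pu(1)] by simp
    from hidealD(6)[OF gI this, of "inverse (s ^ ?W ?u)"]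
    have "const_poly (inverse (s ^ ?W ?u)) * (const_poly (s ^ ?W ?u) * act l ?b (q ?u s)) \<in> act l ?g ` I"
      by (simp only: act_simps act_const)
    moreover have "const_poly (inverse x) * (const_poly x * f) = f" if "x \<noteq> 0" for x :: 'k and f :: "(nat, 'k) mpoly"
    proof -
      have "const_poly (inverse x) * (const_poly x * f) = const_poly (inverse x * x) * f"
        by (simp only: mult.assoc const_poly_hom(4))
      then show ?thesis using that by (simp add: const_poly_hom(2))
    qed
    ultimately have "act l ?b (q ?u s) \<in> act l ?g ` I" using s(1) by (metis power_not_zero)
    then show "act l ?b (q ?u s) \<in> act l ?g ` I \<inter> forms l d" using f by simp
  next
    fix c assume z: "\<And>v. v \<in> Y \<Longrightarrow> (\<Sum>m\<in>{..<r}. lookup (act l ?b (q (h m) s)) v * c m) = 0"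
    have "det (mat r r (\<lambda>(k, m). poly (M (\<nu> (h k)) (h m)) s)) \<noteq> 0" using R s by simp
    then show "\<forall>m\<in>{..<r}. c m = 0" unfolding det_nonzero_iff using z \<nu>Y hF by (auto simp: Mq)
  qed (use Y in auto)
  also have "\<dots> = card (ltset (act l ?g ` I) \<inter> Y)"
  proof -
    have "Y \<subseteq> mons l d" by (auto simp: Y_def)
    then show ?thesis using ltset_inter_forms[OF gI, of d] by (simp add: Int_assoc Int_absorb1)
  qed
  also have "\<dots> \<le> card A" using G1[OF gGL Y] JY by simp
  finally show False using r by simp
qed

lemma pps_minus [simp]: "t \<in> pps l \<Longrightarrow> t - u \<in> pps l"
  by (auto simp: pps_def in_keys_iff lookup_minus subset_iff)

lemma pp_degree_minus_single: "s \<le> lookup t i \<Longrightarrow> pp_degree (t - single i s) + s = pp_degree t"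
  using arg_cong[OF pp_split[of s t i], of pp_degree] by simp

lemma mons_minus_single: "s \<le> lookup t i \<Longrightarrow> t \<in> mons l (d + s) \<Longrightarrow> t - single i s \<in> mons l d"
  using pp_degree_minus_single[of s t i] by (auto simp: mons_def)

subsection \<open>Full rank of multiplication by the last variable\<close>

definition isum :: "(nat, 'k::comm_ring_1) mpoly set \<Rightarrow> (nat, 'k) mpoly set \<Rightarrow> (nat, 'k) mpoly set"
  where "isum A B = {p + q | p q. p \<in> A \<and> q \<in> B}"

lemma isum_iff: "f \<in> isum A B \<longleftrightarrow> (\<exists>p\<in>A. f - p \<in> B)"
proof
  assume "\<exists>p\<in>A. f - p \<in> B"
  then obtain p where "p \<in> A" "f - p \<in> B" by blast
  moreover have "f = p + (f - p)" by simp
  ultimately show "f \<in> isum A B" unfolding isum_def by blast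
next
  assume "f \<in> isum A B"
  then obtain p q where "f = p + q" "p \<in> A" "q \<in> B" by (auto simp: isum_def)
  then show "\<exists>p\<in>A. f - p \<in> B" by (intro bexI[of _ p]) auto
qed

lemma hideal_isum:
  assumes A: "hideal l A" and B: "hideal l B"
  shows "hideal l (isum A B)"
  unfolding hideal_def
proof (intro conjI ballI allI)
  show "isum A B \<subseteq> polyS l" using hidealD(1)[OF A] hidealD(1)[OF B] by (auto simp: isum_def)
  show "0 \<in> isum A B" using hidealD(2)[OF A] hidealD(2)[OF B] by (auto simp: isum_iff intro!: bexI[of _ 0])
  fix f assume "f \<in> isum A B"
  then obtain p q where pq: "f = p + q" "p \<in> A" "q \<in> B" by (auto simp: isum_def)
  show "f + g \<in> isum A B" if g: "g \<in> isum A B" for g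
  proof -
    obtain p' q' where "g = p' + q'" "p' \<in> A" "q' \<in> B" using g by (auto simp: isum_def)
    then have "f + g = (p + p') + (q + q')" "p + p' \<in> A" "q + q' \<in> B"
      using pq hidealD(3)[OF A] hidealD(3)[OF B] by auto
    then show ?thesis unfolding isum_def by blast
  qed
  show "homogeneous_component d f \<in> isum A B" for d
    using pq hidealD(5)[OF A] hidealD(5)[OF B] unfolding isum_def homogeneous_component_add pq(1) by blast
  show "r * f \<in> isum A B" if "r \<in> polyS l" for r
    using pq hidealD(4)[OF A that] hidealD(4)[OF B that] unfolding isum_def pq(1) distrib_left by blast
qed

lemma isum_subset: "hideal l A \<Longrightarrow> hideal l B \<Longrightarrow> A \<subseteq> isum A B \<and> B \<subseteq> isum A B"
  using hidealD(2)[of l A] hidealD(2)[of l B] by (force simp: isum_def)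

text \<open>The ideal generated by the variables of index at least \<open>n\<close>, described by
  its power-products; \<open>highvars_sum\<close> recovers the generators.\<close>

definition highvars :: "nat \<Rightarrow> nat \<Rightarrow> (nat, 'k::comm_ring_1) mpoly set"
  where "highvars l n = mono_ideal l (pps l - pps n)"

lemma highvars_iff: "p \<in> highvars l n \<longleftrightarrow> p \<in> polyS l \<and> keys p \<inter> pps n = {}"
  by (auto simp: highvars_def mono_ideal_def polyS_iff)

lemma hideal_highvars: "hideal l (highvars l n)"
  unfolding highvars_def by (rule hideal_mono_ideal) (auto simp: upcl_def)

text \<open>This singles out DegRevLex for sections: in each degree the power-products free of the
  last variables come first.\<close>

lemma drl_low_high:
  assumes t: "t \<in> pps n" and u: "u \<notin> pps n" and d: "pp_degree t = pp_degree u"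
  shows "drl_greater t u"
proof (rule ccontr)
  assume "\<not> ?thesis"
  then have "drl_greater u t" using drl_total[of t u] t u by auto
  then obtain i where i: "lookup u i < lookup t i" "\<And>j. j > i \<Longrightarrow> lookup u j = lookup t j"
    using d by (auto simp: drl_greater_def)
  have "i < n" using i(1) lookup_pps[OF t, of i] by (metis not_less less_zeroE)
  have "x < n" if "x \<in> keys u" for x
  proof (rule ccontr)
    assume "\<not> x < n"
    then have "lookup u x = 0" using i(2)[of x] lookup_pps[OF t, of x] \<open>i < n\<close> by simp
    then show False using that by (simp add: in_keys_iff)
  qed
  then have "u \<in> pps n" by (auto simp: pps_def)
  then show False using u by simp
qed

lemma drl_exponent_le:
  assumes "drl_greater t u" "pp_degree t = pp_degree u" "t \<in> pps (Suc n)" "u \<in> pps (Suc n)"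
  shows "lookup t n \<le> lookup u n"
proof -
  obtain i where i: "lookup t i < lookup u i" "\<And>j. j > i \<Longrightarrow> lookup t j = lookup u j"
    using assms by (auto simp: drl_greater_def)
  have "i \<le> n" using i(1) lookup_pps[OF assms(4), of i] by (metis not_less_eq_eq less_zeroE)
  then show ?thesis using i by (cases "i = n") auto
qed

lemma drl_of_exponent_less:
  assumes "pp_degree t = pp_degree u" "t \<in> pps (Suc n)" "u \<in> pps (Suc n)" "lookup t n < lookup u n"
  shows "drl_greater t u"
  unfolding drl_greater_def using assms lookup_pps[OF assms(2)] lookup_pps[OF assms(3)]
  by (intro disjI2 conjI exI[of _ n]) auto

text \<open>Correcting \<open>f\<close> by terms with high variables changes, in the degree of
  \<open>t\<close>, only terms smaller than \<open>t\<close>. The homogeneous component of the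
  corrected element therefore lies in \<open>I\<close> and still has leading power-product
  \<open>t\<close>.\<close>

lemma lead_mod_highvars:
  assumes I: "hideal l I" and f: "f \<in> isum I (highvars l n)" "lead f t" "t \<in> pps n" and nl: "n \<le> l"
  shows "t \<in> ltset I"
proof -
  obtain q where q: "q \<in> I" "f - q \<in> highvars l n" using f(1) by (auto simp: isum_iff)
  define d where "d = pp_degree t"
  define q' where "q' = homogeneous_component d q"
  have q': "q' \<in> I" "q' \<in> forms l d"
    using hidealD(5)[OF I q(1)] homogeneous_component_form[OF hidealD(1)[OF I q(1)]] by (auto simp: q'_def)
  have eq: "lookup q' u = lookup f u" if "u \<in> pps n" "pp_degree u = d" for u
  proof -
    have "lookup (f - q) u = 0" using q(2) that(1) by (auto simp: highvars_iff in_keys_iff)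
    then show ?thesis using that(2) by (simp add: q'_def lookup_homogeneous_component lookup_minus)
  qed
  have "lead q' t" unfolding lead_def
  proof (intro conjI ballI impI)
    show "t \<in> keys q'" using eq[of t] f by (auto simp: d_def lead_def in_keys_iff)
    fix u assume u: "u \<in> keys q'" "u \<noteq> t"
    have ud: "pp_degree u = d" using u q' by (auto simp: forms_iff mons_def)
    show "drl_greater t u"
    proof (cases "u \<in> pps n")
      case True
      then have "u \<in> keys f" using eq[OF True ud] u by (auto simp: in_keys_iff)
      then show ?thesis using f(2) u by (auto simp: lead_def)
    next
      case False
      then show ?thesis using drl_low_high[OF f(3) False] ud by (simp add: d_def)
    qed
  qed
  then show ?thesis using q' by (auto simp: ltset_def)
qed

text \<open>Passing to the section by the last variables commutes with taking leading
  power-products.\<close>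

lemma mons_isum_highvars:
  fixes I :: "(nat, 'k::field) mpoly set"
  assumes I: "hideal l I" and nl: "n \<le> l"
  shows "mons l d - ltset (isum I (highvars l n)) = mons n d - ltset I"
proof (intro equalityI subsetI)
  note sub = isum_subset[OF I hideal_highvars[of l n]]
  fix t assume t: "t \<in> mons l d - ltset (isum I (highvars l n))"
  have "t \<in> pps n"
  proof (rule ccontr)
    assume "t \<notin> pps n"
    then have "single t (1::'k) \<in> highvars l n" using t by (auto simp: highvars_iff mons_def)
    moreover have "lead (single t (1::'k)) t" by (auto simp: lead_def)
    ultimately have "t \<in> ltset (isum I (highvars l n))" using sub unfolding ltset_def by blast
    then show False using t by simp
  qed
  then show "t \<in> mons n d - ltset I" using t sub by (auto simp: mons_def ltset_def)
next
  fix t assume "t \<in> mons n d - ltset I"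
  then show "t \<in> mons l d - ltset (isum I (highvars l n))"
    using lead_mod_highvars[OF I _ _ _ nl] pps_mono[OF nl] unfolding ltset_def[of "isum _ _"]
    by (auto simp: mons_def)
qed

text \<open>Only the variables after \<open>n\<close> are factored out, so variable \<open>n\<close>
  acts on a quotient of a ring in \<open>Suc n\<close> variables. The monomial versions below are
  indexed in the same way.\<close>

definition inj_mult :: "nat \<Rightarrow> (nat, 'k::comm_ring_1) mpoly set \<Rightarrow> nat \<Rightarrow> nat \<Rightarrow> nat \<Rightarrow> bool"
  where "inj_mult l I n i s \<longleftrightarrow>
    (\<forall>p\<in>forms l i. var_poly n ^ s * p \<in> isum I (highvars l (Suc n)) \<longrightarrow> p \<in> isum I (highvars l (Suc n)))"

definition surj_mult :: "nat \<Rightarrow> (nat, 'k::comm_ring_1) mpoly set \<Rightarrow> nat \<Rightarrow> nat \<Rightarrow> nat \<Rightarrow> bool"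
  where "surj_mult l I n i s \<longleftrightarrow>
    (\<forall>q\<in>forms l (i + s). \<exists>p\<in>forms l i. q - var_poly n ^ s * p \<in> isum I (highvars l (Suc n)))"

definition inj_mons :: "(nat \<Rightarrow>\<^sub>0 nat) set \<Rightarrow> nat \<Rightarrow> nat \<Rightarrow> nat \<Rightarrow> bool"
  where "inj_mons M n i s \<longleftrightarrow> (\<forall>u\<in>mons (Suc n) i. u + single n s \<in> M \<longrightarrow> u \<in> M)"

definition surj_mons :: "(nat \<Rightarrow>\<^sub>0 nat) set \<Rightarrow> nat \<Rightarrow> nat \<Rightarrow> nat \<Rightarrow> bool"
  where "surj_mons M n i s \<longleftrightarrow> (\<forall>v\<in>mons (Suc n) (i + s). v \<notin> M \<longrightarrow> s \<le> lookup v n)"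

text \<open>In DegRevLex a form in the first \<open>Suc n\<close> variables is divisible by a power
  of variable \<open>n\<close> as soon as its leading power-product is. Modulo the higher variables
  \<open>f\<close> is thus \<open>var_poly n ^ s * g\<close>, and injectivity puts \<open>g\<close>,
  whose leading power-product is \<open>u\<close>, into the ideal.\<close>

lemma inj_mons_ltset:
  fixes I :: "(nat, 'k::field) mpoly set"
  assumes I: "hideal l I" and nl: "n < l" and inj: "inj_mult l I n i s"
  shows "inj_mons (ltset I) n i s"
  unfolding inj_mons_def
proof (intro ballI impI)
  fix u assume u: "u \<in> mons (Suc n) i" and "u + single n s \<in> ltset I"
  let ?t = "u + single n s" and ?A = "isum I (highvars l (Suc n))"
  have td: "pp_degree ?t = i + s" using u by (simp add: mons_def)
  obtain f where f: "f \<in> I" "f \<in> forms l (i + s)" "lead f ?t"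
    using ltset_homogeneous[OF I \<open>?t \<in> ltset I\<close>] td by metis
  have tp: "?t \<in> pps (Suc n)" using u by (simp add: mons_def)
  have ge: "s \<le> lookup w n" if "w \<in> keys f" "w \<in> pps (Suc n)" for w
  proof -
    have "pp_degree w = i + s" using that f(2) by (auto simp: forms_iff mons_def)
    then have "lookup ?t n \<le> lookup w n"
      using f(3) that drl_exponent_le[of ?t w n] tp td by (cases "w = ?t") (auto simp: lead_def)
    then show ?thesis by (simp add: lookup_add)
  qed
  let ?K = "keys f \<inter> pps (Suc n)"
  define g where "g = (\<Sum>w\<in>?K. single (w - single n s) (lookup f w))"
  have Xg: "var_poly n ^ s * g = (\<Sum>w\<in>?K. single w (lookup f w))"
    unfolding g_def var_poly_power sum_distrib_left
  proof (rule sum.cong)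
    fix w assume "w \<in> ?K"
    then have "w = (w - single n s) + single n s" using ge by (intro pp_split) auto
    then show "single (single n s) 1 * single (w - single n s) (lookup f w) = single w (lookup f w)"
      by (simp add: mult_single add.commute)
  qed simp
  have lXg: "lookup (var_poly n ^ s * g) w = (if w \<in> pps (Suc n) then lookup f w else 0)" for w
    unfolding Xg lookup_sum by (auto simp: lookup_single when_def in_keys_iff)
  have lg: "lookup g w = lookup (var_poly n ^ s * g) (single n s + w)" for w
    unfolding var_poly_power lookup_single_times by simp
  have "f - var_poly n ^ s * g \<in> highvars l (Suc n)"
  proof -
    have "var_poly n ^ s * g \<in> polyS l" unfolding Xg using f(2)
      by (intro polyS_sum polyS_single) (auto simp: forms_iff mons_def)
    then show ?thesis using forms_polyS[OF f(2)] unfolding highvars_iff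
      by (auto simp: in_keys_iff lookup_minus lXg)
  qed
  then have "var_poly n ^ s * g - f \<in> highvars l (Suc n)"
    using hidealD(7)[OF hideal_highvars, of "f - var_poly n ^ s * g" l "Suc n"] by simp
  then have "var_poly n ^ s * g \<in> ?A" using f(1) by (auto simp: isum_iff)
  moreover have "g \<in> forms l i" unfolding g_def
  proof (intro forms_sum forms_single)
    fix w assume w: "w \<in> ?K"
    then have eq: "w = (w - single n s) + single n s" using ge by (intro pp_split) auto
    moreover have "w \<in> pps l" "pp_degree w = i + s" using w f(2) by (auto simp: forms_iff mons_def)
    ultimately show "w - single n s \<in> mons l i"
      using w ge by (intro mons_minus_single) (auto simp: mons_def)
  qed
  ultimately have gA: "g \<in> ?A" using inj by (auto simp: inj_mult_def)
  have "lead g u" unfolding lead_def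
  proof (intro conjI ballI impI)
    have "?t \<in> keys f" using f(3) by (simp add: lead_def)
    then show "u \<in> keys g" using tp by (simp add: in_keys_iff lg lXg add.commute)
    fix w assume w: "w \<in> keys g" "w \<noteq> u"
    then have "single n s + w \<in> keys f" by (auto simp: in_keys_iff lg lXg split: if_splits)
    then have "drl_greater (single n s + u) (single n s + w)"
      using f(3) w by (auto simp: lead_def add.commute)
    then show "drl_greater u w" by simp
  qed
  then show "u \<in> ltset I" using lead_mod_highvars[OF I gA] u nl by (simp add: mons_def)
qed

text \<open>If the exponent of \<open>v\<close> at \<open>n\<close> were too small, \<open>v\<close>
  would exceed all terms of a multiple of \<open>var_poly n ^ s\<close> in DegRevLex and so would be
  the leading power-product of an element of \<open>isum I (highvars l (Suc n))\<close>.\<close>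

lemma surj_mons_ltset:
  fixes I :: "(nat, 'k::field) mpoly set"
  assumes I: "hideal l I" and nl: "n < l" and surj: "surj_mult l I n i s"
  shows "surj_mons (ltset I) n i s"
  unfolding surj_mons_def
proof (intro ballI impI, rule ccontr)
  fix v assume v: "v \<in> mons (Suc n) (i + s)" and "v \<notin> ltset I" and "\<not> s \<le> lookup v n"
  then have less: "lookup v n < s" by simp
  have vl: "v \<in> mons l (i + s)" using v pps_mono[of "Suc n" l] nl by (auto simp: mons_def)
  then have "power_product v \<in> (forms l (i + s) :: (nat, 'k) mpoly set)" by (simp add: power_product_def forms_single)
  then obtain p where p: "p \<in> forms l i"
    "power_product v - var_poly n ^ s * p \<in> isum I (highvars l (Suc n))"
    using surj by (auto simp: surj_mult_def)
  let ?f = "power_product v - var_poly n ^ s * p"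
  have kX: "s \<le> lookup w n \<and> pp_degree w = i + s" if "w \<in> keys (var_poly n ^ s * p)" for w
    using that keys_single_times[of "single n s" 1 p] p(1)
    by (fastforce simp: var_poly_power lookup_add forms_iff mons_def)
  have "lead ?f v" unfolding lead_def
  proof (intro conjI ballI impI)
    have "v \<notin> keys (var_poly n ^ s * p)" using kX less by fastforce
    then show "v \<in> keys ?f" by (simp add: in_keys_iff lookup_minus power_product_def)
    fix w assume w: "w \<in> keys ?f" "w \<noteq> v"
    then have "w \<in> keys (var_poly n ^ s * p)"
      by (auto simp: in_keys_iff lookup_minus power_product_def lookup_single when_def)
    from kX[OF this] have wn: "s \<le> lookup w n" "pp_degree w = i + s" by auto
    have "pp_degree v = i + s" "v \<in> pps (Suc n)" using v by (auto simp: mons_def)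
    then show "drl_greater v w"
      using drl_low_high[of v "Suc n" w] drl_of_exponent_less[of v w n] wn less
      by (cases "w \<in> pps (Suc n)") auto
  qed
  then have "v \<in> ltset I" using lead_mod_highvars[OF I p(2)] v nl by (simp add: mons_def)
  then show False using \<open>v \<notin> ltset I\<close> by simp
qed

subsection \<open>Counting\<close>

definition hfn :: "(nat \<Rightarrow>\<^sub>0 nat) set \<Rightarrow> nat \<Rightarrow> nat \<Rightarrow> nat"
  where "hfn M n d = card (mons n d - M)"

text \<open>The dimension of the cokernel of multiplication by the \<open>s\<close>-th power of
  variable \<open>n\<close> into degree \<open>d\<close>.\<close>

definition low_count :: "(nat \<Rightarrow>\<^sub>0 nat) set \<Rightarrow> nat \<Rightarrow> nat \<Rightarrow> nat \<Rightarrow> nat"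
  where "low_count M n d s = card {v \<in> mons (Suc n) d - M. lookup v n < s}"

text \<open>Division by the power of variable \<open>n\<close> embeds the divisible standard
  power-products into the standard ones of degree \<open>i\<close>, since \<open>M\<close> is closed
  under multiples. Injectivity and surjectivity thus become extreme values of two counts.\<close>

lemma divisible_card:
  fixes i s :: nat
  assumes M: "upcl l M" and nl: "n < l"
  defines "D \<equiv> {v \<in> mons (Suc n) (i + s) - M. s \<le> lookup v n}"
  shows "hfn M (Suc n) (i + s) = low_count M n (i + s) s + card D"
    and "card D \<le> hfn M (Suc n) i"
    and "inj_mons M n i s \<longleftrightarrow> card D = hfn M (Suc n) i"
    and "surj_mons M n i s \<longleftrightarrow> low_count M n (i + s) s = 0"
proof -
  let ?L = "{v \<in> mons (Suc n) (i + s) - M. lookup v n < s}"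
  have "mons (Suc n) (i + s) - M = ?L \<union> D" "?L \<inter> D = {}" by (auto simp: D_def)
  then show "hfn M (Suc n) (i + s) = low_count M n (i + s) s + card D"
    unfolding hfn_def low_count_def by (metis (no_types, lifting) card_Un_disjoint finite_Diff finite_Un finite_mons)
  have "finite ?L" by (rule finite_subset[of _ "mons (Suc n) (i + s)"]) auto
  then have "low_count M n (i + s) s = 0 \<longleftrightarrow> ?L = {}" unfolding low_count_def by simp
  then show "surj_mons M n i s \<longleftrightarrow> low_count M n (i + s) s = 0"
    by (force simp: surj_mons_def)
  let ?f = "\<lambda>v. v - single n s"
  have eq: "v = ?f v + single n s" if "v \<in> D" for v using that by (intro pp_split) (auto simp: D_def)
  have inj: "inj_on ?f D" by (rule inj_onI) (metis eq)
  have into: "?f v \<in> mons (Suc n) i - M" if v: "v \<in> D" for v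
  proof -
    have "?f v \<in> mons (Suc n) i"
      using v by (intro mons_minus_single) (auto simp: D_def)
    moreover have "?f v \<notin> M"
    proof
      assume "?f v \<in> M"
      then have "single n s + ?f v \<in> M" using upclD[OF M, of "?f v" "single n s"] nl by simp
      then show False using v eq[OF v] by (simp add: D_def add.commute)
    qed
    ultimately show ?thesis by simp
  qed
  show le: "card D \<le> hfn M (Suc n) i" unfolding hfn_def
    by (rule card_inj_on_le[OF inj]) (use into in auto)
  show "inj_mons M n i s \<longleftrightarrow> card D = hfn M (Suc n) i"
  proof
    assume i: "inj_mons M n i s"
    have "mons (Suc n) i - M \<subseteq> ?f ` D"
    proof
      fix u assume u: "u \<in> mons (Suc n) i - M"
      then have "u + single n s \<in> D" using i by (auto simp: D_def inj_mons_def mons_def lookup_add)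
      moreover have "u = ?f (u + single n s)" by simp
      ultimately show "u \<in> ?f ` D" by blast
    qed
    then have "hfn M (Suc n) i \<le> card (?f ` D)" unfolding hfn_def
      by (intro card_mono finite_imageI finite_subset[of D "mons (Suc n) (i + s)"]) (auto simp: D_def)
    then show "card D = hfn M (Suc n) i" using le card_image[OF inj] by simp
  next
    assume c: "card D = hfn M (Suc n) i"
    have "?f ` D = mons (Suc n) i - M"
      using into c card_image[OF inj] by (intro card_subset_eq) (auto simp: hfn_def)
    show "inj_mons M n i s" unfolding inj_mons_def
    proof (intro ballI impI, rule ccontr)
      fix u assume u: "u \<in> mons (Suc n) i" "u + single n s \<in> M" "u \<notin> M"
      then obtain v where "v \<in> D" "u = ?f v" using \<open>?f ` D = mons (Suc n) i - M\<close> by blast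
      then show False using u eq by (auto simp: D_def)
    qed
  qed
qed

lemma mons_Suc_exponent_0: "{v \<in> mons (Suc n) d - M. lookup v n < Suc 0} = mons n d - M"
proof -
  have "v \<in> pps (Suc n) \<and> lookup v n = 0 \<longleftrightarrow> v \<in> pps n" for v
  proof
    assume "v \<in> pps (Suc n) \<and> lookup v n = 0"
    then have "x < Suc n \<and> x \<noteq> n" if "x \<in> keys v" for x
      using that lookup_pps[of v "Suc n" x] by (cases "x < Suc n") (auto simp: in_keys_iff)
    then show "v \<in> pps n" by (auto simp: pps_def less_Suc_eq)
  qed (use pps_mono[of n "Suc n"] lookup_pps[of v n n] in auto)
  then show ?thesis by (auto simp: mons_def)
qed

lemma low_count_1: "low_count M n d (Suc 0) = hfn M n d"
  by (simp only: low_count_def mons_Suc_exponent_0 hfn_def)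

text \<open>This makes cokernels comparable between coordinate systems: their dimensions are counts
  on initial segments.\<close>

lemma upper_low:
  assumes "n < l" shows "upper l d {v \<in> mons (Suc n) d. lookup v n < s}"
  unfolding upper_def
proof (intro conjI ballI impI)
  show "{v \<in> mons (Suc n) d. lookup v n < s} \<subseteq> mons l d"
    using pps_mono[of "Suc n" l] assms by (auto simp: mons_def)
  fix t u assume t: "t \<in> {v \<in> mons (Suc n) d. lookup v n < s}" and u: "u \<in> mons l d" "drl_greater u t"
  have d: "pp_degree t = d" "pp_degree u = d" using t u by (auto simp: mons_def)
  have "u \<in> pps (Suc n)"
    using drl_low_high[of t "Suc n" u] drl_asym[OF u(2)] t d by (auto simp: mons_def)
  then show "u \<in> {v \<in> mons (Suc n) d. lookup v n < s}"
    using drl_exponent_le[OF u(2), of n] t d by (auto simp: mons_def)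
qed

lemma upper_mons_le:
  assumes "n \<le> l" shows "upper l d (mons n d)"
  unfolding upper_def
proof (intro conjI ballI impI)
  show "mons n d \<subseteq> mons l d" using pps_mono[OF assms] by (auto simp: mons_def)
  fix t u assume t: "t \<in> mons n d" and u: "u \<in> mons l d" "drl_greater u t"
  then show "u \<in> mons n d" using drl_low_high[of t n u] drl_asym[OF u(2)] by (auto simp: mons_def)
qed

lemma card_Diff_le_of_Int:
  assumes "finite Y" "card (J0 \<inter> Y) \<le> card (J \<inter> Y)" shows "card (Y - J) \<le> card (Y - J0)"
  using assms card_Diff_subset_Int[of Y J] card_Diff_subset_Int[of Y J0] by (simp add: Int_commute)

text \<open>Domination makes the section and cokernel counts of \<open>J\<close> at most those of
  \<open>J0\<close>. By full rank the counts of \<open>J0\<close> are already the least compatible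
  with the Hilbert function, so equality propagates from \<open>l\<close> variables down to
  fewer.\<close>

lemma full_rank_transfer:
  assumes J0: "upcl l J0" and J: "upcl l J"
    and eq: "\<And>d. card (J0 \<inter> mons l d) = card (J \<inter> mons l d)"
    and le: "\<And>d Y. upper l d Y \<Longrightarrow> card (J0 \<inter> Y) \<le> card (J \<inter> Y)"
    and fr: "\<And>n i s. n < l \<Longrightarrow> s \<ge> 1 \<Longrightarrow> inj_mons J0 n i s \<or> surj_mons J0 n i s"
  shows "n \<le> l \<Longrightarrow> hfn J n d = hfn J0 n d"
    and "n < l \<Longrightarrow> s \<ge> 1 \<Longrightarrow> inj_mons J n i s \<or> surj_mons J n i s"
proof -
  have hle: "hfn J n d \<le> hfn J0 n d" if "n \<le> l" for n d
    unfolding hfn_def by (rule card_Diff_le_of_Int[OF finite_mons le[OF upper_mons_le[OF that]]])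
  have lle: "low_count J n d s \<le> low_count J0 n d s" if "n < l" for n d s
  proof -
    have "{v \<in> mons (Suc n) d - M. lookup v n < s} = {v \<in> mons (Suc n) d. lookup v n < s} - M" for M
      by auto
    moreover have "finite {v \<in> mons (Suc n) d. lookup v n < s}"
      by (rule finite_subset[of _ "mons (Suc n) d"]) auto
    ultimately show ?thesis
      unfolding low_count_def using card_Diff_le_of_Int[OF _ le[OF upper_low[OF that]]] by simp
  qed
  have heq: "\<forall>d. hfn J n d = hfn J0 n d" if "n \<le> l" for n using that
  proof (induction n rule: inc_induct)
    case base
    show ?case
    proof
      fix d show "hfn J l d = hfn J0 l d"
        unfolding hfn_def using eq[of d] by (simp add: card_Diff_subset_Int Int_commute)
    qed
  next
    case (step n)
    show ?case
    proof
      fix d show "hfn J n d = hfn J0 n d"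
      proof (cases d)
        case 0
        have m0: "mons k 0 = {0}" for k by (auto simp: mons_def)
        then have "hfn M n 0 = hfn M (Suc n) 0" for M by (simp only: hfn_def m0)
        then show ?thesis using step.IH 0 by simp
      next
        case (Suc i)
        note D = divisible_card(1,2)[where i = i and s = 1 and n = n, unfolded One_nat_def low_count_1]
        show ?thesis
        \<comment> \<open>In the injective case the section of \<open>J0\<close> is the first
          difference of the Hilbert function, which is a lower bound for the section of
          \<open>J\<close>. In the surjective case it is zero.\<close>
        proof (cases "inj_mons J0 n i 1")
          case True
          then have "hfn J0 (Suc n) d = hfn J0 n d + hfn J0 (Suc n) i"
            using D(1)[OF J0 step(2)] divisible_card(3)[OF J0 step(2), of i 1] Suc by simp
          moreover have "hfn J (Suc n) d \<le> hfn J n d + hfn J (Suc n) i"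
            using D(1,2)[OF J step(2)] Suc by simp
          ultimately show ?thesis using step.IH hle[of n d] step(2) by simp
        next
          case False
          then have "surj_mons J0 n i 1" using fr[OF step(2), of 1 i] by simp
          then have "hfn J0 n d = 0"
            using divisible_card(4)[OF J0 step(2), of i 1] Suc by (simp add: low_count_1)
          then show ?thesis using hle[of n d] step(2) by simp
        qed
      qed
    qed
  qed
  then show "n \<le> l \<Longrightarrow> hfn J n d = hfn J0 n d" by blast
  assume n: "n < l" and s: "s \<ge> 1"
  then consider "surj_mons J0 n i s" | "inj_mons J0 n i s" using fr by blast
  then show "inj_mons J n i s \<or> surj_mons J n i s"
  proof cases
    case 1
    then show ?thesis using divisible_card(4)[OF J0 n, of i s] divisible_card(4)[OF J n, of i s] lle[OF n, of "i + s" s] by simp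
  next
    case 2
    have "hfn J0 (Suc n) (i + s) = low_count J0 n (i + s) s + hfn J0 (Suc n) i"
      using divisible_card(1,3)[OF J0 n, of i s] 2 by simp
    moreover have "hfn J0 (Suc n) e = hfn J (Suc n) e" for e using heq[of "Suc n"] n by simp
    ultimately have "inj_mons J n i s"
      using divisible_card(1,2,3)[OF J n, of i s] lle[OF n, of "i + s" s] by simp
    then show ?thesis by simp
  qed
qed

subsection \<open>Almost revlex ideals\<close>

text \<open>Up to the maximum at \<open>p\<close> the sequence does not decrease, so a drop ends
  beyond \<open>p\<close>, where quasi-symmetry supplies an index up to \<open>p\<close> with the
  same value. As this value is smaller than \<open>h i\<close>, the index precedes
  \<open>i\<close>.\<close>

lemma quasi_symmetric_drop:
  assumes q: "quasi_symmetric h c" and id: "i < d" "d \<le> c" "h d < h i"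
  shows "\<exists>k<i. h k = h d"
proof -
  have "unimodal h c" using q by (simp add: quasi_symmetric_def)
  then obtain m where m0: "m \<le> c" "\<forall>i j. i \<le> j \<and> j \<le> m \<longrightarrow> h i \<le> h j"
    "\<forall>i j. m \<le> i \<and> i \<le> j \<and> j \<le> c \<longrightarrow> h j \<le> h i"
    by (auto simp: unimodal_def)
  have m: "i \<le> j \<Longrightarrow> j \<le> m \<Longrightarrow> h i \<le> h j" "m \<le> i \<Longrightarrow> i \<le> j \<Longrightarrow> j \<le> c \<Longrightarrow> h j \<le> h i" for i j
    using m0(2,3) by simp_all
  obtain p where p: "p \<le> c" "h p = Max (h ` {..c})" "\<And>j. p < j \<Longrightarrow> j \<le> c \<Longrightarrow> h j \<in> h ` {..p}"
    using q unfolding quasi_symmetric_def by blast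
  have max: "h j \<le> h p" if "j \<le> c" for j using p(2) that by (simp add: Max_ge)
  have mono: "h a \<le> h b" if "a \<le> b" "b \<le> p" for a b
  proof (cases "b \<le> m")
    case True then show ?thesis using m(1)[of a b] that by simp
  next
    case False
    then have "h p \<le> h b" using m(2)[of b p] that p(1) by simp
    then show ?thesis using max[of a] that p(1) by simp
  qed
  have "p < d"
  proof (rule ccontr)
    assume "\<not> ?thesis"
    then have "h i \<le> h d" using mono[of i d] id by simp
    then show False using id by simp
  qed
  then obtain k where k: "k \<le> p" "h d = h k" using p(3)[of d] id by auto
  have "k < i"
  proof (rule ccontr)
    assume "\<not> ?thesis"
    then have "h i \<le> h k" using mono[of i k] k by simp
    then show False using id k by simp
  qed
  then show ?thesis using k by auto
qed

section \<open>Minimal generators of monomial ideals\<close>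

definition min_elems :: "(nat \<Rightarrow>\<^sub>0 nat) set \<Rightarrow> (nat \<Rightarrow>\<^sub>0 nat) set"
  where "min_elems M = {t \<in> M. \<forall>x. lookup t x > 0 \<longrightarrow> t - single x 1 \<notin> M}"

lemma divides_proper:
  assumes M: "upcl l M" and t: "t = u + s" "u \<noteq> 0" "s \<in> M" "u \<in> pps l"
  shows "\<exists>x. lookup t x > 0 \<and> t - single x 1 \<in> M"
proof -
  obtain x where x: "lookup u x > 0" using t(2) by (metis gr0I lookup_zero poly_mapping_eqI)
  moreover have "u - single x 1 \<in> pps l" using t(4) by simp
  moreover have "t - single x 1 = (u - single x 1) + s"
    using x t by (intro poly_mapping_eqI) (auto simp: lookup_add lookup_minus lookup_single when_def)
  ultimately show ?thesis using upclD[OF M t(3)] x t(1) by (intro exI[of _ x]) (auto simp: lookup_add)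
qed

lemma upcl_min_elems:
  assumes M: "upcl l M"
  shows "{u + t | t u. t \<in> min_elems M \<and> u \<in> pps l} = M"
proof (intro equalityI subsetI)
  fix t assume "t \<in> M"
  then show "t \<in> {u + t | t u. t \<in> min_elems M \<and> u \<in> pps l}"
  proof (induction "pp_degree t" arbitrary: t)
    case 0
    then have "t = 0 + 0" "0 \<in> min_elems M" by (auto simp: min_elems_def)
    then show ?case using zero_in_pps by blast
  next
    case (Suc d)
    show ?case
    proof (cases "t \<in> min_elems M")
      case True
      then show ?thesis using zero_in_pps by (metis (mono_tags, lifting) add.left_neutral mem_Collect_eq)
    next
      case False
      then obtain x where x: "lookup t x > 0" "t - single x 1 \<in> M" using Suc.prems by (auto simp: min_elems_def)
      then have eq: "t = (t - single x 1) + single x 1" by (intro pp_split) simp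
      then have "d = pp_degree (t - single x 1)" using Suc.hyps(2) pp_degree_minus_single[of 1 t x] x(1) by simp
      from Suc.hyps(1)[OF this x(2)] obtain s u where s: "t - single x 1 = u + s" "s \<in> min_elems M" "u \<in> pps l" by blast
      have "x < l" using upcl_pps[OF M Suc.prems] x(1) lookup_pps[of t l x] by (cases "x < l") auto
      then have "single x 1 + u \<in> pps l" using s(3) by simp
      moreover have "t = (single x 1 + u) + s" using eq[unfolded s(1)] by (simp add: ac_simps)
      ultimately show ?thesis using s(2) by blast
    qed
  qed
qed (use upclD[OF M] in \<open>auto simp: min_elems_def\<close>)

text \<open>If fewer elements generated, an omitted minimal element would be a proper multiple of
  another element of \<open>M\<close>.\<close>

lemma minimal_pp_generators_min_elems:
  assumes M: "upcl l M"
  shows "minimal_pp_generators l (mono_ideal l M :: (nat, 'k::field) mpoly set) (min_elems M)"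
  unfolding minimal_pp_generators_def
proof (intro conjI allI impI)
  have pps: "min_elems M \<subseteq> pps l" using upcl_pps[OF M] by (auto simp: min_elems_def)
  then show "min_elems M \<subseteq> pps l" .
  show "genideal (poly_ring l) (power_product ` min_elems M) = (mono_ideal l M :: (nat, 'k) mpoly set)"
    by (simp only: genideal_power_products[OF pps] upcl_min_elems[OF M])
  fix T assume T: "T \<subset> min_elems M"
  then obtain t where t: "t \<in> min_elems M" "t \<notin> T" by blast
  let ?N = "{u + t | t u. t \<in> T \<and> u \<in> pps l}"
  show "genideal (poly_ring l) (power_product ` T) \<noteq> (mono_ideal l M :: (nat, 'k) mpoly set)"
  proof
    assume "genideal (poly_ring l) (power_product ` T) = (mono_ideal l M :: (nat, 'k) mpoly set)"
    moreover have "T \<subseteq> pps l" using T pps by blast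
    ultimately have eq: "(mono_ideal l ?N :: (nat, 'k) mpoly set) = mono_ideal l M"
      by (simp only: genideal_power_products)
    have "?N \<subseteq> pps l" using \<open>T \<subseteq> pps l\<close> by auto
    then have "?N = M" using mono_ideal_inj[OF _ _ eq] M by (auto simp: upcl_def)
    then obtain s u where s: "t = u + s" "s \<in> T" "u \<in> pps l" using t by (auto simp: min_elems_def)
    have "u \<noteq> 0" using s t(2) by auto
    moreover have "s \<in> M" using s T by (auto simp: min_elems_def)
    ultimately show False using divides_proper[OF M s(1) _ _ s(3)] t by (auto simp: min_elems_def)
  qed
qed

lemma almost_revlexI:
  assumes M: "upcl l M"
    and r: "\<And>t t'. t \<in> min_elems M \<Longrightarrow> t' \<in> pps l \<Longrightarrow> pp_degree t' = pp_degree t \<Longrightarrow> drl_greater t' t \<Longrightarrow> t' \<in> M"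
  shows "almost_revlex l (mono_ideal l M :: (nat, 'k::field) mpoly set)"
  unfolding almost_revlex_def
proof (intro exI conjI ballI impI)
  show "minimal_pp_generators l (mono_ideal l M :: (nat, 'k) mpoly set) (min_elems M)"
    by (rule minimal_pp_generators_min_elems[OF M])
  show "power_product t' \<in> (mono_ideal l M :: (nat, 'k) mpoly set)"
    if "t \<in> min_elems M" "t' \<in> pps l" "pp_degree t' = pp_degree t \<and> drl_greater t' t" for t t'
    using r[of t t'] that M by (subst power_product_mono_ideal) (auto simp: upcl_def)
qed

lemma almost_revlexE:
  assumes "almost_revlex l (J :: (nat, 'k::field) mpoly set)"
  obtains M T where "upcl l M" "J = mono_ideal l M" "M = {u + t | t u. t \<in> T \<and> u \<in> pps l}" "T \<subseteq> pps l"
    "\<And>t t'. t \<in> T \<Longrightarrow> t' \<in> pps l \<Longrightarrow> pp_degree t' = pp_degree t \<Longrightarrow> drl_greater t' t \<Longrightarrow> t' \<in> M"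
proof -
  obtain T where T: "T \<subseteq> pps l" "genideal (poly_ring l) (power_product ` T) = J"
    "\<And>t t'. t \<in> T \<Longrightarrow> t' \<in> pps l \<Longrightarrow> pp_degree t' = pp_degree t \<Longrightarrow> drl_greater t' t \<Longrightarrow> power_product t' \<in> J"
    using assms by (auto simp: almost_revlex_def minimal_pp_generators_def)
  let ?M = "{u + t | t u. t \<in> T \<and> u \<in> pps l}"
  have J: "J = mono_ideal l ?M" by (rule trans[OF T(2)[symmetric] genideal_power_products[OF T(1)]])
  have up: "upcl l ?M" unfolding upcl_def
  proof (intro conjI ballI)
    fix s v assume "s \<in> ?M" and v: "v \<in> pps l"
    then obtain t u where "s = u + t" "t \<in> T" "u \<in> pps l" by auto
    then have "v + s = (v + u) + t" "t \<in> T" "v + u \<in> pps l" using v by (auto simp: add.assoc)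
    then show "v + s \<in> ?M" by blast
  qed (use T in auto)
  show ?thesis
  proof (rule that[OF up J refl T(1)])
    fix t t' assume "t \<in> T" "t' \<in> pps l" "pp_degree t' = pp_degree t" "drl_greater t' t"
    then have "power_product t' \<in> J" by (rule T(3))
    moreover have "?M \<subseteq> pps l" using up by (simp add: upcl_def)
    ultimately show "t' \<in> ?M" unfolding J by (simp only: power_product_mono_ideal)
  qed
qed

lemma ltset_mono_ideal: "M \<subseteq> pps l \<Longrightarrow> ltset (mono_ideal l M :: (nat, 'k::field) mpoly set) = M"
proof (intro equalityI subsetI)
  fix t assume "M \<subseteq> pps l" "t \<in> M"
  then have "single t 1 \<in> (mono_ideal l M :: (nat, 'k) mpoly set)" "lead (single t (1::'k)) t"
    by (auto simp: mono_ideal_def lead_def)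
  then show "t \<in> ltset (mono_ideal l M :: (nat, 'k) mpoly set)" unfolding ltset_def by blast
qed (auto simp: ltset_def lead_def mono_ideal_def)

lemma HF_mono_ideal: "upcl l M \<Longrightarrow> HF l (mono_ideal l M :: (nat, 'k::field) mpoly set) d = hfn M l d"
  using HF_eq_card[OF hideal_mono_ideal, of l M d, where 'k = 'k] ltset_mono_ideal[of M l, where 'k = 'k]
  by (simp add: hfn_def upcl_def)

text \<open>In the first degree where the ideals differ, equal counts give an element on either side
  that the other ideal lacks, and both are generators because the lower degrees agree. The larger of
  the two then belongs to both ideals.\<close>

lemma almost_revlex_unique:
  fixes J1 J2 :: "(nat, 'k::field) mpoly set"
  assumes J1: "almost_revlex l J1" and J2: "almost_revlex l J2" and HF: "\<And>d. HF l J1 d = HF l J2 d"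
  shows "J1 = J2"
proof -
  obtain M1 T1 where M1: "upcl l M1" "J1 = mono_ideal l M1" "M1 = {u + t | t u. t \<in> T1 \<and> u \<in> pps l}" "T1 \<subseteq> pps l"
    "\<And>t t'. t \<in> T1 \<Longrightarrow> t' \<in> pps l \<Longrightarrow> pp_degree t' = pp_degree t \<Longrightarrow> drl_greater t' t \<Longrightarrow> t' \<in> M1"
    using J1 by (rule almost_revlexE) blast
  obtain M2 T2 where M2: "upcl l M2" "J2 = mono_ideal l M2" "M2 = {u + t | t u. t \<in> T2 \<and> u \<in> pps l}" "T2 \<subseteq> pps l"
    "\<And>t t'. t \<in> T2 \<Longrightarrow> t' \<in> pps l \<Longrightarrow> pp_degree t' = pp_degree t \<Longrightarrow> drl_greater t' t \<Longrightarrow> t' \<in> M2"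
    using J2 by (rule almost_revlexE) blast
  have card_eq: "card (mons l d - M1) = card (mons l d - M2)" for d
    using HF[of d] HF_mono_ideal[OF M1(1), where 'k = 'k] HF_mono_ideal[OF M2(1), where 'k = 'k]
    by (simp add: hfn_def M1(2) M2(2))
  have "M1 \<inter> mons l d = M2 \<inter> mons l d" for d
  proof (induction d rule: less_induct)
    case (less d)
    have c: "card (M1 \<inter> mons l d) = card (M2 \<inter> mons l d)"
    proof -
      have "card (mons l d - M) + card (M \<inter> mons l d) = card (mons l d)" for M
        by (metis Diff_Diff_Int Int_commute Un_Diff_Int add.commute card_Un_disjoint finite_Diff finite_Int finite_mons Diff_disjoint inf.commute)
      then show ?thesis using card_eq[of d] by (metis add_left_cancel)
    qed
    have new: "a \<in> T1" if a: "a \<in> M1 \<inter> mons l d" and a': "a \<notin> M2" for a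
    proof -
      obtain t u where t: "a = u + t" "t \<in> T1" "u \<in> pps l" using a M1(3) by blast
      have "u = 0"
      proof (rule ccontr)
        assume "u \<noteq> 0"
        then have "pp_degree t < d" using t(1) a by (auto simp: mons_def) (metis less_add_same_cancel2 neq0_conv pp_degree_eq_0_iff)
        moreover have "t = 0 + t" by simp
        then have "t \<in> M1" using t(2) zero_in_pps unfolding M1(3) by blast
        ultimately have "t \<in> M2" using less[of "pp_degree t"] upcl_pps[OF M1(1)] by (auto simp: mons_def)
        then show False using upclD[OF M2(1) _ t(3)] t(1) a' by auto
      qed
      then show ?thesis using t by simp
    qed
    have new2: "a \<in> T2" if a: "a \<in> M2 \<inter> mons l d" and a': "a \<notin> M1" for a
    proof -
      obtain t u where t: "a = u + t" "t \<in> T2" "u \<in> pps l" using a M2(3) by blast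
      have "u = 0"
      proof (rule ccontr)
        assume "u \<noteq> 0"
        then have "pp_degree t < d" using t(1) a by (auto simp: mons_def) (metis less_add_same_cancel2 neq0_conv pp_degree_eq_0_iff)
        moreover have "t = 0 + t" by simp
        then have "t \<in> M2" using t(2) zero_in_pps unfolding M2(3) by blast
        ultimately have "t \<in> M1" using less[of "pp_degree t"] upcl_pps[OF M2(1)] by (auto simp: mons_def)
        then show False using upclD[OF M1(1) _ t(3)] t(1) a' by auto
      qed
      then show ?thesis using t by simp
    qed
    show ?case
    proof (rule ccontr)
      assume ne: "M1 \<inter> mons l d \<noteq> M2 \<inter> mons l d"
      have "\<not> M1 \<inter> mons l d \<subseteq> M2 \<inter> mons l d" "\<not> M2 \<inter> mons l d \<subseteq> M1 \<inter> mons l d"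
        using ne c card_subset_eq[of "M2 \<inter> mons l d" "M1 \<inter> mons l d"] card_subset_eq[of "M1 \<inter> mons l d" "M2 \<inter> mons l d"]
        by auto
      then obtain a b where ab: "a \<in> M1 \<inter> mons l d" "a \<notin> M2" "b \<in> M2 \<inter> mons l d" "b \<notin> M1" by blast
      then have "a \<in> T1" "b \<in> T2" "a \<noteq> b" using new new2 by auto
      then consider "drl_greater a b" | "drl_greater b a" using drl_total by blast
      then show False using M1(5)[of a b] M2(5)[of b a] ab \<open>a \<in> T1\<close> \<open>b \<in> T2\<close> by cases (auto simp: mons_def)
    qed
  qed
  then have "t \<in> M1 \<longleftrightarrow> t \<in> M2" for t
    using upcl_pps[OF M1(1), of t] upcl_pps[OF M2(1), of t] by (fastforce simp: mons_def)
  then have "M1 = M2" by auto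
  then show ?thesis by (simp add: M1(2) M2(2))
qed

text \<open>For a minimal generator \<open>t = u x\<^sub>n\<^sup>s\<close> multiplication by \<open>x\<^sub>n\<^sup>s\<close> is not injective, so it is surjective and
  the Hilbert function drops from the degree \<open>i\<close> of \<open>u\<close> to the degree \<open>d\<close> of \<open>t\<close>. If the value at \<open>d\<close> was
  already taken at some \<open>k < i\<close>, then \<open>x\<^sub>n\<^sup>d\<^sup>-\<^sup>k\<close> is bijective, so every standard power-product
  of degree \<open>d\<close> is divisible by a higher power of \<open>x\<^sub>n\<close> than \<open>x\<^sub>n\<^sup>s\<close>.\<close>

lemma almost_revlex_of_full_rank:
  assumes M: "upcl l M"
    and fr: "\<And>n i s. n < l \<Longrightarrow> s \<ge> 1 \<Longrightarrow> inj_mons M n i s \<or> surj_mons M n i s"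
    and stable: "\<And>t i j. t \<in> M \<Longrightarrow> i < j \<Longrightarrow> j < l \<Longrightarrow> lookup t j > 0 \<Longrightarrow> t - single j 1 + single i 1 \<in> M"
    and quasi: "\<And>n. 4 \<le> n \<Longrightarrow> n \<le> l \<Longrightarrow> quasi_symmetric (hfn M n) c"
    and bound: "\<And>n e. 3 \<le> n \<Longrightarrow> n < l \<Longrightarrow> c \<le> e \<Longrightarrow> inj_mons M n e 1"
  shows "almost_revlex l (mono_ideal l M :: (nat, 'k::field) mpoly set)"
proof (rule almost_revlexI[OF M], rule ccontr)
  fix t t' assume t: "t \<in> min_elems M" and t': "t' \<in> pps l" "pp_degree t' = pp_degree t" "drl_greater t' t" "t' \<notin> M"
  have tM: "t \<in> M" and tl: "t \<in> pps l" using t upcl_pps[OF M] by (auto simp: min_elems_def)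
  define d where "d = pp_degree t"
  have "t \<noteq> 0" using t'(2,3) by (auto simp: drl_greater_def)
  then have ne: "keys t \<noteq> {}" by simp
  define n where "n = Max (keys t)"
  have n: "n \<in> keys t" "\<And>x. x \<in> keys t \<Longrightarrow> x \<le> n" using ne by (auto simp: n_def)
  have nl: "n < l" using n(1) tl by (auto simp: pps_def)
  have tn: "t \<in> pps (Suc n)" using n(2) by (auto simp: pps_def less_Suc_eq_le)
  have t'n: "t' \<in> pps (Suc n)" using drl_low_high[OF tn, of t'] drl_asym[OF t'(3)] t'(2) by auto
  define s where "s = lookup t n"
  have s: "s \<ge> 1" using n(1) by (simp add: s_def in_keys_iff)
  define u where "u = t - single n s"
  have tu: "t = u + single n s" unfolding u_def by (rule pp_split) (simp add: s_def)
  define i where "i = pp_degree u"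
  have d: "d = i + s" using arg_cong[OF tu, of pp_degree] by (simp add: d_def i_def)
  have un: "u \<in> mons (Suc n) i" using tn by (simp add: mons_def i_def u_def)
  have uM: "u \<notin> M"
  proof
    assume "u \<in> M"
    moreover have "single n s \<noteq> 0" using s by (metis lookup_single_eq lookup_zero not_one_le_zero)
    ultimately have "\<exists>x. lookup t x > 0 \<and> t - single x 1 \<in> M"
      using divides_proper[OF M, of t "single n s" u] tu nl by (simp add: add.commute)
    then show False using t by (auto simp: min_elems_def)
  qed
  have ninj: "\<not> inj_mons M n i s" using un uM tM tu by (auto simp: inj_mons_def)
  then have surj: "surj_mons M n i s" using fr[OF nl s] by blast
  have t'd: "t' \<in> mons (Suc n) (i + s)" using t'n t'(2) d by (simp add: mons_def d_def)
  \<comment> \<open>Surjectivity bounds the exponent of the standard \<open>t'\<close> at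
    \<open>n\<close> from below, DegRevLex bounds it from above.\<close>
  have "s \<le> lookup t' n" using surj t'd t'(4) by (auto simp: surj_mons_def)
  moreover have "lookup t' n \<le> s" using drl_exponent_le[OF t'(3) t'(2) t'n tn] by (simp add: s_def)
  ultimately have t's: "lookup t' n = s" by simp
  show False
  proof (cases "3 \<le> n")
    case True
    \<comment> \<open>Variable \<open>n\<close> is injective from degree \<open>c\<close> on, so a
      minimal generator that involves it cannot occur in a degree above \<open>c\<close>.\<close>
    have dc: "d \<le> c"
    proof (rule ccontr)
      assume "\<not> ?thesis"
      then have "c \<le> d - 1" by simp
      then have inj: "inj_mons M n (d - 1) 1" using bound[OF True nl] by simp
      have e: "t - single n 1 + single n 1 = t" using s by (intro pp_split[symmetric]) (simp add: s_def)
      have "t - single n 1 \<in> mons (Suc n) (d - 1)"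
        using tn d s by (intro mons_minus_single) (auto simp: mons_def d_def s_def)
      moreover have "t - single n 1 + single n 1 \<in> M" using tM e by simp
      ultimately have "t - single n 1 \<in> M" using inj unfolding inj_mons_def by blast
      then show False using t s by (auto simp: min_elems_def s_def)
    qed
    let ?h = "hfn M (Suc n)"
    have "?h d < ?h i"
    proof -
      have "?h d = low_count M n (i + s) s + card {v \<in> mons (Suc n) (i + s) - M. s \<le> lookup v n}"
        using divisible_card(1)[OF M nl, of i s] d by simp
      moreover have "low_count M n (i + s) s = 0" using divisible_card(4)[OF M nl, of i s] surj by simp
      moreover have "card {v \<in> mons (Suc n) (i + s) - M. s \<le> lookup v n} \<noteq> ?h i"
        using divisible_card(3)[OF M nl, of i s] ninj by simp
      ultimately show ?thesis using divisible_card(2)[OF M nl, of i s] by simp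
    qed
    then obtain k where k: "k < i" "?h k = ?h d"
      using quasi_symmetric_drop[OF quasi[of "Suc n"], of i d] True nl dc d s by auto
    define r where "r = d - k"
    have r: "d = k + r" "r > s" "r \<ge> 1" using k d s by (auto simp: r_def)
    \<comment> \<open>Equal values of the Hilbert function make an injective multiplication
      surjective.\<close>
    have "surj_mons M n k r"
    proof (cases "inj_mons M n k r")
      case True
      then have "card {v \<in> mons (Suc n) (k + r) - M. r \<le> lookup v n} = ?h (k + r)"
        using divisible_card(3)[OF M nl, of k r] k r by simp
      then have "low_count M n (k + r) r = 0" using divisible_card(1)[OF M nl, of k r] by simp
      then show ?thesis using divisible_card(4)[OF M nl] by simp
    qed (use fr[OF nl r(3)] in blast)
    then have "r \<le> lookup t' n" using t'd t'(4) d r by (auto simp: surj_mons_def)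
    then show False using t's r by simp
  next
    case False
    have d': "pp_degree t' = pp_degree t" by (rule t'(2))
    obtain x where x: "lookup t' x < lookup t x" "\<And>y. y > x \<Longrightarrow> lookup t' y = lookup t y"
      using t'(2,3) by (auto simp: drl_greater_def)
    have xn: "x < n"
    proof -
      have "x \<le> n" using x(1) n(2)[of x] by (auto simp: in_keys_iff)
      moreover have "x \<noteq> n" using x(1) t's by (auto simp: s_def)
      ultimately show ?thesis by simp
    qed
    have deg: "pp_degree v = (\<Sum>y<Suc n. lookup v y)" if "v \<in> pps (Suc n)" for v
      using that by (intro pp_degree_eq_sum) (auto simp: pps_def)
    \<comment> \<open>At most three variables are involved. As \<open>t\<close> and
      \<open>t'\<close> agree at index \<open>n\<close>, they can only differ at 0 and 1, and
      \<open>t'\<close> arises from \<open>t\<close> by moving \<open>k\<close> factors from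
      variable 1 to variable 0.\<close>
    have x1: "x = 1"
    proof (rule ccontr)
      assume "x \<noteq> 1"
      then have "x = 0" using xn False by simp
      have "lookup t' y \<le> lookup t y" for y using x \<open>x = 0\<close> by (cases "y = 0") auto
      then have "(\<Sum>y<Suc n. lookup t' y) < (\<Sum>y<Suc n. lookup t y)"
        using x(1) \<open>x = 0\<close> by (intro sum_strict_mono_ex1 ballI bexI[of _ 0]) auto
      then show False using deg[OF tn] deg[OF t'n] d' by simp
    qed
    then have n2: "n = 2" using xn False by simp
    define k where "k = lookup t 1 - lookup t' 1"
    have "m \<le> lookup t 1 \<Longrightarrow> t - single 1 m + single 0 m \<in> M" for m
    proof (induction m)
      case 0 then show ?case using tM by simp
    next
      case (Suc m)
      let ?v = "t - single 1 m + single 0 m"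
      have "?v \<in> M" using Suc by simp
      moreover have "lookup ?v 1 > 0" using Suc.prems by (simp add: lookup_add lookup_minus lookup_single when_def)
      ultimately have "?v - single 1 1 + single 0 1 \<in> M" using stable[of ?v 0 1] nl n2 by simp
      moreover have "?v - single 1 1 + single 0 1 = t - single 1 (Suc m) + single 0 (Suc m)"
        by (intro poly_mapping_eqI) (auto simp: lookup_add lookup_minus lookup_single when_def)
      ultimately show ?case by simp
    qed
    then have kM: "t - single 1 k + single 0 k \<in> M" by (simp add: k_def)
    have "t' = t - single 1 k + single 0 k"
    proof (rule poly_mapping_eqI)
      fix y
      have sum3: "(\<Sum>y<Suc n. f y) = f 0 + f 1 + f 2" for f :: "nat \<Rightarrow> nat"
        by (simp add: n2 numeral_2_eq_2)
      have "lookup t' 0 + lookup t' 1 + lookup t' 2 = lookup t 0 + lookup t 1 + lookup t 2"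
        using d' deg[OF tn] deg[OF t'n] by (simp only: sum3)
      moreover have "lookup t' 2 = lookup t 2" "lookup t' 1 < lookup t 1" using x x1 by auto
      ultimately have "lookup t' 0 = lookup t 0 + k" "lookup t' 1 = lookup t 1 - k" by (auto simp: k_def)
      then show "lookup t' y = lookup (t - single 1 k + single 0 k) y"
        using x(2)[of y] x1 by (cases "y = 0"; cases "y = 1") (auto simp: lookup_add lookup_minus lookup_single when_def)
    qed
    then show False using kM t'(4) by simp
  qed
qed

subsection \<open>Ideals generated by an ideal and linear forms\<close>

text \<open>The sum of \<open>I\<close> and the ideal generated by the forms \<open>f j\<close>. The
  explicit coefficients allow substitutions and parameters to be followed termwise.\<close>

definition add_forms :: "nat \<Rightarrow> (nat, 'k::comm_ring_1) mpoly set \<Rightarrow> ('j \<Rightarrow> (nat, 'k) mpoly) \<Rightarrow> 'j set \<Rightarrow> (nat, 'k) mpoly set"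
  where "add_forms l I f K = {q + (\<Sum>j\<in>K. c j * f j) | q c. q \<in> I \<and> (\<forall>j. c j \<in> polyS l)}"

lemma add_formsI: "q \<in> I \<Longrightarrow> (\<And>j. c j \<in> polyS l) \<Longrightarrow> q + (\<Sum>j\<in>K. c j * f j) \<in> add_forms l I f K"
  by (auto simp: add_forms_def)

lemma add_formsE:
  assumes "p \<in> add_forms l I f K"
  obtains q c where "q \<in> I" "\<And>j. c j \<in> polyS l" "p = q + (\<Sum>j\<in>K. c j * f j)"
  using assms by (auto simp: add_forms_def)

lemma hideal_add_forms:
  fixes I :: "(nat, 'k::comm_ring_1) mpoly set"
  assumes I: "hideal l I" and f: "\<And>j. j \<in> K \<Longrightarrow> f j \<in> forms l 1"
  shows "hideal l (add_forms l I f K)"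
  unfolding hideal_def
proof (intro conjI ballI allI subsetI)
  let ?A = "add_forms l I f K"
  show "0 \<in> ?A" using add_formsI[OF hidealD(2)[OF I], of "\<lambda>_. 0" l f K] by simp
  fix p assume "p \<in> ?A"
  then obtain q c where p: "q \<in> I" "\<And>j. c j \<in> polyS l" "p = q + (\<Sum>j\<in>K. c j * f j)" by (rule add_formsE) blast
  show "p \<in> polyS l" unfolding p(3) using p(1,2) f hidealD(1)[OF I]
    by (intro polyS_add polyS_sum polyS_mult) (auto dest: forms_polyS)
  show "p + p' \<in> ?A" if "p' \<in> ?A" for p'
  proof -
    obtain q' c' where p': "q' \<in> I" "\<And>j. c' j \<in> polyS l" "p' = q' + (\<Sum>j\<in>K. c' j * f j)"
      using \<open>p' \<in> ?A\<close> by (rule add_formsE) blast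
    have "p + p' = (q + q') + (\<Sum>j\<in>K. (c j + c' j) * f j)" by (simp add: p p' sum.distrib distrib_right)
    then show ?thesis using add_formsI[of "q + q'" I "\<lambda>j. c j + c' j" l f K] hidealD(3)[OF I p(1) p'(1)] p(2) p'(2)
      by (simp add: polyS_add)
  qed
  show "r * p \<in> ?A" if "r \<in> polyS l" for r
  proof -
    have "r * p = r * q + (\<Sum>j\<in>K. (r * c j) * f j)" by (simp add: p sum_distrib_left distrib_left mult.assoc)
    then show ?thesis using add_formsI[of "r * q" I "\<lambda>j. r * c j" l f K] hidealD(4)[OF I that p(1)] p(2) that
      by (simp add: polyS_mult)
  qed
  show "homogeneous_component d p \<in> ?A" for d
  proof -
    \<comment> \<open>The forms have degree 1, so degree \<open>d\<close> of the sum uses the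
      coefficients in degree \<open>d - 1\<close>, and degree 0 receives nothing from them.\<close>
    define c' where "c' = (\<lambda>j. if d = 0 then 0 else homogeneous_component (d - 1) (c j))"
    have "homogeneous_component d (c j * f j) = c' j * f j" if "j \<in> K" for j
      using homogeneous_component_mult_form[OF p(2)[of j] f[OF that], of "d - 1"]
        homogeneous_component_mult_form(2)[OF p(2)[of j] f[OF that], of 0] by (cases d) (auto simp: c'_def)
    then have "homogeneous_component d p = homogeneous_component d q + (\<Sum>j\<in>K. c' j * f j)"
      by (simp add: p(3) homogeneous_component_add homogeneous_component_sum)
    moreover have "c' j \<in> polyS l" for j
      using homogeneous_component_form[OF p(2)[of j]] by (auto simp: c'_def intro: forms_polyS)
    ultimately show ?thesis using add_formsI[of "homogeneous_component d q" I c' l f K] hidealD(5)[OF I p(1)] by simp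
  qed
qed

lemma subset_add_forms: "I \<subseteq> add_forms l I f K"
proof
  fix q assume "q \<in> I"
  then show "q \<in> add_forms l I f K" using add_formsI[of q I "\<lambda>_. 0" l f K] by simp
qed

lemma generator_add_forms:
  assumes "0 \<in> I" "finite K" "j \<in> K" shows "f j \<in> add_forms l I f K"
proof -
  have "(\<Sum>i\<in>K. (if i = j then 1 else 0) * f i) = f j" using assms by (simp add: if_distrib[of "\<lambda>x. x * _"] cong: if_cong)
  then show ?thesis using add_formsI[OF assms(1), of "\<lambda>i. if i = j then 1 else 0" l f K] by simp
qed

lemma add_forms_minimal:
  assumes A: "hideal l A" and "I \<subseteq> A" "\<And>j. j \<in> K \<Longrightarrow> f j \<in> A"
  shows "add_forms l I f K \<subseteq> A"
  using assms by (auto elim!: add_formsE intro!: hidealD(3)[OF A] hideal_sum[OF A] hidealD(4)[OF A])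

lemma add_forms_eq_sum_genideal:
  fixes I :: "(nat, 'k::comm_ring_1) mpoly set"
  assumes I: "hideal l I" and f: "\<And>j. j \<in> K \<Longrightarrow> f j \<in> forms l 1" and K: "finite K"
  shows "I <+>\<^bsub>poly_ring l\<^esub> genideal (poly_ring l) (f ` K) = add_forms l I f K"
proof
  interpret cring "poly_ring l :: (nat, 'k) mpoly ring" by (rule cring_poly_ring)
  have A: "hideal l (add_forms l I f K)" by (rule hideal_add_forms[OF I f])
  have fS: "f ` K \<subseteq> carrier (poly_ring l)" using f forms_polyS by fastforce
  have G: "ideal (genideal (poly_ring l) (f ` K)) (poly_ring l)" by (rule genideal_ideal[OF fS])
  have "genideal (poly_ring l) (f ` K) \<subseteq> add_forms l I f K"
    using generator_add_forms[OF hidealD(2)[OF I] K, of _ f l] by (intro genideal_minimal[OF hideal_ideal[OF A]]) auto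
  then show "I <+>\<^bsub>poly_ring l\<^esub> genideal (poly_ring l) (f ` K) \<subseteq> add_forms l I f K"
    using subset_add_forms[of I l f K] hidealD(3)[OF A] by (auto simp: set_add_def')
  have sumG: "(\<Sum>j\<in>K'. c j * f j) \<in> genideal (poly_ring l) (f ` K)" if "finite K'" "K' \<subseteq> K" "\<And>j. c j \<in> polyS l" for c K'
    using that
  proof (induction K' rule: finite_induct)
    case empty then show ?case using ideal_poly_ringD(2)[OF G] by simp
  next
    case (insert j K')
    have "f j \<in> genideal (poly_ring l) (f ` K)" using genideal_self[OF fS] insert.prems by auto
    then show ?case using ideal_poly_ringD(3)[OF G ideal_poly_ringD(4)[OF G]] insert by simp
  qed
  show "add_forms l I f K \<subseteq> I <+>\<^bsub>poly_ring l\<^esub> genideal (poly_ring l) (f ` K)"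
  proof
    fix p assume "p \<in> add_forms l I f K"
    then obtain q c where p: "q \<in> I" "\<And>j. c j \<in> polyS l" "p = q + (\<Sum>j\<in>K. c j * f j)" by (rule add_formsE) blast
    then show "p \<in> I <+>\<^bsub>poly_ring l\<^esub> genideal (poly_ring l) (f ` K)"
      using sumG[of K c] K by (auto simp: set_add_def')
  qed
qed

lemma act_add_forms:
  assumes g: "g \<in> GL l"
  shows "act l g ` add_forms l I f K = add_forms l (act l g ` I) (\<lambda>j. act l g (f j)) K"
proof
  obtain h where h: "h \<in> GL l" "h * g = 1\<^sub>m l" using g by (rule GL_inverse)
  have gh: "g \<in> carrier_mat l l" "h \<in> carrier_mat l l" using g h by (auto simp: GL_def)
  show "act l g ` add_forms l I f K \<subseteq> add_forms l (act l g ` I) (\<lambda>j. act l g (f j)) K"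
  proof
    fix x assume "x \<in> act l g ` add_forms l I f K"
    then obtain p where "p \<in> add_forms l I f K" and x: "x = act l g p" by blast
    from \<open>p \<in> add_forms l I f K\<close>
    obtain q c where p: "q \<in> I" "\<And>j. c j \<in> polyS l" "p = q + (\<Sum>j\<in>K. c j * f j)" by (rule add_formsE) blast
    have "x = act l g q + (\<Sum>j\<in>K. act l g (c j) * act l g (f j))" by (simp add: x p(3) act_simps)
    then show "x \<in> add_forms l (act l g ` I) (\<lambda>j. act l g (f j)) K"
      using add_formsI[of "act l g q" "act l g ` I" "\<lambda>j. act l g (c j)" l "\<lambda>j. act l g (f j)" K] p(1) by simp
  qed
  show "add_forms l (act l g ` I) (\<lambda>j. act l g (f j)) K \<subseteq> act l g ` add_forms l I f K"
  proof
    fix x assume "x \<in> add_forms l (act l g ` I) (\<lambda>j. act l g (f j)) K"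
    then obtain q c where p: "q \<in> act l g ` I" "\<And>j. c j \<in> polyS l" "x = q + (\<Sum>j\<in>K. c j * act l g (f j))" by (rule add_formsE) blast
    then obtain q0 where q0: "q0 \<in> I" "q = act l g q0" by blast
    have "x = act l g (q0 + (\<Sum>j\<in>K. act l h (c j) * f j))"
      by (simp add: act_simps p(3) q0 act_inverse[OF gh h(2) p(2)])
    then show "x \<in> act l g ` add_forms l I f K"
      using add_formsI[OF q0(1), of "\<lambda>j. act l h (c j)" l f K] by auto
  qed
qed

lemma highvars_sum:
  fixes p :: "(nat, 'k::comm_ring_1) mpoly"
  assumes p: "p \<in> highvars l n"
  shows "\<exists>c. (\<forall>j. c j \<in> polyS l) \<and> p = (\<Sum>j\<in>{n..<l}. c j * var_poly j)"
proof -
  \<comment> \<open>Choosing one high variable in each term distributes the terms among the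
    generators.\<close>
  define \<sigma> where "\<sigma> = (\<lambda>t::nat \<Rightarrow>\<^sub>0 nat. SOME j. j \<in> keys t \<and> n \<le> j)"
  have \<sigma>: "\<sigma> t \<in> keys t \<and> n \<le> \<sigma> t \<and> \<sigma> t < l" if t: "t \<in> keys p" for t
  proof -
    have "t \<in> pps l" "t \<notin> pps n" using p t by (auto simp: highvars_iff polyS_iff)
    then have "\<exists>j. j \<in> keys t \<and> n \<le> j" by (auto simp: pps_def not_less)
    then have "\<sigma> t \<in> keys t \<and> n \<le> \<sigma> t" unfolding \<sigma>_def by (rule someI_ex)
    then show ?thesis using \<open>t \<in> pps l\<close> by (auto simp: pps_def)
  qed
  define c where "c = (\<lambda>j. \<Sum>t\<in>{t \<in> keys p. \<sigma> t = j}. single (t - single j 1) (lookup p t))"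
  have "c j \<in> polyS l" for j unfolding c_def
    using p by (intro polyS_sum polyS_single pps_minus) (auto simp: highvars_iff polyS_iff)
  moreover have "p = (\<Sum>j\<in>{n..<l}. c j * var_poly j)"
  proof -
    have "c j * var_poly j = (\<Sum>t\<in>{t \<in> keys p. \<sigma> t = j}. single t (lookup p t))" for j
      unfolding c_def sum_distrib_right
    proof (rule sum.cong)
      fix t assume t: "t \<in> {t \<in> keys p. \<sigma> t = j}"
      then have "1 \<le> lookup t j" using \<sigma>[of t] by (auto simp: in_keys_iff)
      then have "t - single j 1 + single j 1 = t" by (rule pp_split[symmetric])
      then show "single (t - single j 1) (lookup p t) * var_poly j = single t (lookup p t)"
        by (simp add: var_poly_def mult_single)
    qed simp
    then have "(\<Sum>j\<in>{n..<l}. c j * var_poly j) = (\<Sum>j\<in>{n..<l}. \<Sum>t\<in>{t \<in> keys p. \<sigma> t = j}. single t (lookup p t))" by simp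
    also have "\<dots> = (\<Sum>t\<in>keys p. single t (lookup p t))"
      by (rule sum.group) (use \<sigma> in auto)
    finally show ?thesis by (simp add: sum_single_keys)
  qed
  ultimately show ?thesis by blast
qed

lemma isum_highvars_eq_add_forms:
  fixes I :: "(nat, 'k::comm_ring_1) mpoly set"
  assumes I: "hideal l I"
  shows "isum I (highvars l n) = add_forms l I var_poly {n..<l}"
proof
  show "isum I (highvars l n) \<subseteq> add_forms l I var_poly {n..<l}"
  proof
    fix f assume "f \<in> isum I (highvars l n)"
    then obtain p q where pq: "p \<in> I" "q \<in> highvars l n" "f = p + q" by (auto simp: isum_def)
    then obtain c where "\<forall>j. c j \<in> polyS l" "q = (\<Sum>j\<in>{n..<l}. c j * var_poly j)" using highvars_sum by blast
    then show "f \<in> add_forms l I var_poly {n..<l}" using pq add_formsI[OF pq(1), of c l] by simp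
  qed
  note S = isum_subset[OF I hideal_highvars[of l n]]
  have "var_poly j \<in> (highvars l n :: (nat, 'k) mpoly set)" if "j \<in> {n..<l}" for j
    using that by (auto simp: highvars_iff var_poly_def pps_def)
  then show "add_forms l I var_poly {n..<l} \<subseteq> isum I (highvars l n)"
    using S by (intro add_forms_minimal[OF hideal_isum[OF I hideal_highvars]]) auto
qed

subsection \<open>The strong Lefschetz property in quotients\<close>

text \<open>Full rank on the quotient is restated with representatives, so that cosets disappear
  from the later arguments.\<close>

lemma SLP_quotientD:
  assumes R: "cring R" and J: "ideal J R" and G: "\<And>d. G d \<subseteq> carrier R" and z: "z \<in> carrier R"
    and S: "SLP (R Quot J) (quotient_grading R G J) (J +>\<^bsub>R\<^esub> z)" and s: "s \<ge> 1"
  shows "(\<forall>x\<in>G i. \<forall>y\<in>G i. (z [^]\<^bsub>R\<^esub> s \<otimes>\<^bsub>R\<^esub> x) \<ominus>\<^bsub>R\<^esub> (z [^]\<^bsub>R\<^esub> s \<otimes>\<^bsub>R\<^esub> y) \<in> J \<longrightarrow> x \<ominus>\<^bsub>R\<^esub> y \<in> J) \<or>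
    (\<forall>w\<in>G (i + s). \<exists>x\<in>G i. w \<ominus>\<^bsub>R\<^esub> (z [^]\<^bsub>R\<^esub> s \<otimes>\<^bsub>R\<^esub> x) \<in> J)"
proof -
  interpret R: cring R by (rule R)
  interpret J: ideal J R by (rule J)
  interpret Q: cring "R Quot J" by (rule J.quotient_is_cring[OF R])
  let ?c = "\<lambda>x. J +>\<^bsub>R\<^esub> x"
  have eq: "?c x = ?c y \<longleftrightarrow> x \<ominus>\<^bsub>R\<^esub> y \<in> J" if "x \<in> carrier R" "y \<in> carrier R" for x y
    using R.quotient_eq_iff_same_a_r_cos[OF J that] by simp
  have mult: "?c x \<otimes>\<^bsub>R Quot J\<^esub> ?c y = ?c (x \<otimes>\<^bsub>R\<^esub> y)" if "x \<in> carrier R" "y \<in> carrier R" for x y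
    using J.rcoset_mult_add[OF that] by (simp add: FactRing_def)
  have pow: "?c z [^]\<^bsub>R Quot J\<^esub> n = ?c (z [^]\<^bsub>R\<^esub> n)" for n :: nat
  proof (induction n)
    case 0 then show ?case by (simp add: FactRing_def)
  next
    case (Suc n)
    then show ?case using mult[of "z [^]\<^bsub>R\<^esub> n" z] z by simp
  qed
  have zs: "z [^]\<^bsub>R\<^esub> s \<in> carrier R" using z by simp
  have m: "?c z [^]\<^bsub>R Quot J\<^esub> s \<otimes>\<^bsub>R Quot J\<^esub> ?c x = ?c (z [^]\<^bsub>R\<^esub> s \<otimes>\<^bsub>R\<^esub> x)" if "x \<in> G d" for x d
    unfolding pow using mult[OF zs, of x] that G by auto
  from S s have "inj_on (\<lambda>x. ?c z [^]\<^bsub>R Quot J\<^esub> s \<otimes>\<^bsub>R Quot J\<^esub> x) (?c ` G i) \<or>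
      (\<lambda>x. ?c z [^]\<^bsub>R Quot J\<^esub> s \<otimes>\<^bsub>R Quot J\<^esub> x) ` (?c ` G i) = ?c ` G (i + s)"
    unfolding SLP_def quotient_grading_def by blast
  then show ?thesis
  proof
    assume inj: "inj_on (\<lambda>x. ?c z [^]\<^bsub>R Quot J\<^esub> s \<otimes>\<^bsub>R Quot J\<^esub> x) (?c ` G i)"
    have "x \<ominus>\<^bsub>R\<^esub> y \<in> J" if xy: "x \<in> G i" "y \<in> G i" and d: "(z [^]\<^bsub>R\<^esub> s \<otimes>\<^bsub>R\<^esub> x) \<ominus>\<^bsub>R\<^esub> (z [^]\<^bsub>R\<^esub> s \<otimes>\<^bsub>R\<^esub> y) \<in> J" for x y
    proof -
      have car: "x \<in> carrier R" "y \<in> carrier R" using xy G by auto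
      then have "?c (z [^]\<^bsub>R\<^esub> s \<otimes>\<^bsub>R\<^esub> x) = ?c (z [^]\<^bsub>R\<^esub> s \<otimes>\<^bsub>R\<^esub> y)" using d zs by (subst eq) auto
      then have "?c x = ?c y" using inj_onD[OF inj, of "?c x" "?c y"] xy m by auto
      then show ?thesis using eq car by simp
    qed
    then show ?thesis by blast
  next
    assume sur: "(\<lambda>x. ?c z [^]\<^bsub>R Quot J\<^esub> s \<otimes>\<^bsub>R Quot J\<^esub> x) ` (?c ` G i) = ?c ` G (i + s)"
    have "\<exists>x\<in>G i. w \<ominus>\<^bsub>R\<^esub> (z [^]\<^bsub>R\<^esub> s \<otimes>\<^bsub>R\<^esub> x) \<in> J" if w: "w \<in> G (i + s)" for w
    proof -
      have "?c w \<in> (\<lambda>x. ?c z [^]\<^bsub>R Quot J\<^esub> s \<otimes>\<^bsub>R Quot J\<^esub> x) ` (?c ` G i)" using sur w by blast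
      then obtain x where x: "x \<in> G i" "?c w = ?c (z [^]\<^bsub>R\<^esub> s \<otimes>\<^bsub>R\<^esub> x)" using m by auto
      have "w \<in> carrier R" "z [^]\<^bsub>R\<^esub> s \<otimes>\<^bsub>R\<^esub> x \<in> carrier R" using w x G zs by auto
      then show ?thesis using x eq by auto
    qed
    then show ?thesis by blast
  qed
qed

lemma minus_poly_ring: "p \<in> polyS l \<Longrightarrow> q \<in> polyS l \<Longrightarrow> p \<ominus>\<^bsub>poly_ring l\<^esub> q = p - q"
  for p :: "(nat, 'k::comm_ring_1) mpoly"
  by (simp add: a_minus_def a_inv_poly_ring)

lemma pow_poly_ring: "p [^]\<^bsub>poly_ring l\<^esub> (n::nat) = p ^ n"
  for p :: "(nat, 'k::comm_ring_1) mpoly"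
  by (induction n) (auto simp: nat_pow_def mult.commute)

lemma ideal_quotient_image:
  fixes I L :: "(nat, 'k::comm_ring_1) mpoly set"
  assumes I: "ideal I (poly_ring l)" and L: "ideal L (poly_ring l)"
  shows "ideal ((\<lambda>p. I +>\<^bsub>poly_ring l\<^esub> p) ` L) (poly_ring l Quot I)"
proof -
  let ?c = "\<lambda>p. I +>\<^bsub>poly_ring l\<^esub> p" and ?Q = "poly_ring l Quot I"
  note s = quotient_ring_simps[OF I] and L' = ideal_poly_ringD[OF L]
  interpret Q: cring ?Q by (rule quotient_cring[OF I])
  have LS: "p \<in> polyS l" if "p \<in> L" for p using that L'(1) by blast
  have inv: "\<ominus>\<^bsub>?Q\<^esub> ?c p = ?c (- p)" if "p \<in> polyS l" for p
    by (rule Q.minus_equality) (use that in \<open>auto simp: s\<close>)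
  show ?thesis
  proof (rule idealI)
    show "ring ?Q" by (rule Q.ring_axioms)
    show "subgroup (?c ` L) (add_monoid ?Q)"
    proof
      show "?c ` L \<subseteq> carrier (add_monoid ?Q)" using LS by (auto simp: s)
      fix x y assume "x \<in> ?c ` L" "y \<in> ?c ` L"
      then show "x \<otimes>\<^bsub>add_monoid ?Q\<^esub> y \<in> ?c ` L" using LS L'(3) by (auto simp: s)
    next
      show "\<one>\<^bsub>add_monoid ?Q\<^esub> \<in> ?c ` L" using L'(2) s(6) by (auto simp: s(5) image_iff intro!: bexI[of _ 0])
      fix x assume "x \<in> ?c ` L"
      then obtain p where p: "p \<in> L" "x = ?c p" by blast
      have "inv\<^bsub>add_monoid ?Q\<^esub> x = \<ominus>\<^bsub>?Q\<^esub> x" by (simp add: a_inv_def)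
      also have "\<dots> = ?c (- p)" using p LS inv by simp
      finally show "inv\<^bsub>add_monoid ?Q\<^esub> x \<in> ?c ` L" using L'(4)[of "- 1" p] p by auto
    qed
  next
    fix a x assume "a \<in> ?c ` L" "x \<in> carrier ?Q"
    then obtain p q where pq: "p \<in> L" "a = ?c p" "q \<in> polyS l" "x = ?c q" by (auto simp: s)
    then have "x \<otimes>\<^bsub>?Q\<^esub> a = ?c (q * p)" "a \<otimes>\<^bsub>?Q\<^esub> x = ?c (q * p)" using LS by (auto simp: s mult.commute)
    then show "x \<otimes>\<^bsub>?Q\<^esub> a \<in> ?c ` L" "a \<otimes>\<^bsub>?Q\<^esub> x \<in> ?c ` L" using L'(4)[OF pq(3,1)] by auto
  qed
qed

text \<open>In \<open>k_SLP\<close> a quotient of a quotient occurs. As the ideal generated by the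
  classes is the image of \<open>add_forms\<close>, one quotient of the polynomial ring can take its
  place.\<close>

lemma genideal_quotient:
  fixes I :: "(nat, 'k::comm_ring_1) mpoly set"
  assumes I: "hideal l I" and f: "\<And>j. j \<in> K \<Longrightarrow> f j \<in> forms l 1" and K: "finite K"
  shows "genideal (poly_ring l Quot I) ((\<lambda>j. I +>\<^bsub>poly_ring l\<^esub> f j) ` K) = (\<lambda>p. I +>\<^bsub>poly_ring l\<^esub> p) ` add_forms l I f K"
    (is "?G = ?c ` ?A")
proof
  let ?Q = "poly_ring l Quot I"
  have I': "ideal I (poly_ring l)" by (rule hideal_ideal[OF I])
  note s = quotient_ring_simps[OF I']
  interpret Q: cring ?Q by (rule quotient_cring[OF I'])
  have fS: "f j \<in> polyS l" if "j \<in> K" for j using f[OF that] by (rule forms_polyS)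
  have sub: "(\<lambda>j. ?c (f j)) ` K \<subseteq> carrier ?Q" using fS by (auto simp: s)
  have G: "ideal ?G ?Q" by (rule Q.genideal_ideal[OF sub])
  interpret G: ideal ?G ?Q by (rule G)
  show "?G \<subseteq> ?c ` ?A"
    by (rule Q.genideal_minimal[OF ideal_quotient_image[OF I' hideal_ideal[OF hideal_add_forms[OF I f]]]])
      (use generator_add_forms[OF hidealD(2)[OF I] K] in auto)
  have sumG: "?c (\<Sum>j\<in>K'. c j * f j) \<in> ?G" if "finite K'" "K' \<subseteq> K" "\<And>j. c j \<in> polyS l" for c K'
    using that
  proof (induction K' rule: finite_induct)
    case empty
    then show ?case using additive_subgroup.zero_closed[OF G.additive_subgroup_axioms] by (simp add: s)
  next
    case (insert j K')
    have j: "f j \<in> polyS l" "?c (f j) \<in> ?G" using fS Q.genideal_self[OF sub] insert.prems by auto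
    have "?c (c j) \<in> carrier ?Q" using insert.prems(2) by (auto simp: s)
    then have "?c (c j) \<otimes>\<^bsub>?Q\<^esub> ?c (f j) \<in> ?G" using G.I_l_closed[OF j(2)] by simp
    then have "?c (c j * f j) \<in> ?G" using insert.prems(2) j by (simp add: s)
    moreover have "?c (\<Sum>j\<in>K'. c j * f j) \<in> ?G" using insert by simp
    ultimately have "?c (c j * f j) \<oplus>\<^bsub>?Q\<^esub> ?c (\<Sum>j\<in>K'. c j * f j) \<in> ?G"
      by (rule additive_subgroup.a_closed[OF G.additive_subgroup_axioms])
    moreover have "(\<Sum>j\<in>K'. c j * f j) \<in> polyS l" "c j * f j \<in> polyS l"
      using insert.prems fS by (auto intro!: polyS_sum polyS_mult)
    ultimately show ?case using insert.hyps by (simp add: s)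
  qed
  show "?c ` ?A \<subseteq> ?G"
  proof
    fix x assume "x \<in> ?c ` ?A"
    then obtain p0 where p0: "p0 \<in> ?A" "x = ?c p0" by blast
    from p0(1) obtain q c where p: "q \<in> I" "\<And>j. c j \<in> polyS l" "p0 = q + (\<Sum>j\<in>K. c j * f j)" by (rule add_formsE) blast
    let ?p = "\<Sum>j\<in>K. c j * f j"
    have pS: "?p \<in> polyS l" using p(2) fS by (auto intro!: polyS_sum polyS_mult)
    have "?c (q + ?p) = ?c ?p"
      using p(1) pS hidealD(1)[OF I p(1)] by (subst quotient_eq_iff[OF I']) auto
    then show "x \<in> ?G" using sumG[OF K subset_refl p(2)] p(3) p0(2) by simp
  qed
qed

lemma k_SLP_forms:
  fixes I :: "(nat, 'k::field) mpoly set"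
  assumes I: "hideal l I" and S: "k_SLP k (poly_ring l Quot I) (quotient_grading (poly_ring l) (forms l) I)"
  obtains f where "\<And>m. m < k \<Longrightarrow> f m \<in> forms l 1"
    and "\<And>m e s. m < k \<Longrightarrow> s \<ge> 1 \<Longrightarrow>
      (\<forall>p\<in>forms l e. f m ^ s * p \<in> add_forms l I f {..<m} \<longrightarrow> p \<in> add_forms l I f {..<m}) \<or>
      (\<forall>q\<in>forms l (e + s). \<exists>p\<in>forms l e. q - f m ^ s * p \<in> add_forms l I f {..<m})"
proof -
  let ?Q = "poly_ring l Quot I" and ?c = "\<lambda>p. I +>\<^bsub>poly_ring l\<^esub> p"
  let ?G = "quotient_grading (poly_ring l) (forms l) I"
  have I': "ideal I (poly_ring l)" by (rule hideal_ideal[OF I])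
  note s = quotient_ring_simps[OF I']
  from S obtain z where z: "\<And>i. i \<in> {1..k} \<Longrightarrow> z i \<in> ?G 1" "SLP ?Q ?G (z 1)" "1 \<le> k"
    "\<And>i. i \<in> {2..k} \<Longrightarrow> SLP (?Q Quot genideal ?Q (z ` {1..<i})) (quotient_grading ?Q ?G (genideal ?Q (z ` {1..<i})))
      (genideal ?Q (z ` {1..<i}) +>\<^bsub>?Q\<^esub> z i)"
    unfolding k_SLP_def Let_def by blast
  have "\<forall>m\<in>{..<k}. \<exists>p. p \<in> forms l 1 \<and> z (Suc m) = ?c p"
  proof
    fix m assume "m \<in> {..<k}"
    then have "z (Suc m) \<in> ?c ` forms l 1" using z(1)[of "Suc m"] by (simp add: quotient_grading_def)
    then show "\<exists>p. p \<in> forms l 1 \<and> z (Suc m) = ?c p" by blast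
  qed
  from bchoice[OF this] obtain f where f: "\<And>m. m < k \<Longrightarrow> f m \<in> forms l 1" "\<And>m. m < k \<Longrightarrow> z (Suc m) = ?c (f m)"
    by auto
  show ?thesis
  proof (rule that[OF f(1)])
    fix m e s' :: nat assume m: "m < k" and s': "s' \<ge> 1"
    let ?A = "add_forms l I f {..<m}"
    have A: "hideal l ?A" by (rule hideal_add_forms[OF I]) (use f m in auto)
    have fm: "f m \<in> polyS l" using f(1)[OF m] by (rule forms_polyS)
    show "(\<forall>p\<in>forms l e. f m ^ s' * p \<in> ?A \<longrightarrow> p \<in> ?A) \<or> (\<forall>q\<in>forms l (e + s'). \<exists>p\<in>forms l e. q - f m ^ s' * p \<in> ?A)"
    \<comment> \<open>\<open>k_SLP\<close> states the first property for the ring itself and not for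
      the quotient by the zero ideal. Its elements are numbered from 1, the lifted forms from
      0.\<close>
    proof (cases "m = 0")
      case True
      have A0: "?A = I" using True by (auto simp: add_forms_def intro: exI[of _ "\<lambda>_. 0"])
      have "SLP ?Q ?G (?c (f m))" using z(2) f(2)[OF m] True by simp
      from SLP_quotientD[OF cring_poly_ring I' _ _ this s', of e]
      have "(\<forall>x\<in>forms l e. \<forall>y\<in>forms l e. (f m ^ s' * x) - (f m ^ s' * y) \<in> I \<longrightarrow> x - y \<in> I) \<or>
        (\<forall>w\<in>forms l (e + s'). \<exists>x\<in>forms l e. w - f m ^ s' * x \<in> I)"
        using fm by (simp add: forms_polyS minus_poly_ring pow_poly_ring polyS_mult polyS_power subset_iff cong: ball_cong bex_cong)
      then show ?thesis unfolding A0
      proof (elim disjE)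
        assume "\<forall>x\<in>forms l e. \<forall>y\<in>forms l e. (f m ^ s' * x) - (f m ^ s' * y) \<in> I \<longrightarrow> x - y \<in> I"
        from this[rule_format, of _ 0] show "(\<forall>p\<in>forms l e. f m ^ s' * p \<in> I \<longrightarrow> p \<in> I) \<or> (\<forall>q\<in>forms l (e + s'). \<exists>p\<in>forms l e. q - f m ^ s' * p \<in> I)"
          by simp
      qed blast
    next
      case False
      let ?J = "genideal ?Q (z ` {1..<Suc m})"
      have "z ` {1..<Suc m} = (\<lambda>j. ?c (f j)) ` {..<m}"
      proof -
        have "{1..<Suc m} = Suc ` {..<m}" by (simp add: lessThan_atLeast0 image_Suc_atLeastLessThan)
        then show ?thesis using f(2) m by (auto simp: image_image intro!: image_cong)
      qed
      then have J: "?J = ?c ` ?A" using genideal_quotient[OF I, of "{..<m}" f] f(1) m by simp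
      have inJ: "?c p \<in> ?J \<longleftrightarrow> p \<in> ?A" if p: "p \<in> polyS l" for p
      proof
        assume "?c p \<in> ?J"
        then obtain q where q: "q \<in> ?A" "?c p = ?c q" unfolding J by blast
        then have "p - q \<in> I" using quotient_eq_iff[OF I' p hidealD(1)[OF A q(1)]] by simp
        then have "(p - q) + q \<in> ?A" using subset_add_forms[of I l f "{..<m}"] hidealD(3)[OF A _ q(1)] by blast
        then show "p \<in> ?A" by simp
      next
        assume "p \<in> ?A" then show "?c p \<in> ?J" unfolding J by blast
      qed
      have IJ: "ideal ?J ?Q" unfolding J by (rule ideal_quotient_image[OF I' hideal_ideal[OF A]])
      have slp: "SLP (?Q Quot ?J) (quotient_grading ?Q ?G ?J) (?J +>\<^bsub>?Q\<^esub> ?c (f m))"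
        using z(4)[of "Suc m"] f(2)[OF m] False m by simp
      interpret Q: cring ?Q by (rule quotient_cring[OF I'])
      have pow: "?c p [^]\<^bsub>?Q\<^esub> n = ?c (p ^ n)" if "p \<in> polyS l" for p and n :: nat
        by (induction n) (use that in \<open>auto simp: s mult.commute polyS_power\<close>)
      have minus: "?c p \<ominus>\<^bsub>?Q\<^esub> ?c q = ?c (p - q)" if "p \<in> polyS l" "q \<in> polyS l" for p q
      proof -
        have "\<ominus>\<^bsub>?Q\<^esub> ?c q = ?c (- q)" by (rule Q.minus_equality) (use that in \<open>auto simp: s\<close>)
        then show ?thesis using that by (simp add: a_minus_def s)
      qed
      have mult: "?c (f m) [^]\<^bsub>?Q\<^esub> s' \<otimes>\<^bsub>?Q\<^esub> ?c p = ?c (f m ^ s' * p)" if "p \<in> polyS l" for p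
        using pow[OF fm] that fm by (simp add: s polyS_power)
      have Gc: "?G d \<subseteq> carrier ?Q" for d by (auto simp: quotient_grading_def s forms_polyS)
      have fc: "?c (f m) \<in> carrier ?Q" using fm by (simp add: s)
      have pS: "f m ^ s' * p \<in> polyS l" if "p \<in> forms l d" for p d
        using that fm by (intro polyS_mult polyS_power) (auto dest: forms_polyS)
      from SLP_quotientD[OF Q.cring_axioms IJ Gc fc slp s', of e]
      show ?thesis
      proof
        assume inj: "\<forall>x\<in>?G e. \<forall>y\<in>?G e. (?c (f m) [^]\<^bsub>?Q\<^esub> s' \<otimes>\<^bsub>?Q\<^esub> x) \<ominus>\<^bsub>?Q\<^esub> (?c (f m) [^]\<^bsub>?Q\<^esub> s' \<otimes>\<^bsub>?Q\<^esub> y) \<in> ?J \<longrightarrow> x \<ominus>\<^bsub>?Q\<^esub> y \<in> ?J"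
        have "p \<in> ?A" if p: "p \<in> forms l e" "f m ^ s' * p \<in> ?A" for p
        proof -
          have "?c p \<in> ?G e" "?c 0 \<in> ?G e" using p(1) by (auto simp: quotient_grading_def)
          moreover have "(?c (f m) [^]\<^bsub>?Q\<^esub> s' \<otimes>\<^bsub>?Q\<^esub> ?c p) \<ominus>\<^bsub>?Q\<^esub> (?c (f m) [^]\<^bsub>?Q\<^esub> s' \<otimes>\<^bsub>?Q\<^esub> ?c 0) \<in> ?J"
            using p pS[OF p(1)] forms_polyS[OF p(1)] mult[of p] mult[of 0] minus[of "f m ^ s' * p" 0] inJ[of "f m ^ s' * p"] by simp
          ultimately have "?c p \<ominus>\<^bsub>?Q\<^esub> ?c 0 \<in> ?J" using inj by blast
          then show ?thesis using minus[of p 0] inJ[of p] forms_polyS[OF p(1)] by simp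
        qed
        then show ?thesis by blast
      next
        assume sur: "\<forall>w\<in>?G (e + s'). \<exists>x\<in>?G e. w \<ominus>\<^bsub>?Q\<^esub> (?c (f m) [^]\<^bsub>?Q\<^esub> s' \<otimes>\<^bsub>?Q\<^esub> x) \<in> ?J"
        have "\<exists>p\<in>forms l e. q - f m ^ s' * p \<in> ?A" if q: "q \<in> forms l (e + s')" for q
        proof -
          have "?c q \<in> ?G (e + s')" using q by (auto simp: quotient_grading_def)
          then obtain x where "x \<in> ?G e" "?c q \<ominus>\<^bsub>?Q\<^esub> (?c (f m) [^]\<^bsub>?Q\<^esub> s' \<otimes>\<^bsub>?Q\<^esub> x) \<in> ?J" using sur by blast
          then obtain p where p: "p \<in> forms l e" "?c q \<ominus>\<^bsub>?Q\<^esub> (?c (f m) [^]\<^bsub>?Q\<^esub> s' \<otimes>\<^bsub>?Q\<^esub> ?c p) \<in> ?J"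
            by (auto simp: quotient_grading_def)
          then have "?c (q - f m ^ s' * p) \<in> ?J"
            using mult[OF forms_polyS[OF p(1)]] minus[OF forms_polyS[OF q] pS[OF p(1)]] by simp
          then show ?thesis using p(1) inJ[OF polyS_diff[OF forms_polyS[OF q] pS[OF p(1)]]] by blast
        qed
        then show ?thesis by blast
      qed
    qed
  qed
qed

lemma add_forms_eqI:
  fixes I :: "(nat, 'k::comm_ring_1) mpoly set"
  assumes I: "hideal l I" and f: "\<And>j. j \<in> K \<Longrightarrow> f j \<in> forms l 1" "\<And>j. j \<in> K' \<Longrightarrow> f' j \<in> forms l 1"
    and K: "\<And>j. j \<in> K \<Longrightarrow> f j \<in> add_forms l I f' K'" "\<And>j. j \<in> K' \<Longrightarrow> f' j \<in> add_forms l I f K"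
  shows "add_forms l I f K = add_forms l I f' K'"
proof
  show "add_forms l I f K \<subseteq> add_forms l I f' K'"
    by (rule add_forms_minimal[OF hideal_add_forms[OF I f(2)] subset_add_forms K(1)])
  show "add_forms l I f' K' \<subseteq> add_forms l I f K"
    by (rule add_forms_minimal[OF hideal_add_forms[OF I f(1)] subset_add_forms K(2)])
qed

lemma add_forms_image_cong:
  fixes I :: "(nat, 'k::comm_ring_1) mpoly set"
  assumes I: "hideal l I" and f: "\<And>j. j \<in> K \<Longrightarrow> f j \<in> forms l 1" "\<And>j. j \<in> K' \<Longrightarrow> f' j \<in> forms l 1"
    and fin: "finite K" "finite K'" and img: "f ` K = f' ` K'"
  shows "add_forms l I f K = add_forms l I f' K'"
proof (rule add_forms_eqI[OF I f])
  fix j assume "j \<in> K"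
  then obtain i where "i \<in> K'" "f j = f' i" using img by blast
  then show "f j \<in> add_forms l I f' K'" using generator_add_forms[OF hidealD(2)[OF I] fin(2)] by metis
next
  fix j assume "j \<in> K'"
  then obtain i where "i \<in> K" "f' j = f i" using img by (metis imageE image_eqI)
  then show "f' j \<in> add_forms l I f K" using generator_add_forms[OF hidealD(2)[OF I] fin(1)] by metis
qed

lemma act_row:
  assumes A: "A \<in> carrier_mat l l" "g \<in> carrier_mat l l" "A * g = 1\<^sub>m l" and r: "r < l"
  shows "act l g (linear_form l (\<lambda>m. A $$ (r, m))) = var_poly r"
proof -
  have "act l g (linear_form l (\<lambda>m. A $$ (r, m))) = linear_form l (\<lambda>m. if r = m then 1 else 0)"
    unfolding act_linear_form
  proof (rule linear_form_cong)
    fix m assume m: "m < l"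
    have "(A * g) $$ (r, m) = (\<Sum>j<l. A $$ (r, j) * g $$ (j, m))"
      using A(1,2) r m by (simp add: scalar_prod_def atLeast0LessThan)
    then show "(\<Sum>j<l. A $$ (r, j) * g $$ (j, m)) = (if r = m then 1 else 0)" unfolding A(3) using r m by simp
  qed
  then show ?thesis using linear_form_delta[OF r, of 1] by (simp add: const_poly_hom)
qed

lemma basis_change:
  fixes f :: "nat \<Rightarrow> (nat, 'k::field) mpoly"
  assumes f: "\<And>r. r < l \<Longrightarrow> f r \<in> forms l 1"
    and indep: "\<And>c. (\<Sum>r<l. const_poly (c r) * f r) = 0 \<Longrightarrow> \<forall>r<l. c r = 0"
  shows "\<exists>g\<in>GL l. \<forall>r<l. act l g (f r) = var_poly r"
proof -
  let ?B = "mat l l (\<lambda>(i, j). lookup (f j) (single i 1))"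
  have "det ?B \<noteq> 0" unfolding det_nonzero_iff
  proof (intro allI impI)
    fix c j assume z: "\<forall>i<l. (\<Sum>j<l. lookup (f j) (single i 1) * c j) = 0" and j: "j < l"
    let ?p = "\<Sum>r<l. const_poly (c r) * f r"
    have "?p \<in> forms l 1" using f by (intro forms_sum forms_scale) auto
    then have "?p = linear_form l (\<lambda>j. lookup ?p (single j 1))" by (rule form1_eq_linear_form)
    also have "\<dots> = linear_form l (\<lambda>j. 0)"
      by (rule linear_form_cong) (use z in \<open>simp add: lookup_sum mult.commute[of "c _"]\<close>)
    also have "\<dots> = 0" by (simp add: linear_form_def const_poly_hom)
    finally show "c j = 0" using indep j by blast
  qed
  moreover define A where "A = transpose_mat ?B"
  ultimately have "A \<in> GL l" using det_transpose[of ?B l] by (simp add: GL_iff_det)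
  then obtain g where g: "g \<in> GL l" "A * g = 1\<^sub>m l" by (rule GL_inverse)
  have "act l g (f r) = var_poly r" if r: "r < l" for r
  proof -
    have "f r = linear_form l (\<lambda>m. lookup (f r) (single m 1))" by (rule form1_eq_linear_form[OF f[OF r]])
    also have "\<dots> = linear_form l (\<lambda>m. A $$ (r, m))"
      by (rule linear_form_cong) (use r in \<open>simp add: A_def\<close>)
    finally show ?thesis using act_row[OF _ _ g(2) r] \<open>A \<in> GL l\<close> g(1) by (simp add: GL_def)
  qed
  then show ?thesis using g(1) by blast
qed

text \<open>By counting, some nonzero linear functional vanishes on all \<open>f m\<close>; a
  variable on which it is nonzero lies outside the span.\<close>

lemma form_outside_span:
  fixes f :: "nat \<Rightarrow> (nat, 'k::field) mpoly"
  assumes k: "k < l"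
  shows "\<exists>w\<in>forms l 1. \<forall>c. w \<noteq> (\<Sum>m<k. const_poly (c m) * f m)"
proof -
  obtain c where c: "\<exists>j\<in>{..<l}. c j \<noteq> 0" "\<forall>i\<in>{..<k}. (\<Sum>j\<in>{..<l}. lookup (f i) (single j 1) * c j) = 0"
    using nontrivial_solution[of "{..<k}" "{..<l}" "\<lambda>i j. lookup (f i) (single j 1)"] k by auto
  then obtain j0 where j0: "j0 < l" "c j0 \<noteq> 0" by auto
  let ?\<phi> = "\<lambda>p. \<Sum>j<l. lookup p (single j 1) * c j"
  have "var_poly j0 \<noteq> (\<Sum>m<k. const_poly (b m) * f m)" for b
  proof
    assume eq: "var_poly j0 = (\<Sum>m<k. const_poly (b m) * f m)"
    have "?\<phi> (\<Sum>m<k. const_poly (b m) * f m) = (\<Sum>m<k. b m * ?\<phi> (f m))"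
      by (simp add: lookup_sum sum_distrib_left sum_distrib_right mult.assoc) (rule sum.swap)
    also have "\<dots> = 0" using c(2) by simp
    also have "?\<phi> (\<Sum>m<k. const_poly (b m) * f m) = ?\<phi> (var_poly j0)" by (simp only: eq)
    also have "\<dots> = (\<Sum>j<l. if j = j0 then c j else 0)"
      by (rule sum.cong) (auto simp: var_poly_def lookup_single when_def)
    finally show False using j0 by simp
  qed
  then show ?thesis using var_poly_form[OF j0(1)] by blast
qed

lemma hideal_power_diff:
  assumes A: "hideal l A" and ab: "a \<in> polyS l" "b \<in> polyS l" "a - b \<in> A"
  shows "a ^ n - b ^ n \<in> A"
proof (induction n)
  case 0 then show ?case using hidealD(2)[OF A] by simp
next
  case (Suc n)
  have "a ^ Suc n - b ^ Suc n = a * (a ^ n - b ^ n) + b ^ n * (a - b)" by (simp add: algebra_simps)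
  then show ?case using hidealD(3)[OF A hidealD(4)[OF A ab(1) Suc] hidealD(4)[OF A _ ab(3), of "b ^ n"]] ab(2)
    by (simp add: polyS_power)
qed

text \<open>A Lefschetz element that is linearly dependent on the earlier ones is zero in the quotient.
  This is only possible if the degree 1 part of the quotient vanishes, and then it can be replaced by
  any linear form.\<close>

lemma k_SLP_independent_forms:
  fixes I :: "(nat, 'k::field) mpoly set"
  assumes I: "hideal l I" and S: "k_SLP l (poly_ring l Quot I) (quotient_grading (poly_ring l) (forms l) I)"
  obtains f where "\<And>m. m < l \<Longrightarrow> f m \<in> forms l 1"
    and "\<And>c. (\<Sum>m<l. const_poly (c m) * f m) = 0 \<Longrightarrow> \<forall>m<l. c m = 0"
    and "\<And>m e s. m < l \<Longrightarrow> s \<ge> 1 \<Longrightarrow>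
      (\<forall>p\<in>forms l e. f m ^ s * p \<in> add_forms l I f {..<m} \<longrightarrow> p \<in> add_forms l I f {..<m}) \<or>
      (\<forall>q\<in>forms l (e + s). \<exists>p\<in>forms l e. q - f m ^ s * p \<in> add_forms l I f {..<m})"
proof -
  obtain f where f: "\<And>m. m < l \<Longrightarrow> f m \<in> forms l 1"
    and fr: "\<And>m e s. m < l \<Longrightarrow> s \<ge> 1 \<Longrightarrow>
      (\<forall>p\<in>forms l e. f m ^ s * p \<in> add_forms l I f {..<m} \<longrightarrow> p \<in> add_forms l I f {..<m}) \<or>
      (\<forall>q\<in>forms l (e + s). \<exists>p\<in>forms l e. q - f m ^ s * p \<in> add_forms l I f {..<m})"
    by (rule k_SLP_forms[OF I S]) blast
  let ?A = "\<lambda>f m. add_forms l I f {..<m}"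
  have A: "hideal l (?A f m)" if "m \<le> l" for m by (rule hideal_add_forms[OF I]) (use f that in auto)
  \<comment> \<open>The forms are changed only modulo the preceding ideal. This preserves all the
    ideals, and with them full rank, while independence is achieved one form at a time.\<close>
  define good where "good = (\<lambda>k f'. (\<forall>m<k. f' m \<in> forms l 1) \<and>
    (\<forall>c. (\<Sum>m<k. const_poly (c m) * f' m) = 0 \<longrightarrow> (\<forall>m<k. c m = 0)) \<and>
    (\<forall>m\<le>k. ?A f' m = ?A f m) \<and> (\<forall>m<k. f' m - f m \<in> ?A f m))"
  have "\<exists>f'. good k f'" if "k \<le> l" for k using that
  proof (induction k)
    case 0
    have "good 0 f" by (simp add: good_def)
    then show ?case by blast
  next
    case (Suc k)
    then obtain f' where f': "good k f'" by auto
    have k: "k < l" using Suc.prems by simp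
    have "\<exists>w\<in>forms l 1. w - f k \<in> ?A f k \<and> (\<forall>c. w \<noteq> (\<Sum>m<k. const_poly (c m) * f' m))"
    proof (cases "\<exists>c. f k = (\<Sum>m<k. const_poly (c m) * f' m)")
      case False
      then show ?thesis using f[OF k] hidealD(2)[OF A[of k]] k by (intro bexI[of _ "f k"]) auto
    next
      case True
      then obtain c where c: "f k = (\<Sum>m<k. const_poly (c m) * f' m)" by blast
      have "f k \<in> ?A f' k" unfolding c
        using add_formsI[OF hidealD(2)[OF I], of "\<lambda>m. const_poly (c m)" l f' "{..<k}"] by simp
      then have fk: "f k \<in> ?A f k" using f' by (simp add: good_def)
      \<comment> \<open>The class of \<open>f k\<close> is zero, yet multiplication by it from
        degree 0 to degree 1 has full rank, so one of these two degrees of the quotient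
        vanishes.\<close>
      have sub: "forms l 1 \<subseteq> ?A f k"
        using fr[OF k, of 1 0]
      proof
        assume "\<forall>p\<in>forms l 0. f k ^ 1 * p \<in> ?A f k \<longrightarrow> p \<in> ?A f k"
        then have "1 \<in> ?A f k" using fk by (metis forms_one mult.right_neutral power_one_right)
        then have "?A f k = polyS l" using one_in_hideal[OF A[of k]] k by simp
        then show ?thesis by (auto dest: forms_polyS)
      next
        assume r: "\<forall>q\<in>forms l (0 + 1). \<exists>p\<in>forms l 0. q - f k ^ 1 * p \<in> ?A f k"
        show ?thesis
        proof
          fix q :: "(nat, 'k) mpoly" assume "q \<in> forms l 1"
          then obtain p where p: "p \<in> forms l 0" "q - f k * p \<in> ?A f k" using r by auto
          have "p * f k \<in> ?A f k" using hidealD(4)[OF A[of k] forms_polyS[OF p(1)] fk] k by simp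
          then have "(q - f k * p) + p * f k \<in> ?A f k" by (rule hidealD(3)[OF A[OF less_imp_le[OF k]] p(2)])
          moreover have "(q - f k * p) + p * f k = q" by simp
          ultimately show "q \<in> ?A f k" by metis
        qed
      qed simp
      obtain w where w: "w \<in> forms l 1" "\<forall>c. w \<noteq> (\<Sum>m<k. const_poly (c m) * f' m)"
        using form_outside_span[OF k, of f'] by blast
      have "w - f k \<in> ?A f k" using sub w(1) fk hidealD(8)[OF A[of k]] k by auto
      then show ?thesis using w by blast
    qed
    then obtain w where w: "w \<in> forms l 1" "w - f k \<in> ?A f k" "\<And>c. w \<noteq> (\<Sum>m<k. const_poly (c m) * f' m)" by blast
    define f'' where "f'' = f'(k := w)"
    have same: "?A f'' m = ?A f m" if "m \<le> k" for m
    proof -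
      have "?A f'' m = ?A f' m" unfolding add_forms_def using that
        by (intro arg_cong[where f = Collect] ext iff_exI conj_cong) (auto simp: f''_def intro!: sum.cong)
      then show ?thesis using f' that by (simp add: good_def)
    qed
    have forms: "f'' m \<in> forms l 1" if "m < Suc k" for m
      using that w f' by (auto simp: f''_def good_def less_Suc_eq)
    have diff: "f'' m - f m \<in> ?A f m" if "m < Suc k" for m
      using that w f' by (auto simp: f''_def good_def less_Suc_eq)
    have up: "?A g k \<subseteq> ?A g (Suc k)" for g unfolding add_forms_def
    proof
      fix x assume "x \<in> {q + (\<Sum>j<k. c j * g j) |q c. q \<in> I \<and> (\<forall>j. c j \<in> polyS l)}"
      then obtain q c where "q \<in> I" "\<forall>j. c j \<in> polyS l" "x = q + (\<Sum>j<k. c j * g j)" by blast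
      then have "x = q + (\<Sum>j<Suc k. (c(k := 0)) j * g j)" "\<forall>j. (c(k := 0)) j \<in> polyS l" by auto
      then show "x \<in> {q + (\<Sum>j<Suc k. c j * g j) |q c. q \<in> I \<and> (\<forall>j. c j \<in> polyS l)}" using \<open>q \<in> I\<close> by blast
    qed
    have gen: "g j \<in> ?A g m" if "j < m" for g and j m :: nat
      by (rule generator_add_forms[OF hidealD(2)[OF I]]) (use that in auto)
    have last: "?A f'' (Suc k) = ?A f (Suc k)"
    proof (rule add_forms_eqI[OF I])
      fix j assume "j \<in> {..<Suc k}"
      then have j: "j < Suc k" by simp
      show "f'' j \<in> forms l 1" by (rule forms[OF j])
      show "f j \<in> forms l 1" using f j k by simp
      have Ak: "hideal l (?A f'' (Suc k))" by (rule hideal_add_forms[OF I]) (use forms in auto)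
      have Ak': "hideal l (?A f (Suc k))" using A[of "Suc k"] k by simp
      show "f'' j \<in> ?A f (Suc k)"
      proof (cases "j = k")
        case True
        have "w - f k \<in> ?A f (Suc k)" using w(2) up by blast
        then have "(w - f k) + f k \<in> ?A f (Suc k)" by (rule hidealD(3)[OF Ak' _ gen]) simp
        moreover have "(w - f k) + f k = w" by simp
        ultimately have "w \<in> ?A f (Suc k)" by metis
        then show ?thesis using True by (simp add: f''_def)
      next
        case False
        then have "f'' j \<in> ?A f'' k" using gen j by simp
        then show ?thesis using same[of k] up[of f] by auto
      qed
      show "f j \<in> ?A f'' (Suc k)"
      proof (cases "j = k")
        case True
        have "w - f k \<in> ?A f'' (Suc k)" using w(2) same[of k] up[of f''] by auto
        moreover have "w \<in> ?A f'' (Suc k)" using gen[of k "Suc k" f''] by (simp add: f''_def)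
        ultimately have "w - (w - f k) \<in> ?A f'' (Suc k)" using hidealD(8)[OF Ak] by blast
        moreover have "w - (w - f k) = f k" by simp
        ultimately show ?thesis using True by metis
      next
        case False
        then have "f j \<in> ?A f k" using gen j by simp
        then show ?thesis using same[of k] up[of f''] by auto
      qed
    qed
    have "\<forall>m<Suc k. c m = 0" if z: "(\<Sum>m<Suc k. const_poly (c m) * f'' m) = 0" for c
    proof -
      have s: "(\<Sum>m<k. const_poly (c m) * f' m) + const_poly (c k) * w = 0"
      proof -
        have "(\<Sum>m<k. const_poly (c m) * f'' m) = (\<Sum>m<k. const_poly (c m) * f' m)"
          by (rule sum.cong) (auto simp: f''_def)
        then show ?thesis using z by (simp add: f''_def)
      qed
      have ck: "c k = 0"
      proof (rule ccontr)
        assume nz: "c k \<noteq> 0"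
        have "const_poly (inverse (c k)) * (const_poly (c k) * w) = const_poly (inverse (c k) * c k) * w"
          by (simp only: const_poly_hom(4) mult.assoc)
        then have "w = const_poly (inverse (c k)) * (const_poly (c k) * w)" using nz by (simp add: const_poly_hom(2))
        also have "const_poly (c k) * w = - (\<Sum>m<k. const_poly (c m) * f' m)"
          using s by (simp add: eq_neg_iff_add_eq_0 add.commute)
        also have "const_poly (inverse (c k)) * \<dots> = (\<Sum>m<k. const_poly (- (inverse (c k) * c m)) * f' m)"
          by (simp add: sum_distrib_left sum_negf[symmetric] const_poly_hom mult.assoc)
        finally show False using w(3)[of "\<lambda>m. - (inverse (c k) * c m)"] by simp
      qed
      then have "(\<Sum>m<k. const_poly (c m) * f' m) = 0" using s by (simp add: const_poly_hom)
      then have "\<forall>m<k. c m = 0" using f' by (simp add: good_def)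
      then show ?thesis using ck by (simp add: less_Suc_eq)
    qed
    then have "good (Suc k) f''" unfolding good_def
      using forms diff same last by (auto simp: le_Suc_eq)
    then show ?case by blast
  qed
  then obtain f' where f': "good l f'" by blast
  show ?thesis
  proof (rule that[of f'])
    fix m e s :: nat assume m: "m < l" and s: "s \<ge> 1"
    have Am: "?A f' m = ?A f m" using f' m by (simp add: good_def)
    note hA = A[OF less_imp_le[OF m]]
    have S': "f' m \<in> polyS l" "f m \<in> polyS l" using f' f[OF m] m by (auto simp: good_def forms_polyS)
    have d: "f' m ^ s - f m ^ s \<in> ?A f m" by (rule hideal_power_diff[OF hA S']) (use f' m in \<open>simp add: good_def\<close>)
    have dp: "f' m ^ s * p - f m ^ s * p \<in> ?A f m" if "p \<in> polyS l" for p
      using hidealD(4)[OF hA that d] by (simp add: algebra_simps)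
    have inj: "f' m ^ s * p \<in> ?A f m \<longleftrightarrow> f m ^ s * p \<in> ?A f m" if "p \<in> polyS l" for p
      using hidealD(8)[OF hA _ dp[OF that], of "f' m ^ s * p"] hidealD(3)[OF hA _ dp[OF that], of "f m ^ s * p"] by auto
    have sur: "q - f m ^ s * p \<in> ?A f m \<Longrightarrow> q - f' m ^ s * p \<in> ?A f m" if "p \<in> polyS l" for p q
      using hidealD(8)[OF hA _ dp[OF that], of "q - f m ^ s * p"] by (simp add: algebra_simps)
    from fr[OF m s, of e]
    show "(\<forall>p\<in>forms l e. f' m ^ s * p \<in> ?A f' m \<longrightarrow> p \<in> ?A f' m) \<or>
      (\<forall>q\<in>forms l (e + s). \<exists>p\<in>forms l e. q - f' m ^ s * p \<in> ?A f' m)"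
    proof
      assume "\<forall>p\<in>forms l e. f m ^ s * p \<in> ?A f m \<longrightarrow> p \<in> ?A f m"
      then have "\<forall>p\<in>forms l e. f' m ^ s * p \<in> ?A f m \<longrightarrow> p \<in> ?A f m" using inj forms_polyS by blast
      then show ?thesis unfolding Am ..
    next
      assume r: "\<forall>q\<in>forms l (e + s). \<exists>p\<in>forms l e. q - f m ^ s * p \<in> ?A f m"
      have "\<exists>p\<in>forms l e. q - f' m ^ s * p \<in> ?A f m" if "q \<in> forms l (e + s)" for q
      proof -
        obtain p where "p \<in> forms l e" "q - f m ^ s * p \<in> ?A f m" using r \<open>q \<in> forms l (e + s)\<close> by blast
        then show ?thesis using sur[of p q] by (auto dest: forms_polyS)
      qed
      then show ?thesis unfolding Am by blast
    qed
  qed (use f' in \<open>auto simp: good_def\<close>)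
qed

lemma k_SLP_coordinates:
  fixes I :: "(nat, 'k::field) mpoly set"
  assumes I: "hideal l I" and S: "k_SLP l (poly_ring l Quot I) (quotient_grading (poly_ring l) (forms l) I)"
  shows "\<exists>g\<in>GL l. \<forall>n<l. \<forall>e. \<forall>s\<ge>1. inj_mult l (act l g ` I) n e s \<or> surj_mult l (act l g ` I) n e s"
proof -
  obtain f where f: "\<And>m. m < l \<Longrightarrow> f m \<in> forms l 1"
    and indep: "\<And>c. (\<Sum>m<l. const_poly (c m) * f m) = 0 \<Longrightarrow> \<forall>m<l. c m = 0"
    and fr: "\<And>m e s. m < l \<Longrightarrow> s \<ge> 1 \<Longrightarrow>
      (\<forall>p\<in>forms l e. f m ^ s * p \<in> add_forms l I f {..<m} \<longrightarrow> p \<in> add_forms l I f {..<m}) \<or>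
      (\<forall>q\<in>forms l (e + s). \<exists>p\<in>forms l e. q - f m ^ s * p \<in> add_forms l I f {..<m})"
    by (rule k_SLP_independent_forms[OF I S]) blast
  \<comment> \<open>The order is reversed: the first Lefschetz element becomes the last variable, so
    that factoring out the earlier elements kills the variables of high index.\<close>
  have "\<exists>g\<in>GL l. \<forall>r<l. act l g (f (l - 1 - r)) = var_poly r"
  proof (rule basis_change)
    fix c assume z: "(\<Sum>r<l. const_poly (c r) * f (l - 1 - r)) = 0"
    have "(\<Sum>r<l. const_poly (c r) * f (l - 1 - r)) = (\<Sum>m<l. const_poly (c (l - 1 - m)) * f m)"
      by (rule sum.reindex_bij_witness[of _ "\<lambda>m. l - 1 - m" "\<lambda>m. l - 1 - m"]) auto
    then have c: "\<forall>m<l. c (l - 1 - m) = 0" using indep[of "\<lambda>m. c (l - 1 - m)"] z by simp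
    show "\<forall>r<l. c r = 0"
    proof (intro allI impI)
      fix r assume "r < l"
      then have "l - 1 - r < l" "l - 1 - (l - 1 - r) = r" by auto
      then show "c r = 0" using c by metis
    qed
  qed (use f in auto)
  then obtain g where g: "g \<in> GL l" "\<And>r. r < l \<Longrightarrow> act l g (f (l - 1 - r)) = var_poly r" by blast
  obtain h where h: "h \<in> GL l" "h * g = 1\<^sub>m l" using g(1) by (rule GL_inverse)
  have gh: "g \<in> carrier_mat l l" "h \<in> carrier_mat l l" using g h by (auto simp: GL_def)
  note gI = hideal_act[OF I g(1)]
  have "inj_mult l (act l g ` I) n e s \<or> surj_mult l (act l g ` I) n e s" if n: "n < l" and s: "s \<ge> 1" for n e s
  proof -
    define m where "m = l - 1 - n"
    have m: "m < l" "n = l - 1 - m" using n by (auto simp: m_def)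
    have gf: "act l g (f j) = var_poly (l - 1 - j)" if "j < l" for j
    proof -
      have "l - 1 - j < l" "l - 1 - (l - 1 - j) = j" using that by auto
      then show ?thesis using g(2)[of "l - 1 - j"] by simp
    qed
    let ?A = "add_forms l I f {..<m}"
    have "act l g ` ?A = add_forms l (act l g ` I) (\<lambda>j. act l g (f j)) {..<m}" by (rule act_add_forms[OF g(1)])
    also have "\<dots> = add_forms l (act l g ` I) var_poly {Suc n..<l}"
    proof (rule add_forms_image_cong[OF gI])
      show "(\<lambda>j. act l g (f j)) ` {..<m} = var_poly ` {Suc n..<l}"
      proof (intro equalityI subsetI)
        fix x assume "x \<in> (\<lambda>j. act l g (f j)) ` {..<m}"
        then obtain j where "j < m" "x = act l g (f j)" by blast
        then have "x = var_poly (l - 1 - j)" "l - 1 - j \<in> {Suc n..<l}" using gf[of j] m by auto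
        then show "x \<in> var_poly ` {Suc n..<l}" by blast
      next
        fix x assume "x \<in> (var_poly ` {Suc n..<l} :: (nat, 'k) mpoly set)"
        then obtain j where "j \<in> {Suc n..<l}" "x = var_poly j" by blast
        then have "x = act l g (f (l - 1 - j))" "l - 1 - j \<in> {..<m}" using g(2)[of j] m by auto
        then show "x \<in> (\<lambda>j. act l g (f j)) ` {..<m}" by blast
      qed
    qed (use f m in \<open>auto intro!: act_forms simp del: One_nat_def intro: var_poly_form\<close>)
    also have "\<dots> = isum (act l g ` I) (highvars l (Suc n))" by (rule isum_highvars_eq_add_forms[OF gI, symmetric])
    finally have img: "act l g ` ?A = isum (act l g ` I) (highvars l (Suc n))" .
    have gv: "act l g (f m) = var_poly n" using gf m by simp
    have ginj: "act l g x \<in> act l g ` ?A \<longleftrightarrow> x \<in> ?A" if "x \<in> polyS l" for x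
    proof
      assume "act l g x \<in> act l g ` ?A"
      then obtain y where y: "y \<in> ?A" "act l g x = act l g y" by blast
      have gh1: "g * h = 1\<^sub>m l" using mat_mult_left_right_inverse[OF gh(2,1) h(2)] .
      have "y \<in> polyS l" using y(1) hidealD(1)[OF hideal_add_forms[OF I, of "{..<m}" f]] f m by auto
      then have "x = y" using act_inverse[OF gh(2,1) gh1] that y(2) by metis
      then show "x \<in> ?A" using y by simp
    qed blast
    from fr[OF m(1) s, of e] show ?thesis
    proof
      assume i: "\<forall>p\<in>forms l e. f m ^ s * p \<in> ?A \<longrightarrow> p \<in> ?A"
      have "p \<in> act l g ` ?A" if p: "p \<in> forms l e" "var_poly n ^ s * p \<in> act l g ` ?A" for p
      proof -
        have pe: "p = act l g (act l h p)" using act_inverse[OF gh h(2)] p(1) by (simp add: forms_polyS)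
        then have "var_poly n ^ s * p = act l g (f m ^ s * act l h p)" by (simp add: act_simps gv)
        then have "f m ^ s * act l h p \<in> ?A" using ginj[of "f m ^ s * act l h p"] p(2) f[OF m(1)]
          by (simp add: polyS_mult polyS_power forms_polyS)
        then have "act l h p \<in> ?A" using i act_forms[OF p(1)] by blast
        then show ?thesis using pe by blast
      qed
      then show ?thesis unfolding inj_mult_def img[symmetric] by blast
    next
      assume r: "\<forall>q\<in>forms l (e + s). \<exists>p\<in>forms l e. q - f m ^ s * p \<in> ?A"
      have "\<exists>p\<in>forms l e. q - var_poly n ^ s * p \<in> act l g ` ?A" if q: "q \<in> forms l (e + s)" for q
      proof -
        obtain p where p: "p \<in> forms l e" "act l h q - f m ^ s * p \<in> ?A" using r act_forms[OF q, of h] by blast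
        have "act l g (act l h q - f m ^ s * p) = q - var_poly n ^ s * act l g p"
          using act_inverse[OF gh h(2)] q by (simp add: act_simps gv forms_polyS)
        then show ?thesis using p act_forms[OF p(1)] by (metis imageI)
      qed
      then show ?thesis unfolding surj_mult_def img[symmetric] by blast
    qed
  qed
  then show ?thesis using g(1) by blast
qed

lemma gin_coordinates:
  fixes I :: "(nat, 'k::field_char_0) mpoly set"
  assumes "is_gin l I J P"
  obtains g where "g \<in> GL l" "ltset (act l g ` I) = J"
  using assms polyfun_GL_nonzero[of l P] unfolding is_gin_def by metis

text \<open>Full rank holds in the Lefschetz coordinates, and \<open>J\<close> dominates the leading
  power-products there while having the same number of them in each degree.\<close>

lemma full_rank_gin:
  fixes I :: "(nat, 'k::field_char_0) mpoly set"
  assumes I: "hideal l I" and S: "k_SLP l (poly_ring l Quot I) (quotient_grading (poly_ring l) (forms l) I)"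
    and J: "is_gin l I J P" and n: "n < l" and s: "s \<ge> 1"
  shows "inj_mons J n i s \<or> surj_mons J n i s"
proof -
  obtain g where g: "g \<in> GL l" "\<And>n e s. n < l \<Longrightarrow> s \<ge> 1 \<Longrightarrow> inj_mult l (act l g ` I) n e s \<or> surj_mult l (act l g ` I) n e s"
    using k_SLP_coordinates[OF I S] by blast
  obtain g1 where g1: "g1 \<in> GL l" "ltset (act l g1 ` I) = J" using J by (rule gin_coordinates)
  note gI = hideal_act[OF I g(1)]
  show ?thesis
  proof (rule full_rank_transfer(2)[of l "ltset (act l g ` I)" J])
    show "upcl l (ltset (act l g ` I))" by (rule ltset_upcl[OF gI])
    show "upcl l J" using J by (simp add: is_gin_def)
    show "card (ltset (act l g ` I) \<inter> mons l d) = card (J \<inter> mons l d)" for d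
      using card_ltset_act[OF I g(1)] card_ltset_act[OF I g1(1)] g1(2) by simp
    show "card (ltset (act l g ` I) \<inter> Y) \<le> card (J \<inter> Y)" if "upper l d Y" for d Y
      using J g(1) that by (auto simp: is_gin_def)
    show "inj_mons (ltset (act l g ` I)) n i s \<or> surj_mons (ltset (act l g ` I)) n i s" if "n < l" "s \<ge> 1" for n i s
      using g(2)[OF that] inj_mons_ltset[OF gI that(1)] surj_mons_ltset[OF gI that(1)] by blast
  qed (use n s in auto)
qed

subsection \<open>The sectional matrix\<close>

lemma card_diff_ltset:
  "card (mons l d - M) = card (mons l d) - card (M \<inter> mons l d)"
  by (simp add: card_Diff_subset_Int Int_commute)

lemma HF_act:
  fixes I :: "(nat, 'k::field) mpoly set"
  assumes "hideal l I" "g \<in> GL l" shows "HF l (act l g ` I) d = HF l I d"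
  using card_ltset_act[OF assms, of d] HF_eq_card[OF assms(1), of d] HF_eq_card[OF hideal_act[OF assms], of d]
  by (simp add: card_diff_ltset)

text \<open>Once the forms are the last variables, the section is a matter of leading power-products
  without these variables.\<close>

lemma HF_section_coordinates:
  fixes I :: "(nat, 'k::field) mpoly set"
  assumes I: "hideal l I" and g: "g \<in> GL l" and nl: "n \<le> l"
    and f: "\<And>k. k < l - n \<Longrightarrow> f k \<in> forms l 1" "\<And>k. k < l - n \<Longrightarrow> act l g (f k) = var_poly (n + k)"
  shows "HF l (add_forms l I f {..<l - n}) d = hfn (ltset (act l g ` I)) n d"
proof -
  note gI = hideal_act[OF I g]
  have A: "hideal l (add_forms l I f {..<l - n})" by (rule hideal_add_forms[OF I]) (use f in auto)
  have "act l g ` add_forms l I f {..<l - n} = add_forms l (act l g ` I) (\<lambda>j. act l g (f j)) {..<l - n}"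
    by (rule act_add_forms[OF g])
  also have "\<dots> = add_forms l (act l g ` I) var_poly {n..<l}"
  proof (rule add_forms_image_cong[OF gI])
    have "{n..<l} = (\<lambda>k. n + k) ` {..<l - n}"
      using nl image_add_atLeastLessThan[of n 0 "l - n"] by (simp add: lessThan_atLeast0)
    then show "(\<lambda>j. act l g (f j)) ` {..<l - n} = var_poly ` {n..<l}"
      using f(2) by (auto simp: image_image intro!: image_cong)
  qed (use f act_forms in \<open>auto simp del: One_nat_def intro: var_poly_form\<close>)
  also have "\<dots> = isum (act l g ` I) (highvars l n)" by (rule isum_highvars_eq_add_forms[OF gI, symmetric])
  finally have "HF l (add_forms l I f {..<l - n}) d = HF l (isum (act l g ` I) (highvars l n)) d"
    using HF_act[OF A g, of d] by simp
  also have "\<dots> = hfn (ltset (act l g ` I)) n d"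
    using HF_eq_card[OF hideal_isum[OF gI hideal_highvars], of n d] mons_isum_highvars[OF gI nl, of d]
    by (simp add: hfn_def)
  finally show ?thesis .
qed

text \<open>The determinant argument of \<open>ltset_act_semicontinuous\<close>, with the
  coefficients of the linear forms as parameters.\<close>

lemma ltset_add_forms_semicontinuous:
  fixes I :: "(nat, 'k::field) mpoly set"
  assumes I: "hideal l I"
  defines "F \<equiv> \<lambda>a k. linear_form l (\<lambda>j. a (k::nat, j))"
  shows "\<exists>\<phi>. polyfun ({..<D} \<times> {..<l}) \<phi> \<and> \<phi> a1 \<noteq> 0 \<and>
    (\<forall>a. \<phi> a \<noteq> 0 \<longrightarrow> card (ltset (add_forms l I (F a1) {..<D}) \<inter> mons l d) \<le> card (ltset (add_forms l I (F a) {..<D}) \<inter> mons l d))"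
proof -
  let ?A = "\<lambda>a. add_forms l I (F a) {..<D}"
  have A: "hideal l (?A a)" for a by (rule hideal_add_forms[OF I]) (simp add: F_def)
  let ?T = "ltset (?A a1) \<inter> mons l d"
  have finT: "finite ?T" by simp
  obtain t where t: "bij_betw t {..<card ?T} ?T"
    using ex_bij_betw_nat_finite[OF finT] by (auto simp: atLeast0LessThan)
  have "\<forall>i\<in>{..<card ?T}. \<exists>qc. fst qc \<in> I \<and> (\<forall>j. snd qc j \<in> polyS l) \<and> lead (fst qc + (\<Sum>j<D. snd qc j * F a1 j)) (t i)"
  proof
    fix i assume "i \<in> {..<card ?T}"
    then have "t i \<in> ltset (?A a1)" using t by (auto simp: bij_betw_def)
    then obtain p where p: "p \<in> ?A a1" "lead p (t i)" by (auto simp: ltset_def)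
    from p(1) obtain q c where "q \<in> I" "\<And>j. c j \<in> polyS l" "p = q + (\<Sum>j<D. c j * F a1 j)" by (rule add_formsE) blast
    then show "\<exists>qc. fst qc \<in> I \<and> (\<forall>j. snd qc j \<in> polyS l) \<and> lead (fst qc + (\<Sum>j<D. snd qc j * F a1 j)) (t i)"
      using p(2) by (intro exI[of _ "(q, c)"]) simp
  qed
  from bchoice[OF this] obtain qc where qc: "\<And>i. i < card ?T \<Longrightarrow> fst (qc i) \<in> I \<and> (\<forall>j. snd (qc i) j \<in> polyS l) \<and>
    lead (fst (qc i) + (\<Sum>j<D. snd (qc i) j * F a1 j)) (t i)" by auto
  define Q where "Q = (\<lambda>i a. fst (qc i) + (\<Sum>j<D. snd (qc i) j * F a j))"
  have Q: "Q i a \<in> ?A a" "lead (Q i a1) (t i)" if "i < card ?T" for i a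
    using qc[OF that] by (auto simp: Q_def intro!: add_formsI)
  have Qfam: "polyfam ({..<D} \<times> {..<l}) (Q i)" for i
    unfolding Q_def F_def by (intro polyfam_add polyfam_const polyfam_sum polyfam_mult polyfam_linear_form polyfun_coord) auto
  let ?f = "\<lambda>a. det (mat (card ?T) (card ?T) (\<lambda>(i, j). lookup (Q j a) (t i)))"
  have pf: "polyfun ({..<D} \<times> {..<l}) ?f"
    by (rule polyfun_det, rule polyfam_lookup, rule Qfam)
  have nz: "?f a1 \<noteq> 0" unfolding det_nonzero_iff
  proof (intro allI impI)
    fix c j assume z: "\<forall>i<card ?T. (\<Sum>j<card ?T. lookup (Q j a1) (t i) * c j) = 0" and j: "j < card ?T"
    have "\<forall>j\<in>{..<card ?T}. c j = 0"
      by (rule lead_family_indep[where p = "\<lambda>j. Q j a1" and t = t])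
        (use Q z t in \<open>auto simp: bij_betw_def\<close>)
    then show "c j = 0" using j by simp
  qed
  have "card ?T \<le> card (ltset (?A a) \<inter> mons l d)" if a: "?f a \<noteq> 0" for a
  proof -
    have "card {..<card ?T} \<le> card (ltset (?A a \<inter> forms l d) \<inter> mons l d)"
    proof (rule indep_le_card_ltset[where p = "\<lambda>j. homogeneous_component d (Q j a)"])
      show "subsp (?A a \<inter> forms l d)" by (rule subsp_hideal_forms[OF A])
      show "homogeneous_component d (Q j a) \<in> ?A a \<inter> forms l d" if "j \<in> {..<card ?T}" for j
        using that Q(1)[of j a] hidealD(1,5)[OF A] homogeneous_component_form by blast
      fix c assume z: "\<And>u. u \<in> mons l d \<Longrightarrow> (\<Sum>j\<in>{..<card ?T}. lookup (homogeneous_component d (Q j a)) u * c j) = 0"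
      have ti: "t i \<in> mons l d" "pp_degree (t i) = d" if "i < card ?T" for i
        using t that by (auto simp: bij_betw_def mons_def)
      have "(\<Sum>j<card ?T. lookup (Q j a) (t i) * c j) = 0" if "i < card ?T" for i
        using z[OF ti(1)[OF that]] ti(2)[OF that] by (simp add: lookup_homogeneous_component)
      then show "\<forall>j\<in>{..<card ?T}. c j = 0" using a unfolding det_nonzero_iff by auto
    qed auto
    then show ?thesis using ltset_inter_forms[OF A, of a d] by (simp add: Int_assoc)
  qed
  then show ?thesis using pf nz by blast
qed

text \<open>Where the linear forms are part of a coordinate system, domination by \<open>J\<close>
  gives one inequality; semicontinuity at a choice taken from generic coordinates gives the
  other.\<close>

lemma sectional_matrix_gin:
  fixes I :: "(nat, 'k::field_char_0) mpoly set"
  assumes I: "hideal l I" and J: "is_gin l I J P" and nl: "n \<le> l"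
  shows "sectional_matrix l I n d = hfn J n d"
proof -
  define D where "D = l - n"
  let ?X = "{..<D} \<times> {..<l}"
  define F where "F = (\<lambda>a k. linear_form l (\<lambda>j. a (k::nat, j) :: 'k))"
  let ?A = "\<lambda>a. add_forms l I (F a) {..<D}"
  have A: "hideal l (?A a)" for a by (rule hideal_add_forms[OF I]) (simp add: F_def)
  have Aeq: "I <+>\<^bsub>poly_ring l\<^esub> genideal (poly_ring l) ((\<lambda>k. linear_form l (\<lambda>j. a (k, j))) ` {..<D}) = ?A a" for a
    using add_forms_eq_sum_genideal[OF I, of "{..<D}" "F a"] by (simp add: F_def)
  obtain g1 where g1: "g1 \<in> GL l" "ltset (act l g1 ` I) = J" using J by (rule gin_coordinates)
  obtain h where h: "h \<in> GL l" "h * g1 = 1\<^sub>m l" using g1(1) by (rule GL_inverse)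
  have hc: "h \<in> carrier_mat l l" using h by (simp add: GL_def)
  \<comment> \<open>The first \<open>n\<close> rows are kept from the generic coordinates and the
    remaining ones carry the parameters; at \<open>a1\<close> the matrix is \<open>h\<close>
    again.\<close>
  define B where "B = (\<lambda>a. mat l l (\<lambda>(r, m). if r < n then h $$ (r, m) else a (r - n, m)))"
  define a1 where "a1 = (\<lambda>(k, m). h $$ (n + k, m))"
  have B1: "B a1 = h" using hc by (intro eq_matI) (auto simp: B_def a1_def)
  have HFB: "HF l (?A a) d = hfn (ltset (act l g ` I)) n d"
    if g: "g \<in> GL l" "B a * g = 1\<^sub>m l" for a g
    unfolding D_def
  proof (rule HF_section_coordinates[OF I g(1) nl])
    fix k assume k: "k < l - n"
    show "F a k \<in> forms l 1" by (simp add: F_def)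
    have "F a k = linear_form l (\<lambda>m. B a $$ (n + k, m))"
      unfolding F_def by (rule linear_form_cong) (use k in \<open>simp add: B_def\<close>)
    then show "act l g (F a k) = var_poly (n + k)"
      using act_row[OF _ _ g(2), of "n + k"] g(1) k by (simp add: B_def GL_def)
  qed
  have HF1: "HF l (?A a1) d = hfn J n d" using HFB[OF g1(1), of a1] h(2) g1(2) by (simp add: B1)
  have ge: "hfn J n d \<le> HF l (?A a) d" if det: "det (B a) \<noteq> 0" for a
  proof -
    have "B a \<in> GL l" using det by (simp add: GL_iff_det B_def)
    then obtain g where g: "g \<in> GL l" "B a * g = 1\<^sub>m l" by (rule GL_inverse)
    have "card (ltset (act l g ` I) \<inter> mons n d) \<le> card (J \<inter> mons n d)"
      using J g(1) upper_mons_le[OF nl, of d] by (auto simp: is_gin_def)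
    then have "hfn J n d \<le> hfn (ltset (act l g ` I)) n d"
      unfolding hfn_def by (rule card_Diff_le_of_Int[OF finite_mons])
    then show ?thesis using HFB[OF g] by simp
  qed
  have pdet: "polyfun ?X (\<lambda>a. det (B a))" unfolding B_def
  proof (rule polyfun_det)
    fix i j assume "i < l" "j < l"
    then show "polyfun ?X (\<lambda>a. if i < n then h $$ (i, j) else a (i - n, j))"
      by (cases "i < n") (auto simp: D_def intro!: polyfun_coord)
  qed
  have d1: "det (B a1) \<noteq> 0" using h(1) by (simp add: B1 GL_iff_det)
  obtain \<phi> where \<phi>: "polyfun ?X \<phi>" "\<phi> a1 \<noteq> 0"
    "\<And>a. \<phi> a \<noteq> 0 \<Longrightarrow> card (ltset (?A a1) \<inter> mons l d) \<le> card (ltset (?A a) \<inter> mons l d)"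
    using ltset_add_forms_semicontinuous[OF I, of D a1 d] unfolding F_def by blast
  have eq: "HF l (?A a) d = hfn J n d" if "det (B a) * \<phi> a \<noteq> 0" for a
  proof -
    have "HF l (?A a) d \<le> HF l (?A a1) d"
      using \<phi>(3)[of a] that by (simp add: HF_eq_card[OF A] card_diff_ltset diff_le_mono2)
    then show ?thesis using ge[of a] HF1 that by simp
  qed
  note pf = polyfun_mult[OF pdet \<phi>(1)]
  show ?thesis unfolding sectional_matrix_def D_def[symmetric] Aeq
  proof (rule the_equality)
    let ?U = "{a \<in> ?X \<rightarrow>\<^sub>E UNIV. det (B a) * \<phi> a \<noteq> 0}"
    have "\<exists>c\<in>?X \<rightarrow>\<^sub>E UNIV. det (B c) * \<phi> c \<noteq> 0"
      using polyfun_common_nonzero[OF pf _ pf, of a1 a1] d1 \<phi>(2) by auto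
    then show "\<exists>U. zariski_open ?X U \<and> U \<noteq> {} \<and> (\<forall>a\<in>U. HF l (?A a) d = hfn J n d)"
      using zariski_open_polyfun[OF pf] eq by (intro exI[of _ ?U]) auto
    fix v assume "\<exists>U. zariski_open ?X U \<and> U \<noteq> {} \<and> (\<forall>a\<in>U. HF l (?A a) d = v)"
    then obtain U a where U: "zariski_open ?X U" "a \<in> U" "\<And>a. a \<in> U \<Longrightarrow> HF l (?A a) d = v" by blast
    obtain f where f: "polyfun ?X f" "f a \<noteq> 0" "\<And>b. b \<in> ?X \<rightarrow>\<^sub>E UNIV \<Longrightarrow> f b \<noteq> 0 \<Longrightarrow> b \<in> U"
      using zariski_openE[OF U(1,2)] by blast
    have "det (B a1) * \<phi> a1 \<noteq> 0" using d1 \<phi>(2) by simp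
    then obtain c where "c \<in> ?X \<rightarrow>\<^sub>E UNIV" "f c \<noteq> 0" "det (B c) * \<phi> c \<noteq> 0"
      using polyfun_common_nonzero[OF f(1,2) pf] by blast
    then show "v = hfn J n d" using U(3)[OF f(3)] eq by auto
  qed
qed

subsection \<open>The Koszul complex\<close>

text \<open>Vectors are total functions that vanish from the rank on. They inherit the pointwise
  group structure, and ranks become side conditions instead of lengths.\<close>

type_synonym 'k pvec = "nat \<Rightarrow> (nat, 'k) mpoly"
type_synonym 'k chain = "bool list \<Rightarrow> 'k pvec"

definition sm :: "(nat, 'k::comm_ring_1) mpoly \<Rightarrow> 'k pvec \<Rightarrow> 'k pvec"
  where "sm p v = (\<lambda>k. p * v k)"

lemma sm_simps:
  "sm p (v + w) = sm p v + sm p w" "sm p (v - w) = sm p v - sm p w" "sm p (- v) = - sm p v" "sm p 0 = 0"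
  "sm p (sm q v) = sm (p * q) v" "sm 0 v = 0" "sm 1 v = v"
  by (auto simp: sm_def fun_eq_iff distrib_left right_diff_distrib mult.assoc)

lemma sm_sum: "sm p (\<Sum>i\<in>A. f i) = (\<Sum>i\<in>A. sm p (f i))"
  using sum_comp_morphism[where h = "sm p" and g = f and A = A, OF sm_simps(4) sm_simps(1)] by (simp only: comp_def)

text \<open>The Koszul complex on the variables \<open>x # xs\<close> is the mapping cone of multiplication by \<open>x\<close> on the complex
  on \<open>xs\<close>. A chain assigns a coefficient to each subset of the variables, encoded as a list of booleans.\<close>

definition ctail :: "bool \<Rightarrow> 'k chain \<Rightarrow> 'k chain"
  where "ctail h c = (\<lambda>b. c (h # b))"

definition cjoin :: "'k::comm_ring_1 chain \<Rightarrow> 'k chain \<Rightarrow> 'k chain"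
  where "cjoin c d = (\<lambda>bs. case bs of [] \<Rightarrow> 0 | h # b \<Rightarrow> if h then d b else c b)"

definition csm :: "(nat, 'k::comm_ring_1) mpoly \<Rightarrow> 'k chain \<Rightarrow> 'k chain"
  where "csm p c = (\<lambda>b. sm p (c b))"

lemma csm_simps:
  "csm p (c + d) = csm p c + csm p d" "csm p (c - d) = csm p c - csm p d" "csm p (- c) = - csm p c" "csm p 0 = 0"
  "csm p (csm q c) = csm (p * q) c" "csm 0 c = 0" "csm 1 c = c"
  by (auto simp: csm_def fun_eq_iff sm_simps[unfolded fun_eq_iff])

lemma ctail_simps [simp]:
  "ctail h (c + d) = ctail h c + ctail h d" "ctail h (c - d) = ctail h c - ctail h d" "ctail h (- c) = - ctail h c"
  "ctail h 0 = 0" "ctail h (csm p c) = csm p (ctail h c)"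
  "ctail False (cjoin c d) = c" "ctail True (cjoin c d) = d"
  by (auto simp: ctail_def csm_def cjoin_def fun_eq_iff)

lemma cjoin_simps:
  "cjoin c d + cjoin c' d' = cjoin (c + c') (d + d')" "cjoin c d - cjoin c' d' = cjoin (c - c') (d - d')"
  "- cjoin c d = cjoin (- c) (- d)" "csm p (cjoin c d) = cjoin (csm p c) (csm p d)" "cjoin 0 0 = 0"
  by (auto simp: csm_def cjoin_def fun_eq_iff sm_def split: list.splits)

primrec kd :: "nat list \<Rightarrow> 'k::comm_ring_1 chain \<Rightarrow> 'k chain" where
  "kd [] c = 0"
| "kd (x # xs) c = cjoin (kd xs (ctail False c) + csm (var_poly x) (ctail True c)) (- kd xs (ctail True c))"

lemma kd_add: "kd xs (c + d) = kd xs c + kd xs d"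
  by (induction xs arbitrary: c d) (auto simp: csm_simps cjoin_simps algebra_simps)

lemma kd_csm: "kd xs (csm p c) = csm p (kd xs c)"
  by (induction xs arbitrary: c) (auto simp: csm_simps cjoin_simps mult.commute)

lemma kd_zero [simp]: "kd xs 0 = 0"
  using kd_csm[of xs 0 0] by (simp only: csm_simps)

lemma kd_uminus: "kd xs (- c) = - kd xs c"
  using kd_csm[of xs "- 1" c] by (simp add: csm_def sm_def fun_Compl_def fun_eq_iff)

lemma kd_diff: "kd xs (c - d) = kd xs c - kd xs d"
  using kd_add[of xs c "- d"] by (simp add: kd_uminus)

lemma kd_sum: "kd xs (\<Sum>i\<in>A. f i) = (\<Sum>i\<in>A. kd xs (f i))"
  using sum_comp_morphism[where h = "kd xs" and g = f and A = A, OF kd_zero kd_add] by (simp only: comp_def)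

lemma csm_sum: "csm p (\<Sum>i\<in>A. f i) = (\<Sum>i\<in>A. csm p (f i))"
  using sum_comp_morphism[where h = "csm p" and g = f and A = A, OF csm_simps(4) csm_simps(1)] by (simp only: comp_def)

text \<open>The minus sign in the second component of the cone makes the mixed terms cancel.\<close>

lemma kd_kd: "kd xs (kd xs c) = 0"
  by (induction xs arbitrary: c) (auto simp: cjoin_simps kd_add kd_csm kd_uminus csm_simps)

section \<open>Graded coefficient modules and exactness of mapping cones\<close>

definition addgrp :: "'m::ab_group_add set \<Rightarrow> bool"
  where "addgrp G \<longleftrightarrow> 0 \<in> G \<and> (\<forall>x\<in>G. \<forall>y\<in>G. x + y \<in> G) \<and> (\<forall>x\<in>G. - x \<in> G)"

lemma addgrpD:
  assumes "addgrp G"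
  shows "0 \<in> G" "x \<in> G \<Longrightarrow> y \<in> G \<Longrightarrow> x + y \<in> G" "x \<in> G \<Longrightarrow> - x \<in> G" "x \<in> G \<Longrightarrow> y \<in> G \<Longrightarrow> x - y \<in> G"
  using assms by (auto simp: addgrp_def diff_conv_add_uminus simp del: add_uminus_conv_diff)

lemma addgrp_sum: "addgrp G \<Longrightarrow> (\<And>i. i \<in> A \<Longrightarrow> f i \<in> G) \<Longrightarrow> sum f A \<in> G"
  by (induction A rule: infinite_finite_induct) (auto intro: addgrpD)

lemma addgrp_zero [simp]: "addgrp {0}"
  by (simp add: addgrp_def)

text \<open>Homological degree is the number of selected variables; the differential lowers it and
  raises the coefficient degree by one.\<close>

definition ch :: "nat \<Rightarrow> nat \<Rightarrow> 'k::comm_ring_1 pvec set \<Rightarrow> 'k chain set"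
  where "ch n p G = {c. \<forall>b. c b \<in> G \<and> (c b \<noteq> 0 \<longrightarrow> length b = n \<and> count_list b True = p)}"

lemma chD: "c \<in> ch n p G \<Longrightarrow> c b \<in> G" "c \<in> ch n p G \<Longrightarrow> c b \<noteq> 0 \<Longrightarrow> length b = n \<and> count_list b True = p"
  by (auto simp: ch_def)

lemma addgrp_ch: "addgrp G \<Longrightarrow> addgrp (ch n p G)"
  unfolding addgrp_def[of "ch n p G"]
proof (intro conjI ballI)
  assume G: "addgrp G"
  show "0 \<in> ch n p G" using addgrpD(1)[OF G] by (auto simp: ch_def)
  fix c assume c: "c \<in> ch n p G"
  show "- c \<in> ch n p G" using c addgrpD(3)[OF G] by (auto simp: ch_def)
  fix d assume d: "d \<in> ch n p G"
  have "(c + d) b \<noteq> 0 \<Longrightarrow> c b \<noteq> 0 \<or> d b \<noteq> 0" for b by auto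
  then show "c + d \<in> ch n p G" using c d addgrpD(2)[OF G] by (auto simp: ch_def)
qed

lemma ch_mono: "G \<subseteq> H \<Longrightarrow> ch n p G \<subseteq> ch n p H"
  by (auto simp: ch_def)

lemma ch_of_values: "c \<in> ch n p G \<Longrightarrow> (\<And>b. c b \<in> H) \<Longrightarrow> c \<in> ch n p H"
  by (auto simp: ch_def)

lemma ch_Suc:
  assumes "addgrp G"
  shows "c \<in> ch (Suc n) (Suc p) G \<longleftrightarrow> c [] = 0 \<and> ctail False c \<in> ch n (Suc p) G \<and> ctail True c \<in> ch n p G"
proof
  assume c: "c \<in> ch (Suc n) (Suc p) G"
  then have "c [] = 0" using chD(2)[OF c, of "[]"] by auto
  moreover have "ctail False c \<in> ch n (Suc p) G" "ctail True c \<in> ch n p G"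
    using chD(1)[OF c] chD(2)[OF c, of "False # _"] chD(2)[OF c, of "True # _"] by (auto simp: ch_def ctail_def)
  ultimately show "c [] = 0 \<and> ctail False c \<in> ch n (Suc p) G \<and> ctail True c \<in> ch n p G" by simp
next
  assume c: "c [] = 0 \<and> ctail False c \<in> ch n (Suc p) G \<and> ctail True c \<in> ch n p G"
  have "c b \<in> G \<and> (c b \<noteq> 0 \<longrightarrow> length b = Suc n \<and> count_list b True = Suc p)" for b
  proof (cases b)
    case Nil then show ?thesis using c addgrpD(1)[OF assms] by simp
  next
    case (Cons h b')
    then show ?thesis
      using chD[of "ctail False c" n "Suc p" G b'] chD[of "ctail True c" n p G b'] c by (cases h) (auto simp: ctail_def)
  qed
  then show "c \<in> ch (Suc n) (Suc p) G" by (simp add: ch_def)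
qed

lemma ch_Suc_0:
  assumes "addgrp G"
  shows "c \<in> ch (Suc n) 0 G \<longleftrightarrow> c [] = 0 \<and> ctail False c \<in> ch n 0 G \<and> ctail True c = 0"
proof
  assume c: "c \<in> ch (Suc n) 0 G"
  then have "c [] = 0" using chD(2)[OF c, of "[]"] by auto
  moreover have "ctail False c \<in> ch n 0 G"
    using chD(1)[OF c] chD(2)[OF c, of "False # _"] by (auto simp: ch_def ctail_def)
  moreover have "ctail True c = 0"
  proof
    fix b show "ctail True c b = 0 b" using chD(2)[OF c, of "True # b"] by (cases "c (True # b) = 0") (simp_all add: ctail_def)
  qed
  ultimately show "c [] = 0 \<and> ctail False c \<in> ch n 0 G \<and> ctail True c = 0" by simp
next
  assume c: "c [] = 0 \<and> ctail False c \<in> ch n 0 G \<and> ctail True c = 0"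
  have "c b \<in> G \<and> (c b \<noteq> 0 \<longrightarrow> length b = Suc n \<and> count_list b True = 0)" for b
  proof (cases b)
    case Nil then show ?thesis using c addgrpD(1)[OF assms] by simp
  next
    case (Cons h b')
    have "ctail True c b' = 0" using c by simp
    then show ?thesis
      using chD[of "ctail False c" n 0 G b'] c addgrpD(1)[OF assms] Cons by (cases h) (auto simp: ctail_def)
  qed
  then show "c \<in> ch (Suc n) 0 G" by (simp add: ch_def)
qed

lemma ctail_cjoin: "c [] = 0 \<Longrightarrow> cjoin (ctail False c) (ctail True c) = c"
  by (auto simp: cjoin_def ctail_def fun_eq_iff split: list.splits)

lemma cjoin_ch: "addgrp G \<Longrightarrow> c \<in> ch n (Suc p) G \<Longrightarrow> d \<in> ch n p G \<Longrightarrow> cjoin c d \<in> ch (Suc n) (Suc p) G"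
  by (simp add: ch_Suc) (simp add: cjoin_def)

lemma cjoin_ch_0: "addgrp G \<Longrightarrow> c \<in> ch n 0 G \<Longrightarrow> cjoin c 0 \<in> ch (Suc n) 0 G"
  by (simp add: ch_Suc_0) (simp add: cjoin_def)

lemma ch_map:
  assumes c: "c \<in> ch n p G" and f: "\<And>v. v \<in> G \<Longrightarrow> f v \<in> H" "f 0 = 0"
  shows "(\<lambda>b. f (c b)) \<in> ch n p H"
  unfolding ch_def
proof (intro CollectI allI conjI impI)
  fix b show "f (c b) \<in> H" using f(1) chD(1)[OF c] by simp
  assume "f (c b) \<noteq> 0"
  then have "c b \<noteq> 0" using f(2) by (cases "c b = 0") simp_all
  then show "length b = n" "count_list b True = p" using chD(2)[OF c] by auto
qed

locale graded_module =
  fixes l :: nat and M :: "int \<Rightarrow> 'k::field pvec set"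
  assumes grp: "\<And>e. addgrp (M e)"
    and var: "\<And>e x v. x < l \<Longrightarrow> v \<in> M e \<Longrightarrow> sm (var_poly x) v \<in> M (e + 1)"
    and scale: "\<And>e c v. v \<in> M e \<Longrightarrow> sm (const_poly c) v \<in> M e"
begin

lemma chgrp: "addgrp (ch n p (M e))"
  by (rule addgrp_ch[OF grp])

lemma csm_var_ch: "x < l \<Longrightarrow> c \<in> ch n p (M e) \<Longrightarrow> csm (var_poly x) c \<in> ch n p (M (e + 1))"
  unfolding csm_def by (rule ch_map[where f = "sm (var_poly x)"]) (rule var sm_simps(4) | assumption)+

lemma csm_const_ch: "c \<in> ch n p (M e) \<Longrightarrow> csm (const_poly a) c \<in> ch n p (M e)"
  unfolding csm_def by (rule ch_map[where f = "sm (const_poly a)"]) (rule scale sm_simps(4) | assumption)+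

lemma kd_ch_0: "set xs \<subseteq> {..<l} \<Longrightarrow> c \<in> ch (length xs) 0 (M e) \<Longrightarrow> kd xs c = 0"
proof (induction xs arbitrary: c)
  case (Cons x xs)
  then have "ctail False c \<in> ch (length xs) 0 (M e)" "ctail True c = 0"
    using ch_Suc_0[OF grp[of e], of c "length xs"] by auto
  moreover have "kd xs (ctail False c) = 0" by (rule Cons.IH) (use Cons.prems calculation in auto)
  ultimately show ?case by (simp only: kd.simps csm_simps cjoin_simps kd_zero add_0 minus_zero)
qed simp

lemma kd_ch: "set xs \<subseteq> {..<l} \<Longrightarrow> c \<in> ch (length xs) (Suc p) (M e) \<Longrightarrow> kd xs c \<in> ch (length xs) p (M (e + 1))"
proof (induction xs arbitrary: c p)
  case Nil
  show ?case unfolding kd.simps by (rule addgrpD(1)[OF chgrp])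
next
  case (Cons x xs)
  have c: "ctail False c \<in> ch (length xs) (Suc p) (M e)" "ctail True c \<in> ch (length xs) p (M e)"
    using ch_Suc[OF grp[of e], of c "length xs" p] Cons.prems by auto
  have 1: "kd xs (ctail False c) + csm (var_poly x) (ctail True c) \<in> ch (length xs) p (M (e + 1))"
    using Cons.IH[OF _ c(1)] csm_var_ch[OF _ c(2), of x] Cons.prems by (intro addgrpD(2)[OF chgrp]) auto
  show ?case
  proof (cases p)
    case 0
    then have "kd xs (ctail True c) = 0" using kd_ch_0[of xs "ctail True c" e] c(2) Cons.prems by simp
    then show ?thesis using cjoin_ch_0[OF grp, of _ "length xs" "e + 1"] 1 0 by simp
  next
    case (Suc q)
    have "- kd xs (ctail True c) \<in> ch (length xs) q (M (e + 1))"
      using Cons.IH[of "ctail True c" q] c(2) Cons.prems Suc by (intro addgrpD(3)[OF chgrp]) auto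
    then show ?thesis using cjoin_ch[OF grp, of _ "length xs" q "e + 1"] 1 Suc by simp
  qed
qed

end

text \<open>Exactness at homological degree \<open>p\<close> and coefficient degree \<open>e\<close> of the Koszul complex of the quotient \<open>M/N\<close>,
  expressed with representatives in \<open>M\<close>.\<close>

definition acyc :: "nat list \<Rightarrow> (int \<Rightarrow> 'k::field pvec set) \<Rightarrow> (int \<Rightarrow> 'k pvec set) \<Rightarrow> nat \<Rightarrow> int \<Rightarrow> bool"
  where "acyc xs M N p e \<longleftrightarrow> (\<forall>c\<in>ch (length xs) p (M e). (\<forall>b. kd xs c b \<in> N (e + 1)) \<longrightarrow>
    (\<exists>d\<in>ch (length xs) (Suc p) (M (e - 1)). \<forall>b. (c - kd xs d) b \<in> N e))"

text \<open>Injectivity of variable \<open>x\<close> in degree \<open>e\<close> on the homology in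
  degree 0 of the complex on \<open>xs\<close>, that is, on \<open>M\<close> modulo \<open>N\<close>
  and the multiples of the variables \<open>xs\<close>.\<close>

definition regular0 :: "nat \<Rightarrow> nat list \<Rightarrow> (int \<Rightarrow> 'k::field pvec set) \<Rightarrow> (int \<Rightarrow> 'k pvec set) \<Rightarrow> int \<Rightarrow> bool"
  where "regular0 x xs M N e \<longleftrightarrow> (\<forall>z\<in>ch (length xs) 0 (M e). \<forall>w\<in>ch (length xs) 1 (M e).
    (\<forall>b. (csm (var_poly x) z - kd xs w) b \<in> N (e + 1)) \<longrightarrow>
    (\<exists>d\<in>ch (length xs) 1 (M (e - 1)). \<forall>b. (z - kd xs d) b \<in> N e))"

locale graded_pair = M: graded_module l M + N: graded_module l N
  for l and M N :: "int \<Rightarrow> 'k::field pvec set"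
begin

text \<open>The relation makes the pair of \<open>- w\<close> and \<open>z\<close> a cycle of the
  mapping cone modulo \<open>N\<close>; up to sign, the \<open>x\<close> component of a chain
  bounding it bounds \<open>z\<close>.\<close>

lemma cone_core:
  assumes x: "x < l" "set xs \<subseteq> {..<l}" and ac: "acyc (x # xs) M N (Suc p) e"
    and z: "z \<in> ch (length xs) p (M e)" "\<And>b. kd xs z b \<in> N (e + 1)"
    and w: "w \<in> ch (length xs) (Suc p) (M e)" "\<And>b. (csm (var_poly x) z - kd xs w) b \<in> N (e + 1)"
  shows "\<exists>d\<in>ch (length xs) (Suc p) (M (e - 1)). \<forall>b. (z - kd xs d) b \<in> N e"
proof -
  let ?c = "cjoin (- w) z"
  have c: "?c \<in> ch (length (x # xs)) (Suc p) (M e)"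
    using cjoin_ch[OF M.grp addgrpD(3)[OF M.chgrp w(1)] z(1)] by simp
  have kc: "kd (x # xs) ?c = cjoin (csm (var_poly x) z - kd xs w) (- kd xs z)"
    by (simp add: kd_uminus)
  have "kd (x # xs) ?c b \<in> N (e + 1)" for b
    unfolding kc using w(2) addgrpD(3)[OF N.grp z(2)] addgrpD(1)[OF N.grp]
    by (auto simp: cjoin_def split: list.splits)
  then obtain d where d: "d \<in> ch (length (x # xs)) (Suc (Suc p)) (M (e - 1))" "\<And>b. (?c - kd (x # xs) d) b \<in> N e"
    using ac c unfolding acyc_def by blast
  have d1: "ctail True d \<in> ch (length xs) (Suc p) (M (e - 1))"
    using d(1) ch_Suc[OF M.grp[of "e - 1"], of d "length xs" "Suc p"] by simp
  have "(z - kd xs (- ctail True d)) b \<in> N e" for b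
    using d(2)[of "True # b"] by (simp add: cjoin_def kd_uminus)
  then show ?thesis using addgrpD(3)[OF M.chgrp d1] by blast
qed

text \<open>A cycle \<open>z\<close> in degree \<open>e - 1\<close> becomes, after multiplication by
  \<open>x\<close>, a cycle in degree \<open>e\<close>. There exactness is already known, and the
  resulting relation feeds \<open>cone_core\<close>.\<close>

lemma acyc_down:
  assumes x: "x < l" "set xs \<subseteq> {..<l}" and p: "p \<ge> 1"
    and ac: "\<And>e. e \<ge> e0 \<Longrightarrow> acyc (x # xs) M N (Suc p) e"
    and large: "\<And>e. e \<ge> E \<Longrightarrow> acyc xs M N p e"
    and e: "e \<ge> e0"
  shows "acyc xs M N p e"
proof (cases "e \<ge> E")
  case True then show ?thesis by (rule large)
next
  case False
  then have "e \<le> E" by simp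
  then show ?thesis using e
  proof (induction e rule: int_le_induct)
    case base
    show ?case using large by simp
  next
    case (step e)
    have IH: "acyc xs M N p e" using step by simp
    show ?case unfolding acyc_def
    proof (intro ballI impI)
      fix z assume z: "z \<in> ch (length xs) p (M (e - 1))" "\<forall>b. kd xs z b \<in> N (e - 1 + 1)"
      have Xz: "csm (var_poly x) z \<in> ch (length xs) p (M e)" using M.csm_var_ch[OF x(1) z(1)] by simp
      have "kd xs (csm (var_poly x) z) b \<in> N (e + 1)" for b
        using N.var[OF x(1), of "kd xs z b" e] z(2) unfolding kd_csm by (simp add: csm_def)
      then obtain w where "w \<in> ch (length xs) (Suc p) (M (e - 1))" "\<forall>b. (csm (var_poly x) z - kd xs w) b \<in> N e"
        using IH Xz unfolding acyc_def by blast
      then show "\<exists>d\<in>ch (length xs) (Suc p) (M (e - 1 - 1)). \<forall>b. (z - kd xs d) b \<in> N (e - 1)"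
        using cone_core[OF x ac[of "e - 1"] z(1), of w] z(2) step.prems by simp
    qed
  qed
qed

lemma regular0_of_acyc:
  assumes x: "x < l" "set xs \<subseteq> {..<l}" and ac: "acyc (x # xs) M N 1 e"
  shows "regular0 x xs M N e"
  unfolding regular0_def
proof (intro ballI impI)
  fix z w assume z: "z \<in> ch (length xs) 0 (M e)" and w: "w \<in> ch (length xs) 1 (M e)"
    "\<forall>b. (csm (var_poly x) z - kd xs w) b \<in> N (e + 1)"
  have "kd xs z b \<in> N (e + 1)" for b
    using M.kd_ch_0[OF x(2) z] addgrpD(1)[OF N.grp] by simp
  then show "\<exists>d\<in>ch (length xs) 1 (M (e - 1)). \<forall>b. (z - kd xs d) b \<in> N e"
    using cone_core[OF x, of 0 e z w] ac z w by simp
qed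

text \<open>The other direction of the long exact sequence of the cone: the \<open>x\<close>
  component of a cycle is bounded first, by exactness or by regularity, and the corrected remaining
  component is then a cycle on \<open>xs\<close>.\<close>

lemma acyc_up:
  assumes x: "x < l" "set xs \<subseteq> {..<l}" and p: "p \<ge> 1"
    and ac: "\<And>p. p \<ge> 1 \<Longrightarrow> acyc xs M N p e"
    and reg: "regular0 x xs M N e"
  shows "acyc (x # xs) M N p e"
  unfolding acyc_def
proof (intro ballI impI)
  fix c assume c: "c \<in> ch (length (x # xs)) p (M e)" "\<forall>b. kd (x # xs) c b \<in> N (e + 1)"
  obtain q where q: "p = Suc q" using p by (cases p) auto
  let ?c0 = "ctail False c" and ?c1 = "ctail True c"
  have c01: "c [] = 0" "?c0 \<in> ch (length xs) p (M e)" "?c1 \<in> ch (length xs) q (M e)"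
    using c(1) ch_Suc[OF M.grp[of e], of c "length xs" q] q by auto
  have k0: "(kd xs ?c0 + csm (var_poly x) ?c1) b \<in> N (e + 1)" and k1: "kd xs ?c1 b \<in> N (e + 1)" for b
    using spec[OF c(2), of "False # b"] addgrpD(3)[OF N.grp, of "kd (x # xs) c (True # b)"] spec[OF c(2), of "True # b"]
    by (auto simp: cjoin_def)
  have "\<exists>d1\<in>ch (length xs) p (M (e - 1)). \<forall>b. (?c1 - kd xs d1) b \<in> N e"
  proof (cases q)
    case 0
    have "- ?c0 \<in> ch (length xs) 1 (M e)" using addgrpD(3)[OF M.chgrp c01(2)] q 0 by simp
    moreover have "(csm (var_poly x) ?c1 - kd xs (- ?c0)) b \<in> N (e + 1)" for b
      using k0[of b] by (simp add: kd_uminus add.commute)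
    ultimately show ?thesis using reg c01(3) q 0 unfolding regular0_def by simp blast
  next
    case (Suc q')
    then show ?thesis using ac[of q] c01(3) k1 q unfolding acyc_def by auto
  qed
  then obtain d1 where d1: "d1 \<in> ch (length xs) p (M (e - 1))" "\<And>b. (?c1 - kd xs d1) b \<in> N e" by blast
  define c0' where "c0' = ?c0 + csm (var_poly x) d1"
  have "csm (var_poly x) d1 \<in> ch (length xs) p (M e)" using M.csm_var_ch[OF x(1) d1(1)] by simp
  then have c0': "c0' \<in> ch (length xs) p (M e)" unfolding c0'_def by (rule addgrpD(2)[OF M.chgrp c01(2)])
  have "kd xs c0' b \<in> N (e + 1)" for b
  proof -
    have "kd xs c0' = (kd xs ?c0 + csm (var_poly x) ?c1) - csm (var_poly x) (?c1 - kd xs d1)"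
      by (simp add: c0'_def kd_add kd_csm csm_simps)
    moreover have "csm (var_poly x) (?c1 - kd xs d1) b \<in> N (e + 1)"
      using N.var[OF x(1) d1(2)[of b]] by (simp add: csm_def)
    ultimately show ?thesis using addgrpD(4)[OF N.grp k0[of b]] by simp
  qed
  then obtain d0 where d0: "d0 \<in> ch (length xs) (Suc p) (M (e - 1))" "\<And>b. (c0' - kd xs d0) b \<in> N e"
    using ac[OF p] c0' unfolding acyc_def by blast
  let ?d = "cjoin d0 (- d1)"
  have "?d \<in> ch (length (x # xs)) (Suc p) (M (e - 1))"
    using cjoin_ch[OF M.grp d0(1) addgrpD(3)[OF M.chgrp d1(1)]] by simp
  moreover have "(c - kd (x # xs) ?d) b \<in> N e" for b
  proof -
    have "cjoin ?c0 ?c1 - kd (x # xs) ?d = cjoin (c0' - kd xs d0) (?c1 - kd xs d1)"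
      by (simp add: cjoin_simps kd_uminus csm_simps c0'_def algebra_simps)
    then have "c - kd (x # xs) ?d = cjoin (c0' - kd xs d0) (?c1 - kd xs d1)"
      by (simp only: ctail_cjoin[of c, OF c01(1)])
    then show ?thesis using d0(2) d1(2) addgrpD(1)[OF N.grp] by (auto simp: cjoin_def split: list.splits)
  qed
  ultimately show "\<exists>d\<in>ch (length (x # xs)) (Suc p) (M (e - 1)). \<forall>b. (c - kd (x # xs) d) b \<in> N e" by blast
qed

lemma acyc_Nil: "p \<ge> 1 \<Longrightarrow> acyc [] M N p e"
  unfolding acyc_def
proof (intro ballI impI)
  fix c assume p: "p \<ge> 1" and c: "c \<in> ch (length []) p (M e)"
  have "c = 0"
  proof
    fix b show "c b = 0 b" using chD(2)[OF c, of b] p by (cases "c b = 0") auto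
  qed
  then show "\<exists>d\<in>ch (length []) (Suc p) (M (e - 1)). \<forall>b. (c - kd [] d) b \<in> N e"
    using addgrpD(1)[OF M.chgrp] addgrpD(1)[OF N.grp] by (intro bexI[of _ 0]) auto
qed

text \<open>The complex is built up from the end of the list, and \<open>ys\<close> is the part
  present when \<open>x\<close> is added. The hypothesis thus says that the variables, read
  backwards, form a regular sequence in degree \<open>e\<close>.\<close>

lemma acyc_of_regular:
  assumes "set xs \<subseteq> {..<l}" "p \<ge> 1" "\<And>x ys zs. xs = zs @ x # ys \<Longrightarrow> regular0 x ys M N e"
  shows "acyc xs M N p e"
  using assms
proof (induction xs arbitrary: p)
  case Nil then show ?case using acyc_Nil by simp
next
  case (Cons x xs)
  show ?case
  proof (rule acyc_up)
    show "regular0 x xs M N e" using Cons.prems(3)[of "[]" x xs] by simp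
    show "acyc xs M N p e" if "p \<ge> 1" for p
      using Cons.IH[OF _ that] Cons.prems by (metis append_Cons insert_subset list.simps(15))
  qed (use Cons.prems in auto)
qed

end

text \<open>The chain of homological degree 0: it is carried by the empty subset of the
  variables.\<close>

definition cbase :: "nat \<Rightarrow> 'k::comm_ring_1 pvec \<Rightarrow> 'k chain"
  where "cbase n v = (\<lambda>b. if b = replicate n False then v else 0)"

lemma count_list_True_0: "count_list b True = 0 \<longleftrightarrow> b = replicate (length b) False"
  by (induction b) auto

lemma cbase_ch: "addgrp G \<Longrightarrow> v \<in> G \<Longrightarrow> cbase n v \<in> ch n 0 G"
  using count_list_True_0[of "replicate n False"] by (auto simp: cbase_def ch_def addgrp_def)

lemma ch_0_cbase: "c \<in> ch n 0 G \<Longrightarrow> c = cbase n (c (replicate n False))"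
  using count_list_True_0 by (fastforce simp: ch_def cbase_def fun_eq_iff)

lemma cbase_simps:
  "cbase n (v + w) = cbase n v + cbase n w" "cbase n (v - w) = cbase n v - cbase n w"
  "csm p (cbase n v) = cbase n (sm p v)" "cbase n 0 = 0" "cbase n v (replicate n False) = v"
  by (auto simp: cbase_def fun_eq_iff csm_def sm_def)

lemma cbase_sum: "cbase n (\<Sum>i\<in>A. f i) = (\<Sum>i\<in>A. cbase n (f i))"
  using sum_comp_morphism[where h = "cbase n" and g = f and A = A, OF cbase_simps(4) cbase_simps(1)] by (simp only: comp_def)

subsection \<open>Graded free modules\<close>

text \<open>Integer degrees let the shifts of free modules go below 0, where the graded piece is
  zero.\<close>

definition formsZ :: "nat \<Rightarrow> int \<Rightarrow> (nat, 'k::comm_ring_1) mpoly set"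
  where "formsZ l d = (if d < 0 then {0} else forms l (nat d))"

definition fm :: "nat \<Rightarrow> nat \<Rightarrow> (nat \<Rightarrow> nat) \<Rightarrow> int \<Rightarrow> 'k::comm_ring_1 pvec set"
  where "fm l r a e = {v. \<forall>k. v k \<in> formsZ l (e - int (a k)) \<and> (r \<le> k \<longrightarrow> v k = 0)}"

lemma formsZ_zero [simp]: "0 \<in> formsZ l d"
  by (simp add: formsZ_def)

lemma formsZ_add: "p \<in> formsZ l d \<Longrightarrow> q \<in> formsZ l d \<Longrightarrow> p + q \<in> formsZ l d"
  by (auto simp: formsZ_def split: if_splits)

lemma formsZ_uminus: "p \<in> formsZ l d \<Longrightarrow> - p \<in> formsZ l d"
  by (auto simp: formsZ_def split: if_splits)

lemma formsZ_sum: "(\<And>i. i \<in> A \<Longrightarrow> f i \<in> formsZ l d) \<Longrightarrow> sum f A \<in> formsZ l d"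
  by (induction A rule: infinite_finite_induct) (auto intro: formsZ_add)

lemma formsZ_mult: "p \<in> formsZ l d \<Longrightarrow> q \<in> formsZ l e \<Longrightarrow> p * q \<in> formsZ l (d + e)"
  using forms_mult[of p l "nat d" q "nat e"] by (auto simp: formsZ_def nat_add_distrib split: if_splits)

lemma formsZ_of_nat [simp]: "formsZ l (int d) = forms l d"
  by (simp add: formsZ_def)

lemma formsZ_polyS: "p \<in> formsZ l d \<Longrightarrow> p \<in> polyS l"
  by (auto simp: formsZ_def dest: forms_polyS split: if_splits)

lemma var_formsZ: "x < l \<Longrightarrow> var_poly x \<in> formsZ l 1"
  using var_poly_form[of x l] by (simp add: formsZ_def)

lemma const_formsZ: "const_poly c \<in> formsZ l 0"
  using forms_const[of c l] by (simp add: formsZ_def)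

lemma formsZ_keys: "p \<in> formsZ l d \<Longrightarrow> t \<in> keys p \<Longrightarrow> t \<in> pps l \<and> int (pp_degree t) = d"
  by (auto simp: formsZ_def forms_iff mons_def split: if_splits)

lemma formsZ_iff: "p \<in> formsZ l d \<longleftrightarrow> (\<forall>t\<in>keys p. t \<in> pps l \<and> int (pp_degree t) = d)"
proof
  assume h: "\<forall>t\<in>keys p. t \<in> pps l \<and> int (pp_degree t) = d"
  show "p \<in> formsZ l d"
  proof (cases "d < 0")
    case True
    then have "keys p = {}" using h by force
    then show ?thesis using True by (simp add: formsZ_def)
  next
    case False
    then show ?thesis using h by (force simp: formsZ_def forms_iff mons_def)
  qed
qed (use formsZ_keys in blast)

definition hcZ :: "int \<Rightarrow> ('x, 'k::comm_ring_1) mpoly \<Rightarrow> ('x, 'k) mpoly"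
  where "hcZ d p = (if d < 0 then 0 else homogeneous_component (nat d) p)"

lemma hcZ_formsZ: "p \<in> polyS l \<Longrightarrow> hcZ d p \<in> formsZ l d"
  by (simp add: hcZ_def formsZ_def homogeneous_component_form)

lemma lookup_hcZ: "lookup (hcZ d p) t = (if int (pp_degree t) = d then lookup p t else 0)"
  by (auto simp: hcZ_def lookup_homogeneous_component)

lemma hcZ_sum: "hcZ d (sum f A) = (\<Sum>i\<in>A. hcZ d (f i))"
  by (simp add: hcZ_def homogeneous_component_sum)

lemma hcZ_of_form: "p \<in> formsZ l d \<Longrightarrow> hcZ d p = p"
  by (rule poly_mapping_eqI) (auto simp: lookup_hcZ formsZ_iff in_keys_iff)

lemma hcZ_mult:
  fixes p q :: "(nat, 'k::comm_ring_1) mpoly"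
  assumes p: "p \<in> polyS l" and q: "q \<in> formsZ l f"
  shows "hcZ d (q * p) = q * hcZ (d - f) p"
proof (cases "f < 0")
  case True
  then have "q = 0" using q by (simp add: formsZ_def)
  then show ?thesis by (simp add: hcZ_def)
next
  case False
  then have q': "q \<in> forms l (nat f)" using q by (simp add: formsZ_def)
  show ?thesis
  proof (cases "d < f")
    case True
    then show ?thesis using homogeneous_component_mult_form(2)[OF p q', of "nat d"] False
      by (auto simp: hcZ_def mult.commute)
  next
    case df: False
    then have "nat d = nat (d - f) + nat f" using False by simp
    then show ?thesis using homogeneous_component_mult_form(1)[OF p q', of "nat (d - f)"] False df
      by (simp add: hcZ_def mult.commute)
  qed
qed

lemma addgrp_fm: "addgrp (fm l r a e)"
  unfolding addgrp_def by (auto simp: fm_def formsZ_add formsZ_uminus)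

lemma fm_graded: "graded_module l (fm l r a :: int \<Rightarrow> 'k::field pvec set)"
proof
  show "addgrp (fm l r a e :: 'k pvec set)" for e by (rule addgrp_fm)
  show "sm (var_poly x) v \<in> fm l r a (e + 1)" if "x < l" "v \<in> fm l r a e" for e x and v :: "'k pvec"
  proof -
    have "var_poly x * v k \<in> formsZ l (e + 1 - int (a k))" for k
      using formsZ_mult[OF var_formsZ[OF that(1)], of "v k" "e - int (a k)"] that(2) by (simp add: fm_def algebra_simps)
    then show ?thesis using that(2) by (simp add: fm_def sm_def)
  qed
  show "sm (const_poly c) v \<in> fm l r a e" if "v \<in> fm l r a e" for e c and v :: "'k pvec"
  proof -
    have "const_poly c * v k \<in> formsZ l (e - int (a k))" for k
      using formsZ_mult[OF const_formsZ, of "v k" l "e - int (a k)" c] that by (simp add: fm_def)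
    then show ?thesis using that by (simp add: fm_def sm_def)
  qed
qed

definition divx :: "nat \<Rightarrow> (nat, 'k::comm_ring_1) mpoly \<Rightarrow> (nat, 'k) mpoly"
  where "divx x p = (\<Sum>t\<in>{t \<in> keys p. lookup t x > 0}. single (t - single x 1) (lookup p t))"

lemma lookup_var_divx: "lookup (var_poly x * divx x p) t = (if lookup t x > 0 then lookup p t else 0)"
proof -
  have "var_poly x * divx x p = (\<Sum>t\<in>{t \<in> keys p. lookup t x > 0}. single t (lookup p t))"
    unfolding divx_def sum_distrib_left
  proof (rule sum.cong)
    fix t assume t: "t \<in> {t \<in> keys p. lookup t x > 0}"
    then have "t - single x 1 + single x 1 = t" by (intro pp_split[symmetric]) simp
    then show "var_poly x * single (t - single x 1) (lookup p t) = single t (lookup p t)"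
      by (simp add: var_poly_def mult_single add.commute)
  qed simp
  then show ?thesis by (auto simp: lookup_sum lookup_single when_def in_keys_iff)
qed

lemma divx_formsZ: "p \<in> formsZ l (d + 1) \<Longrightarrow> divx x p \<in> formsZ l d"
  unfolding divx_def
proof (rule formsZ_sum)
  fix t assume p: "p \<in> formsZ l (d + 1)" and t: "t \<in> {t \<in> keys p. lookup t x > 0}"
  then have eq: "t = t - single x 1 + single x 1" by (intro pp_split) simp
  have "t \<in> pps l" "int (pp_degree t) = d + 1" using formsZ_keys[OF p] t by auto
  moreover from this have "t - single x 1 \<in> pps l" by (subst (asm) eq) simp
  moreover have "pp_degree t = pp_degree (t - single x 1) + 1" using arg_cong[OF eq, of pp_degree] by simp
  ultimately show "single (t - single x 1) (lookup p t) \<in> formsZ l d" by (auto simp: formsZ_iff)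
qed

text \<open>Together with \<open>kd_base_image\<close> this identifies the boundaries in homological
  degree 0 with the vectors over the ideal generated by the variables \<open>xs\<close>.\<close>

lemma kd_base_keys:
  fixes w :: "'k::field chain"
  shows "t \<in> keys (kd xs w (replicate (length xs) False) k) \<Longrightarrow> \<exists>x\<in>set xs. lookup t x > 0"
proof (induction xs arbitrary: w)
  case (Cons x xs)
  let ?F = "replicate (length xs) False"
  have "kd (x # xs) w (replicate (length (x # xs)) False) k =
      kd xs (ctail False w) ?F k + var_poly x * ctail True w ?F k"
    by (simp add: cjoin_def csm_def sm_def)
  then have "t \<in> keys (kd xs (ctail False w) ?F k) \<or> t \<in> keys (var_poly x * ctail True w ?F k)"
    using Cons.prems Poly_Mapping.keys_add by fastforce
  then show ?case
  proof
    assume "t \<in> keys (var_poly x * ctail True w ?F k)"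
    then obtain u where "t = single x 1 + u"
      using keys_single_times[of "single x 1" "1::'k" "ctail True w ?F k"] by (auto simp: var_poly_def)
    then show ?thesis by (intro bexI[of _ x]) (auto simp: lookup_add)
  qed (use Cons.IH in auto)
qed simp

lemma cjoin_cbase: "cjoin (cbase n v) 0 = cbase (Suc n) v"
  by (auto simp: cjoin_def cbase_def fun_eq_iff split: list.splits)

lemma kd_cbase: "kd xs (cbase (length xs) v) = 0"
proof (induction xs)
  case (Cons x xs)
  have "ctail False (cbase (Suc (length xs)) v) = cbase (length xs) v" "ctail True (cbase (Suc (length xs)) v) = 0"
    unfolding cjoin_cbase[symmetric] by simp_all
  then show ?case using Cons by (simp only: kd.simps length_Cons csm_simps kd_zero add_0 minus_zero cjoin_simps)
qed simp

lemma kd_base_image: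
  fixes v :: "'k::field pvec"
  assumes "set xs \<subseteq> {..<l}" "v \<in> fm l r a (e + 1)" "\<And>k t. t \<in> keys (v k) \<Longrightarrow> \<exists>x\<in>set xs. lookup t x > 0"
  shows "\<exists>w\<in>ch (length xs) 1 (fm l r a e). kd xs w = cbase (length xs) v"
  using assms
proof (induction xs arbitrary: v)
  case Nil
  then have "keys (v k) = {}" for k by fastforce
  then have "v = 0" by (auto simp: fun_eq_iff)
  then have "cbase 0 v = 0" by (simp only: cbase_simps)
  then show ?case using addgrpD(1)[OF addgrp_ch[OF addgrp_fm], of 0 1 l r a e] by (intro bexI[of _ 0]) (simp only: kd.simps list.size, simp)
next
  case (Cons x xs)
  define u where "u = (\<lambda>k. divx x (v k))"
  \<comment> \<open>The terms divisible by variable \<open>x\<close> are split off; those left over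
    are covered by the remaining variables.\<close>
  define v2 where "v2 = v - sm (var_poly x) u"
  have u: "u \<in> fm l r a e" unfolding fm_def
  proof (intro CollectI allI conjI impI)
    fix k
    have "v k \<in> formsZ l ((e - int (a k)) + 1)" using Cons.prems(2) by (simp add: fm_def algebra_simps)
    then show "u k \<in> formsZ l (e - int (a k))" unfolding u_def by (rule divx_formsZ)
    show "u k = 0" if "r \<le> k" using Cons.prems(2) that by (simp add: fm_def u_def divx_def)
  qed
  have xu: "sm (var_poly x) u \<in> fm l r a (e + 1)"
    using graded_module.var[OF fm_graded _ u, of x] Cons.prems(1) by simp
  have v2: "v2 \<in> fm l r a (e + 1)" unfolding v2_def by (rule addgrpD(4)[OF addgrp_fm Cons.prems(2) xu])
  have l2: "lookup (v2 k) t = (if lookup t x > 0 then 0 else lookup (v k) t)" for k t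
    by (simp add: v2_def sm_def lookup_minus u_def lookup_var_divx)
  have "\<exists>y\<in>set xs. lookup t y > 0" if t: "t \<in> keys (v2 k)" for k t
  proof -
    have "t \<in> keys (v k)" "lookup t x = 0" using t by (auto simp: in_keys_iff l2 split: if_splits)
    then show ?thesis using Cons.prems(3)[of t k] by auto
  qed
  then obtain w0 where w0: "w0 \<in> ch (length xs) 1 (fm l r a e)" "kd xs w0 = cbase (length xs) v2"
    using Cons.IH[OF _ v2] Cons.prems(1) by auto
  let ?w = "cjoin w0 (cbase (length xs) u)"
  have "?w \<in> ch (length (x # xs)) 1 (fm l r a e)"
    using cjoin_ch[OF addgrp_fm, of w0 "length xs" 0] w0(1) cbase_ch[OF addgrp_fm u] by simp
  moreover have "kd (x # xs) ?w = cbase (length (x # xs)) v"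
  proof -
    have "kd (x # xs) ?w = cjoin (cbase (length xs) v2 + csm (var_poly x) (cbase (length xs) u)) 0"
      by (simp only: kd.simps ctail_simps w0(2) kd_cbase minus_zero)
    also have "cbase (length xs) v2 + csm (var_poly x) (cbase (length xs) u) = cbase (length xs) (v2 + sm (var_poly x) u)"
      by (simp only: cbase_simps)
    also have "v2 + sm (var_poly x) u = v" by (simp add: v2_def)
    finally show ?thesis by (simp only: cjoin_cbase length_Cons)
  qed
  ultimately show ?case by blast
qed

lemma zero_graded: "graded_module l (\<lambda>_. {0 :: 'k::field pvec})"
  by standard (simp_all add: sm_simps)

text \<open>Distinct variables form a regular sequence on a free module: membership in the ideal of
  \<open>ys\<close> is decided term by term, and multiplying a term by a variable outside
  \<open>ys\<close> does not change it.\<close>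

lemma fm_acyc:
  assumes xs: "set xs \<subseteq> {..<l}" "distinct xs" and p: "p \<ge> 1"
  shows "acyc xs (fm l r a :: int \<Rightarrow> 'k::field pvec set) (\<lambda>_. {0}) p e"
proof -
  interpret graded_pair l "fm l r a :: int \<Rightarrow> 'k pvec set" "\<lambda>_. {0}"
    using fm_graded zero_graded by (rule graded_pair.intro)
  show ?thesis
  proof (rule acyc_of_regular[OF xs(1) p])
    fix x ys zs assume xe: "xs = zs @ x # ys"
    have xys: "x \<notin> set ys" "x < l" "set ys \<subseteq> {..<l}" using xs xe by auto
    show "regular0 x ys (fm l r a :: int \<Rightarrow> 'k pvec set) (\<lambda>_. {0}) e" unfolding regular0_def
    proof (intro ballI impI)
      fix z w :: "'k chain"
      let ?F = "replicate (length ys) False"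
      assume z: "z \<in> ch (length ys) 0 (fm l r a e)" and w: "w \<in> ch (length ys) 1 (fm l r a e)"
        "\<forall>b. (csm (var_poly x) z - kd ys w) b \<in> {0}"
      define z0 where "z0 = z ?F"
      have zz: "z = cbase (length ys) z0" unfolding z0_def by (rule ch_0_cbase[OF z])
      have z0: "z0 \<in> fm l r a e" unfolding z0_def by (rule chD(1)[OF z])
      have eq: "var_poly x * z0 k = kd ys w ?F k" for k
      proof -
        have "(csm (var_poly x) z - kd ys w) ?F = 0" using w(2) by simp
        then have "(csm (var_poly x) z - kd ys w) ?F k = 0" by simp
        then show ?thesis by (simp add: csm_def sm_def z0_def)
      qed
      have "\<exists>y\<in>set ys. lookup t y > 0" if t: "t \<in> keys (z0 k)" for t k
      proof -
        have "single x 1 + t \<in> keys (var_poly x * z0 k)"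
          using t keys_single_times_eq[of "1::'k" "single x 1" "z0 k"] by (simp add: var_poly_def)
        then obtain y where "y \<in> set ys" "lookup (single x 1 + t) y > 0" using kd_base_keys unfolding eq by blast
        then show ?thesis using xys(1) by (auto simp: lookup_add lookup_single when_def split: if_splits)
      qed
      then obtain d where d: "d \<in> ch (length ys) 1 (fm l r a (e - 1))" "kd ys d = cbase (length ys) z0"
        using kd_base_image[OF xys(3), of z0 r a "e - 1"] z0 by auto
      have "(z - kd ys d) b \<in> {0}" for b by (simp add: zz d(2))
      then show "\<exists>d\<in>ch (length ys) 1 (fm l r a (e - 1)). \<forall>b. (z - kd ys d) b \<in> {0}" using d(1) by blast
    qed
  qed
qed

subsection \<open>Bases of homology\<close>

text \<open>Says that \<open>A\<close> modulo \<open>B\<close> has dimension \<open>m\<close>, by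
  representatives and without forming the quotient.\<close>

definition qbasis :: "'k::field chain set \<Rightarrow> 'k chain set \<Rightarrow> nat \<Rightarrow> bool"
  where "qbasis A B m \<longleftrightarrow> (\<exists>b. (\<forall>k<m. b k \<in> A) \<and>
    (\<forall>v\<in>A. \<exists>c. v - (\<Sum>k<m. csm (const_poly (c k)) (b k)) \<in> B) \<and>
    (\<forall>c. (\<Sum>k<m. csm (const_poly (c k)) (b k)) \<in> B \<longrightarrow> (\<forall>k<m. c k = 0)))"

lemma csm_const_add: "csm (const_poly (a + b)) c = csm (const_poly a) c + csm (const_poly b) c"
  by (rule ext, rule ext) (simp add: csm_def sm_def const_poly_hom distrib_right)

lemma csm_const_sum: "csm (const_poly (sum f A)) c = (\<Sum>i\<in>A. csm (const_poly (f i)) c)"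
proof -
  have "csm (const_poly (0::'a)) c = 0" by (simp add: const_poly_hom csm_simps)
  from sum_comp_morphism[where h = "\<lambda>a. csm (const_poly a) c" and g = f and A = A, OF this csm_const_add]
  show ?thesis by (simp only: comp_def)
qed

text \<open>A dimension count modulo \<open>B\<close>; applied in both directions it makes the
  dimension well defined.\<close>

lemma qbasis_le:
  fixes A B :: "'k::field chain set"
  assumes B: "addgrp B" "\<And>a x. x \<in> B \<Longrightarrow> csm (const_poly a) x \<in> B"
    and m: "qbasis A B m" and m': "qbasis A B m'"
  shows "m' \<le> m"
proof (rule ccontr)
  assume "\<not> m' \<le> m"
  obtain b where b: "\<And>v. v \<in> A \<Longrightarrow> \<exists>c. v - (\<Sum>k<m. csm (const_poly (c k)) (b k)) \<in> B"
    using m unfolding qbasis_def by blast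
  obtain b' where b': "\<And>k. k < m' \<Longrightarrow> b' k \<in> A"
    "\<And>c. (\<Sum>k<m'. csm (const_poly (c k)) (b' k)) \<in> B \<Longrightarrow> \<forall>k<m'. c k = 0"
    using m' unfolding qbasis_def by blast
  have "\<forall>j\<in>{..<m'}. \<exists>c. b' j - (\<Sum>k<m. csm (const_poly (c k)) (b k)) \<in> B" using b b'(1) by blast
  from bchoice[OF this] obtain C where C: "\<And>j. j < m' \<Longrightarrow> b' j - (\<Sum>k<m. csm (const_poly (C j k)) (b k)) \<in> B" by auto
  obtain c where c: "\<exists>j\<in>{..<m'}. c j \<noteq> 0" "\<forall>k\<in>{..<m}. (\<Sum>j\<in>{..<m'}. C j k * c j) = 0"
    using nontrivial_solution[of "{..<m}" "{..<m'}" "\<lambda>k j. C j k"] \<open>\<not> m' \<le> m\<close> by auto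
  have "(\<Sum>j<m'. csm (const_poly (c j)) (b' j - (\<Sum>k<m. csm (const_poly (C j k)) (b k)))) \<in> B"
    using B C by (intro addgrp_sum) auto
  moreover have "(\<Sum>j<m'. csm (const_poly (c j)) (b' j - (\<Sum>k<m. csm (const_poly (C j k)) (b k)))) =
      (\<Sum>j<m'. csm (const_poly (c j)) (b' j)) - (\<Sum>j<m'. \<Sum>k<m. csm (const_poly (c j * C j k)) (b k))"
    by (simp only: csm_simps csm_sum const_poly_hom(4)[symmetric] sum_subtractf)
  moreover have "(\<Sum>j<m'. \<Sum>k<m. csm (const_poly (c j * C j k)) (b k)) = 0"
  proof -
    have "(\<Sum>j<m'. \<Sum>k<m. csm (const_poly (c j * C j k)) (b k)) = (\<Sum>k<m. \<Sum>j<m'. csm (const_poly (c j * C j k)) (b k))"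
      by (rule sum.swap)
    also have "\<dots> = (\<Sum>k<m. csm (const_poly (\<Sum>j<m'. C j k * c j)) (b k))"
      by (simp only: csm_const_sum mult.commute)
    also have "\<dots> = (\<Sum>k<m. 0)"
      by (rule sum.cong) (use c(2) in \<open>simp_all only: lessThan_iff const_poly_hom csm_simps\<close>)
    finally show ?thesis by simp
  qed
  ultimately have "(\<Sum>j<m'. csm (const_poly (c j)) (b' j)) \<in> B" by simp
  then show False using b'(2) c(1) by blast
qed

definition cyc :: "nat \<Rightarrow> nat \<Rightarrow> (int \<Rightarrow> 'k::field pvec set) \<Rightarrow> int \<Rightarrow> 'k chain set"
  where "cyc l p M e = {c \<in> ch l p (M e). kd [0..<l] c = 0}"

definition bnd :: "nat \<Rightarrow> nat \<Rightarrow> (int \<Rightarrow> 'k::field pvec set) \<Rightarrow> int \<Rightarrow> 'k chain set"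
  where "bnd l p M e = kd [0..<l] ` ch l (Suc p) (M (e - 1))"

lemma (in graded_module) bnd_closed:
  "addgrp (bnd l p M e)" "x \<in> bnd l p M e \<Longrightarrow> csm (const_poly a) x \<in> bnd l p M e"
proof -
  show "addgrp (bnd l p M e)" unfolding addgrp_def bnd_def
  proof (intro conjI ballI)
    show "0 \<in> kd [0..<l] ` ch l (Suc p) (M (e - 1))" using addgrpD(1)[OF chgrp] kd_zero by (metis imageI)
    fix x assume "x \<in> kd [0..<l] ` ch l (Suc p) (M (e - 1))"
    then obtain c where c: "c \<in> ch l (Suc p) (M (e - 1))" "x = kd [0..<l] c" by blast
    show "- x \<in> kd [0..<l] ` ch l (Suc p) (M (e - 1))"
      unfolding c(2) kd_uminus[symmetric] by (rule imageI[OF addgrpD(3)[OF chgrp c(1)]])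
    fix y assume "y \<in> kd [0..<l] ` ch l (Suc p) (M (e - 1))"
    then obtain d where d: "d \<in> ch l (Suc p) (M (e - 1))" "y = kd [0..<l] d" by blast
    show "x + y \<in> kd [0..<l] ` ch l (Suc p) (M (e - 1))"
      unfolding c(2) d(2) kd_add[symmetric] by (rule imageI[OF addgrpD(2)[OF chgrp c(1) d(1)]])
  qed
  assume "x \<in> bnd l p M e"
  then obtain c where c: "c \<in> ch l (Suc p) (M (e - 1))" "x = kd [0..<l] c" by (auto simp: bnd_def)
  show "csm (const_poly a) x \<in> bnd l p M e"
    unfolding bnd_def c(2) kd_csm[symmetric] by (rule imageI[OF csm_const_ch[OF c(1)]])
qed

text \<open>A short exact sequence from \<open>Y\<close> through \<open>F\<close> to
  \<open>Z\<close>, with \<open>F\<close> acyclic in positive homological degrees.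
  \<open>Y_small\<close> encodes minimality: the elements of \<open>Y\<close> lie in the maximal
  ideal times \<open>F\<close>, expressed as being boundaries.\<close>

locale cover_step = F: graded_module l F + Z: graded_module l Z + Y: graded_module l Y
  for l and F Z Y :: "int \<Rightarrow> 'k::field pvec set" +
  fixes \<pi> :: "'k pvec \<Rightarrow> 'k pvec"
  assumes pi_add: "\<pi> (v + w) = \<pi> v + \<pi> w" and pi_sm: "\<pi> (sm f v) = sm f (\<pi> v)"
    and pi_image: "\<pi> ` F e = Z e" and pi_kernel: "Y e = {v \<in> F e. \<pi> v = 0}"
    and F_acyc: "p \<ge> 1 \<Longrightarrow> acyc [0..<l] F (\<lambda>_. {0}) p e"
    and Y_small: "v \<in> Y e \<Longrightarrow> \<exists>w\<in>ch l 1 (F (e - 1)). kd [0..<l] w = cbase l v"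
begin

abbreviation "cpi c \<equiv> (\<lambda>b. \<pi> (c b))"

lemma pi_zero: "\<pi> 0 = 0"
  using pi_sm[of 0 0] by (simp only: sm_simps)

lemma cpi_add: "cpi (c + d) = cpi c + cpi d"
  by (rule ext) (simp only: plus_fun_apply pi_add)

lemma cpi_csm: "cpi (csm p c) = csm p (cpi c)"
  by (rule ext) (simp only: csm_def pi_sm)

lemma cpi_uminus: "cpi (- c) = - cpi c" for c :: "'k chain"
  using cpi_csm[of "- 1" c] by (simp add: csm_def sm_def fun_Compl_def fun_eq_iff)

lemma cpi_diff: "cpi (c - d) = cpi c - cpi d" for c d :: "'k chain"
  using cpi_add[of c "- d"] cpi_uminus[of d] by simp

lemma cpi_zero: "cpi 0 = 0"
  by (rule ext) (simp only: zero_fun_apply pi_zero)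

lemma cpi_sum: "cpi (\<Sum>i\<in>A. f i) = (\<Sum>i\<in>A. cpi (f i))"
  using sum_comp_morphism[where h = "\<lambda>c. cpi c" and g = f and A = A, OF cpi_zero cpi_add] by (simp only: comp_def)

lemma cpi_cjoin: "cpi (cjoin c d) = cjoin (cpi c) (cpi d)"
  by (rule ext) (auto simp: cjoin_def pi_zero split: list.splits)

lemma cpi_kd: "kd xs (cpi c) = cpi (kd xs c)"
proof (induction xs arbitrary: c)
  case Nil
  show ?case by (simp only: kd.simps cpi_zero)
next
  case (Cons x xs)
  have "ctail h (cpi c) = cpi (ctail h c)" for h by (simp only: ctail_def)
  then show ?case using Cons
    by (simp only: kd.simps cpi_cjoin cpi_add cpi_csm cpi_uminus)
qed

lemma cpi_ch: "c \<in> ch n p (F e) \<Longrightarrow> cpi c \<in> ch n p (Z e)"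
  by (rule ch_map[where f = \<pi>]) (use pi_image pi_zero in auto)

lemma cpi_lift:
  assumes z: "z \<in> ch n p (Z e)" shows "\<exists>y\<in>ch n p (F e). cpi y = z"
proof -
  \<comment> \<open>Zero is lifted to zero so that the lift keeps the support of the chain.\<close>
  have "\<forall>b. \<exists>v. v \<in> F e \<and> \<pi> v = z b \<and> (z b = 0 \<longrightarrow> v = 0)"
  proof
    fix b show "\<exists>v. v \<in> F e \<and> \<pi> v = z b \<and> (z b = 0 \<longrightarrow> v = 0)"
    proof (cases "z b = 0")
      case True
      then show ?thesis using addgrpD(1)[OF F.grp] pi_zero by (intro exI[of _ 0]) simp
    next
      case False
      have "z b \<in> \<pi> ` F e" using chD(1)[OF z] pi_image by simp
      then obtain v where "z b = \<pi> v" "v \<in> F e" by (rule imageE)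
      then show ?thesis using False by (intro exI[of _ v]) simp
    qed
  qed
  from choice[OF this] obtain y where y: "\<And>b. y b \<in> F e \<and> \<pi> (y b) = z b \<and> (z b = 0 \<longrightarrow> y b = 0)" by blast
  have "y \<in> ch n p (F e)" unfolding ch_def
  proof (intro CollectI allI conjI impI)
    fix b show "y b \<in> F e" using y by simp
    assume "y b \<noteq> 0"
    then have "z b \<noteq> 0" using y by blast
    then show "length b = n" "count_list b True = p" using chD(2)[OF z] by auto
  qed
  then show ?thesis using y by (intro bexI[of _ y]) auto
qed

lemma cpi_kernel: "c \<in> ch n p (F e) \<Longrightarrow> cpi c = 0 \<Longrightarrow> c \<in> ch n p (Y e)"
  by (rule ch_of_values[of c n p "F e"]) (auto simp: pi_kernel chD(1) dest: fun_cong)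

lemma Y_F: "c \<in> ch n p (Y e) \<Longrightarrow> c \<in> ch n p (F e) \<and> cpi c = 0"
proof
  assume c: "c \<in> ch n p (Y e)"
  show "c \<in> ch n p (F e)" using c ch_mono[of "Y e" "F e" n p] pi_kernel by auto
  show "cpi c = 0"
  proof
    fix b show "cpi c b = 0 b" using chD(1)[OF c, of b] by (simp only: pi_kernel) simp
  qed
qed

lemma F_exact:
  assumes c: "c \<in> ch l p (F e)" "kd [0..<l] c = 0" and p: "p \<ge> 1"
  shows "\<exists>d\<in>ch l (Suc p) (F (e - 1)). kd [0..<l] d = c"
proof -
  have "\<forall>b. kd [0..<l] c b \<in> {0}" using c(2) by simp
  then obtain d where d: "d \<in> ch l (Suc p) (F (e - 1))" "\<And>b. (c - kd [0..<l] d) b = 0"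
    using F_acyc[OF p, of e] c(1) unfolding acyc_def by auto
  have "kd [0..<l] d = c"
  proof
    fix b show "kd [0..<l] d b = c b" using d(2)[of b] by simp
  qed
  then show ?thesis using d(1) by blast
qed

text \<open>This makes the connecting map onto. Minimality supplies the case \<open>p = 0\<close>,
  for which acyclicity of \<open>F\<close> is not assumed.\<close>

lemma Y_boundary_in_F:
  assumes c: "c \<in> cyc l p Y e" shows "\<exists>y\<in>ch l (Suc p) (F (e - 1)). kd [0..<l] y = c"
proof (cases "p = 0")
  case True
  have c': "c \<in> ch l 0 (Y e)" using c True by (simp add: cyc_def)
  obtain w where "w \<in> ch l 1 (F (e - 1))" "kd [0..<l] w = cbase l (c (replicate l False))"
    using Y_small[OF chD(1)[OF c']] by blast
  then show ?thesis using ch_0_cbase[OF c'] True by auto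
next
  case False
  then show ?thesis using F_exact[of c p e] c Y_F[of c l p e] by (auto simp: cyc_def)
qed

text \<open>The connecting isomorphism \<open>H\<^sub>p\<^sub>+\<^sub>1(Z) \<cong> H\<^sub>p(Y)\<close> of \<open>0 \<rightarrow> Y \<rightarrow> F \<rightarrow> Z \<rightarrow> 0\<close>.\<close>

lemma qbasis_shift:
  assumes "qbasis (cyc l p Y e) (bnd l p Y e) m"
  shows "qbasis (cyc l (Suc p) Z (e - 1)) (bnd l (Suc p) Z (e - 1)) m"
proof -
  let ?d = "kd [0..<l]"
  have sub: "set [0..<l] \<subseteq> {..<l}" by auto
  obtain b where b: "\<And>k. k < m \<Longrightarrow> b k \<in> cyc l p Y e"
    "\<And>v. v \<in> cyc l p Y e \<Longrightarrow> \<exists>c. v - (\<Sum>k<m. csm (const_poly (c k)) (b k)) \<in> bnd l p Y e"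
    "\<And>c. (\<Sum>k<m. csm (const_poly (c k)) (b k)) \<in> bnd l p Y e \<Longrightarrow> \<forall>k<m. c k = 0"
    using assms unfolding qbasis_def by blast
  have "\<forall>k\<in>{..<m}. \<exists>y. y \<in> ch l (Suc p) (F (e - 1)) \<and> ?d y = b k" using Y_boundary_in_F b(1) by blast
  from bchoice[OF this] obtain y where y: "\<And>k. k < m \<Longrightarrow> y k \<in> ch l (Suc p) (F (e - 1))" "\<And>k. k < m \<Longrightarrow> ?d (y k) = b k"
    by auto
  have comb: "(\<Sum>k<m. csm (const_poly (c k)) (y k)) \<in> ch l (Suc p) (F (e - 1))" for c
    using y(1) by (intro addgrp_sum[OF F.chgrp] F.csm_const_ch) auto
  have dcomb: "?d (\<Sum>k<m. csm (const_poly (c k)) (y k)) = (\<Sum>k<m. csm (const_poly (c k)) (b k))" for c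
    unfolding kd_sum kd_csm by (rule sum.cong) (simp_all only: lessThan_iff y(2))
  have picomb: "cpi (\<Sum>k<m. csm (const_poly (c k)) (y k)) = (\<Sum>k<m. csm (const_poly (c k)) (cpi (y k)))" for c
    by (simp only: cpi_sum cpi_csm)
  show ?thesis unfolding qbasis_def
  proof (intro exI[of _ "\<lambda>k. cpi (y k)"] conjI allI impI ballI)
    fix k assume k: "k < m"
    have "?d (cpi (y k)) = cpi (b k)" by (simp only: cpi_kd y(2)[OF k])
    also have "cpi (b k) = 0" using b(1)[OF k] Y_F[of "b k" l p e] unfolding cyc_def by blast
    finally show "cpi (y k) \<in> cyc l (Suc p) Z (e - 1)" using cpi_ch[OF y(1)[OF k]] by (simp add: cyc_def)
  next
    fix z assume z: "z \<in> cyc l (Suc p) Z (e - 1)"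
    then obtain x where x: "x \<in> ch l (Suc p) (F (e - 1))" "cpi x = z" using cpi_lift[of z l "Suc p" "e - 1"] unfolding cyc_def by blast
    have dx: "?d x \<in> ch l p (F e)" using F.kd_ch[OF sub, of x p "e - 1"] x(1) by simp
    have "cpi (?d x) = 0" using z x(2) by (simp add: cpi_kd[symmetric] cyc_def)
    then have "?d x \<in> cyc l p Y e" using cpi_kernel[OF dx] by (simp add: cyc_def kd_kd)
    then obtain c w where c: "?d x - (\<Sum>k<m. csm (const_poly (c k)) (b k)) = ?d w" and w: "w \<in> ch l (Suc p) (Y (e - 1))"
      using b(2) by (force simp: bnd_def)
    let ?s = "\<Sum>k<m. csm (const_poly (c k)) (y k)"
    \<comment> \<open>A cycle of \<open>F\<close>, hence a boundary; its image under
      \<open>\<pi>\<close> shows that \<open>z\<close> and the combination have the same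
      class.\<close>
    let ?u = "x - ?s - w"
    have "?u \<in> ch l (Suc p) (F (e - 1))"
      using Y_F[OF w] by (intro addgrpD(4)[OF F.chgrp] x(1) comb) simp
    moreover have "?d ?u = 0" using c by (simp only: kd_diff dcomb diff_self)
    ultimately obtain v where v: "v \<in> ch l (Suc (Suc p)) (F (e - 1 - 1))" "?d v = ?u" using F_exact[of ?u "Suc p" "e - 1"] by auto
    have "cpi ?u = z - (\<Sum>k<m. csm (const_poly (c k)) (cpi (y k)))"
      using Y_F[OF w] by (simp only: cpi_diff picomb x(2) diff_zero)
    moreover have "cpi ?u = ?d (cpi v)" by (simp only: v(2)[symmetric] cpi_kd)
    ultimately have "z - (\<Sum>k<m. csm (const_poly (c k)) (cpi (y k))) = ?d (cpi v)" by simp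
    then show "\<exists>c. z - (\<Sum>k<m. csm (const_poly (c k)) (cpi (y k))) \<in> bnd l (Suc p) Z (e - 1)"
      using cpi_ch[OF v(1)] unfolding bnd_def by blast
  next
    fix c k assume "(\<Sum>k<m. csm (const_poly (c k)) (cpi (y k))) \<in> bnd l (Suc p) Z (e - 1)" and k: "k < m"
    then obtain u where u: "u \<in> ch l (Suc (Suc p)) (Z (e - 1 - 1))" "(\<Sum>k<m. csm (const_poly (c k)) (cpi (y k))) = ?d u"
      by (auto simp: bnd_def)
    obtain u' where u': "u' \<in> ch l (Suc (Suc p)) (F (e - 1 - 1))" "cpi u' = u" using cpi_lift[OF u(1)] by blast
    let ?s = "\<Sum>k<m. csm (const_poly (c k)) (y k)"
    have "?d u' \<in> ch l (Suc p) (F (e - 1))" using F.kd_ch[OF sub, of u' "Suc p" "e - 1 - 1"] u'(1) by simp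
    then have "?s - ?d u' \<in> ch l (Suc p) (F (e - 1))" by (rule addgrpD(4)[OF F.chgrp comb])
    moreover have "cpi (?s - ?d u') = 0"
      by (simp only: cpi_diff picomb cpi_kd[symmetric] u'(2) u(2) diff_self)
    ultimately have mem: "?s - ?d u' \<in> ch l (Suc p) (Y (e - 1))" by (rule cpi_kernel)
    have eq: "(\<Sum>k<m. csm (const_poly (c k)) (b k)) = ?d (?s - ?d u')" by (simp only: kd_diff dcomb kd_kd diff_zero)
    have "(\<Sum>k<m. csm (const_poly (c k)) (b k)) \<in> bnd l p Y e" unfolding bnd_def eq by (rule imageI[OF mem])
    then show "c k = 0" using b(3) k by blast
  qed
qed

end

lemma qbasis_zero:
  assumes "qbasis A B 0" shows "A \<subseteq> B"
proof
  fix v assume "v \<in> A"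
  then obtain c :: "nat \<Rightarrow> 'a" where "v - (\<Sum>k<(0::nat). csm (const_poly (c k)) (SOME b. True)) \<in> B"
    using assms unfolding qbasis_def by auto
  then show "v \<in> B" by simp
qed

lemma qbasis_trivial:
  assumes q: "qbasis A B m" and A: "A \<subseteq> {0}" and B: "0 \<in> B"
  shows "m = 0"
proof (rule ccontr)
  assume m: "m \<noteq> 0"
  obtain b :: "nat \<Rightarrow> 'a chain" where b: "\<And>k. k < m \<Longrightarrow> b k \<in> A" "\<And>c. (\<Sum>k<m. csm (const_poly (c k)) (b k)) \<in> B \<Longrightarrow> \<forall>k<m. c k = 0"
    using q unfolding qbasis_def by blast
  have "csm (const_poly (1::'a)) (b k) = 0" if "k < m" for k
  proof -
    have "b k = 0" using b(1)[OF that] A by blast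
    then show ?thesis by (simp only: csm_simps)
  qed
  then have "(\<Sum>k<m. csm (const_poly (1::'a)) (b k)) = (\<Sum>k<m. 0)" by (intro sum.cong) simp_all
  then have "(\<Sum>k<m. csm (const_poly (1::'a)) (b k)) \<in> B" using B by simp
  then show False using b(2)[of "\<lambda>_. 1"] m by simp
qed

lemma fm_small:
  fixes v :: "'k::field pvec"
  assumes v: "v \<in> fm l r a e" "\<And>k. lookup (v k) 0 = 0"
  shows "\<exists>w\<in>ch l 1 (fm l r a (e - 1)). kd [0..<l] w = cbase l v"
proof -
  have "\<exists>x\<in>set [0..<l]. lookup t x > 0" if t: "t \<in> keys (v k)" for k t
  proof -
    have tl: "t \<in> pps l" using formsZ_keys[of "v k" l _ t] v(1) t by (auto simp: fm_def)
    have "t \<noteq> 0" using t v(2)[of k] by (auto simp: in_keys_iff)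
    then obtain x where x: "lookup t x \<noteq> 0" using poly_mapping_eqI[of t 0] by auto
    then have "x < l" using lookup_pps[OF tl, of x] by (cases "x < l") auto
    then show ?thesis using x by (intro bexI[of _ x]) auto
  qed
  then show ?thesis using kd_base_image[of "[0..<l]" l v r a "e - 1"] v(1) by (simp add: atLeast0LessThan)
qed

lemma sum_fun_apply: "(\<Sum>i\<in>A. f i) j = (\<Sum>i\<in>A. f i j)" for f :: "'i \<Rightarrow> 'j \<Rightarrow> 'm::comm_monoid_add"
  by (induction A rule: infinite_finite_induct) auto

locale free_cover = cover_step l "fm l r a" Z Y \<pi>
  for l r a and Z Y :: "int \<Rightarrow> 'k::field pvec set" and \<pi> +
  assumes Y_const: "v \<in> Y e \<Longrightarrow> lookup (v k) 0 = 0"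
begin

text \<open>Nakayama's lemma: modulo the multiples of the variables, \<open>Z\<close> in degree
  \<open>e\<close> has the images of the basis elements of degree \<open>e\<close> as a basis. They
  generate because the other coordinates have no constant term, and they are independent because
  vectors in the kernel \<open>Y\<close> have none.\<close>

lemma qbasis_start: "qbasis (cyc l 0 Z e) (bnd l 0 Z e) (card {k. k < r \<and> int (a k) = e})"
proof -
  let ?S = "{k. k < r \<and> int (a k) = e}" and ?d = "kd [0..<l]" and ?F = "replicate l False"
  define m where "m = card ?S"
  have "finite ?S" by simp
  from ex_bij_betw_nat_finite[OF this] obtain f where f: "bij_betw f {..<m} ?S"
    by (auto simp: m_def atLeast0LessThan)
  have fS: "f i < r" "int (a (f i)) = e" if "i < m" for i using bij_betwE[OF f] that by auto
  have finj: "f i = f j \<Longrightarrow> i = j" if "i < m" "j < m" for i j using f that by (auto simp: bij_betw_def inj_on_def)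
  define ek :: "nat \<Rightarrow> 'k pvec" where "ek k = (\<lambda>j. if j = k then 1 else 0)" for k
  define comb where "comb c = (\<Sum>i<m. sm (const_poly (c i)) (ek (f i)))" for c :: "nat \<Rightarrow> 'k"
  have ek: "ek (f i) \<in> fm l r a e" if "i < m" for i
    using fS[OF that] by (auto simp: fm_def ek_def formsZ_def)
  have comb: "comb c \<in> fm l r a e" for c
    unfolding comb_def by (intro addgrp_sum[OF addgrp_fm] graded_module.scale[OF fm_graded] ek) simp
  have comb_val: "comb c j = (\<Sum>i<m. if f i = j then const_poly (c i) else 0)" for c j
    unfolding comb_def sum_fun_apply by (rule sum.cong) (auto simp: sm_def ek_def)
  have comb_f: "comb c (f i) = const_poly (c i)" if "i < m" for c i
  proof -
    have "(\<Sum>i'<m. if f i' = f i then const_poly (c i') else 0) = (\<Sum>i'<m. if i' = i then const_poly (c i') else (0 :: (nat, 'k) mpoly))"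
      by (rule sum.cong) (use finj that in auto)
    then show ?thesis using that by (simp add: comb_val)
  qed
  have comb_0: "comb c j = 0" if "j \<notin> ?S" for c j
    unfolding comb_val using fS that by (intro sum.neutral) auto
  have picomb: "(\<Sum>i<m. csm (const_poly (c i)) (cbase l (\<pi> (ek (f i))))) = cbase l (\<pi> (comb c))" for c
  proof -
    have "\<pi> (comb c) = (\<Sum>i<m. sm (const_poly (c i)) (\<pi> (ek (f i))))"
      unfolding comb_def using sum_comp_morphism[where h = \<pi> and A = "{..<m}" and g = "\<lambda>i. sm (const_poly (c i)) (ek (f i))", OF pi_zero pi_add]
      by (simp only: comp_def pi_sm)
    then show ?thesis by (simp only: cbase_sum cbase_simps)
  qed
  have kdF: "lookup (?d u ?F k) 0 = 0" for u :: "'k chain" and k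
    using kd_base_keys[of 0 "[0..<l]" u k] by (auto simp: in_keys_iff)
  have picb: "cpi (cbase l v) = cbase l (\<pi> v)" for v
    by (rule ext) (simp add: cbase_def pi_zero)
  have "qbasis (cyc l 0 Z e) (bnd l 0 Z e) m" unfolding qbasis_def
  proof (intro exI[of _ "\<lambda>i. cbase l (\<pi> (ek (f i)))"] conjI allI impI ballI)
    fix i assume "i < m"
    then have "\<pi> (ek (f i)) \<in> Z e" using ek pi_image by blast
    then show "cbase l (\<pi> (ek (f i))) \<in> cyc l 0 Z e"
      using cbase_ch[OF Z.grp] kd_cbase[of "[0..<l]"] by (simp add: cyc_def)
  next
    fix z assume z: "z \<in> cyc l 0 Z e"
    then have z': "z \<in> ch l 0 (Z e)" by (simp add: cyc_def)
    have "z ?F \<in> \<pi> ` fm l r a e" using chD(1)[OF z'] pi_image by simp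
    then obtain w where w: "z ?F = \<pi> w" "w \<in> fm l r a e" by (rule imageE)
    \<comment> \<open>Removing the constant terms leaves a vector in the maximal ideal times the
      free module, hence a boundary.\<close>
    define c where "c i = lookup (w (f i)) 0" for i
    have w0: "lookup ((w - comb c) k) 0 = 0" for k
    proof (cases "k \<in> ?S")
      case True
      then obtain i where i: "i < m" "k = f i" using f unfolding bij_betw_def by (metis (no_types, lifting) imageE lessThan_iff)
      then show ?thesis by (simp add: lookup_minus comb_f c_def const_poly_def)
    next
      case False
      have "0 \<notin> keys (w k)"
      proof
        assume k: "0 \<in> keys (w k)"
        have "w k \<in> formsZ l (e - int (a k))" "r \<le> k \<longrightarrow> w k = 0" using w(2) by (auto simp: fm_def)
        then show False using formsZ_keys[OF _ k, of l "e - int (a k)"] k False by force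
      qed
      then show ?thesis using comb_0[OF False] by (simp add: lookup_minus in_keys_iff)
    qed
    have "w - comb c \<in> fm l r a e" by (rule addgrpD(4)[OF addgrp_fm w(2) comb])
    from fm_small[OF this w0] obtain u where u: "u \<in> ch l 1 (fm l r a (e - 1))" "?d u = cbase l (w - comb c)" by blast
    have "?d (cpi u) = cbase l (\<pi> (w - comb c))" by (simp only: cpi_kd u(2) picb)
    also have "\<pi> (w - comb c) = \<pi> w - \<pi> (comb c)" using pi_add[of "w - comb c" "comb c"] by (simp add: algebra_simps)
    also have "cbase l (\<pi> w - \<pi> (comb c)) = z - (\<Sum>i<m. csm (const_poly (c i)) (cbase l (\<pi> (ek (f i)))))"
      unfolding picomb cbase_simps(2) w(1)[symmetric] ch_0_cbase[OF z', symmetric] by (rule refl)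
    finally have eq: "z - (\<Sum>i<m. csm (const_poly (c i)) (cbase l (\<pi> (ek (f i))))) = ?d (cpi u)" by (rule sym)
    have "cpi u \<in> ch l (Suc 0) (Z (e - 1))" using cpi_ch[OF u(1)] by simp
    then have "z - (\<Sum>i<m. csm (const_poly (c i)) (cbase l (\<pi> (ek (f i))))) \<in> bnd l 0 Z e"
      unfolding bnd_def eq by (rule imageI)
    then show "\<exists>c. z - (\<Sum>i<m. csm (const_poly (c i)) (cbase l (\<pi> (ek (f i))))) \<in> bnd l 0 Z e" by blast
  next
    fix c i assume "(\<Sum>i<m. csm (const_poly (c i)) (cbase l (\<pi> (ek (f i))))) \<in> bnd l 0 Z e" and i: "i < m"
    then have "cbase l (\<pi> (comb c)) \<in> bnd l 0 Z e" by (simp only: picomb)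
    then obtain u' where u': "u' \<in> ch l (Suc 0) (Z (e - 1))" "cbase l (\<pi> (comb c)) = ?d u'" by (auto simp: bnd_def)
    obtain u where u: "u \<in> ch l (Suc 0) (fm l r a (e - 1))" "cpi u = u'" using cpi_lift[OF u'(1)] by blast
    have sub: "set [0..<l] \<subseteq> {..<l}" by auto
    have du: "?d u \<in> ch l 0 (fm l r a e)" using F.kd_ch[OF sub, of u 0 "e - 1"] u(1) by simp
    let ?y = "comb c - ?d u ?F"
    have "\<pi> (?d u ?F) = ?d u' ?F" using cpi_kd[of "[0..<l]" u] unfolding u(2) by (rule fun_cong[symmetric])
    also have "\<dots> = \<pi> (comb c)" by (simp only: u'(2)[symmetric] cbase_simps)
    finally have "\<pi> ?y = 0" using pi_add[of ?y "?d u ?F"] by simp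
    moreover have "?y \<in> fm l r a e" by (rule addgrpD(4)[OF addgrp_fm comb chD(1)[OF du]])
    ultimately have "?y \<in> Y e" by (simp only: pi_kernel) simp
    then have "lookup (?y (f i)) 0 = 0" by (rule Y_const)
    then have "lookup (comb c (f i)) 0 = 0" using kdF[of u "f i"] by (simp add: lookup_minus)
    then show "c i = 0" by (simp add: comb_f[OF i] const_poly_def)
  qed
  then show ?thesis by (simp add: m_def)
qed

end

subsection \<open>Resolutions\<close>

text \<open>Resolutions with \<open>I\<close> itself as the last step of the complex: the free module with index \<open>i\<close> in the sense of
  \<open>minimal_free_resolution\<close> covers the \<open>i\<close>-th syzygy module inside the free module of rank \<open>tgt_rank r i\<close>.\<close>

definition tgt_rank :: "(nat \<Rightarrow> nat) \<Rightarrow> nat \<Rightarrow> nat"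
  where "tgt_rank r i = (case i of 0 \<Rightarrow> 1 | Suc j \<Rightarrow> r j)"

definition tgt_deg :: "(nat \<Rightarrow> nat \<Rightarrow> nat) \<Rightarrow> nat \<Rightarrow> nat \<Rightarrow> nat"
  where "tgt_deg a i = (case i of 0 \<Rightarrow> (\<lambda>_. 0) | Suc j \<Rightarrow> a j)"

definition pmap :: "nat \<Rightarrow> nat \<Rightarrow> (nat \<Rightarrow> nat \<Rightarrow> (nat, 'k::comm_ring_1) mpoly) \<Rightarrow> 'k pvec \<Rightarrow> 'k pvec"
  where "pmap m n P v = (\<lambda>j. if j < m then \<Sum>k<n. P j k * v k else 0)"

definition vecS :: "nat \<Rightarrow> nat \<Rightarrow> 'k::comm_ring_1 pvec set"
  where "vecS l n = {v. \<forall>k. v k \<in> polyS l \<and> (n \<le> k \<longrightarrow> v k = 0)}"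

definition syz :: "(nat, 'k::comm_ring_1) mpoly set \<Rightarrow> (nat \<Rightarrow> nat) \<Rightarrow> (nat \<Rightarrow> nat \<Rightarrow> nat \<Rightarrow> (nat, 'k) mpoly) \<Rightarrow> nat \<Rightarrow> 'k pvec set"
  where "syz I r P i = (case i of 0 \<Rightarrow> {z. z 0 \<in> I} | Suc j \<Rightarrow> {z. pmap (tgt_rank r j) (r j) (P j) z = 0})"

definition fres :: "nat \<Rightarrow> (nat, 'k::comm_ring_1) mpoly set \<Rightarrow> (nat \<Rightarrow> nat) \<Rightarrow> (nat \<Rightarrow> nat \<Rightarrow> nat) \<Rightarrow>
    (nat \<Rightarrow> nat \<Rightarrow> nat \<Rightarrow> (nat, 'k) mpoly) \<Rightarrow> bool"
  where "fres l I r a P \<longleftrightarrow>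
    (\<forall>i. \<forall>m<tgt_rank r i. \<forall>k<r i. P i m k \<in> formsZ l (int (a i k) - int (tgt_deg a i m)) \<and> (i > 0 \<longrightarrow> lookup (P i m k) 0 = 0)) \<and>
    (\<forall>i. pmap (tgt_rank r i) (r i) (P i) ` vecS l (r i) = vecS l (tgt_rank r i) \<inter> syz I r P i)"

lemma tgt_simps [simp]: "tgt_rank r 0 = 1" "tgt_rank r (Suc i) = r i" "tgt_deg a 0 = (\<lambda>_. 0)" "tgt_deg a (Suc i) = a i"
  by (simp_all add: tgt_rank_def tgt_deg_def)

lemma syz_simps: "syz I r P 0 = {z. z 0 \<in> I}" "syz I r P (Suc i) = {z. pmap (tgt_rank r i) (r i) (P i) z = 0}"
  by (simp_all add: syz_def)

lemma fm_vecS: "v \<in> fm l r a e \<Longrightarrow> v \<in> vecS l r"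
  by (auto simp: fm_def vecS_def intro: formsZ_polyS)

lemma pmap_add: "pmap m n P (v + w) = pmap m n P v + pmap m n P w"
  by (auto simp: pmap_def fun_eq_iff distrib_left sum.distrib)

lemma pmap_sm: "pmap m n P (sm f v) = sm f (pmap m n P v)"
  by (auto simp: pmap_def fun_eq_iff sm_def sum_distrib_left mult.left_commute)

lemma pmap_cong: "(\<And>j k. j < m \<Longrightarrow> k < n \<Longrightarrow> P j k = P' j k) \<Longrightarrow> pmap m n P = pmap m n P'"
  by (auto simp: pmap_def fun_eq_iff)

lemma formsZ_of_component: "p \<in> formsZ l (int a - int b) \<longleftrightarrow> p = 0 \<or> (\<exists>e. a = b + e \<and> p \<in> forms l e)"
proof (cases "a < b")
  case False
  then have "nat (int a - int b) = a - b" "a = b + (a - b)" by simp_all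
  then show ?thesis using False unfolding formsZ_def by (metis add_diff_cancel_left' diff_ge_0_iff_ge forms_zero not_less of_nat_le_iff)
qed (auto simp: formsZ_def)

lemma fresD:
  assumes "fres l I r a P"
  shows "m < tgt_rank r i \<Longrightarrow> k < r i \<Longrightarrow> P i m k \<in> formsZ l (int (a i k) - int (tgt_deg a i m))"
    "m < r i \<Longrightarrow> k < r (Suc i) \<Longrightarrow> lookup (P (Suc i) m k) 0 = 0"
    "pmap (tgt_rank r i) (r i) (P i) ` vecS l (r i) = vecS l (tgt_rank r i) \<inter> syz I r P i"
  using assms unfolding fres_def by (auto dest: spec[of _ "Suc i"])

lemma vec_vecS: "free_module l n = vec n ` vecS l n"
proof (intro equalityI subsetI)
  fix v :: "(nat, 'a) mpoly vec" assume v: "v \<in> free_module l n"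
  have "v = vec n (\<lambda>k. if k < n then v $ k else 0)" using v by (auto simp: free_module_def)
  moreover have "(\<lambda>k. if k < n then v $ k else 0) \<in> vecS l n" using v by (auto simp: free_module_def vecS_def)
  ultimately show "v \<in> vec n ` vecS l n" by blast
qed (auto simp: free_module_def vecS_def)

lemma vec_inj: "inj_on (vec n) (vecS l n)"
proof (rule inj_onI)
  fix v w :: "'a pvec" assume vw: "v \<in> vecS l n" "w \<in> vecS l n" "vec n v = vec n w"
  show "v = w"
  proof
    fix k show "v k = w k"
    proof (cases "k < n")
      case True
      then have "v k = vec n v $ k" "w k = vec n w $ k" by simp_all
      then show ?thesis using vw(3) by simp
    qed (use vw in \<open>auto simp: vecS_def\<close>)
  qed
qed

lemma mult_vec_pmap: "A \<in> carrier_mat m n \<Longrightarrow> A *\<^sub>v vec n v = vec m (pmap m n (\<lambda>j k. A $$ (j, k)) v)"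
  by (rule eq_vecI) (auto simp: pmap_def scalar_prod_def atLeast0LessThan)

lemma pmap_vecS:
  assumes "\<And>j k. j < m \<Longrightarrow> k < n \<Longrightarrow> P j k \<in> polyS l" "v \<in> vecS l n"
  shows "pmap m n P v \<in> vecS l m"
  using assms by (auto simp: pmap_def vecS_def intro!: polyS_sum polyS_mult)

lemma vec_image_eq_iff: "A \<subseteq> vecS l n \<Longrightarrow> B \<subseteq> vecS l n \<Longrightarrow> vec n ` A = vec n ` B \<longleftrightarrow> A = B"
  using inj_on_image_eq_iff[OF vec_inj, of A l n B] by blast

text \<open>Matrices on vectors and \<open>pmap\<close> on functions describe the same maps. The
  degree condition comes first, since it keeps the images inside the polynomial ring, and the
  exactness conditions are then compared one index at a time.\<close>

lemma resolution_iff_fres: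
  fixes I :: "(nat, 'k::comm_ring_1) mpoly set"
  assumes dim: "\<And>i. \<phi> i \<in> carrier_mat (tgt_rank r i) (r i)" and I: "I \<subseteq> polyS l"
  shows "minimal_free_resolution l I r a \<phi> \<longleftrightarrow> fres l I r a (\<lambda>i j k. \<phi> i $$ (j, k))"
proof -
  let ?P = "\<lambda>i j k. \<phi> i $$ (j, k)"
  define deg where "deg \<longleftrightarrow> (\<forall>i. \<forall>m<tgt_rank r i. \<forall>k<r i. ?P i m k \<in> formsZ l (int (a i k) - int (tgt_deg a i m)))"
  have deg_iff: "deg \<longleftrightarrow> (\<forall>k < r 0. \<phi> 0 $$ (0, k) \<in> forms l (a 0 k)) \<and>
    (\<forall>i. \<forall>m < r i. \<forall>k < r (Suc i). \<phi> (Suc i) $$ (m, k) = 0 \<or>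
      (\<exists>e. a (Suc i) k = a i m + e \<and> \<phi> (Suc i) $$ (m, k) \<in> forms l e))"
  proof -
    have "deg \<longleftrightarrow> (\<forall>m<tgt_rank r 0. \<forall>k<r 0. ?P 0 m k \<in> formsZ l (int (a 0 k) - int (tgt_deg a 0 m))) \<and>
       (\<forall>i. \<forall>m<tgt_rank r (Suc i). \<forall>k<r (Suc i). ?P (Suc i) m k \<in> formsZ l (int (a (Suc i) k) - int (tgt_deg a (Suc i) m)))"
      unfolding deg_def by (metis not0_implies_Suc)
    then show ?thesis by (simp add: formsZ_of_component)
  qed
  have const_iff: "(\<forall>i. \<forall>m<tgt_rank r i. \<forall>k<r i. i > 0 \<longrightarrow> lookup (?P i m k) 0 = 0) \<longleftrightarrow>
    (\<forall>i. \<forall>m < r i. \<forall>k < r (Suc i). lookup (\<phi> (Suc i) $$ (m, k)) 0 = 0)"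
    by (metis gr0_conv_Suc tgt_simps(2))
  have P: "?P i j k \<in> polyS l" if deg "j < tgt_rank r i" "k < r i" for i j k
    using that formsZ_polyS unfolding deg_def by blast
  have im: "(\<lambda>w. \<phi> i *\<^sub>v w) ` free_module l (r i) = vec (tgt_rank r i) ` pmap (tgt_rank r i) (r i) (?P i) ` vecS l (r i)" for i
    unfolding vec_vecS image_image by (simp only: mult_vec_pmap[OF dim])
  have sub: "pmap (tgt_rank r i) (r i) (?P i) ` vecS l (r i) \<subseteq> vecS l (tgt_rank r i)" if deg for i
    by (intro image_subsetI pmap_vecS P[OF that])
  have ex0: "(\<lambda>v. (\<phi> 0 *\<^sub>v v) $ 0) ` free_module l (r 0) = I \<longleftrightarrow>
      pmap (tgt_rank r 0) (r 0) (?P 0) ` vecS l (r 0) = vecS l (tgt_rank r 0) \<inter> syz I r ?P 0" if d: deg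
  proof -
    let ?X = "pmap (tgt_rank r 0) (r 0) (?P 0) ` vecS l (r 0)"
    have "(\<lambda>v. (\<phi> 0 *\<^sub>v v) $ 0) ` free_module l (r 0) = (\<lambda>z. z 0) ` ?X"
    proof -
      have "(\<phi> 0 *\<^sub>v vec (r 0) v) $ 0 = pmap (tgt_rank r 0) (r 0) (?P 0) v 0" for v
        by (simp only: mult_vec_pmap[OF dim]) simp
      then show ?thesis unfolding vec_vecS image_image by simp
    qed
    moreover have "(\<lambda>z. z 0) ` X = I \<longleftrightarrow> X = vecS l 1 \<inter> {z. z 0 \<in> I}" if X: "X \<subseteq> vecS l 1" for X
    proof
      assume "X = vecS l 1 \<inter> {z. z 0 \<in> I}"
      moreover have "(\<lambda>k. if k = 0 then p else 0) \<in> vecS l 1" if "p \<in> I" for p :: "(nat, 'k) mpoly"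
        using that I by (auto simp: vecS_def)
      ultimately show "(\<lambda>z. z 0) ` X = I" by (auto intro!: rev_image_eqI)
    next
      assume e: "(\<lambda>z. z 0) ` X = I"
      have "z \<in> X" if z: "z \<in> vecS l 1" "z 0 \<in> I" for z
      proof -
        have "z 0 \<in> (\<lambda>z. z 0) ` X" using z(2) e by simp
        then obtain x where x: "z 0 = x 0" "x \<in> X" by (rule imageE)
        have "x k = z k" for k using x X z(1) by (cases "k = 0") (auto simp: vecS_def)
        then have "x = z" by (rule ext)
        then show ?thesis using x by simp
      qed
      then show "X = vecS l 1 \<inter> {z. z 0 \<in> I}" using e X by blast
    qed
    ultimately show ?thesis using sub[OF d, of 0] by (simp add: syz_simps)
  qed
  have exS: "(\<lambda>w. \<phi> (Suc i) *\<^sub>v w) ` free_module l (r (Suc i)) =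
      {v \<in> free_module l (r i). \<phi> i *\<^sub>v v = 0\<^sub>v (dim_row (\<phi> i))} \<longleftrightarrow>
      pmap (tgt_rank r (Suc i)) (r (Suc i)) (?P (Suc i)) ` vecS l (r (Suc i)) = vecS l (tgt_rank r (Suc i)) \<inter> syz I r ?P (Suc i)" if d: deg for i
  proof -
    have "\<phi> i *\<^sub>v vec (r i) v = 0\<^sub>v (dim_row (\<phi> i)) \<longleftrightarrow> pmap (tgt_rank r i) (r i) (?P i) v = 0" for v
    proof -
      have "vec (tgt_rank r i) (pmap (tgt_rank r i) (r i) (?P i) v) = 0\<^sub>v (tgt_rank r i) \<longleftrightarrow> (\<forall>j<tgt_rank r i. pmap (tgt_rank r i) (r i) (?P i) v j = 0)"
        by (auto simp: vec_eq_iff)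
      also have "\<dots> \<longleftrightarrow> pmap (tgt_rank r i) (r i) (?P i) v = 0" by (auto simp: fun_eq_iff pmap_def)
      finally show ?thesis using dim[of i] by (simp add: mult_vec_pmap[OF dim])
    qed
    then have "{v \<in> free_module l (r i). \<phi> i *\<^sub>v v = 0\<^sub>v (dim_row (\<phi> i))} = vec (r i) ` (vecS l (r i) \<inter> syz I r ?P (Suc i))"
      unfolding vec_vecS syz_simps by blast
    then show ?thesis using vec_image_eq_iff[OF sub[OF d, of "Suc i"], of "vecS l (r i) \<inter> syz I r ?P (Suc i)"] im[of "Suc i"]
      by simp
  qed
  define C where "C \<longleftrightarrow> (\<forall>i. \<forall>m<tgt_rank r i. \<forall>k<r i. i > 0 \<longrightarrow> lookup (?P i m k) 0 = 0)"
  define M0 where "M0 \<longleftrightarrow> (\<lambda>v. (\<phi> 0 *\<^sub>v v) $ 0) ` free_module l (r 0) = I"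
  define MS where "MS i \<longleftrightarrow> (\<lambda>w. \<phi> (Suc i) *\<^sub>v w) ` free_module l (r (Suc i)) =
    {v \<in> free_module l (r i). \<phi> i *\<^sub>v v = 0\<^sub>v (dim_row (\<phi> i))}" for i
  define E where "E i \<longleftrightarrow> pmap (tgt_rank r i) (r i) (?P i) ` vecS l (r i) = vecS l (tgt_rank r i) \<inter> syz I r ?P i" for i
  have M0: "deg \<Longrightarrow> M0 \<longleftrightarrow> E 0" and MS: "deg \<Longrightarrow> MS i \<longleftrightarrow> E (Suc i)" for i
    unfolding M0_def MS_def E_def by (rule ex0 exS, assumption)+
  have "minimal_free_resolution l I r a \<phi> \<longleftrightarrow> deg \<and> C \<and> M0 \<and> (\<forall>i. MS i)"
    unfolding minimal_free_resolution_def C_def const_iff deg_iff M0_def MS_def using dim[of 0] dim[of "Suc _"] by auto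
  also have "\<dots> \<longleftrightarrow> deg \<and> C \<and> (\<forall>i. E i)"
  proof -
    have "(\<forall>i. E i) \<longleftrightarrow> E 0 \<and> (\<forall>i. E (Suc i))" by (metis not0_implies_Suc)
    then show ?thesis using M0 MS by blast
  qed
  also have "\<dots> \<longleftrightarrow> fres l I r a ?P"
    unfolding fres_def deg_def C_def E_def by meson
  finally show ?thesis .
qed

lemma lookup_mult_0: "lookup p 0 = 0 \<Longrightarrow> lookup (p * q) 0 = 0" for p q :: "('x, 'k::comm_ring_1) mpoly"
proof (rule ccontr)
  assume p: "lookup p 0 = 0" and "lookup (p * q) 0 \<noteq> 0"
  then have "0 \<in> keys (p * q)" by (simp add: in_keys_iff)
  then obtain s t where st: "0 = s + t" "s \<in> keys p" using Poly_Mapping.keys_mult[of p q] by blast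
  have "s = 0"
  proof (rule poly_mapping_eqI)
    fix x have "lookup s x + lookup t x = 0" using arg_cong[OF st(1), of "\<lambda>t. lookup t x"] by (simp add: lookup_add)
    then show "lookup s x = lookup 0 x" by simp
  qed
  then show False using st(2) p by (simp add: in_keys_iff)
qed

definition idealgr :: "nat \<Rightarrow> (nat, 'k::comm_ring_1) mpoly set \<Rightarrow> int \<Rightarrow> 'k pvec set"
  where "idealgr l I e = fm l 1 (\<lambda>_. 0) e \<inter> {z. z 0 \<in> I}"

lemma fres_cong:
  assumes "\<And>i m k. m < tgt_rank r i \<Longrightarrow> k < r i \<Longrightarrow> P i m k = P' i m k" "fres l I r a P"
  shows "fres l I r a P'"
proof -
  have pm: "pmap (tgt_rank r i) (r i) (P i) = pmap (tgt_rank r i) (r i) (P' i)" for i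
    by (rule pmap_cong) (rule assms(1))
  have "syz I r P = syz I r P'" by (rule ext) (simp add: syz_def pm split: nat.split)
  then show ?thesis using assms unfolding fres_def by (simp only: pm) (metis (no_types, lifting))
qed

section \<open>The syzygy modules of a minimal resolution\<close>

locale resolution =
  fixes l :: nat and I :: "(nat, 'k::field) mpoly set" and r a P
  assumes ideal: "hideal l I" and res: "fres l I r a P"
begin

definition syzgr :: "nat \<Rightarrow> int \<Rightarrow> 'k pvec set"
  where "syzgr i e = fm l (tgt_rank r i) (tgt_deg a i) e \<inter> syz I r P i"

abbreviation "cover i \<equiv> pmap (tgt_rank r i) (r i) (P i)"

lemma cover_zero: "cover i 0 = 0"
  using pmap_sm[of _ _ _ 0 0] by (simp only: sm_simps)

lemma syz_add: "v \<in> syz I r P i \<Longrightarrow> w \<in> syz I r P i \<Longrightarrow> v + w \<in> syz I r P i"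
  using hidealD(3)[OF ideal] by (cases i) (auto simp: syz_simps pmap_add)

lemma syz_sm: "f \<in> polyS l \<Longrightarrow> v \<in> syz I r P i \<Longrightarrow> sm f v \<in> syz I r P i"
proof (cases i)
  case 0
  then show "f \<in> polyS l \<Longrightarrow> v \<in> syz I r P i \<Longrightarrow> sm f v \<in> syz I r P i"
    using hidealD(4)[OF ideal] by (simp add: syz_simps sm_def)
next
  case (Suc j)
  assume "v \<in> syz I r P i"
  then have "cover j v = 0" using Suc by (simp add: syz_simps)
  then have "cover j (sm f v) = 0" by (simp only: pmap_sm sm_simps)
  then show "sm f v \<in> syz I r P i" using Suc by (simp add: syz_simps)
qed

lemma syz_zero: "0 \<in> syz I r P i"
  using hidealD(2)[OF ideal] cover_zero by (cases i) (simp_all add: syz_simps)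

lemma syz_graded: "graded_module l (syzgr i)"
proof
  have um: "- v = sm (- 1) v" for v :: "'k pvec" by (rule ext) (simp add: sm_def)
  have "v \<in> syz I r P i \<Longrightarrow> - v \<in> syz I r P i" for v unfolding um by (rule syz_sm) simp_all
  then show "addgrp (syzgr i e)" for e
    unfolding addgrp_def syzgr_def by (intro conjI ballI IntI addgrpD(1-3)[OF addgrp_fm] syz_zero syz_add) auto
  show "x < l \<Longrightarrow> v \<in> syzgr i e \<Longrightarrow> sm (var_poly x) v \<in> syzgr i (e + 1)" for e x v
    using graded_module.var[OF fm_graded] syz_sm[OF forms_polyS[OF var_poly_form]] unfolding syzgr_def by blast
  show "v \<in> syzgr i e \<Longrightarrow> sm (const_poly c) v \<in> syzgr i e" for e c v
    using graded_module.scale[OF fm_graded] syz_sm[OF const_poly_in_polyS] unfolding syzgr_def by blast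
qed

lemma cover_image: "cover i ` fm l (r i) (a i) e = syzgr i e"
proof (intro equalityI subsetI)
  fix z assume "z \<in> cover i ` fm l (r i) (a i) e"
  then obtain v where v: "z = cover i v" "v \<in> fm l (r i) (a i) e" by (rule imageE)
  have "z \<in> syz I r P i" using fresD(3)[OF res, of i] fm_vecS[OF v(2)] v(1) by blast
  moreover have "z \<in> fm l (tgt_rank r i) (tgt_deg a i) e" unfolding fm_def
  proof (intro CollectI allI conjI impI)
    fix j
    show "z j = 0" if "tgt_rank r i \<le> j" using that by (simp add: v(1) pmap_def)
    have "(\<Sum>k<r i. P i j k * v k) \<in> formsZ l (e - int (tgt_deg a i j))" if j: "j < tgt_rank r i"
    proof (rule formsZ_sum)
      fix k assume "k \<in> {..<r i}"
      then have "P i j k \<in> formsZ l (int (a i k) - int (tgt_deg a i j))" "v k \<in> formsZ l (e - int (a i k))"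
        using fresD(1)[OF res j] v(2) by (auto simp: fm_def)
      from formsZ_mult[OF this] show "P i j k * v k \<in> formsZ l (e - int (tgt_deg a i j))" by simp
    qed
    then show "z j \<in> formsZ l (e - int (tgt_deg a i j))" by (simp add: v(1) pmap_def)
  qed
  ultimately show "z \<in> syzgr i e" by (simp add: syzgr_def)
next
  fix z assume z: "z \<in> syzgr i e"
  then have "z \<in> vecS l (tgt_rank r i) \<inter> syz I r P i" using fm_vecS by (auto simp: syzgr_def)
  then have "z \<in> cover i ` vecS l (r i)" by (simp only: fresD(3)[OF res])
  then obtain v where v: "z = cover i v" "v \<in> vecS l (r i)" by (rule imageE)
  have vS: "v k \<in> polyS l" for k using v(2) by (simp add: vecS_def)
  \<comment> \<open>Any preimage works after taking homogeneous components of the right degrees,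
    since the entries of the matrix are forms.\<close>
  define w where "w k = hcZ (e - int (a i k)) (v k)" for k
  have "w \<in> fm l (r i) (a i) e" unfolding fm_def w_def
    by (intro CollectI allI conjI hcZ_formsZ vS) (use v(2) in \<open>auto simp: vecS_def hcZ_def\<close>)
  moreover have "cover i w = z"
  proof
    fix j
    show "cover i w j = z j"
    proof (cases "j < tgt_rank r i")
      case True
      have "P i j k * w k = hcZ (e - int (tgt_deg a i j)) (P i j k * v k)" if "k < r i" for k
        using hcZ_mult[OF vS fresD(1)[OF res True that], of "e - int (tgt_deg a i j)"] by (simp add: w_def)
      then have "cover i w j = (\<Sum>k<r i. hcZ (e - int (tgt_deg a i j)) (P i j k * v k))" using True by (simp add: pmap_def)
      also have "\<dots> = hcZ (e - int (tgt_deg a i j)) (z j)" using True by (simp add: v(1) pmap_def hcZ_sum)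
      also have "\<dots> = z j" using z by (intro hcZ_of_form[of _ l]) (simp add: syzgr_def fm_def)
      finally show ?thesis .
    qed (simp add: v(1) pmap_def)
  qed
  ultimately show "z \<in> cover i ` fm l (r i) (a i) e" by blast
qed

text \<open>Syzygies have no constant terms because they are images under the next matrix, whose
  entries have none.\<close>

lemma free_cover: "free_cover l (r i) (a i) (syzgr i) (syzgr (Suc i)) (cover i)"
proof -
  have const: "lookup (v k) 0 = 0" if v: "v \<in> syzgr (Suc i) e" for v e k
  proof -
    have "v \<in> cover (Suc i) ` fm l (r (Suc i)) (a (Suc i)) e" using v by (simp only: cover_image)
    then obtain w where w: "v = cover (Suc i) w" by blast
    show ?thesis
    proof (cases "k < r i")
      case True
      have "lookup (\<Sum>m<r (Suc i). P (Suc i) k m * w m) 0 = (\<Sum>m<r (Suc i). lookup (P (Suc i) k m * w m) 0)"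
        by (rule lookup_sum)
      also have "\<dots> = 0" using fresD(2)[OF res True] by (intro sum.neutral ballI lookup_mult_0) auto
      finally show ?thesis using True by (simp add: w pmap_def)
    qed (simp add: w pmap_def)
  qed
  show ?thesis
  proof (intro free_cover.intro cover_step.intro fm_graded syz_graded cover_step_axioms.intro free_cover_axioms.intro)
    show "cover i (v + w) = cover i v + cover i w" for v w by (rule pmap_add)
    show "cover i (sm f v) = sm f (cover i v)" for f v by (rule pmap_sm)
    show "cover i ` fm l (r i) (a i) e = syzgr i e" for e by (rule cover_image)
    show "syzgr (Suc i) e = {v \<in> fm l (r i) (a i) e. cover i v = 0}" for e by (auto simp: syzgr_def syz_simps)
    show "acyc [0..<l] (fm l (r i) (a i) :: int \<Rightarrow> 'k pvec set) (\<lambda>_. {0}) p e" if "p \<ge> 1" for p e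
      using that by (intro fm_acyc) auto
    show "\<exists>w\<in>ch l 1 (fm l (r i) (a i) (e - 1)). kd [0..<l] w = cbase l v" if v: "v \<in> syzgr (Suc i) e" for v e
      using v const[OF v] by (intro fm_small) (simp_all add: syzgr_def)
  qed (rule const)
qed

lemma qbasis_shifts:
  "qbasis (cyc l p (syzgr i) e) (bnd l p (syzgr i) e) m \<Longrightarrow>
    qbasis (cyc l (p + i) (syzgr 0) (e - int i)) (bnd l (p + i) (syzgr 0) (e - int i)) m"
proof (induction i arbitrary: p e)
  case (Suc i)
  have "cover_step l (fm l (r i) (a i)) (syzgr i) (syzgr (Suc i)) (cover i)" by (rule free_cover.axioms(1)[OF free_cover])
  from Suc.IH[OF cover_step.qbasis_shift[OF this Suc.prems]] show ?case by (simp add: algebra_simps)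
qed simp

lemma syzgr_0: "syzgr 0 = idealgr l I"
  by (rule ext) (simp add: syzgr_def idealgr_def syz_simps)

text \<open>The Koszul homology of \<open>I\<close> computes the Betti numbers, by dimension shifting along the resolution.\<close>

theorem koszul_betti:
  "qbasis (cyc l i (idealgr l I) (int j - int i)) (bnd l i (idealgr l I) (int j - int i)) (card {k. k < r i \<and> a i k = j})"
  using qbasis_shifts[OF free_cover.qbasis_start[OF free_cover, of i "int j"]] by (simp add: syzgr_0)

lemma ideal_graded: "graded_module l (idealgr l I)"
  using syz_graded[of 0] by (simp add: syzgr_0)

lemma is_resolution:
  "\<exists>\<phi>. minimal_free_resolution l I r a \<phi>"
proof -
  let ?\<phi> = "\<lambda>i. mat (tgt_rank r i) (r i) (\<lambda>(m, k). P i m k)"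
  have "fres l I r a (\<lambda>i j k. ?\<phi> i $$ (j, k))" by (rule fres_cong[OF _ res]) simp
  then have "minimal_free_resolution l I r a ?\<phi>"
    using resolution_iff_fres[of ?\<phi> r I l a] hidealD(1)[OF ideal] by (simp add: subsetI)
  then show ?thesis by blast
qed

text \<open>The count depends on the ideal alone: for any two resolutions both counts are the
  dimension of the same Koszul homology.\<close>

lemma betti_eq: "betti l I i j = card {k. k < r i \<and> a i k = j}"
  unfolding betti_def
proof (rule the_equality)
  show "\<exists>r' a' \<phi>. minimal_free_resolution l I r' a' \<phi> \<and> card {k. k < r i \<and> a i k = j} = card {k. k < r' i \<and> a' i k = j}"
    using is_resolution by blast
  fix b assume "\<exists>r a \<phi>. minimal_free_resolution l I r a \<phi> \<and> b = card {k. k < r i \<and> a i k = j}"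
  then obtain r' a' \<phi> where h: "minimal_free_resolution l I r' a' \<phi>" "b = card {k. k < r' i \<and> a' i k = j}" by blast
  have "\<phi> i \<in> carrier_mat (tgt_rank r' i) (r' i)" for i
    using h(1) unfolding minimal_free_resolution_def by (cases i) auto
  from resolution_iff_fres[OF this, of I l a'] have "fres l I r' a' (\<lambda>i j k. \<phi> i $$ (j, k))"
    using h(1) hidealD(1)[OF ideal] by (simp add: subsetI)
  then have "resolution l I r' a' (\<lambda>i j k. \<phi> i $$ (j, k))" using ideal by (simp add: resolution_def)
  note q' = resolution.koszul_betti[OF this, of i j]
  have le: "qbasis X (bnd l i (idealgr l I) e) m \<Longrightarrow> qbasis X (bnd l i (idealgr l I) e) m' \<Longrightarrow> m' \<le> m" for X e m m'
    by (rule qbasis_le[OF graded_module.bnd_closed(1)[OF ideal_graded]])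
      (erule graded_module.bnd_closed(2)[OF ideal_graded])
  show "b = card {k. k < r i \<and> a i k = j}"
    using le[OF q' koszul_betti[of i j]] le[OF koszul_betti[of i j] q'] h(2) by simp
qed

text \<open>Hilbert's syzygy theorem: the Koszul complex on \<open>l\<close> variables has no
  nonzero chains beyond homological degree \<open>l\<close>.\<close>

lemma rank_zero: assumes "k < r i" shows "i \<le> l"
proof (rule ccontr)
  assume "\<not> i \<le> l"
  let ?e = "int (a i k) - int i"
  have "cyc l i (idealgr l I) ?e \<subseteq> {0}"
  proof
    fix c assume "c \<in> cyc l i (idealgr l I) ?e"
    then have c: "c \<in> ch l i (idealgr l I ?e)" by (simp add: cyc_def)
    have "c b = 0" for b using chD(2)[OF c, of b] count_le_length[of b True] \<open>\<not> i \<le> l\<close> by (cases "c b = 0") auto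
    then have "c = 0" by (intro ext) simp
    then show "c \<in> {0}" by simp
  qed
  from qbasis_trivial[OF koszul_betti this] addgrpD(1)[OF graded_module.bnd_closed(1)[OF ideal_graded]]
  have "card {k'. k' < r i \<and> a i k' = a i k} = 0" by blast
  then show False using assms by auto
qed

text \<open>The maxima that define \<open>reg\<close> range over finite sets, by
  \<open>rank_zero\<close> and the finiteness of each rank.\<close>

lemma degree_le_reg: assumes k: "k < r i" shows "int (a i k) - int i \<le> reg l I"
proof -
  define B where "B = {i. \<exists>j. betti l I i j \<noteq> 0}"
  define f where "f i = int (Max {j. betti l I i j \<noteq> 0}) - int i" for i
  have ne: "betti l I i j \<noteq> 0 \<longleftrightarrow> (\<exists>k<r i. a i k = j)" for i j
    unfolding betti_eq by (auto simp: card_eq_0_iff)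
  have "B \<subseteq> {..l}" unfolding B_def ne using rank_zero by blast
  then have fin: "finite (f ` B)" by (simp add: finite_subset)
  have reg: "reg l I = Max (f ` B)" unfolding reg_def B_def f_def by (rule arg_cong[where f = Max]) auto
  have "i \<in> B" using k unfolding B_def ne mem_Collect_eq by blast
  then have "f i \<le> reg l I" unfolding reg by (intro Max_ge fin imageI)
  moreover have "a i k \<le> Max {j. betti l I i j \<noteq> 0}"
  proof (rule Max_ge)
    have "{j. betti l I i j \<noteq> 0} \<subseteq> a i ` {..<r i}" unfolding ne by auto
    then show "finite {j. betti l I i j \<noteq> 0}" by (rule finite_subset) simp
    show "a i k \<in> {j. betti l I i j \<noteq> 0}" unfolding ne mem_Collect_eq using k by blast
  qed
  ultimately show ?thesis by (simp add: f_def)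
qed

text \<open>A cycle modulo \<open>I\<close> has its differential in \<open>I\<close>, in homological
  degree \<open>q = p - 1\<close>. The homology there is counted by generators of a degree above
  \<open>c + q\<close>, of which there are none. Correction by a chain in \<open>I\<close> then
  gives a cycle of the acyclic complex on the polynomial ring.\<close>

lemma acyc_beyond:
  assumes c: "\<And>i k. k < r i \<Longrightarrow> a i k \<le> c + i" and p: "p \<ge> 1" and e: "e \<ge> int c"
  shows "acyc [0..<l] (fm l 1 (\<lambda>_. 0)) (idealgr l I) p e"
  unfolding acyc_def
proof (intro ballI impI)
  let ?M = "fm l 1 (\<lambda>_. 0) :: int \<Rightarrow> 'k pvec set" and ?d = "kd [0..<l]"
  have sub: "set [0..<l] \<subseteq> {..<l}" by auto
  fix x assume x: "x \<in> ch (length [0..<l]) p (?M e)" "\<forall>b. ?d x b \<in> idealgr l I (e + 1)"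
  obtain q where q: "p = Suc q" using p by (cases p) auto
  have xl: "x \<in> ch l (Suc q) (?M e)" using x(1) q by simp
  have "?d x \<in> ch l q (?M (e + 1))" using graded_module.kd_ch[OF fm_graded sub, of x q 1 "\<lambda>_. 0" e] xl by simp
  then have "?d x \<in> ch l q (idealgr l I (e + 1))" by (rule ch_of_values) (use x(2) in simp)
  then have cyc: "?d x \<in> cyc l q (idealgr l I) (e + 1)" by (simp add: cyc_def kd_kd)
  define j where "j = nat (e + 1) + q"
  have j: "int j - int q = e + 1" using e by (simp add: j_def)
  have "{k. k < r q \<and> a q k = j} = {}" using c[of _ q] e by (force simp: j_def)
  then have "cyc l q (idealgr l I) (e + 1) \<subseteq> bnd l q (idealgr l I) (e + 1)"
    using koszul_betti[of q j] unfolding j by (intro qbasis_zero) (simp only: card.empty)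
  then obtain d where d: "d \<in> ch l p (idealgr l I e)" "?d x = ?d d" using cyc q by (auto simp: bnd_def)
  have dM: "d \<in> ch l (Suc q) (?M e)" using d(1) ch_mono[of "idealgr l I e" "?M e" l p] q by (auto simp: idealgr_def)
  have xd: "x - d \<in> ch l (Suc q) (?M e)" by (rule addgrpD(4)[OF addgrp_ch[OF addgrp_fm] xl dM])
  have "acyc [0..<l] ?M (\<lambda>_. {0}) p e" using p by (intro fm_acyc) auto
  moreover have "\<forall>b. ?d (x - d) b \<in> {0}" by (simp add: kd_diff d(2))
  ultimately obtain w where w: "w \<in> ch (length [0..<l]) (Suc p) (?M (e - 1))" "\<And>b. (x - d - ?d w) b \<in> {0}"
    using xd q unfolding acyc_def by auto
  have "(x - ?d w) b \<in> idealgr l I e" for b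
  proof -
    have "(x - ?d w) b = d b" using w(2)[of b] by (simp add: algebra_simps)
    then show ?thesis using chD(1)[OF d(1)] by simp
  qed
  then show "\<exists>w\<in>ch (length [0..<l]) (Suc p) (?M (e - 1)). \<forall>b. (x - ?d w) b \<in> idealgr l I e" using w(1) by blast
qed

text \<open>Variables are peeled off from the front of the list. In degrees at least
  \<open>E\<close> regularity gives exactness for every tail at once, and this starts the descent of
  \<open>acyc_down\<close>.\<close>

lemma regular0_beyond:
  assumes c: "\<And>i k. k < r i \<Longrightarrow> a i k \<le> c + i"
    and E: "\<And>n e. n < l \<Longrightarrow> e \<ge> E \<Longrightarrow> regular0 n [Suc n..<l] (fm l 1 (\<lambda>_. 0)) (idealgr l I) e"
    and n: "n < l" and e: "e \<ge> int c"
  shows "regular0 n [Suc n..<l] (fm l 1 (\<lambda>_. 0)) (idealgr l I) e"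
proof -
  let ?M = "fm l 1 (\<lambda>_. 0) :: int \<Rightarrow> 'k pvec set"
  interpret graded_pair l ?M "idealgr l I"
    by (rule graded_pair.intro[OF fm_graded ideal_graded])
  have large: "acyc [m..<l] ?M (idealgr l I) p e" if "p \<ge> 1" "e \<ge> E" for m p e
  proof (rule acyc_of_regular)
    show "set [m..<l] \<subseteq> {..<l}" by auto
    fix x ys zs assume xs: "[m..<l] = zs @ x # ys"
    have "m + length zs < l" using arg_cong[OF xs, of length] by simp
    then have "x = m + length zs" "ys = [Suc (m + length zs)..<l]"
      using arg_cong[OF xs, of "\<lambda>xs. xs ! length zs"] arg_cong[OF xs, of "drop (Suc (length zs))"] by (simp_all add: drop_upt)
    then show "regular0 x ys ?M (idealgr l I) e" using E[of x e] \<open>m + length zs < l\<close> that(2) by simp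
  qed (rule that)
  have ac: "acyc [m..<l] ?M (idealgr l I) p e" if "m \<le> l" "p \<ge> 1" "e \<ge> int c" for m p e
    using that
  proof (induction m arbitrary: p e)
    case 0
    then show ?case using acyc_beyond[OF c] by simp
  next
    case (Suc m)
    have eq: "[m..<l] = m # [Suc m..<l]" using Suc.prems by (simp add: upt_conv_Cons)
    show ?case
    proof (rule acyc_down[where x = m and E = E and ?e0.0 = "int c"])
      show "acyc (m # [Suc m..<l]) ?M (idealgr l I) (Suc p) e" if "e \<ge> int c" for e
        using Suc.IH[of "Suc p" e] Suc.prems that unfolding eq by simp
    qed (use Suc.prems large in auto)
  qed
  have "[n..<l] = n # [Suc n..<l]" using n by (simp add: upt_conv_Cons)
  then have "acyc (n # [Suc n..<l]) ?M (idealgr l I) 1 e" using ac[of n 1 e] n e by simp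
  then show ?thesis by (intro regular0_of_acyc) (use n in auto)
qed

end

text \<open>The regularity belongs to \<open>I\<close>, whereas the Koszul argument runs in generic
  coordinates; the same ranks and degrees serve both ideals.\<close>

lemma fres_act:
  fixes I :: "(nat, 'k::field) mpoly set"
  assumes g: "g \<in> GL l" and I: "hideal l I" and res: "fres l I r a P"
  shows "fres l (act l g ` I) r a (\<lambda>i m k. act l g (P i m k))"
proof -
  obtain h where hg: "h \<in> GL l" "h * g = 1\<^sub>m l" using g by (rule GL_inverse)
  have gh: "g \<in> carrier_mat l l" "h \<in> carrier_mat l l" using g hg by (auto simp: GL_def)
  have h: "h \<in> GL l" "\<And>p. p \<in> polyS l \<Longrightarrow> act l h (act l g p) = p" "\<And>p. p \<in> polyS l \<Longrightarrow> act l g (act l h p) = p"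
    using hg act_inverse[OF gh hg(2)] act_inverse[OF gh(2,1) mat_mult_left_right_inverse[OF gh(2,1) hg(2)]] by auto
  let ?G = "\<lambda>v k. act l g (v k)" and ?H = "\<lambda>v k. act l h (v k)"
  let ?P = "\<lambda>i m k. act l g (P i m k)"
  have act0: "act l g p = 0 \<longleftrightarrow> p = 0" if "p \<in> polyS l" for p
    using h(2)[OF that] act_simps by metis
  have GS: "?G v \<in> vecS l n" and HS: "?H v \<in> vecS l n" if "v \<in> vecS l n" for v n
    using that by (auto simp: vecS_def act_simps)
  have HG: "?H (?G v) = v" and GH: "?G (?H v) = v" if "v \<in> vecS l n" for v n
    using that h(2,3) by (auto simp: vecS_def fun_eq_iff)
  have imS: "?G ` vecS l n = vecS l n" for n
    using GS HS GH by (force intro: rev_image_eqI)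
  have PS: "P i m k \<in> polyS l" if "m < tgt_rank r i" "k < r i" for i m k
    using fresD(1)[OF res that] by (rule formsZ_polyS)
  have pm: "pmap m n (\<lambda>j k. act l g (Q j k)) (?G v) = ?G (pmap m n Q v)" for m n Q v
    by (rule ext) (simp add: pmap_def act_simps)
  have pm0: "pmap (tgt_rank r i) (r i) (?P i) (?G v) = 0 \<longleftrightarrow> pmap (tgt_rank r i) (r i) (P i) v = 0" if "v \<in> vecS l (r i)" for i v
  proof -
    have "pmap (tgt_rank r i) (r i) (P i) v \<in> vecS l (tgt_rank r i)" by (rule pmap_vecS[OF PS that])
    then show ?thesis unfolding pm by (auto simp: fun_eq_iff vecS_def act0)
  qed
  have syz: "vecS l (tgt_rank r i) \<inter> syz (act l g ` I) r ?P i = ?G ` (vecS l (tgt_rank r i) \<inter> syz I r P i)" for i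
  proof -
    have "?G v \<in> syz (act l g ` I) r ?P i \<longleftrightarrow> v \<in> syz I r P i" if v: "v \<in> vecS l (tgt_rank r i)" for v
    proof (cases i)
      case 0
      have "v 0 \<in> I" if "act l g (v 0) = act l g p" "p \<in> I" for p
      proof -
        have "v 0 = act l h (act l g (v 0))" using v by (intro h(2)[symmetric]) (simp add: vecS_def)
        also have "\<dots> = p" unfolding that(1) by (rule h(2)[OF hidealD(1)[OF I that(2)]])
        finally show ?thesis using that(2) by simp
      qed
      then show ?thesis using 0 by (auto simp: syz_simps)
    next
      case (Suc j)
      then show ?thesis using pm0[of v j] v by (simp add: syz_simps)
    qed
    note iff = this
    show ?thesis
    proof (intro equalityI subsetI)
      fix x assume x: "x \<in> vecS l (tgt_rank r i) \<inter> syz (act l g ` I) r ?P i"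
      then have "x \<in> ?G ` vecS l (tgt_rank r i)" by (simp only: imS IntD1)
      then obtain v where v: "x = ?G v" "v \<in> vecS l (tgt_rank r i)" by (rule imageE)
      have "v \<in> syz I r P i" using iff[OF v(2)] x unfolding v(1) by (rule iffD1[OF _ IntD2])
      then show "x \<in> ?G ` (vecS l (tgt_rank r i) \<inter> syz I r P i)" using v by (intro image_eqI[of _ ?G v]) auto
    next
      fix x assume "x \<in> ?G ` (vecS l (tgt_rank r i) \<inter> syz I r P i)"
      then obtain v where v: "x = ?G v" "v \<in> vecS l (tgt_rank r i) \<inter> syz I r P i" by (rule imageE)
      then show "x \<in> vecS l (tgt_rank r i) \<inter> syz (act l g ` I) r ?P i"
        unfolding v(1) by (intro IntI GS[OF IntD1[OF v(2)]] iffD2[OF iff IntD2[OF v(2)]] IntD1[OF v(2)])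
    qed
  qed
  show ?thesis unfolding fres_def
  proof (intro conjI allI impI)
    fix i m k assume mk: "m < tgt_rank r i" "k < r i"
    have f: "act l g (P i m k) \<in> formsZ l d" if "P i m k \<in> formsZ l d" for d
      using that act_forms[of "P i m k" l "nat d" g] by (auto simp: formsZ_def act_simps split: if_splits)
    show "?P i m k \<in> formsZ l (int (a i k) - int (tgt_deg a i m))" by (rule f[OF fresD(1)[OF res mk]])
    assume "0 < i"
    then have "lookup (P i m k) 0 = 0" using fresD(2)[OF res] mk by (cases i) auto
    moreover have fm: "P i m k \<in> formsZ l (int (a i k) - int (tgt_deg a i m))" by (rule fresD(1)[OF res mk])
    ultimately show "lookup (?P i m k) 0 = 0"
    \<comment> \<open>Linear substitutions keep degrees, so a constant term could only come from an
      entry of degree 0, and such an entry is zero by minimality.\<close>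
    proof (cases "int (a i k) - int (tgt_deg a i m) = 0")
      case True
      then have "P i m k \<in> forms l 0" using fm by (simp add: formsZ_def)
      from forms_0[OF this] have "P i m k = 0" using \<open>lookup (P i m k) 0 = 0\<close> by (simp add: const_poly_hom)
      then show ?thesis by (simp add: act_simps)
    next
      case False
      have "0 \<notin> keys (?P i m k)" using formsZ_keys[OF f[OF fm], of 0] False by auto
      then show ?thesis by (simp add: in_keys_iff)
    qed
  next
    fix i
    have "pmap (tgt_rank r i) (r i) (?P i) ` vecS l (r i) = pmap (tgt_rank r i) (r i) (?P i) ` ?G ` vecS l (r i)" by (simp only: imS)
    also have "\<dots> = ?G ` pmap (tgt_rank r i) (r i) (P i) ` vecS l (r i)" unfolding image_image pm by (rule refl)
    also have "\<dots> = ?G ` (vecS l (tgt_rank r i) \<inter> syz I r P i)" by (simp only: fresD(3)[OF res])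
    finally show "pmap (tgt_rank r i) (r i) (?P i) ` vecS l (r i) = vecS l (tgt_rank r i) \<inter> syz (act l g ` I) r ?P i"
      by (simp only: syz)
  qed
qed

section \<open>From Koszul exactness to multiplication by a variable\<close>

lemma highvars_support:
  "f \<in> polyS l \<Longrightarrow> f \<in> highvars l n \<longleftrightarrow> (\<forall>t\<in>keys f. \<exists>y\<in>set [n..<l]. lookup t y > 0)"
proof -
  assume f: "f \<in> polyS l"
  have "t \<notin> pps n \<longleftrightarrow> (\<exists>y\<in>set [n..<l]. lookup t y > 0)" if t: "t \<in> keys f" for t
  proof -
    have tl: "t \<in> pps l" using f t by (auto simp: polyS_iff)
    have "y \<in> {..<n}" if "y \<in> keys t" "\<not> (\<exists>y\<in>set [n..<l]. lookup t y > 0)" for y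
      using that lookup_pps[OF tl, of y] by (cases "y < l"; cases "y < n") (auto simp: in_keys_iff)
    moreover have "t \<notin> pps n" if "y \<in> set [n..<l]" "lookup t y > 0" for y
      using that lookup_pps[of t n y] by auto
    ultimately show ?thesis unfolding pps_def by blast
  qed
  then show ?thesis using f unfolding highvars_iff by blast
qed

definition evec :: "(nat, 'k::comm_ring_1) mpoly \<Rightarrow> 'k pvec"
  where "evec f = (\<lambda>k. if k = 0 then f else 0)"

lemma evec_fm [simp]:
  "evec f \<in> fm l 1 (\<lambda>_. 0) e \<longleftrightarrow> f \<in> formsZ l e" "evec f \<in> fm l (Suc 0) (\<lambda>_. 0) e \<longleftrightarrow> f \<in> formsZ l e"
  by (auto simp: fm_def evec_def)

lemma fm_evec: "v \<in> fm l 1 (\<lambda>_. 0) e \<Longrightarrow> v = evec (v 0)"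
  by (auto simp: fm_def evec_def fun_eq_iff)

lemma evec_simps: "evec (f + g) = evec f + evec g" "evec (f - g) = evec f - evec g" "sm p (evec f) = evec (p * f)" "evec f 0 = f"
  by (auto simp: evec_def sm_def fun_eq_iff)

lemma isum_highvars_form:
  fixes I :: "(nat, 'k::field) mpoly set"
  assumes I: "hideal l I" and f: "f \<in> forms l d" "f \<in> isum I (highvars l n)"
  shows "\<exists>q\<in>I \<inter> forms l d. f - q \<in> highvars l n \<inter> forms l d"
proof -
  obtain q where q: "q \<in> I" "f - q \<in> highvars l n" using f(2) by (auto simp: isum_iff)
  let ?q = "homogeneous_component d q"
  have "?q \<in> I" "?q \<in> forms l d"
    using hidealD(5)[OF I q(1)] homogeneous_component_form[OF hidealD(1)[OF I q(1)]] by auto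
  moreover have "f - ?q \<in> highvars l n"
    using hidealD(5)[OF hideal_highvars q(2), of d] by (simp add: homogeneous_component_diff homogeneous_component_of_form[OF f(1)])
  ultimately show ?thesis using f(1) by blast
qed

lemma kd_highvars:
  fixes w :: "'k::field chain"
  assumes "w \<in> ch (length [n..<l]) 1 (fm l 1 (\<lambda>_. 0) e)"
  shows "kd [n..<l] w (replicate (l - n) False) 0 \<in> highvars l n"
proof -
  have "set [n..<l] \<subseteq> {..<l}" by auto
  then have "kd [n..<l] w \<in> ch (length [n..<l]) 0 (fm l 1 (\<lambda>_. 0) (e + 1))"
    using graded_module.kd_ch[OF fm_graded, of "[n..<l]" l w 0 1 "\<lambda>_. 0" e] assms by simp
  then have "kd [n..<l] w (replicate (l - n) False) 0 \<in> polyS l"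
    using chD(1) fm_vecS unfolding vecS_def by blast
  then show ?thesis using kd_base_keys[of _ "[n..<l]" w 0] by (simp add: highvars_support)
qed

lemma highvars_kd:
  fixes f :: "(nat, 'k::field) mpoly"
  assumes "f \<in> highvars l n" "f \<in> formsZ l e"
  shows "\<exists>w\<in>ch (length [n..<l]) 1 (fm l 1 (\<lambda>_. 0) (e - 1)). kd [n..<l] w = cbase (length [n..<l]) (evec f)"
proof (rule kd_base_image)
  show "evec f \<in> fm l 1 (\<lambda>_. 0) (e - 1 + 1)" using assms(2) by simp
  fix k t assume t: "t \<in> keys (evec f k)"
  then have "t \<in> keys f" by (simp add: evec_def split: if_splits)
  then show "\<exists>x\<in>set [n..<l]. 0 < lookup t x"
    using assms(1) highvars_support[OF formsZ_polyS[OF assms(2)]] by blast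
qed auto

text \<open>The homology in degree 0 on the variables after \<open>n\<close> is the quotient by
  \<open>I\<close> and these variables, so both notions express the same injectivity.\<close>

lemma inj_mult_of_regular0:
  fixes I :: "(nat, 'k::field) mpoly set"
  assumes I: "hideal l I" and n: "n < l" and reg: "regular0 n [Suc n..<l] (fm l 1 (\<lambda>_. 0)) (idealgr l I) (int i)"
  shows "inj_mult l I n i 1"
  unfolding inj_mult_def
proof (intro ballI impI)
  let ?xs = "[Suc n..<l]" and ?M = "fm l 1 (\<lambda>_. 0) :: int \<Rightarrow> 'k pvec set"
  let ?F = "replicate (l - Suc n) False"
  fix p assume p: "p \<in> forms l i" "var_poly n ^ 1 * p \<in> isum I (highvars l (Suc n))"
  have xp: "var_poly n * p \<in> forms l (Suc i)" using forms_mult[OF var_poly_form[OF n] p(1)] by simp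
  obtain q where q: "q \<in> I" "q \<in> forms l (Suc i)" "var_poly n * p - q \<in> highvars l (Suc n)" "var_poly n * p - q \<in> forms l (Suc i)"
    using isum_highvars_form[OF I xp, of "Suc n"] p(2) by auto
  have fz: "formsZ l (int i + 1) = (forms l (Suc i) :: (nat, 'k) mpoly set)" by (simp add: formsZ_def nat_add_distrib)
  obtain w where w: "w \<in> ch (length ?xs) 1 (?M (int i))" "kd ?xs w = cbase (length ?xs) (evec (var_poly n * p - q))"
    using highvars_kd[OF q(3), of "int i + 1"] q(4) fz by auto
  let ?z = "cbase (length ?xs) (evec p)"
  have z: "?z \<in> ch (length ?xs) 0 (?M (int i))" using p(1) by (intro cbase_ch addgrp_fm) simp
  have "csm (var_poly n) ?z - kd ?xs w = cbase (length ?xs) (evec q)"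
    unfolding w(2) by (simp only: cbase_simps(2,3)[symmetric] cbase_simps(3) evec_simps(2,3)) (simp add: cbase_simps(2)[symmetric])
  moreover have "evec q \<in> idealgr l I (int i + 1)" using q by (simp add: idealgr_def evec_simps fz)
  moreover have "0 \<in> idealgr l I (int i + 1)" using addgrpD(1)[OF addgrp_fm] hidealD(2)[OF I] by (simp add: idealgr_def)
  ultimately have "\<forall>b. (csm (var_poly n) ?z - kd ?xs w) b \<in> idealgr l I (int i + 1)" by (simp add: cbase_def)
  then obtain d where d: "d \<in> ch (length ?xs) 1 (?M (int i - 1))" "\<And>b. (?z - kd ?xs d) b \<in> idealgr l I (int i)"
    using reg z w(1) unfolding regular0_def by blast
  have "p - kd ?xs d ?F 0 \<in> I" using d(2)[of ?F] by (simp add: idealgr_def cbase_simps(5) evec_simps(4))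
  moreover have "p - (p - kd ?xs d ?F 0) \<in> highvars l (Suc n)" using kd_highvars[OF d(1)] by simp
  ultimately show "p \<in> isum I (highvars l (Suc n))" unfolding isum_iff by blast
qed

lemma regular0_of_inj_mult:
  fixes I :: "(nat, 'k::field) mpoly set"
  assumes I: "hideal l I" and n: "n < l" and inj: "inj_mult l I n i 1"
  shows "regular0 n [Suc n..<l] (fm l 1 (\<lambda>_. 0)) (idealgr l I) (int i)"
  unfolding regular0_def
proof (intro ballI impI)
  let ?xs = "[Suc n..<l]" and ?M = "fm l 1 (\<lambda>_. 0) :: int \<Rightarrow> 'k pvec set"
  let ?F = "replicate (l - Suc n) False"
  fix z w assume z: "z \<in> ch (length ?xs) 0 (?M (int i))" and w: "w \<in> ch (length ?xs) 1 (?M (int i))"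
    "\<forall>b. (csm (var_poly n) z - kd ?xs w) b \<in> idealgr l I (int i + 1)"
  define p where "p = z ?F 0"
  have zM: "z ?F \<in> ?M (int i)" by (rule chD(1)[OF z])
  then have p: "p \<in> forms l i" unfolding p_def fm_def by auto
  have "(csm (var_poly n) z - kd ?xs w) ?F 0 \<in> I" using w(2) by (simp add: idealgr_def)
  then have "var_poly n * p - kd ?xs w ?F 0 \<in> I" by (simp add: csm_def sm_def p_def)
  moreover have "var_poly n * p - (var_poly n * p - kd ?xs w ?F 0) \<in> highvars l (Suc n)" using kd_highvars[OF w(1)] by simp
  ultimately have "var_poly n ^ 1 * p \<in> isum I (highvars l (Suc n))" unfolding isum_iff power_one_right by blast
  then have "p \<in> isum I (highvars l (Suc n))" using inj p unfolding inj_mult_def by blast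
  then obtain q where q: "q \<in> I" "q \<in> forms l i" "p - q \<in> highvars l (Suc n)" "p - q \<in> forms l i"
    using isum_highvars_form[OF I p, of "Suc n"] by auto
  obtain d where d: "d \<in> ch (length ?xs) 1 (?M (int i - 1))" "kd ?xs d = cbase (length ?xs) (evec (p - q))"
    using highvars_kd[OF q(3), of "int i"] q(4) by auto
  have "z ?F = evec p" using fm_evec[OF zM] by (simp add: p_def)
  then have "z = cbase (length ?xs) (evec p)" using ch_0_cbase[OF z] by simp
  then have eq: "z - kd ?xs d = cbase (length ?xs) (evec p - evec (p - q))" unfolding d(2) cbase_simps(2) by simp
  have "evec p - evec (p - q) = evec q" by (simp only: evec_simps(2)[symmetric]) simp
  then have "z - kd ?xs d = cbase (length ?xs) (evec q)" using eq by simp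
  moreover have "evec q \<in> idealgr l I (int i)" using q by (simp add: idealgr_def evec_simps)
  moreover have "0 \<in> idealgr l I (int i)" using addgrpD(1)[OF addgrp_fm] hidealD(2)[OF I] by (simp add: idealgr_def)
  ultimately have "\<forall>b. (z - kd ?xs d) b \<in> idealgr l I (int i)" by (simp add: cbase_def)
  then show "\<exists>d\<in>ch (length ?xs) 1 (?M (int i - 1)). \<forall>b. (z - kd ?xs d) b \<in> idealgr l I (int i)" using d(1) by blast
qed

text \<open>A converse of \<open>inj_mons_ltset\<close> for \<open>s = 1\<close>: if the normal form
  of \<open>p\<close> were nonzero, its standard leading power-product would become non-standard on
  multiplication by variable \<open>n\<close>, against \<open>inj\<close>.\<close>

lemma inj_mult_of_inj_mons:
  fixes I :: "(nat, 'k::field) mpoly set"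
  assumes I: "hideal l I" and n: "n < l" and inj: "inj_mons (ltset I) n i 1"
  shows "inj_mult l I n i 1"
  unfolding inj_mult_def
proof (intro ballI impI)
  let ?A = "isum I (highvars l (Suc n))"
  have A: "hideal l ?A" by (rule hideal_isum[OF I hideal_highvars])
  fix p assume p: "p \<in> forms l i" "var_poly n ^ 1 * p \<in> ?A"
  obtain v where v: "v \<in> ?A \<inter> forms l i" "keys (p - v) \<inter> ltset (?A \<inter> forms l i) = {}"
    using reduce_mod_subsp[OF subsp_hideal_forms[OF A] _ p(1)] by blast
  let ?f = "p - v"
  have f: "?f \<in> forms l i" using p v by blast
  have xv: "var_poly n * v \<in> ?A" using hidealD(4)[OF A forms_polyS[OF var_poly_form[OF n]]] v by blast
  have xf: "var_poly n * ?f \<in> ?A"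
    using hidealD(8)[OF A _ xv, of "var_poly n * p"] p(2) by (simp add: right_diff_distrib)
  have "?f = 0"
  proof (rule ccontr)
    assume "?f \<noteq> 0"
    then obtain t where t: "lead ?f t" using lead_exists by blast
    have tm: "t \<in> mons l i" using lead_form_degree[OF t f] .
    have "t \<in> keys ?f" using t by (simp add: lead_def)
    then have "t \<notin> ltset ?A" using v(2) tm unfolding ltset_inter_forms[OF A] by blast
    then have t': "t \<in> mons (Suc n) i - ltset I" using mons_isum_highvars[OF I, of "Suc n" i] tm n by auto
    have "lead (var_poly n * ?f) (single n 1 + t)" unfolding var_poly_def using lead_single_times[OF t, of "single n 1"] by simp
    moreover have "var_poly n * ?f \<noteq> 0" using calculation lead_nonzero by blast
    ultimately have "single n 1 + t \<in> ltset ?A" using xf unfolding ltset_def by blast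
    moreover have "single n 1 + t \<in> mons (Suc n) (Suc i)" using t' by (simp add: mons_def)
    ultimately have "t + single n 1 \<in> ltset I" using mons_isum_highvars[OF I, of "Suc n" "Suc i"] n by (auto simp: add.commute)
    then show False using inj t' unfolding inj_mons_def by blast
  qed
  then show "p \<in> ?A" using v by simp
qed

text \<open>A standard power-product one degree higher has a standard divisor in the degree already
  treated, and this divisor contains variable \<open>n\<close>.\<close>

lemma surj_mons_Suc:
  assumes M: "upcl l M" and n: "n < l" and s: "surj_mons M n i 1"
  shows "surj_mons M n (Suc i) 1"
  unfolding surj_mons_def
proof (intro ballI impI)
  fix v assume v: "v \<in> mons (Suc n) (Suc i + 1)" "v \<notin> M"
  have "pp_degree v \<noteq> 0" using v(1) by (simp add: mons_def)
  then have "v \<noteq> 0" by auto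
  then obtain x where x: "lookup v x \<noteq> 0" using poly_mapping_eqI[of v 0] by auto
  then have eq: "v = (v - single x 1) + single x 1" by (intro pp_split) simp
  have xn: "x < Suc n" using x lookup_pps[of v "Suc n" x] v(1) by (cases "x < Suc n") (auto simp: mons_def)
  have "v - single x 1 \<notin> M"
  proof
    assume "v - single x 1 \<in> M"
    then have "single x 1 + (v - single x 1) \<in> M" using upclD[OF M, of "v - single x 1" "single x 1"] xn n by simp
    then show False using v(2) eq by (simp add: add.commute)
  qed
  moreover have "v - single x 1 \<in> mons (Suc n) (i + 1)" using v(1) x by (intro mons_minus_single) simp_all
  ultimately have "1 \<le> lookup (v - single x 1) n" using s unfolding surj_mons_def by blast
  then show "1 \<le> lookup v n" by (simp add: lookup_minus)
qed

lemma eventually_inj_mons: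
  assumes M: "upcl l M" and fr: "\<And>n i. n < l \<Longrightarrow> inj_mons M n i 1 \<or> surj_mons M n i 1"
  shows "\<exists>E. \<forall>n<l. \<forall>i\<ge>E. inj_mons M n i 1"
proof -
  have "\<exists>E. \<forall>i\<ge>E. inj_mons M n i 1" if n: "n < l" for n
  proof (cases "\<forall>i. inj_mons M n i 1")
    case False
    then obtain i0 where i0: "surj_mons M n i0 1" using fr[OF n] by blast
    have surj: "surj_mons M n i 1" if "i \<ge> i0" for i
      using that by (induction i rule: dec_induct) (use i0 in \<open>auto intro: surj_mons_Suc[OF M n, unfolded One_nat_def]\<close>)
    let ?h = "hfn M (Suc n)"
    have step: "?h (Suc i) \<le> ?h i" and eq: "?h (Suc i) = ?h i \<Longrightarrow> inj_mons M n i 1" if "i \<ge> i0" for i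
      using divisible_card[OF M n, of i 1] surj[OF that] by auto
    \<comment> \<open>The least value of the Hilbert function beyond \<open>i0\<close> is kept once
      reached, because the function cannot increase there.\<close>
    obtain E where E: "E \<ge> i0" "\<And>i. i \<ge> i0 \<Longrightarrow> ?h E \<le> ?h i"
      using ex_has_least_nat[of "\<lambda>i. i \<ge> i0" i0 ?h] by blast
    have le: "?h i \<le> ?h E" if "i \<ge> E" for i
      using that
    proof (induction i rule: dec_induct)
      case (step i)
      then show ?case using \<open>\<And>i. i \<ge> i0 \<Longrightarrow> ?h (Suc i) \<le> ?h i\<close>[of i] E(1) by simp
    qed simp
    have "inj_mons M n i 1" if "i \<ge> E" for i
    proof (rule eq)
      show "i \<ge> i0" using that E(1) by simp
      show "?h (Suc i) = ?h i" using le[OF that] le[of "Suc i"] E(2)[of i] E(2)[of "Suc i"] that E(1) by simp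
    qed
    then show ?thesis by blast
  qed blast
  then have "\<forall>n\<in>{..<l}. \<exists>E. \<forall>i\<ge>E. inj_mons M n i 1" by blast
  from bchoice[OF this] obtain f where f: "\<And>n i. n < l \<Longrightarrow> i \<ge> f n \<Longrightarrow> inj_mons M n i 1" by blast
  show ?thesis
  \<comment> \<open>The sum is a common upper bound for the finitely many
    \<open>f n\<close>.\<close>
  proof (intro exI[of _ "\<Sum>n<l. f n"] allI impI)
    fix n i assume n: "n < l" and "i \<ge> (\<Sum>n<l. f n)"
    moreover have "f n \<le> (\<Sum>n<l. f n)" using n by (intro member_le_sum) auto
    ultimately show "inj_mons M n i 1" using f by simp
  qed
qed

text \<open>The resolution of \<open>I\<close>, transported by \<open>g\<close>, carries the
  regularity bound into the coordinates of \<open>J\<close>; injectivity on power-products and on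
  forms is translated in both directions around the Koszul argument.\<close>

theorem inj_mons_beyond_reg:
  fixes I :: "(nat, 'k::field) mpoly set"
  assumes I: "hideal l I" and res: "fres l I r a P" and g: "g \<in> GL l" and J: "ltset (act l g ` I) = J"
    and fr: "\<And>n i. n < l \<Longrightarrow> inj_mons J n i 1 \<or> surj_mons J n i 1"
    and n: "n < l" and e: "nat (reg l I) \<le> e"
  shows "inj_mons J n e 1"
proof -
  let ?I = "act l g ` I"
  have gI: "hideal l ?I" by (rule hideal_act[OF I g])
  have upJ: "upcl l J" using ltset_upcl[OF gI] J by simp
  have bound: "a i k \<le> nat (reg l I) + i" if "k < r i" for i k
    using resolution.degree_le_reg[of l I r a P k i] that I res by (simp add: resolution_def)
  interpret g: resolution l ?I r a "\<lambda>i m k. act l g (P i m k)"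
    using gI fres_act[OF g I res] by unfold_locales
  obtain E where E: "\<And>n i. n < l \<Longrightarrow> i \<ge> E \<Longrightarrow> inj_mons J n i 1"
    using eventually_inj_mons[OF upJ fr] by blast
  have "regular0 n [Suc n..<l] (fm l 1 (\<lambda>_. 0)) (idealgr l ?I) (int e)"
  proof (rule g.regular0_beyond[where c = "nat (reg l I)" and E = "int E"])
    show "regular0 m [Suc m..<l] (fm l 1 (\<lambda>_. 0)) (idealgr l ?I) d" if "m < l" "int E \<le> d" for m d
    proof -
      have "inj_mult l ?I m (nat d) 1"
        using E[OF that(1), of "nat d"] that(2) J by (intro inj_mult_of_inj_mons[OF gI that(1)]) simp
      from regular0_of_inj_mult[OF gI that(1) this] show ?thesis using that(2) by simp
    qed
  qed (use bound n e in auto)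
  from inj_mult_of_regular0[OF gI n this] show ?thesis using inj_mons_ltset[OF gI n] J by blast
qed

subsection \<open>Existence of minimal free resolutions\<close>

definition hcv :: "(nat \<Rightarrow> nat) \<Rightarrow> int \<Rightarrow> 'k::comm_ring_1 pvec \<Rightarrow> 'k pvec"
  where "hcv a e v = (\<lambda>k. hcZ (e - int (a k)) (v k))"

text \<open>Graded submodules of the free module of rank \<open>n\<close> with generators in the
  degrees \<open>a\<close>.\<close>

definition gsub :: "nat \<Rightarrow> nat \<Rightarrow> (nat \<Rightarrow> nat) \<Rightarrow> 'k::comm_ring_1 pvec set \<Rightarrow> bool"
  where "gsub l n a Z \<longleftrightarrow> Z \<subseteq> vecS l n \<and> 0 \<in> Z \<and> (\<forall>v\<in>Z. \<forall>w\<in>Z. v + w \<in> Z) \<and>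
    (\<forall>f\<in>polyS l. \<forall>v\<in>Z. sm f v \<in> Z) \<and> (\<forall>v\<in>Z. \<forall>e. hcv a e v \<in> Z)"

lemma gsubD:
  assumes "gsub l n a Z"
  shows "Z \<subseteq> vecS l n" "0 \<in> Z" "v \<in> Z \<Longrightarrow> w \<in> Z \<Longrightarrow> v + w \<in> Z" "f \<in> polyS l \<Longrightarrow> v \<in> Z \<Longrightarrow> sm f v \<in> Z"
    "v \<in> Z \<Longrightarrow> hcv a e v \<in> Z" "v \<in> Z \<Longrightarrow> w \<in> Z \<Longrightarrow> v - w \<in> Z"
proof -
  show 1: "Z \<subseteq> vecS l n" "0 \<in> Z" and 3: "v \<in> Z \<Longrightarrow> w \<in> Z \<Longrightarrow> v + w \<in> Z" and 4: "f \<in> polyS l \<Longrightarrow> v \<in> Z \<Longrightarrow> sm f v \<in> Z"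
    and "v \<in> Z \<Longrightarrow> hcv a e v \<in> Z" for v w f e
    using assms unfolding gsub_def by blast+
  have eq: "v - w = v + sm (- 1) w" by (rule ext) (simp add: sm_def)
  have "w \<in> Z \<Longrightarrow> sm (- 1) w \<in> Z" by (rule 4) simp_all
  then show "v \<in> Z \<Longrightarrow> w \<in> Z \<Longrightarrow> v - w \<in> Z" unfolding eq by (intro 3)
qed

lemma gsub_sum: "gsub l n a Z \<Longrightarrow> (\<And>i. i \<in> A \<Longrightarrow> f i \<in> Z) \<Longrightarrow> sum f A \<in> Z"
  by (induction A rule: infinite_finite_induct) (auto intro: gsubD)

lemma hcv_fm: "v \<in> vecS l n \<Longrightarrow> hcv a e v \<in> fm l n a e"
  unfolding fm_def hcv_def by (intro CollectI allI conjI hcZ_formsZ) (auto simp: vecS_def hcZ_def)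

lemma hcv_sum: "hcv a e (\<Sum>i\<in>A. f i) = (\<Sum>i\<in>A. hcv a e (f i))"
  by (rule ext) (simp only: hcv_def sum_fun_apply hcZ_sum)

lemma hcv_sm:
  assumes "f \<in> polyS l" "v \<in> fm l n a d"
  shows "hcv a e (sm f v) = sm (hcZ (e - d) f) v"
proof
  fix k
  have "v k \<in> formsZ l (d - int (a k))" using assms(2) by (simp add: fm_def)
  from hcZ_mult[OF assms(1) this, of "e - int (a k)"]
  show "hcv a e (sm f v) k = sm (hcZ (e - d) f) v k" by (simp add: hcv_def sm_def mult.commute)
qed

lemma sum_hcv:
  assumes v: "v \<in> vecS l n"
  shows "\<exists>N. v = (\<Sum>e<N. hcv a (int e) v)"
proof -
  define N where "N = Suc (\<Sum>k<n. a k + (\<Sum>t\<in>keys (v k). pp_degree t))"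
  have N: "pp_degree t + a k < N" if "t \<in> keys (v k)" "k < n" for t k
  proof -
    have "a k + (\<Sum>t\<in>keys (v k). pp_degree t) \<le> (\<Sum>k<n. a k + (\<Sum>t\<in>keys (v k). pp_degree t))"
      using that(2) by (intro member_le_sum[where f = "\<lambda>k. a k + (\<Sum>t\<in>keys (v k). pp_degree t)"]) auto
    moreover have "pp_degree t \<le> (\<Sum>t\<in>keys (v k). pp_degree t)" using that(1) by (intro member_le_sum) auto
    ultimately show ?thesis by (simp add: N_def)
  qed
  have "v k = (\<Sum>e<N. hcv a (int e) v) k" for k
  proof (rule poly_mapping_eqI)
    fix t
    have "lookup ((\<Sum>e<N. hcv a (int e) v) k) t = (\<Sum>e<N. if e = pp_degree t + a k then lookup (v k) t else 0)"
      unfolding sum_fun_apply lookup_sum hcv_def lookup_hcZ by (rule sum.cong) auto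
    also have "\<dots> = lookup (v k) t"
    proof (cases "t \<in> keys (v k)")
      case True
      then have "k < n" using v by (cases "k < n") (auto simp: vecS_def)
      then show ?thesis using N[OF True] by simp
    qed (simp add: in_keys_iff)
    finally show "lookup (v k) t = lookup ((\<Sum>e<N. hcv a (int e) v) k) t" by simp
  qed
  then have "v = (\<Sum>e<N. hcv a (int e) v)" by (rule ext)
  then show ?thesis by blast
qed

text \<open>The initial module for a position-over-term order, one coordinate at a time: leading
  power-products at \<open>k\<close> of homogeneous elements that vanish before
  \<open>k\<close>.\<close>

definition ltk :: "nat \<Rightarrow> nat \<Rightarrow> (nat \<Rightarrow> nat) \<Rightarrow> 'k::comm_ring_1 pvec set \<Rightarrow> nat \<Rightarrow> (nat \<Rightarrow>\<^sub>0 nat) set"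
  where "ltk l n a Z k = {t. \<exists>e. \<exists>z\<in>Z \<inter> fm l n a (int e). (\<forall>j<k. z j = 0) \<and> lead (z k) t}"

text \<open>Reduction coordinate by coordinate: an element of \<open>N\<close> is subtracted that
  clears coordinate \<open>k\<close> and leaves the earlier ones zero.\<close>

lemma gsub_le_of_ltk:
  fixes Z N :: "'k::field pvec set"
  assumes Z: "gsub l n a Z" and N: "gsub l n a N" and NZ: "N \<subseteq> Z" and lt: "\<And>k. k < n \<Longrightarrow> ltk l n a Z k \<subseteq> ltk l n a N k"
  shows "Z \<subseteq> N"
proof -
  have core: "z \<in> N" if "k \<le> n" "z \<in> Z" "z \<in> fm l n a (int e)" "\<And>j. j < k \<Longrightarrow> z j = 0" for k z e
    using that
  proof (induction "n - k" arbitrary: k z)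
    case 0
    have "z j = 0" for j using 0 by (cases "j < n") (auto simp: fm_def)
    then have "z = 0" by (intro ext) simp
    then show ?case using gsubD(2)[OF N] by (simp only:)
  next
    case (Suc m)
    then have k: "k < n" "m = n - Suc k" by auto
    \<comment> \<open>The entries at \<open>k\<close> of the admissible elements of \<open>N\<close>
      form a space of forms of one degree, to which reduction by leading terms applies.\<close>
    define V where "V = {w k | w. w \<in> N \<inter> fm l n a (int e) \<and> (\<forall>j<k. w j = 0)}"
    have zk: "z k \<in> formsZ l (int e - int (a k))" using Suc.prems(3) by (simp add: fm_def)
    have "\<exists>w. w \<in> N \<and> w \<in> fm l n a (int e) \<and> (\<forall>j<k. w j = 0) \<and> w k = z k"
    proof (cases "int e < int (a k)")
      case True
      then have "z k = 0" using zk by (simp add: formsZ_def)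
      then show ?thesis using gsubD(2)[OF N] addgrpD(1)[OF addgrp_fm] by (intro exI[of _ 0]) auto
    next
      case False
      define d where "d = nat (int e - int (a k))"
      have fd: "formsZ l (int e - int (a k)) = (forms l d :: (nat, 'k) mpoly set)" using False by (simp add: formsZ_def d_def)
      have V: "V \<subseteq> forms l d" using fd by (auto simp: V_def fm_def)
      have "subsp V" unfolding subsp_def
      proof (intro conjI ballI allI)
        show "0 \<in> V" unfolding V_def using gsubD(2)[OF N] addgrpD(1)[OF addgrp_fm] by (intro CollectI exI[of _ 0]) auto
        fix p assume "p \<in> V"
        then obtain w where w: "p = w k" "w \<in> N" "w \<in> fm l n a (int e)" "\<forall>j<k. w j = 0" by (auto simp: V_def)
        have "sm (const_poly c) w \<in> N \<inter> fm l n a (int e)" for c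
          using gsubD(4)[OF N const_poly_in_polyS w(2)] graded_module.scale[OF fm_graded w(3)] by blast
        moreover have "const_poly c * p = sm (const_poly c) w k" "\<forall>j<k. sm (const_poly c) w j = 0" for c using w by (simp_all add: sm_def)
        ultimately show "const_poly c * p \<in> V" for c unfolding V_def by blast
        fix q assume "q \<in> V"
        then obtain w' where w': "q = w' k" "w' \<in> N" "w' \<in> fm l n a (int e)" "\<forall>j<k. w' j = 0" by (auto simp: V_def)
        have "w + w' \<in> N \<inter> fm l n a (int e)"
          using gsubD(3)[OF N w(2) w'(2)] addgrpD(2)[OF addgrp_fm w(3) w'(3)] by blast
        moreover have "p + q = (w + w') k" "\<forall>j<k. (w + w') j = 0" using w w' by simp_all
        ultimately show "p + q \<in> V" unfolding V_def by blast
      qed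
      from reduce_mod_subsp[OF this V, of "z k"] obtain v where v: "v \<in> V" "keys (z k - v) \<inter> ltset V = {}"
        using zk fd by auto
      then obtain w where w: "v = w k" "w \<in> N" "w \<in> fm l n a (int e)" "\<forall>j<k. w j = 0" by (auto simp: V_def)
      have zw: "z - w \<in> Z" "z - w \<in> fm l n a (int e)" "\<forall>j<k. (z - w) j = 0"
        using gsubD(6)[OF Z Suc.prems(2)] NZ w Suc.prems addgrpD(4)[OF addgrp_fm Suc.prems(3) w(3)] by auto
      have "z k - v = 0"
      proof (rule ccontr)
        assume "z k - v \<noteq> 0"
        then obtain t where t: "lead ((z - w) k) t" using lead_exists[of "z k - v"] w(1) by auto
        then have "t \<in> ltk l n a Z k" unfolding ltk_def using zw by blast
        then have "t \<in> ltk l n a N k" using lt k(1) by blast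
        then obtain e' w' where w': "w' \<in> N" "w' \<in> fm l n a (int e')" "\<forall>j<k. w' j = 0" "lead (w' k) t"
          unfolding ltk_def by blast
        have "(z - w) k \<in> formsZ l (int e - int (a k))" "w' k \<in> formsZ l (int e' - int (a k))"
          using zw(2) w'(2) unfolding fm_def by blast+
        moreover have tk: "t \<in> keys ((z - w) k)" "t \<in> keys (w' k)" using t w'(4) by (auto simp: lead_def)
        ultimately have "int e - int (a k) = int e' - int (a k)" using formsZ_keys by metis
        then have "w' k \<in> V" using w' unfolding V_def by auto
        then have "t \<in> ltset V" using w'(4) lead_nonzero[OF w'(4)] unfolding ltset_def by blast
        then show False using v(2) tk(1) w(1) by auto
      qed
      then show ?thesis using w by (intro exI[of _ w]) auto
    qed
    then obtain w where w: "w \<in> N" "w \<in> fm l n a (int e)" "\<And>j. j < k \<Longrightarrow> w j = 0" "w k = z k" by blast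
    have "z - w \<in> N"
    proof (rule Suc.hyps(1)[OF k(2)])
      show "z - w \<in> Z" using gsubD(6)[OF Z Suc.prems(2)] NZ w(1) by blast
      show "z - w \<in> fm l n a (int e)" by (rule addgrpD(4)[OF addgrp_fm Suc.prems(3) w(2)])
      show "(z - w) j = 0" if "j < Suc k" for j using that w Suc.prems(4)[of j] by (cases "j = k") auto
    qed (use k in simp)
    then show ?case using gsubD(3)[OF N _ w(1), of "z - w"] by simp
  qed
  show ?thesis
  proof
    fix z assume z: "z \<in> Z"
    have zv: "z \<in> vecS l n" using z gsubD(1)[OF Z] by blast
    obtain m where m: "z = (\<Sum>e<m. hcv a (int e) z)" using sum_hcv[OF zv] by blast
    have "hcv a (int e) z \<in> N" for e
      using core[of 0 "hcv a (int e) z" e] gsubD(5)[OF Z z] hcv_fm[OF zv] by simp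
    then have "(\<Sum>e<m. hcv a (int e) z) \<in> N" by (intro gsub_sum[OF N])
    then show "z \<in> N" using m by simp
  qed
qed

definition pspan :: "nat \<Rightarrow> 'k::comm_ring_1 pvec set \<Rightarrow> 'k pvec set"
  where "pspan l F = {\<Sum>z\<in>F. sm (c z) z | c. \<forall>z. c z \<in> polyS l}"

definition homs :: "nat \<Rightarrow> nat \<Rightarrow> (nat \<Rightarrow> nat) \<Rightarrow> 'k::comm_ring_1 pvec set"
  where "homs l n a = (\<Union>d::nat. fm l n a (int d))"

lemma pspan_least: "gsub l n a Z \<Longrightarrow> F \<subseteq> Z \<Longrightarrow> pspan l F \<subseteq> Z"
  unfolding pspan_def by (auto intro!: gsub_sum gsubD(4))

lemma sm_add_left: "sm (p + q) v = sm p v + sm q v"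
  by (rule ext) (simp add: sm_def distrib_right)

lemma pspan_base: "finite F \<Longrightarrow> z \<in> F \<Longrightarrow> z \<in> pspan l F"
proof -
  assume F: "finite F" "z \<in> F"
  have "(\<Sum>z'\<in>F. sm (if z' = z then 1 else 0) z') = (\<Sum>z'\<in>F. if z' = z then z else 0)"
    by (rule sum.cong) (auto simp: sm_simps)
  also have "\<dots> = z" using F by simp
  finally show ?thesis unfolding pspan_def by (intro CollectI exI[of _ "\<lambda>z'. if z' = z then 1 else 0"]) auto
qed

lemma pspan_gsub:
  assumes F: "finite F" "F \<subseteq> homs l n a"
  shows "gsub l n a (pspan l F)"
proof -
  have "\<forall>z\<in>F. \<exists>d::nat. z \<in> fm l n a (int d)" using F(2) by (auto simp: homs_def)
  from bchoice[OF this] obtain d :: "_ \<Rightarrow> nat" where d: "\<And>z. z \<in> F \<Longrightarrow> z \<in> fm l n a (int (d z))" by blast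
  show ?thesis unfolding gsub_def
  proof (intro conjI ballI allI)
    show "pspan l F \<subseteq> vecS l n"
    proof
      fix v assume "v \<in> pspan l F"
      then obtain c where c: "v = (\<Sum>z\<in>F. sm (c z) z)" "\<forall>z. c z \<in> polyS l" by (auto simp: pspan_def)
      have zk: "z k = 0" if "z \<in> F" "n \<le> k" for z k
        using fm_vecS[OF d[OF that(1)]] that(2) by (simp add: vecS_def)
      have "(\<Sum>z\<in>F. c z * z k) \<in> polyS l" for k
        using fm_vecS[OF d] c(2) by (intro polyS_sum polyS_mult) (auto simp: vecS_def)
      moreover have "(\<Sum>z\<in>F. c z * z k) = 0" if "n \<le> k" for k
      proof (intro sum.neutral ballI)
        fix z assume "z \<in> F"
        from zk[OF this that] show "c z * z k = 0" by simp
      qed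
      ultimately show "v \<in> vecS l n" unfolding c(1) vecS_def sum_fun_apply sm_def by blast
    qed
    have "(\<Sum>z\<in>F. sm 0 z) = 0" by (simp add: sm_simps)
    then show "0 \<in> pspan l F" unfolding pspan_def by (intro CollectI exI[of _ "\<lambda>_. 0"]) (simp add: sm_simps)
    fix v assume "v \<in> pspan l F"
    then obtain c where c: "v = (\<Sum>z\<in>F. sm (c z) z)" "\<And>z. c z \<in> polyS l" by (auto simp: pspan_def)
    have "sm f v = (\<Sum>z\<in>F. sm (f * c z) z)" for f by (simp only: c(1) sm_sum sm_simps)
    then show "sm f v \<in> pspan l F" if "f \<in> polyS l" for f
      unfolding pspan_def using that c(2) by (intro CollectI exI[of _ "\<lambda>z. f * c z"] conjI allI polyS_mult)
    have "hcv a e v = (\<Sum>z\<in>F. sm (hcZ (e - int (d z)) (c z)) z)" for e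
      unfolding c(1) hcv_sum by (rule sum.cong[OF refl]) (rule hcv_sm[OF c(2) d])
    then show "hcv a e v \<in> pspan l F" for e
      unfolding pspan_def using formsZ_polyS[OF hcZ_formsZ[OF c(2)]]
      by (intro CollectI exI[of _ "\<lambda>z. hcZ (e - int (d z)) (c z)"] conjI allI)
    fix w assume "w \<in> pspan l F"
    then obtain c' where c': "w = (\<Sum>z\<in>F. sm (c' z) z)" "\<And>z. c' z \<in> polyS l" by (auto simp: pspan_def)
    have "v + w = (\<Sum>z\<in>F. sm (c z + c' z) z)" by (simp only: c(1) c'(1) sm_add_left sum.distrib)
    then show "v + w \<in> pspan l F"
      unfolding pspan_def using c(2) c'(2) by (intro CollectI exI[of _ "\<lambda>z. c z + c' z"] conjI allI polyS_add)
  qed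
qed

text \<open>Hilbert's basis theorem: Dickson's lemma yields finitely many leading power-products per
  coordinate, and homogeneous elements that realize them generate.\<close>

lemma gsub_finitely_generated:
  fixes Z :: "'k::field pvec set"
  assumes Z: "gsub l n a Z"
  shows "\<exists>F. finite F \<and> F \<subseteq> Z \<inter> homs l n a \<and> pspan l F = Z"
proof -
  let ?M = "ltk l n a Z"
  have Mp: "?M k \<subseteq> pps l" for k
  proof
    fix t assume "t \<in> ?M k"
    then obtain z :: "'k pvec" and e :: nat where "z \<in> fm l n a (int e)" "lead (z k) t" unfolding ltk_def by blast
    then have "z k \<in> polyS l" "t \<in> keys (z k)" using fm_vecS[of z l n a "int e"] by (auto simp: vecS_def lead_def)
    then show "t \<in> pps l" by (auto simp: polyS_iff)
  qed
  have "\<forall>k. \<exists>N. \<forall>t\<in>?M k. \<exists>s\<in>?M k. pp_degree s \<le> N \<and> (\<exists>u\<in>pps l. t = u + s)" using dickson[OF Mp] by blast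
  from choice[OF this] obtain N where N: "\<And>k t. t \<in> ?M k \<Longrightarrow> \<exists>s\<in>?M k. pp_degree s \<le> N k \<and> (\<exists>u\<in>pps l. t = u + s)"
    by blast
  define S where "S k = {s \<in> ?M k. pp_degree s \<le> N k}" for k
  have "S k \<subseteq> (\<Union>d\<le>N k. mons l d)" for k using Mp by (auto simp: S_def mons_def)
  then have finS: "finite (S k)" for k by (rule finite_subset) auto
  define good where "good ks z \<longleftrightarrow> z \<in> Z \<inter> homs l n a \<and> (\<forall>j<fst ks. z j = 0) \<and> lead (z (fst ks)) (snd ks)" for ks z
  have "\<forall>ks\<in>Sigma {..<n} S. \<exists>z. good ks z"
    unfolding S_def ltk_def good_def homs_def by fastforce
  from bchoice[OF this] obtain W where W: "\<And>ks. ks \<in> Sigma {..<n} S \<Longrightarrow> good ks (W ks)" by blast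
  define F where "F = W ` Sigma {..<n} S"
  have F: "finite F" "F \<subseteq> Z \<inter> homs l n a" using finS W unfolding F_def good_def by auto
  have G: "gsub l n a (pspan l F)" using F by (intro pspan_gsub) auto
  have GZ: "pspan l F \<subseteq> Z" using F by (intro pspan_least[OF Z]) auto
  have "ltk l n a Z k \<subseteq> ltk l n a (pspan l F) k" if k: "k < n" for k
  proof
    fix t assume "t \<in> ?M k"
    then obtain s u where s: "s \<in> S k" "u \<in> pps l" "t = u + s" using N unfolding S_def by blast
    define z where "z = W (k, s)"
    have z: "z \<in> F" "good (k, s) z" using s k W by (auto simp: F_def z_def)
    then obtain d :: nat where d: "z \<in> fm l n a (int d)" by (auto simp: good_def homs_def)
    let ?w = "sm (single u 1) z"
    have "?w \<in> pspan l F" using gsubD(4)[OF G _ pspan_base[OF F(1) z(1)]] s(2) by simp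
    moreover have "?w \<in> fm l n a (int (d + pp_degree u))"
    proof -
      have u: "single u 1 \<in> formsZ l (int (pp_degree u))" using s(2) by (simp add: forms_single mons_def)
      have "single u 1 * z j \<in> formsZ l (int (d + pp_degree u) - int (a j))" for j
        using formsZ_mult[OF u, of "z j" "int d - int (a j)"] d by (simp add: fm_def algebra_simps)
      then show ?thesis using d by (simp add: fm_def sm_def)
    qed
    moreover have "lead (?w k) t" "\<forall>j<k. ?w j = 0"
      using lead_single_times[of "z k" s u] z(2) s(3) by (simp_all add: sm_def good_def)
    ultimately show "t \<in> ltk l n a (pspan l F) k" unfolding ltk_def by blast
  qed
  from gsub_le_of_ltk[OF Z G GZ this] show ?thesis using F GZ by (intro exI[of _ F]) auto
qed

text \<open>The last clause is minimality: the relations among the generators have no constant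
  terms.\<close>

definition mingens :: "nat \<Rightarrow> nat \<Rightarrow> (nat \<Rightarrow> nat) \<Rightarrow> 'k::comm_ring_1 pvec set \<Rightarrow> nat \<Rightarrow> (nat \<Rightarrow> nat) \<Rightarrow> (nat \<Rightarrow> 'k pvec) \<Rightarrow> bool"
  where "mingens l n a Z s b G \<longleftrightarrow> (\<forall>m<s. G m \<in> Z \<inter> fm l n a (int (b m))) \<and>
    (\<lambda>v. \<Sum>m<s. sm (v m) (G m)) ` vecS l s = Z \<and>
    (\<forall>v\<in>vecS l s. (\<Sum>m<s. sm (v m) (G m)) = 0 \<longrightarrow> (\<forall>m. lookup (v m) 0 = 0))"

text \<open>In a generating set of least cardinality no element is a combination of the others, so a homogeneous
  relation cannot have a unit among its coefficients.\<close>

lemma mingens_exist: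
  fixes Z :: "'k::field pvec set"
  assumes Z: "gsub l n a Z"
  shows "\<exists>s b G. mingens l n a Z s b G"
proof -
  let ?Q = "\<lambda>F. finite F \<and> F \<subseteq> Z \<inter> homs l n a \<and> pspan l F = Z"
  obtain F0 where F0: "?Q F0" using gsub_finitely_generated[OF Z] by blast
  obtain F where F: "?Q F" and least: "\<And>F'. ?Q F' \<Longrightarrow> card F \<le> card F'"
    using ex_has_least_nat[of ?Q F0 card, OF F0] by blast
  define s where "s = card F"
  obtain G where G: "bij_betw G {..<s} F"
    using ex_bij_betw_nat_finite[of F] F by (auto simp: s_def atLeast0LessThan)
  have GF: "G m \<in> F" if "m < s" for m using bij_betwE[OF G] that by blast
  have "G m \<in> homs l n a" if "m < s" for m using F GF[OF that] by blast
  then have "\<forall>m\<in>{..<s}. \<exists>d::nat. G m \<in> fm l n a (int d)" unfolding homs_def by blast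
  from bchoice[OF this] obtain b where b: "\<And>m. m < s \<Longrightarrow> G m \<in> fm l n a (int (b m))" by auto
  have sumG: "(\<Sum>m<s. sm (v m) (G m)) = (\<Sum>z\<in>F. sm (v (the_inv_into {..<s} G z)) z)" for v
  proof -
    have "(\<Sum>z\<in>F. sm (v (the_inv_into {..<s} G z)) z) = (\<Sum>m<s. sm (v (the_inv_into {..<s} G (G m))) (G m))"
      by (rule sum.reindex_bij_betw[OF G, symmetric])
    also have "\<dots> = (\<Sum>m<s. sm (v m) (G m))"
      by (rule sum.cong) (use G in \<open>auto simp: bij_betw_def the_inv_into_f_f\<close>)
    finally show ?thesis by simp
  qed
  have image: "(\<lambda>v. \<Sum>m<s. sm (v m) (G m)) ` vecS l s = Z"
  proof (intro equalityI subsetI)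
    fix z assume "z \<in> (\<lambda>v. \<Sum>m<s. sm (v m) (G m)) ` vecS l s"
    then obtain v where v: "z = (\<Sum>m<s. sm (v m) (G m))" "v \<in> vecS l s" by blast
    show "z \<in> Z" unfolding v(1) using F GF v(2) by (intro gsub_sum[OF Z] gsubD(4)[OF Z]) (auto simp: vecS_def)
  next
    fix z assume "z \<in> Z"
    then have "z \<in> pspan l F" using F by simp
    then obtain c where c: "z = (\<Sum>z\<in>F. sm (c z) z)" "\<forall>z. c z \<in> polyS l" by (auto simp: pspan_def)
    let ?v = "\<lambda>m. if m < s then c (G m) else 0"
    have "z = (\<Sum>m<s. sm (c (G m)) (G m))" unfolding c(1) by (rule sum.reindex_bij_betw[OF G, symmetric])
    also have "\<dots> = (\<Sum>m<s. sm (?v m) (G m))" by (rule sum.cong) auto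
    finally have "z = (\<Sum>m<s. sm (?v m) (G m))" .
    moreover have "?v \<in> vecS l s" using c(2) by (simp add: vecS_def)
    ultimately show "z \<in> (\<lambda>v. \<Sum>m<s. sm (v m) (G m)) ` vecS l s" by (rule image_eqI)
  qed
  have "lookup (v m0) 0 = 0" if v: "v \<in> vecS l s" "(\<Sum>m<s. sm (v m) (G m)) = 0" for v m0
  proof (rule ccontr)
    assume c: "lookup (v m0) 0 \<noteq> 0"
    then have m0: "m0 < s" using v(1) by (cases "m0 < s") (auto simp: vecS_def)
    have vS: "v m \<in> polyS l" for m using v(1) by (simp add: vecS_def)
    \<comment> \<open>The component of the relation in the degree of \<open>G m0\<close>; its
      coefficient at \<open>m0\<close> is the nonzero scalar \<open>lookup (v m0) 0\<close>.\<close>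
    define h where "h m = hcZ (int (b m0) - int (b m)) (v m)" for m
    have hS: "h m \<in> polyS l" for m unfolding h_def by (rule formsZ_polyS[OF hcZ_formsZ[OF vS]])
    have "(\<Sum>m<s. sm (h m) (G m)) = hcv a (int (b m0)) (\<Sum>m<s. sm (v m) (G m))"
      unfolding hcv_sum by (rule sum.cong) (use hcv_sm[OF vS b] in \<open>simp_all add: h_def\<close>)
    also have "\<dots> = 0" unfolding v(2) by (rule ext) (simp add: hcv_def hcZ_def)
    finally have "sm (h m0) (G m0) + (\<Sum>m\<in>{..<s} - {m0}. sm (h m) (G m)) = 0"
      using sum.remove[of "{..<s}" m0 "\<lambda>m. sm (h m) (G m)"] m0 by simp
    moreover have "h m0 = const_poly (lookup (v m0) 0)"
    proof -
      have "h m0 \<in> forms l 0" using hcZ_formsZ[OF vS[of m0], of 0] by (simp add: h_def formsZ_def)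
      from forms_0[OF this] show ?thesis by (simp add: h_def lookup_hcZ)
    qed
    ultimately have rel: "sm (const_poly (lookup (v m0) 0)) (G m0) = - (\<Sum>m\<in>{..<s} - {m0}. sm (h m) (G m))"
      by (simp add: eq_neg_iff_add_eq_0)
    let ?F' = "F - {G m0}"
    have F': "finite ?F'" "?F' \<subseteq> homs l n a" using F by auto
    note sub = pspan_gsub[OF F']
    have mem: "(\<Sum>m\<in>{..<s} - {m0}. sm (h m) (G m)) \<in> pspan l ?F'"
    proof (intro gsub_sum[OF sub] gsubD(4)[OF sub] hS pspan_base[OF F'(1)])
      fix m assume m: "m \<in> {..<s} - {m0}"
      then have "G m \<noteq> G m0" using G m0 by (auto simp: bij_betw_def inj_on_def)
      then show "G m \<in> ?F'" using GF m by simp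
    qed
    let ?c = "inverse (lookup (v m0) 0)"
    have "G m0 = sm (const_poly ?c) (sm (const_poly (lookup (v m0) 0)) (G m0))"
    proof -
      have "const_poly ?c * const_poly (lookup (v m0) 0) = (1 :: (nat, 'k) mpoly)"
        using c by (simp add: const_poly_hom(4)[symmetric] const_poly_hom(2))
      then show ?thesis by (simp only: sm_simps)
    qed
    also have "\<dots> = sm (- const_poly ?c) (\<Sum>m\<in>{..<s} - {m0}. sm (h m) (G m))"
      unfolding rel by (rule ext) (simp add: sm_def)
    finally have G0: "G m0 = sm (- const_poly ?c) (\<Sum>m\<in>{..<s} - {m0}. sm (h m) (G m))" .
    have "G m0 \<in> pspan l ?F'" by (subst G0) (rule gsubD(4)[OF sub _ mem], simp)
    then have "F \<subseteq> pspan l ?F'" using pspan_base[OF F'(1)] by blast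
    then have "Z \<subseteq> pspan l ?F'" using pspan_least[OF sub] F by blast
    moreover have "pspan l ?F' \<subseteq> Z" using F by (intro pspan_least[OF Z]) auto
    ultimately have "?Q ?F'" using F by auto
    then have "card F \<le> card ?F'" by (rule least)
    moreover have "card ?F' < card F" using F GF[OF m0] by (intro psubset_card_mono) auto
    ultimately show False by simp
  qed
  then have "mingens l n a Z s b G" unfolding mingens_def using b GF F image by blast
  then show ?thesis by blast
qed

lemma relations_gsub:
  fixes G :: "nat \<Rightarrow> 'k::comm_ring_1 pvec"
  assumes G: "\<And>m. m < s \<Longrightarrow> G m \<in> fm l n a (int (b m))"
  shows "gsub l s b {v \<in> vecS l s. (\<Sum>m<s. sm (v m) (G m)) = 0}"
  unfolding gsub_def
proof (intro conjI ballI allI)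
  show "0 \<in> {v \<in> vecS l s. (\<Sum>m<s. sm (v m) (G m)) = 0}" by (simp add: vecS_def sm_simps)
  fix v assume v: "v \<in> {v \<in> vecS l s. (\<Sum>m<s. sm (v m) (G m)) = 0}"
  then have vS: "v m \<in> polyS l" for m by (simp add: vecS_def)
  have "(\<Sum>m<s. sm (sm f v m) (G m)) = sm f (\<Sum>m<s. sm (v m) (G m))" for f
    by (simp add: sm_sum sm_simps(5)) (simp add: sm_def)
  also have "sm f (\<Sum>m<s. sm (v m) (G m)) = 0" for f using v by (simp add: sm_simps)
  finally show "sm f v \<in> {v \<in> vecS l s. (\<Sum>m<s. sm (v m) (G m)) = 0}" if "f \<in> polyS l" for f
    using v that by (auto simp: vecS_def sm_def)
  show "hcv b e v \<in> {v \<in> vecS l s. (\<Sum>m<s. sm (v m) (G m)) = 0}" for e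
  proof -
    have "(\<Sum>m<s. sm (hcv b e v m) (G m)) = hcv a e (\<Sum>m<s. sm (v m) (G m))"
      unfolding hcv_sum by (rule sum.cong) (use hcv_sm[OF vS G] in \<open>simp_all add: hcv_def\<close>)
    also have "\<dots> = 0" using v by (simp add: hcv_def hcZ_def fun_eq_iff)
    finally show ?thesis using fm_vecS[OF hcv_fm[of v l s b e]] v by simp
  qed
  fix w assume w: "w \<in> {v \<in> vecS l s. (\<Sum>m<s. sm (v m) (G m)) = 0}"
  have "(\<Sum>m<s. sm ((v + w) m) (G m)) = (\<Sum>m<s. sm (v m) (G m)) + (\<Sum>m<s. sm (w m) (G m))"
    by (simp only: plus_fun_apply sm_add_left sum.distrib)
  then show "v + w \<in> {v \<in> vecS l s. (\<Sum>m<s. sm (v m) (G m)) = 0}" using v w by (simp add: vecS_def polyS_add)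
qed auto

text \<open>The relations among minimal generators form a graded submodule again, so generators can
  be chosen at every step. Each choice depends on the preceding one.\<close>

theorem fres_exists:
  fixes I :: "(nat, 'k::field) mpoly set"
  assumes I: "hideal l I"
  shows "\<exists>r a P. fres l I r a P"
proof -
  let ?Z0 = "vecS l 1 \<inter> {z. z 0 \<in> I}"
  have Z0: "gsub l 1 (\<lambda>_. 0) ?Z0" unfolding gsub_def
  proof (intro conjI ballI allI)
    show "0 \<in> ?Z0" using hidealD(2)[OF I] by (simp add: vecS_def)
    fix v assume v: "v \<in> ?Z0"
    show "v + w \<in> ?Z0" if "w \<in> ?Z0" for w using v that hidealD(3)[OF I] by (simp add: vecS_def polyS_add)
    show "sm f v \<in> ?Z0" if "f \<in> polyS l" for f using v that hidealD(4)[OF I] by (simp add: vecS_def polyS_mult sm_def)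
    have "hcZ e (v 0) \<in> I" for e using v hidealD(5)[OF I] hidealD(2)[OF I] by (simp add: hcZ_def)
    then show "hcv (\<lambda>_. 0) e v \<in> ?Z0" for e using fm_vecS[OF hcv_fm[of v l 1 "\<lambda>_. 0" e]] v by (simp add: hcv_def)
  qed auto
  \<comment> \<open>The state of one step: ambient rank and degrees, the module to be covered, and
    the number, degrees and values of its minimal generators.\<close>
  define good :: "nat \<Rightarrow> nat \<times> (nat \<Rightarrow> nat) \<times> 'k pvec set \<times> nat \<times> (nat \<Rightarrow> nat) \<times> (nat \<Rightarrow> 'k pvec) \<Rightarrow> bool"
    where "good i = (\<lambda>(n, a, Z, s, b, G). gsub l n a Z \<and> mingens l n a Z s b G \<and>
      (i = 0 \<longrightarrow> n = 1 \<and> a = (\<lambda>_. 0) \<and> Z = ?Z0))" for i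
  define nxt :: "nat \<times> (nat \<Rightarrow> nat) \<times> 'k pvec set \<times> nat \<times> (nat \<Rightarrow> nat) \<times> (nat \<Rightarrow> 'k pvec) \<Rightarrow>
      nat \<times> (nat \<Rightarrow> nat) \<times> 'k pvec set \<times> nat \<times> (nat \<Rightarrow> nat) \<times> (nat \<Rightarrow> 'k pvec) \<Rightarrow> bool"
    where "nxt = (\<lambda>(n, a, Z, s, b, G) (n', a', Z', _). n' = s \<and> a' = b \<and> Z' = {v \<in> vecS l s. (\<Sum>m<s. sm (v m) (G m)) = 0})"
  have start: "\<exists>x. good 0 x"
  proof -
    obtain s b G where "mingens l 1 (\<lambda>_. 0) ?Z0 s b G" using mingens_exist[OF Z0] by blast
    then have "good 0 (1, \<lambda>_. 0, ?Z0, s, b, G)" using Z0 by (simp add: good_def)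
    then show ?thesis by blast
  qed
  have step: "\<exists>y. good (Suc i) y \<and> nxt x y" if x: "good i x" for i x
  proof -
    obtain n a Z s b G where xe: "x = (n, a, Z, s, b, G)" by (cases x) auto
    have "\<And>m. m < s \<Longrightarrow> G m \<in> fm l n a (int (b m))" using x unfolding xe good_def mingens_def by blast
    from relations_gsub[where G = G, OF this] have Z': "gsub l s b {v \<in> vecS l s. (\<Sum>m<s. sm (v m) (G m)) = 0}" by simp
    obtain s' b' G' where "mingens l s b {v \<in> vecS l s. (\<Sum>m<s. sm (v m) (G m)) = 0} s' b' G'" using mingens_exist[OF Z'] by blast
    then have "good (Suc i) (s, b, {v \<in> vecS l s. (\<Sum>m<s. sm (v m) (G m)) = 0}, s', b', G')" using Z' by (simp add: good_def)
    moreover have "nxt x (s, b, {v \<in> vecS l s. (\<Sum>m<s. sm (v m) (G m)) = 0}, s', b', G')" by (simp add: nxt_def xe)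
    ultimately show ?thesis by blast
  qed
  obtain X where X: "\<And>i. good i (X i)" "\<And>i. nxt (X i) (X (Suc i))"
    using dependent_nat_choice[of good "\<lambda>_. nxt", OF start step] by blast
  define n where "n i = fst (X i)" for i
  define aa where "aa i = fst (snd (X i))" for i
  define Z where "Z i = fst (snd (snd (X i)))" for i
  define r where "r i = fst (snd (snd (snd (X i))))" for i
  define a where "a i = fst (snd (snd (snd (snd (X i)))))" for i
  define G where "G i = snd (snd (snd (snd (snd (X i)))))" for i
  have Xe: "X i = (n i, aa i, Z i, r i, a i, G i)" for i by (simp add: n_def aa_def Z_def r_def a_def G_def)
  have mg: "mingens l (n i) (aa i) (Z i) (r i) (a i) (G i)" and zero: "n 0 = 1" "aa 0 = (\<lambda>_. 0)" "Z 0 = ?Z0" for i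
    using X(1)[of i] X(1)[of 0] unfolding Xe good_def by auto
  have suc: "n (Suc i) = r i" "aa (Suc i) = a i" "Z (Suc i) = {v \<in> vecS l (r i). (\<Sum>m<r i. sm (v m) (G i m)) = 0}" for i
    using X(2)[of i] unfolding Xe nxt_def by auto
  have n: "n i = tgt_rank r i" and aa: "aa i = tgt_deg a i" for i using zero suc by (cases i; simp)+
  let ?P = "\<lambda>i m k. G i k m"
  have Gf: "G i k \<in> Z i" "G i k \<in> fm l (tgt_rank r i) (tgt_deg a i) (int (a i k))" if "k < r i" for i k
    using mg[of i] that unfolding mingens_def n aa by blast+
  have pm: "pmap (tgt_rank r i) (r i) (?P i) v = (\<Sum>m<r i. sm (v m) (G i m))" for i v
  proof
    fix j
    have "(\<Sum>m<r i. sm (v m) (G i m)) j = (\<Sum>m<r i. v m * G i m j)" unfolding sum_fun_apply sm_def by (rule refl)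
    moreover have "(\<Sum>m<r i. v m * G i m j) = 0" if "\<not> j < tgt_rank r i"
      using Gf(2) that by (intro sum.neutral) (auto simp: fm_def)
    ultimately show "pmap (tgt_rank r i) (r i) (?P i) v j = (\<Sum>m<r i. sm (v m) (G i m)) j"
      by (simp add: pmap_def mult.commute)
  qed
  have Zi: "Z i = vecS l (tgt_rank r i) \<inter> syz I r ?P i" for i
    by (cases i) (auto simp: zero suc syz_simps pm)
  have "fres l I r a ?P" unfolding fres_def
  proof (intro conjI allI impI)
    fix i m k assume mk: "m < tgt_rank r i" "k < r i"
    show "G i k m \<in> formsZ l (int (a i k) - int (tgt_deg a i m))" using Gf(2)[OF mk(2)] by (simp add: fm_def)
    assume "0 < i"
    then obtain j where j: "i = Suc j" by (cases i) auto
    have "G i k \<in> vecS l (r j)" "(\<Sum>m<r j. sm (G i k m) (G j m)) = 0" using Gf(1)[OF mk(2)] unfolding j suc by auto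
    then show "lookup (G i k m) 0 = 0" using mg[of j] unfolding mingens_def by blast
  next
    fix i
    have "pmap (tgt_rank r i) (r i) (?P i) ` vecS l (r i) = Z i" unfolding pm using mg[of i] unfolding mingens_def by blast
    then show "pmap (tgt_rank r i) (r i) (?P i) ` vecS l (r i) = vecS l (tgt_rank r i) \<inter> syz I r ?P i" using Zi by simp
  qed
  then show ?thesis by blast
qed

theorem theorem6p15:
  fixes l :: nat and I :: "(nat, 'k::field_char_0) mpoly set"
  assumes "l \<ge> 1"
    and "homogeneous_ideal l I"
    and "I \<noteq> {0}"
    and "k_SLP l (poly_ring l Quot I) (quotient_grading (poly_ring l) (forms l) I)"
    and "\<forall>j. j + 4 \<le> l \<longrightarrow>
           quasi_symmetric (\<lambda>d. sectional_matrix l I (l - j) d) (nat (reg l I))"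
  shows "almost_revlex l (rgin l I) \<and>
    (\<forall>J. almost_revlex l J \<and> (\<forall>d. HF l J d = HF l I d) \<longleftrightarrow> J = rgin l I)"
proof -
  have I: "hideal l I" using assms(2) by (simp add: homogeneous_ideal_iff)
  obtain M P where gin: "is_gin l I M P" using gin_exists[OF I] by blast
  have M: "upcl l M" using gin by (simp add: is_gin_def)
  obtain g where g: "g \<in> GL l" "ltset (act l g ` I) = M" using gin by (rule gin_coordinates)
  obtain r a R where res: "fres l I r a R" using fres_exists[OF I] by blast
  have rgin: "rgin l I = mono_ideal l M" by (rule rgin_eq[OF I gin])
  note full_rank = full_rank_gin[OF I assms(4) gin]
  have ar: "almost_revlex l (rgin l I)" unfolding rgin
  proof (rule almost_revlex_of_full_rank[where c = "nat (reg l I)", OF M])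
    show "inj_mons M n i s \<or> surj_mons M n i s" if "n < l" "s \<ge> 1" for n i s
      using full_rank that by blast
    show "t - single j 1 + single i 1 \<in> M" if "t \<in> M" "i < j" "j < l" "lookup t j > 0" for t i j
      using gin_stable[OF I M g _ that] gin by (auto simp: is_gin_def)
    show "quasi_symmetric (hfn M n) (nat (reg l I))" if n: "4 \<le> n" "n \<le> l" for n
    proof -
      \<comment> \<open>The hypothesis is indexed by the number of linear forms;
        \<open>l - n\<close> of them lead to the row for \<open>n\<close> variables.\<close>
      have "quasi_symmetric (\<lambda>d. sectional_matrix l I (l - (l - n)) d) (nat (reg l I))"
        using n by (intro assms(5)[rule_format]) simp
      then show ?thesis using sectional_matrix_gin[OF I gin n(2)] n(2) by simp
    qed
    show "inj_mons M n e 1" if "3 \<le> n" "n < l" "nat (reg l I) \<le> e" for n e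
      using inj_mons_beyond_reg[OF I res g _ that(2,3)] full_rank[of _ 1] by blast
  qed
  have HF: "HF l (rgin l I) d = HF l I d" for d
    using HF_mono_ideal[OF M, of d, where 'k = 'k] HF_act[OF I g(1), of d] HF_eq_card[OF hideal_act[OF I g(1)], of d]
    by (simp add: rgin hfn_def g(2))
  show ?thesis using ar HF almost_revlex_unique[OF _ ar] by metis
qed

end
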